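(* Let $s=t$ and $F=Z+W\mathbf j$ with $Z,W\in L^\infty(\mathbb T^d;\mathbb C_{\mathbf i}^{s\times s})$. Let $\tau\in\{L,R,(S_L,S_R)\}$ and suppose the spectral essential range $\mathcal R(G_\tau)$ has empty interior and $\mathbb C\setminus\mathcal R(G_\tau)$ is connected. Then $\{T^{(\tau)}_{\boldsymbol n}(F)\}_{\boldsymbol n}\sim_\lambda G_\tau$.
   Context: $\mathbb H$ is the quaternion algebra with units $\mathbf i,\mathbf j,\mathbf k=\mathbf i\mathbf j$; $\mathbb C_{\mathbf i}=\operatorname{span}_{\mathbb R}\{1,\mathbf i\}\cong\mathbb C$. For $A=Z+W\mathbf j$, $\Phi(A)=\begin{bmatrix}Z&W\\-\overline W&\overline Z\end{bmatrix}$. $\mathbb T^d=[-\pi,\pi)^d$; $\langle\boldsymbol k,\boldsymbol\theta\rangle_S=\sum_{j\in S}k_j\theta_j$; $S_L\dot\cup S_R=\{1,\dots,d\}$ is an ordered partition, $\tau=L$ means $S_L=\{1,\dots,d\}$, $\tau=R$ means $S_R=\{1,\dots,d\}$. Sandwich Fourier coefficients $\widehat F^{(S_L,S_R)}(\boldsymbol k)=(2\pi)^{-d}\int e^{-\mathbf i\langle\boldsymbol k,\boldsymbol\theta\rangle_{S_L}}F(\boldsymbol\theta)e^{-\mathbf i\langle\boldsymbol k,\boldsymbol\theta\rangle_{S_R}}d\boldsymbol\theta$, $T^{(\tau)}_{\boldsymbol n}(F)=[\widehat F^{(\tau)}(\alpha-\beta)]_{\alpha,\beta\in\Lambda_{\boldsymbol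 n}}$, $\Lambda_{\boldsymbol n}=\prod_\ell\{0,\dots,n_\ell-1\}$ (lexicographic), $N_{\boldsymbol n}=\prod n_\ell$. With $r_{S_L}(\boldsymbol\theta)_j=-\theta_j$ for $j\in S_L$ and $\theta_j$ for $j\in S_R$, $G_{(S_L,S_R)}(\boldsymbol\theta)=\begin{pmatrix}Z(\boldsymbol\theta)&W(r_{S_L}(-\boldsymbol\theta))\\-\overline{W(r_{S_L}(\boldsymbol\theta))}&\overline{Z(-\boldsymbol\theta)}\end{pmatrix}$. Spectral essential range: for measurable $H:\mathbb T^d\to\mathbb C^{m\times m}$, $\mathcal R(H)=\bigcup_{j=1}^m\mathcal R(\lambda_j(H))$, where $\mathcal R(\lambda_j(H))$ is the essential range of $\boldsymbol\theta\mapsto\lambda_j(H(\boldsymbol\theta))$ for a measurable labeling of eigenvalues. $\{A_{\boldsymbol n}\}\sim_\lambda G$ (for $A_{\boldsymbol n}\in\mathbb H^{d_{\boldsymbol n}\times d_{\boldsymbol n}}$, $G:\mathbb T^d\to\mathbb C^{q\times q}$) means: for all $\Psi\in C_c(\mathbb C)$, $\lim_{\boldsymbol n\to\infty}\frac1{2d_{\boldsymbol n}}\sum_{j=1}^{2d_{\boldsymbol n}}\Psi(\lambda_j(\Phi(A_{\boldsymbol n})))=\frac1{(2\pi)^d}\int_{\mathbb T^d}\frac1q\sum_{i=1}^q\Psi(\lambda_i(G(\boldsymbol\theta)))d\boldsymbol\theta$, limit as $\min_jn_j\to\infty$. *)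

theory Defs
  imports "HOL-Analysis.Analysis" "HOL-Computational_Algebra.Fundamental_Theorem_Algebra"
    "Jordan_Normal_Form.Char_Poly"
begin

definition torus :: "nat \<Rightarrow> (nat \<Rightarrow> real) measure" where
  "torus d = Pi\<^sub>M {..<d} (\<lambda>_. restrict_space lborel {-pi..<pi})"

text \<open>Quaternions z + w j (z, w in C_i) represented by pairs (z, w); quaternion product.\<close>
definition qmul :: "complex \<times> complex \<Rightarrow> complex \<times> complex \<Rightarrow> complex \<times> complex" where
  "qmul p q = (fst p * fst q - snd p * cnj (snd q), fst p * snd q + snd p * cnj (fst q))"

definition ipS :: "nat set \<Rightarrow> (nat \<Rightarrow> int) \<Rightarrow> (nat \<Rightarrow> real) \<Rightarrow> real" where
  "ipS S k \<theta> = (\<Sum>j\<in>S. real_of_int (k j) * \<theta> j)"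

definition sandwich_coeff ::
  "nat \<Rightarrow> nat set \<Rightarrow> ((nat \<Rightarrow> real) \<Rightarrow> nat \<Rightarrow> nat \<Rightarrow> complex) \<Rightarrow> ((nat \<Rightarrow> real) \<Rightarrow> nat \<Rightarrow> nat \<Rightarrow> complex)
    \<Rightarrow> (nat \<Rightarrow> int) \<Rightarrow> nat \<Rightarrow> nat \<Rightarrow> complex \<times> complex" where
  "sandwich_coeff d SL Z W k a b =
    (let g = (\<lambda>\<theta>. qmul (qmul (exp (- \<i> * complex_of_real (ipS SL k \<theta>)), 0) (Z \<theta> a b, W \<theta> a b))
                       (exp (- \<i> * complex_of_real (ipS ({..<d} - SL) k \<theta>)), 0))
     in (complex_of_real (1 / (2*pi)^d) * integral\<^sup>L (torus d) (\<lambda>\<theta>. fst (g \<theta>)),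
         complex_of_real (1 / (2*pi)^d) * integral\<^sup>L (torus d) (\<lambda>\<theta>. snd (g \<theta>))))"

definition Nn :: "nat \<Rightarrow> (nat \<Rightarrow> nat) \<Rightarrow> nat" where
  "Nn d n = (\<Prod>l<d. n l)"

text \<open>Lexicographic enumeration of Lambda_n: the p-th multi-index.\<close>
definition lex_idx :: "nat \<Rightarrow> (nat \<Rightarrow> nat) \<Rightarrow> nat \<Rightarrow> nat \<Rightarrow> nat" where
  "lex_idx d n p j = (p div (\<Prod>l\<in>{j<..<d}. n l)) mod n j"

text \<open>Multilevel block Toeplitz matrix T_n(F) in H^{(N s) x (N s)}, given as the pair of
  complex matrices (Z-part, W-part), i.e. T = Zpart + Wpart j.\<close>
definition toeplitz ::
  "nat \<Rightarrow> nat set \<Rightarrow> nat \<Rightarrow> ((nat \<Rightarrow> real) \<Rightarrow> nat \<Rightarrow> nat \<Rightarrow> complex) \<Rightarrow> ((nat \<Rightarrow> real) \<Rightarrow> nat \<Rightarrow> nat \<Rightarrow> complex)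
    \<Rightarrow> (nat \<Rightarrow> nat) \<Rightarrow> complex mat \<times> complex mat" where
  "toeplitz d SL s Z W n =
    (let m = Nn d n * s;
         c = (\<lambda>i i'. sandwich_coeff d SL Z W
                 (\<lambda>j. int (lex_idx d n (i div s) j) - int (lex_idx d n (i' div s) j)) (i mod s) (i' mod s))
     in (mat m m (\<lambda>(i,i'). fst (c i i')), mat m m (\<lambda>(i,i'). snd (c i i'))))"

definition Phi :: "complex mat \<times> complex mat \<Rightarrow> complex mat" where
  "Phi A = (let Zm = fst A; Wm = snd A; m = dim_row Zm in
     mat (2*m) (2*m) (\<lambda>(i,j). if i < m \<and> j < m then Zm $$ (i,j)
                             else if i < m then Wm $$ (i, j - m)
                             else if j < m then - cnj (Wm $$ (i - m, j))
                             else cnj (Zm $$ (i - m, j - m))))"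

definition tmod :: "real \<Rightarrow> real" where
  "tmod x = x - 2*pi * of_int \<lfloor>(x + pi) / (2*pi)\<rfloor>"

definition tneg :: "nat \<Rightarrow> (nat \<Rightarrow> real) \<Rightarrow> (nat \<Rightarrow> real)" where
  "tneg d \<theta> = (\<lambda>j. if j < d then tmod (- \<theta> j) else undefined)"

definition rS :: "nat \<Rightarrow> nat set \<Rightarrow> (nat \<Rightarrow> real) \<Rightarrow> (nat \<Rightarrow> real)" where
  "rS d SL \<theta> = (\<lambda>j. if j < d then tmod (if j \<in> SL then - \<theta> j else \<theta> j) else undefined)"

definition Gsym ::
  "nat \<Rightarrow> nat set \<Rightarrow> nat \<Rightarrow> ((nat \<Rightarrow> real) \<Rightarrow> nat \<Rightarrow> nat \<Rightarrow> complex) \<Rightarrow> ((nat \<Rightarrow> real) \<Rightarrow> nat \<Rightarrow> nat \<Rightarrow> complex)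
    \<Rightarrow> (nat \<Rightarrow> real) \<Rightarrow> complex mat" where
  "Gsym d SL s Z W \<theta> =
     mat (2 * s) (2 * s) (\<lambda>(i,j). if i < s \<and> j < s then Z \<theta> i j
                             else if i < s then W (rS d SL (tneg d \<theta>)) i (j - s)
                             else if j < s then - cnj (W (rS d SL \<theta>) (i - s) j)
                             else cnj (Z (tneg d \<theta>) (i - s) (j - s)))"

definition eigs :: "complex mat \<Rightarrow> complex multiset" where
  "eigs A = proots (char_poly A)"

definition meas_labeling :: "nat \<Rightarrow> nat \<Rightarrow> ((nat \<Rightarrow> real) \<Rightarrow> complex mat) \<Rightarrow> (nat \<Rightarrow> (nat \<Rightarrow> real) \<Rightarrow> complex) \<Rightarrow> bool" where
  "meas_labeling d m H lam \<longleftrightarrow> (\<forall>j<m. lam j \<in> borel_measurable (torus d)) \<and>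
     (AE \<theta> in torus d. image_mset (\<lambda>j. lam j \<theta>) (mset_set {..<m}) = eigs (H \<theta>))"

definition ess_range :: "nat \<Rightarrow> ((nat \<Rightarrow> real) \<Rightarrow> complex) \<Rightarrow> complex set" where
  "ess_range d f = {z. \<forall>e>0. emeasure (torus d) {\<theta> \<in> space (torus d). dist (f \<theta>) z < e} \<noteq> 0}"

definition spec_ess_range :: "nat \<Rightarrow> nat \<Rightarrow> ((nat \<Rightarrow> real) \<Rightarrow> complex mat) \<Rightarrow> complex set" where
  "spec_ess_range d m H = (let lam = (SOME lam. meas_labeling d m H lam) in (\<Union>j<m. ess_range d (lam j)))"

text \<open>{A_n} ~_lambda G, with A_n quaternion matrices given as (Z-part, W-part), G q x q.\<close>
definition lambda_distributed ::
  "nat \<Rightarrow> ((nat \<Rightarrow> nat) \<Rightarrow> complex mat \<times> complex mat) \<Rightarrow> nat \<Rightarrow> ((nat \<Rightarrow> real) \<Rightarrow> complex mat) \<Rightarrow> bool" where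
  "lambda_distributed d A q G \<longleftrightarrow>
    (\<forall>\<Psi> :: complex \<Rightarrow> complex. continuous_on UNIV \<Psi> \<and> compact (closure {z. \<Psi> z \<noteq> 0}) \<longrightarrow>
      (\<forall>e>0. \<exists>M. \<forall>n. (\<forall>j<d. M \<le> n j) \<longrightarrow>
         norm ((1 / (2 * of_nat (dim_row (fst (A n))))) * sum_mset (image_mset \<Psi> (eigs (Phi (A n))))
           - complex_of_real (1 / (2*pi)^d) *
             integral\<^sup>L (torus d) (\<lambda>\<theta>. (1 / of_nat q) * sum_mset (image_mset \<Psi> (eigs (G \<theta>))))) < e))"

end

theory Submission
  imports Defs "Jordan_Normal_Form.Schur_Decomposition"
begin

text \<open>
  The isomorphism \<open>Phi\<close> turns the quaternionic sandwich Toeplitz matrices exactly into the block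
  Toeplitz matrices of the complex symbol \<open>G\<close>. These are compressions of bounded multiplication
  operators; since trigonometric polynomials are dense in \<open>L\<^sup>2\<close>, a polynomial of the Toeplitz matrix
  differs from the Toeplitz matrix of the polynomial of the symbol by an error whose normalised
  Frobenius norm vanishes, and taking traces proves the distribution formula for polynomial test
  functions. By Schur's inequality, polynomials that are small on the spectral essential range \<open>S\<close>
  and large at a given point off \<open>S\<close> show that all but a vanishing proportion of the eigenvalues
  cluster at \<open>S\<close>. Finally \<open>S\<close> has empty interior and connected complement, so that by the
  Walsh--Lebesgue theorem real parts of polynomials are uniformly dense in the continuous functions
  on \<open>S\<close>. That theorem is obtained by pushing poles to infinity in the complement of \<open>S\<close>, which
  makes \<open>ln (max (norm (z - c)) \<rho>)\<close> approximable as an average of logarithms with poles off \<open>S\<close>;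
  these truncated logarithms generate the Gaussians, and the Stone--Weierstrass theorem applies.
\<close>


section \<open>Polynomial approximation on compact sets with connected complement\<close>

text \<open>The obstacle is non-normality. Traces of polynomials alone do not control continuous
  test functions, since the eigenvalues of a Toeplitz matrix may stray from those of its symbol. Nor
  does smallness of a polynomial P on S make P(G) small, because G is not normal either. Hence the
  powers P^k: where |P| \<le> 1/4 on S, the entries of P(G)^k decay like (3/8)^k, while an
  eigenvalue of the Toeplitz matrix with |P| > 1/2 contributes more than (1/2)^k. The gap 1/4 < 3/8
  < 1/2 fixes the constants, and k is chosen before n. In the approximation part, the mean of ln |z
  - c - \<rho> u| over the N-th roots of unity u discretises Jensen's formula, whose circle mean is
  ln (max |z - c| \<rho>). Its poles may lie in S, so each is smeared along a path off S. The
  smeared potential is then bounded by O(ln N) on S, however close the path comes to S, and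
  averaging over N poles makes this negligible.\<close>

definition poly_approx :: "complex set \<Rightarrow> (complex \<Rightarrow> complex) \<Rightarrow> bool" where
  "poly_approx S g \<longleftrightarrow> (\<forall>e>0. \<exists>p. \<forall>z\<in>S. norm (g z - poly p z) < e)"

text \<open>Real parts are enough in the end, because sums over eigenvalues commute with complex
  conjugation. They are also the natural target: the building blocks are logarithmic potentials,
  which are real.\<close>

definition re_poly_approx :: "complex set \<Rightarrow> (complex \<Rightarrow> real) \<Rightarrow> bool" where
  "re_poly_approx S h \<longleftrightarrow> (\<forall>e>0. \<exists>p. \<forall>z\<in>S. \<bar>h z - Re (poly p z)\<bar> < e)"

lemma bounded_poly_image:
  assumes "bounded (S :: complex set)"
  shows "bounded (poly p ` S)"
proof -
  have "compact (poly p ` closure S)"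
    using assms by (intro compact_continuous_image continuous_intros) auto
  then show ?thesis
    by (meson bounded_subset closure_subset compact_imp_bounded image_mono)
qed

lemma poly_approx_bounded:
  assumes "bounded S" "poly_approx S g"
  obtains B where "B > 0" "\<And>z. z \<in> S \<Longrightarrow> norm (g z) \<le> B"
proof -
  obtain p where p: "\<forall>z\<in>S. norm (g z - poly p z) < 1"
    using assms(2) unfolding poly_approx_def by (auto dest: spec[of _ 1])
  obtain C where C: "\<And>z. z \<in> S \<Longrightarrow> norm (poly p z) \<le> C"
    using bounded_poly_image[OF assms(1), of p] unfolding bounded_iff by auto
  have "norm (g z) \<le> 1 + \<bar>C\<bar>" if "z \<in> S" for z
    using norm_triangle_ineq[of "g z - poly p z" "poly p z"] p C[OF that] that by force
  then show ?thesis using that[of "1 + \<bar>C\<bar>"] by auto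
qed

lemma poly_approx_poly: "poly_approx S (poly p)"
  unfolding poly_approx_def by (intro allI impI exI[of _ p]) auto

lemma poly_approx_cong:
  "poly_approx S g \<Longrightarrow> (\<And>z. z \<in> S \<Longrightarrow> g z = h z) \<Longrightarrow> poly_approx S h"
  unfolding poly_approx_def by (metis (no_types))

lemma poly_approx_const: "poly_approx S (\<lambda>_. c)"
  by (rule poly_approx_cong[OF poly_approx_poly[of S "[:c:]"]]) auto

lemma poly_approx_ident: "poly_approx S (\<lambda>z. z)"
  by (rule poly_approx_cong[OF poly_approx_poly[of S "[:0,1:]"]]) auto

lemma poly_approx_add:
  assumes "poly_approx S g" "poly_approx S h"
  shows "poly_approx S (\<lambda>z. g z + h z)"
  unfolding poly_approx_def
proof (intro allI impI)
  fix e :: real assume "e > 0"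
  then obtain p q where "\<forall>z\<in>S. norm (g z - poly p z) < e/2" "\<forall>z\<in>S. norm (h z - poly q z) < e/2"
    using assms unfolding poly_approx_def by (meson half_gt_zero)
  then have "\<forall>z\<in>S. norm (g z + h z - poly (p + q) z) < e"
    by (auto simp: add_diff_add intro!: norm_add_less[of _ "e/2" _ "e/2", simplified])
  then show "\<exists>p. \<forall>z\<in>S. norm (g z + h z - poly p z) < e" by blast
qed

lemma poly_approx_mult:
  assumes "bounded S" "poly_approx S g" "poly_approx S h"
  shows "poly_approx S (\<lambda>z. g z * h z)"
  unfolding poly_approx_def
proof (intro allI impI)
  fix e :: real assume e: "e > 0"
  obtain B where B: "B > 0" "\<And>z. z \<in> S \<Longrightarrow> norm (g z) \<le> B"
    using poly_approx_bounded[OF assms(1,2)] by blast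
  obtain q where q: "\<forall>z\<in>S. norm (h z - poly q z) < e / (2 * B)"
    using assms(3) e B unfolding poly_approx_def by (metis divide_pos_pos mult_pos_pos zero_less_numeral)
  obtain C where C: "\<And>z. z \<in> S \<Longrightarrow> norm (poly q z) \<le> C"
    using bounded_poly_image[OF assms(1), of q] unfolding bounded_iff by auto
  define C' where "C' = \<bar>C\<bar> + 1"
  have C': "C' > 0" "\<And>z. z \<in> S \<Longrightarrow> norm (poly q z) \<le> C'" using C unfolding C'_def by force+
  obtain p where p: "\<forall>z\<in>S. norm (g z - poly p z) < e / (2 * C')"
    using assms(2) e C' unfolding poly_approx_def by (metis divide_pos_pos mult_pos_pos zero_less_numeral)
  have "norm (g z * h z - poly (p * q) z) < e" if "z \<in> S" for z
  proof -
    have "norm (g z * h z - poly (p * q) z) = norm (g z * (h z - poly q z) + (g z - poly p z) * poly q z)"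
      by (simp add: algebra_simps)
    also have "\<dots> \<le> norm (g z) * norm (h z - poly q z) + norm (g z - poly p z) * norm (poly q z)"
      by (metis norm_mult norm_triangle_ineq)
    also have "\<dots> \<le> B * norm (h z - poly q z) + norm (g z - poly p z) * C'"
      using B C' that by (intro add_mono mult_mono) auto
    also have "\<dots> < B * (e / (2*B)) + e / (2 * C') * C'"
      using p q that B C' by (intro add_strict_mono mult_strict_left_mono mult_strict_right_mono) auto
    also have "\<dots> = e" using B C' by (simp add: field_simps)
    finally show ?thesis .
  qed
  then show "\<exists>p. \<forall>z\<in>S. norm (g z * h z - poly p z) < e" by blast
qed

lemma poly_approx_power:
  "bounded S \<Longrightarrow> poly_approx S g \<Longrightarrow> poly_approx S (\<lambda>z. g z ^ n)"
  by (induction n) (auto intro: poly_approx_const poly_approx_mult)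

lemma poly_approx_sum:
  "(\<And>i. i \<in> I \<Longrightarrow> poly_approx S (g i)) \<Longrightarrow> poly_approx S (\<lambda>z. \<Sum>i\<in>I. g i z)"
  by (induction I rule: infinite_finite_induct) (auto intro: poly_approx_const poly_approx_add)

lemma poly_approx_limit:
  assumes "\<And>e. e > 0 \<Longrightarrow> \<exists>h. poly_approx S h \<and> (\<forall>z\<in>S. norm (g z - h z) < e)"
  shows "poly_approx S g"
  unfolding poly_approx_def
proof (intro allI impI)
  fix e :: real assume "e > 0"
  then obtain h where h: "poly_approx S h" "\<forall>z\<in>S. norm (g z - h z) < e/2"
    using assms[of "e/2"] by auto
  then obtain p where "\<forall>z\<in>S. norm (h z - poly p z) < e/2"
    using \<open>e > 0\<close> unfolding poly_approx_def by (meson half_gt_zero)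
  then have "\<forall>z\<in>S. norm (g z - poly p z) < e"
    using h(2) by (metis (no_types, lifting) dist_norm dist_triangle_half_r dist_commute)
  then show "\<exists>p. \<forall>z\<in>S. norm (g z - poly p z) < e" by blast
qed

lemma re_poly_approx_cong:
  "re_poly_approx S g \<Longrightarrow> (\<And>z. z \<in> S \<Longrightarrow> g z = h z) \<Longrightarrow> re_poly_approx S h"
  unfolding re_poly_approx_def by (metis (no_types))

lemma re_poly_approx_limit:
  assumes "\<And>e. e > 0 \<Longrightarrow> \<exists>h. re_poly_approx S h \<and> (\<forall>z\<in>S. \<bar>g z - h z\<bar> < e)"
  shows "re_poly_approx S g"
  unfolding re_poly_approx_def
proof (intro allI impI)
  fix e :: real assume "e > 0"
  then obtain h where h: "re_poly_approx S h" "\<forall>z\<in>S. \<bar>g z - h z\<bar> < e/2"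
    using assms[of "e/2"] by auto
  then obtain p where p: "\<forall>z\<in>S. \<bar>h z - Re (poly p z)\<bar> < e/2"
    using \<open>e > 0\<close> unfolding re_poly_approx_def by (meson half_gt_zero)
  have "\<bar>g z - Re (poly p z)\<bar> < e" if "z \<in> S" for z
    using h(2) p that by (smt (verit) field_sum_of_halves)
  then show "\<exists>p. \<forall>z\<in>S. \<bar>g z - Re (poly p z)\<bar> < e" by blast
qed

lemma re_poly_approx_Re:
  assumes "poly_approx S g" shows "re_poly_approx S (\<lambda>z. Re (g z))"
  unfolding re_poly_approx_def
proof (intro allI impI)
  fix e :: real assume "e > 0"
  then obtain p where "\<forall>z\<in>S. norm (g z - poly p z) < e"
    using assms unfolding poly_approx_def by blast
  then have "\<forall>z\<in>S. \<bar>Re (g z) - Re (poly p z)\<bar> < e"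
    using abs_Re_le_cmod by (smt (verit, best) minus_complex.sel(1))
  then show "\<exists>p. \<forall>z\<in>S. \<bar>Re (g z) - Re (poly p z)\<bar> < e" by blast
qed

lemma re_poly_approx_const: "re_poly_approx S (\<lambda>_. c)"
  using re_poly_approx_Re[OF poly_approx_const[of S "of_real c"]] by simp

lemma re_poly_approx_add:
  assumes "re_poly_approx S g" "re_poly_approx S h"
  shows "re_poly_approx S (\<lambda>z. g z + h z)"
  unfolding re_poly_approx_def
proof (intro allI impI)
  fix e :: real assume "e > 0"
  then obtain p q where pq: "\<forall>z\<in>S. \<bar>g z - Re (poly p z)\<bar> < e/2" "\<forall>z\<in>S. \<bar>h z - Re (poly q z)\<bar> < e/2"
    using assms unfolding re_poly_approx_def by (meson half_gt_zero)
  have "\<bar>g z + h z - Re (poly (p + q) z)\<bar> < e" if "z \<in> S" for z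
    using pq that by (smt (verit) field_sum_of_halves plus_complex.sel(1) poly_add)
  then show "\<exists>p. \<forall>z\<in>S. \<bar>g z + h z - Re (poly p z)\<bar> < e" by blast
qed

lemma re_poly_approx_cmult:
  assumes "re_poly_approx S g"
  shows "re_poly_approx S (\<lambda>z. c * g z)"
proof (cases "c = 0")
  case True
  then show ?thesis using re_poly_approx_const[of S 0] by simp
next
  case False
  show ?thesis
    unfolding re_poly_approx_def
  proof (intro allI impI)
    fix e :: real assume "e > 0"
    then obtain p where p: "\<forall>z\<in>S. \<bar>g z - Re (poly p z)\<bar> < e / \<bar>c\<bar>"
      using assms False unfolding re_poly_approx_def by (meson divide_pos_pos zero_less_abs_iff)
    have "\<bar>c * g z - Re (poly (Polynomial.smult (of_real c) p) z)\<bar> < e" if "z \<in> S" for z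
    proof -
      have "\<bar>c * g z - Re (poly (Polynomial.smult (of_real c) p) z)\<bar> = \<bar>c\<bar> * \<bar>g z - Re (poly p z)\<bar>"
        by (simp add: abs_mult[symmetric] algebra_simps)
      also have "\<dots> < \<bar>c\<bar> * (e / \<bar>c\<bar>)"
        using p that False by (intro mult_strict_left_mono) auto
      finally show ?thesis using False by simp
    qed
    then show "\<exists>p. \<forall>z\<in>S. \<bar>c * g z - Re (poly p z)\<bar> < e" by blast
  qed
qed

lemma re_poly_approx_diff:
  "re_poly_approx S g \<Longrightarrow> re_poly_approx S h \<Longrightarrow> re_poly_approx S (\<lambda>z. g z - h z)"
  using re_poly_approx_add[OF _ re_poly_approx_cmult[of S h "-1"], of g] by simp

lemma re_poly_approx_sum:
  "(\<And>i. i \<in> I \<Longrightarrow> re_poly_approx S (g i)) \<Longrightarrow> re_poly_approx S (\<lambda>z. \<Sum>i\<in>I. g i z)"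
  by (induction I rule: infinite_finite_induct) (auto intro: re_poly_approx_const re_poly_approx_add)

text \<open>Geometric series in \<open>g\<close>, with uniform tail 2 (1/2)^n. It moves a pole from
  x to a nearby y, since 1/(z - y) = (1/(z - x)) (1/(1 - g z)) for g z = (y - x)/(z - x).\<close>

lemma poly_approx_inverse_one_minus:
  assumes S: "bounded S" and g: "poly_approx S g" and half: "\<And>z. z \<in> S \<Longrightarrow> norm (g z) \<le> 1/2"
  shows "poly_approx S (\<lambda>z. 1 / (1 - g z))"
proof (rule poly_approx_limit)
  fix e :: real assume e: "e > 0"
  obtain n where n: "2 * (1/2::real) ^ n < e"
    using real_arch_pow_inv[of "e/2" "1/2"] e by (auto simp: mult.commute)
  have "norm (1 / (1 - g z) - (\<Sum>i<n. g z ^ i)) < e" if "z \<in> S" for z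
  proof -
    have ne: "g z \<noteq> 1" using half[OF that] by auto
    have "norm (1 - g z) \<ge> 1/2"
      using half[OF that] norm_triangle_ineq2[of 1 "g z"] by simp
    moreover have "1 / (1 - g z) - (\<Sum>i<n. g z ^ i) = g z ^ n / (1 - g z)"
      using ne by (simp add: sum_gp_strict field_simps)
    ultimately have "norm (1 / (1 - g z) - (\<Sum>i<n. g z ^ i)) \<le> (1/2)^n / (1/2)"
      using half[OF that] by (auto simp only: norm_divide norm_power intro!: frac_le power_mono zero_le_power norm_ge_zero)
    then show ?thesis using n by simp
  qed
  moreover have "poly_approx S (\<lambda>z. \<Sum>i<n. g z ^ i)"
    using S g by (intro poly_approx_sum poly_approx_power)
  ultimately show "\<exists>h. poly_approx S h \<and> (\<forall>z\<in>S. norm (1 / (1 - g z) - h z) < e)" by blast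
qed

text \<open>The same device for logarithmic potentials: ln |1 - g| is the real part of Ln (1 - g),
  whose Taylor series converges uniformly for |g| \<le> 1/2.\<close>

lemma re_poly_approx_ln_one_minus:
  assumes S: "bounded S" and g: "poly_approx S g" and half: "\<And>z. z \<in> S \<Longrightarrow> norm (g z) \<le> 1/2"
  shows "re_poly_approx S (\<lambda>z. ln (norm (1 - g z)))"
proof -
  \<comment> \<open>The term i = 0 vanishes, as division by \<open>of_nat 0\<close> yields 0; this
    is the form of \<open>Ln_series\<close>.\<close>
  define L where "L n w = (\<Sum>i<n. (-1) ^ Suc i / of_nat i * w ^ i)" for n and w :: complex
  have "poly_approx S (\<lambda>z. Ln (1 - g z))"
  proof (rule poly_approx_limit)
    fix e :: real assume e: "e > 0"
    have unif: "uniform_limit (cball 0 (1/2)) L (\<lambda>w. Ln (1 + w)) sequentially"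
    proof -
      have "uniform_limit (cball (0::complex) (1/2)) (\<lambda>n w. \<Sum>i<n. (-1) ^ Suc i / of_nat i * w ^ i)
          (\<lambda>w. \<Sum>i. (-1) ^ Suc i / of_nat i * w ^ i) sequentially"
      proof (rule Weierstrass_m_test)
        fix i :: nat and w :: complex assume "w \<in> cball 0 (1/2)"
        then have w: "norm w \<le> 1/2" by simp
        have "norm ((-1) ^ Suc i / of_nat i * w ^ i :: complex) = (1 / real i) * norm w ^ i"
          by (simp add: norm_mult norm_divide norm_power)
        also have "\<dots> \<le> 1 * (1/2) ^ i"
          using w by (intro mult_mono power_mono) (auto simp: divide_le_eq)
        finally show "norm ((-1) ^ Suc i / of_nat i * w ^ i :: complex) \<le> (1/2)^i" by simp
      qed (simp add: summable_geometric)
      moreover have "(\<Sum>i. (-1) ^ Suc i / of_nat i * w ^ i) = Ln (1 + w)" if "w \<in> cball 0 (1/2)" for w :: complex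
        using Ln_series[of w] that by (simp add: sums_iff)
      ultimately show ?thesis unfolding L_def
        using uniform_limit_cong'[of "cball 0 (1/2)" "\<lambda>n w. \<Sum>i<n. (-1) ^ Suc i / of_nat i * w ^ i"
            "\<lambda>n w. \<Sum>i<n. (-1) ^ Suc i / of_nat i * w ^ i" "\<lambda>w. \<Sum>i. (-1) ^ Suc i / of_nat i * w ^ i" "\<lambda>w. Ln (1 + w)" sequentially]
        by blast
    qed
    then obtain n where n: "\<And>w. w \<in> cball 0 (1/2) \<Longrightarrow> dist (L n w) (Ln (1 + w)) < e"
      using e unfolding uniform_limit_iff eventually_sequentially by blast
    have "norm (Ln (1 - g z) - L n (- g z)) < e" if "z \<in> S" for z
      using n[of "- g z"] half[OF that] by (simp add: dist_norm norm_minus_commute)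
    moreover have "poly_approx S (\<lambda>z. L n (- g z))"
      unfolding L_def
      using S g poly_approx_mult[OF S poly_approx_const[of S "-1"] g]
      by (intro poly_approx_sum poly_approx_mult poly_approx_const poly_approx_power) auto
    ultimately show "\<exists>h. poly_approx S h \<and> (\<forall>z\<in>S. norm (Ln (1 - g z) - h z) < e)" by blast
  qed
  then have "re_poly_approx S (\<lambda>z. Re (Ln (1 - g z)))" by (rule re_poly_approx_Re)
  then show ?thesis
  proof (rule re_poly_approx_cong)
    fix z assume "z \<in> S"
    then have "1 - g z \<noteq> 0" using half[of z] by auto
    then show "Re (Ln (1 - g z)) = ln (norm (1 - g z))" by simp
  qed
qed

text \<open>Pole pushing: the set of admissible poles is open and closed in the complement of \<open>S\<close>.\<close>

lemma poly_approx_Cauchy_kernel: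
  assumes S: "compact S" and conn: "connected (- S)" and \<zeta>: "\<zeta> \<notin> S"
  shows "poly_approx S (\<lambda>z. 1 / (z - \<zeta>))" "re_poly_approx S (\<lambda>z. ln (norm (z - \<zeta>)))"
proof -
  have bd: "bounded S" using S compact_imp_bounded by blast
  define P where "P \<zeta> \<longleftrightarrow> poly_approx S (\<lambda>z. 1 / (z - \<zeta>)) \<and> re_poly_approx S (\<lambda>z. ln (norm (z - \<zeta>)))" for \<zeta>
  obtain R where R: "R > 0" "\<And>z. z \<in> S \<Longrightarrow> norm z \<le> R"
    using bd unfolding bounded_pos by blast
  \<comment> \<open>At twice the radius of S the quotient z/\<zeta>0 has modulus at most 1/2 on S,
    so power series in z itself provide the first admissible pole.\<close>
  define \<zeta>0 :: complex where "\<zeta>0 = of_real (2 * R)"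
  have \<zeta>0: "\<zeta>0 \<notin> S" "\<zeta>0 \<noteq> 0" "norm \<zeta>0 = 2 * R" using R unfolding \<zeta>0_def by force+
  have g0: "poly_approx S (\<lambda>z. z * (1 / \<zeta>0))"
    by (intro poly_approx_mult bd poly_approx_ident poly_approx_const)
  have h0: "norm (z * (1 / \<zeta>0)) \<le> 1/2" if "z \<in> S" for z
    using R(1) R(2)[OF that] \<zeta>0 by (simp add: norm_mult norm_divide)
  have far: "z - \<zeta>0 = (-\<zeta>0) * (1 - z * (1 / \<zeta>0))" for z using \<zeta>0 by (simp add: field_simps)
  have P0: "P \<zeta>0"
    unfolding P_def
  proof
    have "poly_approx S (\<lambda>z. (-1/\<zeta>0) * (1 / (1 - z * (1 / \<zeta>0))))"
      by (intro poly_approx_mult bd poly_approx_const poly_approx_inverse_one_minus g0 h0)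
    then show "poly_approx S (\<lambda>z. 1 / (z - \<zeta>0))"
      by (rule poly_approx_cong) (simp add: far)
    have "re_poly_approx S (\<lambda>z. ln (norm \<zeta>0) + ln (norm (1 - z * (1 / \<zeta>0))))"
      by (intro re_poly_approx_add re_poly_approx_const re_poly_approx_ln_one_minus bd g0 h0)
    then show "re_poly_approx S (\<lambda>z. ln (norm (z - \<zeta>0)))"
    proof (rule re_poly_approx_cong)
      fix z assume "z \<in> S"
      then have "z * (1 / \<zeta>0) \<noteq> 1" using h0[of z] by auto
      then show "ln (norm \<zeta>0) + ln (norm (1 - z * (1 / \<zeta>0))) = ln (norm (z - \<zeta>0))"
        using \<zeta>0 R(1) unfolding far by (simp add: norm_mult ln_mult)
    qed
  qed
  have step: "\<exists>T. openin (top_of_set (- S)) T \<and> a \<in> T \<and> (\<forall>x\<in>T. \<forall>y\<in>T. P x \<longrightarrow> P y)"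
    if aS: "a \<in> - S" for a
  proof -
    have "open (- S)" using S by (simp add: compact_imp_closed open_Compl)
    then obtain e where e: "e > 0" "ball a e \<subseteq> - S"
      using openE[OF _ aS] by metis
    \<comment> \<open>S keeps distance e from a, so for x, y in the small ball |y - x| \<le> e/4 and
      |z - x| \<ge> e/2 on S, whence the quotient is at most 1/2. As x and y are interchangeable,
      \<open>P\<close> is locally constant on the complement, which is what induction over a
      connected set requires.\<close>
    have "P y" if x: "x \<in> ball a (e/8)" and y: "y \<in> ball a (e/8)" and Px: "P x" for x y
    proof -
      have dS: "norm (z - x) \<ge> e/2" if "z \<in> S" for z
      proof -
        have "z \<notin> ball a e" using e that by auto
        then show ?thesis using x dist_triangle[of a z x] e(1)
          by (simp add: dist_norm norm_minus_commute)
      qed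
      have "dist x y < e/4" using x y dist_triangle[of x y a] by (auto simp: dist_commute)
      then have xy: "norm (y - x) \<le> e/4" by (simp add: dist_norm norm_minus_commute)
      have g: "poly_approx S (\<lambda>z. (y - x) * (1 / (z - x)))"
        using Px unfolding P_def by (intro poly_approx_mult bd poly_approx_const) auto
      have h: "norm ((y - x) * (1 / (z - x))) \<le> 1/2" if "z \<in> S" for z
      proof -
        have "norm (y - x) / norm (z - x) \<le> (e/4) / (e/2)"
          using dS[OF that] xy e(1) by (intro frac_le) auto
        then show ?thesis using e(1) by (simp add: norm_mult norm_divide)
      qed
      have zx: "z - x \<noteq> 0" if "z \<in> S" for z using dS[OF that] e(1) by auto
      have near: "z - y = (z - x) * (1 - (y - x) * (1 / (z - x)))" if "z \<in> S" for z
        using zx[OF that] by (simp add: field_simps)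
      show "P y"
        unfolding P_def
      proof
        have "poly_approx S (\<lambda>z. (1 / (z - x)) * (1 / (1 - (y - x) * (1 / (z - x)))))"
          using Px unfolding P_def
          by (intro poly_approx_mult bd poly_approx_inverse_one_minus g h) auto
        then show "poly_approx S (\<lambda>z. 1 / (z - y))"
          by (rule poly_approx_cong) (simp add: near)
        have "re_poly_approx S (\<lambda>z. ln (norm (z - x)) + ln (norm (1 - (y - x) * (1 / (z - x)))))"
          using Px unfolding P_def by (intro re_poly_approx_add re_poly_approx_ln_one_minus bd g h) auto
        then show "re_poly_approx S (\<lambda>z. ln (norm (z - y)))"
        proof (rule re_poly_approx_cong)
          fix z assume z: "z \<in> S"
          then have "(y - x) * (1 / (z - x)) \<noteq> 1" using h[of z] by auto
          then show "ln (norm (z - x)) + ln (norm (1 - (y - x) * (1 / (z - x)))) = ln (norm (z - y))"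
            using zx[OF z] unfolding near[OF z] by (simp add: norm_mult ln_mult)
        qed
      qed
    qed
    moreover have "openin (top_of_set (- S)) (ball a (e/8))"
    proof (rule open_subset)
      show "ball a (e/8) \<subseteq> - S" using e(1) by (intro order_trans[OF subset_ball e(2)]) simp
    qed auto
    moreover have "a \<in> ball a (e/8)" using e(1) by simp
    ultimately show ?thesis by (intro exI[of _ "ball a (e/8)"] conjI ballI impI)
  qed
  have "P \<zeta>"
    using \<zeta>0(1) \<zeta> by (intro connected_induction_simple[OF conn _ _ P0 step]) auto
  then show "poly_approx S (\<lambda>z. 1 / (z - \<zeta>))" "re_poly_approx S (\<lambda>z. ln (norm (z - \<zeta>)))"
    unfolding P_def by auto
qed

section \<open>Logarithmic potentials with poles off S near a given point\<close>

lemma ln_fact_ge: "real M * ln (real M) - real M \<le> ln (fact M)"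
proof (cases "M = 0")
  case False
  have sm: "summable (\<lambda>n. inverse (fact n) * real M ^ n)"
    using summable_exp[of "real M"] by (simp add: field_simps)
  \<comment> \<open>A single term of the exponential series already gives M^M / M! \<le> exp M, a
    weak form of Stirling that suffices.\<close>
  have "(\<Sum>n\<in>{M}. inverse (fact n) * real M ^ n) \<le> (\<Sum>n. inverse (fact n) * real M ^ n)"
    by (rule sum_le_suminf[OF sm]) auto
  then have "real M ^ M / fact M \<le> exp (real M)"
    by (simp add: exp_def scaleR_conv_of_real field_simps)
  then have "ln (real M ^ M / fact M) \<le> real M"
    using False by (subst ln_le_cancel_iff[of "real M ^ M / fact M" "exp (real M)", unfolded ln_exp]) auto
  then show ?thesis using False by (simp add: ln_div ln_realpow)
qed auto

text \<open>The indices left and right of \<open>i0\<close> give two sums of nonpositive terms, each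
  over part of {1..M} and hence at least the full sum. In the full sum, M ln M cancels against ln
  M!, so the bound is linear in M and survives averaging as a constant.\<close>

lemma sum_ln_distance_ge:
  fixes r :: real
  assumes r: "0 < r" "r \<le> 1" and i0: "i0 < M"
  shows "2 * (real M * ln (r/4) - real M)
    \<le> (\<Sum>i\<in>{..<M} - {i0}. ln (\<bar>real i - real i0\<bar> * r / (4 * real M)))"
proof -
  define g where "g j = ln (real j * r / (4 * real M))" for j :: nat
  have M: "M > 0" using i0 by auto
  have neg: "g j \<le> 0" if "j \<in> {1..M}" for j
  proof -
    have "real j * r \<le> real M * 1" using that r by (intro mult_mono) auto
    then show ?thesis using that r M unfolding g_def by (subst ln_le_zero_iff) (auto simp: field_simps)
  qed
  have eq: "(\<Sum>j=1..M. g j) = real M * ln (r/4) - real M * ln (real M) + ln (fact M)"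
  proof -
    have "(\<Sum>j=1..M. g j) = (\<Sum>j=1..M. ln (real j) + (ln (r/4) - ln (real M)))"
      using r M by (intro sum.cong) (auto simp: g_def ln_mult ln_div)
    also have "\<dots> = (\<Sum>j=1..M. ln (real j)) + real M * (ln (r/4) - ln (real M))"
      by (simp add: sum.distrib)
    also have "(\<Sum>j=1..M. ln (real j)) = ln (fact M)"
      by (subst fact_prod, simp only: of_nat_prod, subst ln_prod) auto
    finally show ?thesis by (simp add: algebra_simps)
  qed
  have "{..<M} - {i0} = {..<i0} \<union> {i0<..<M}" using i0 by auto
  then have "(\<Sum>i\<in>{..<M} - {i0}. ln (\<bar>real i - real i0\<bar> * r / (4 * real M)))
     = (\<Sum>i\<in>{..<i0}. ln (\<bar>real i - real i0\<bar> * r / (4 * real M)))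
      + (\<Sum>i\<in>{i0<..<M}. ln (\<bar>real i - real i0\<bar> * r / (4 * real M)))"
    by (simp add: sum.union_disjoint disjoint_iff)
  also have "(\<Sum>i\<in>{..<i0}. ln (\<bar>real i - real i0\<bar> * r / (4 * real M))) = (\<Sum>j\<in>{1..i0}. g j)"
    unfolding g_def
    by (rule sum.reindex_bij_witness[where i = "\<lambda>j. i0 - j" and j = "\<lambda>i. i0 - i"])
       (auto simp: of_nat_diff)
  also have "(\<Sum>i\<in>{i0<..<M}. ln (\<bar>real i - real i0\<bar> * r / (4 * real M))) = (\<Sum>j\<in>{1..<M - i0}. g j)"
    unfolding g_def
    by (rule sum.reindex_bij_witness[where i = "\<lambda>j. i0 + j" and j = "\<lambda>i. i - i0"])
       (auto simp: of_nat_diff)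
  finally have "(\<Sum>i\<in>{..<M} - {i0}. ln (\<bar>real i - real i0\<bar> * r / (4 * real M)))
      = (\<Sum>j\<in>{1..i0}. g j) + (\<Sum>j\<in>{1..<M - i0}. g j)" .
  moreover have "(\<Sum>j\<in>{1..M}. - g j) \<ge> (\<Sum>j\<in>{1..i0}. - g j)"
    using i0 by (intro sum_mono2) (auto simp: neg)
  moreover have "(\<Sum>j\<in>{1..M}. - g j) \<ge> (\<Sum>j\<in>{1..<M - i0}. - g j)"
    using i0 by (intro sum_mono2) (auto simp: neg)
  ultimately have "2 * (\<Sum>j=1..M. g j) \<le> (\<Sum>i\<in>{..<M} - {i0}. ln (\<bar>real i - real i0\<bar> * r / (4 * real M)))"
    by (simp add: sum_negf)
  moreover have "2 * (real M * ln (r/4) - real M) \<le> 2 * (\<Sum>j=1..M. g j)"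
    unfolding eq using ln_fact_ge[of M] by simp
  ultimately show ?thesis by (rule order_trans[rotated])
qed

lemma abs_ln_diff_le:
  fixes x D r :: real
  assumes "0 < r" "2 * r \<le> D" "\<bar>x - D\<bar> \<le> r"
  shows "\<bar>ln x - ln D\<bar> \<le> 2 * r / D"
proof -
  have pos: "x > 0" "D > 0" "D - r > 0" using assms by auto
  have "ln x - ln D \<le> (x - D) / D" using ln_diff_le pos by blast
  also have "\<dots> \<le> 2 * r / D" using assms pos by (intro divide_right_mono) auto
  finally have 1: "ln x - ln D \<le> 2 * r / D" .
  have "ln D - ln x \<le> (D - x) / x" using ln_diff_le pos by blast
  also have "\<dots> \<le> r / (D - r)"
    using assms pos by (intro frac_le) auto
  also have "\<dots> \<le> 2 * r / D" using assms pos by (simp add: field_simps)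
  finally show ?thesis using 1 by linarith
qed

text \<open>A bounded substitute for ln |z - \<zeta>| when \<zeta> may lie in S. Empty interior
  provides a point off S near \<zeta>, and the connected complement a path from it that leaves the
  disc of radius r. Spreading the pole over M points of the path, at equally spaced distances from
  \<zeta>, leaves at most one pole much closer to z than the spacing, with weight 1/M. So the lower
  bound depends on r only, not on how the path winds around S.\<close>

lemma log_average_near_point:
  assumes S: "compact S" "interior S = {}" "connected (- S)" and r: "0 < r" "r \<le> 1"
  obtains p where "re_poly_approx S p"
    and "\<And>z. z \<in> S \<Longrightarrow> 2 * ln (r/4) - 3 \<le> p z"
    and "\<And>z. z \<in> S \<Longrightarrow> p z \<le> ln (norm (z - \<zeta>) + r)"
    and "\<And>z. z \<in> S \<Longrightarrow> 2 * r \<le> norm (z - \<zeta>) \<Longrightarrow> \<bar>p z - ln (norm (z - \<zeta>))\<bar> \<le> 2 * r / norm (z - \<zeta>)"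
proof -
  have bd: "bounded S" and cl: "closed S" using S compact_imp_bounded compact_imp_closed by auto
  have "\<not> ball \<zeta> (r/2) \<subseteq> S"
    using S(2) r by (metis interior_maximal open_ball centre_in_ball half_gt_zero subset_empty empty_iff)
  then obtain \<xi>0 where \<xi>0: "\<xi>0 \<notin> S" "norm (\<xi>0 - \<zeta>) < r/2"
    unfolding subset_iff mem_ball dist_norm norm_minus_commute[of \<zeta>] by blast
  obtain R where R: "R > 0" "\<And>z. z \<in> S \<Longrightarrow> norm z \<le> R" using bd unfolding bounded_pos by blast
  define \<eta> :: complex where "\<eta> = of_real (R + norm \<zeta> + 1)"
  have n\<eta>: "norm \<eta> = R + norm \<zeta> + 1" unfolding \<eta>_def using R by (simp only: norm_of_real) simp
  have \<eta>: "\<eta> \<notin> S" using R(2)[of \<eta>] n\<eta> norm_ge_zero[of \<zeta>] by force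
  have \<eta>r: "norm (\<eta> - \<zeta>) \<ge> r" using norm_triangle_ineq2[of \<eta> \<zeta>] n\<eta> R(1) r by linarith
  have "path_connected (- S)" using S cl by (simp add: connected_open_path_connected open_Compl)
  then obtain g where g: "path g" "path_image g \<subseteq> - S" "pathstart g = \<xi>0" "pathfinish g = \<eta>"
    using \<xi>0 \<eta> unfolding path_connected_def by blast
  have E: "compact (path_image g)" "connected (path_image g)"
    using g by (auto simp: compact_path_image connected_path_image)
  obtain \<delta> where \<delta>: "\<delta> > 0" "\<And>x y. x \<in> path_image g \<Longrightarrow> y \<in> S \<Longrightarrow> \<delta> \<le> dist x y"
    using separate_compact_closed[OF E(1) cl] g by blast
  \<comment> \<open>The path starts within r/2 of \<zeta> and ends at distance at least r, so by
    connectedness it meets every circle in between.\<close>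
  have ex: "\<exists>x\<in>path_image g. norm (x - \<zeta>) = t" if t: "r/2 \<le> t" "t \<le> r" for t
  proof -
    have "connected ((\<lambda>x. norm (x - \<zeta>)) ` path_image g)"
      by (intro connected_continuous_image continuous_intros E)
    moreover have "norm (\<xi>0 - \<zeta>) \<in> (\<lambda>x. norm (x - \<zeta>)) ` path_image g"
      "norm (\<eta> - \<zeta>) \<in> (\<lambda>x. norm (x - \<zeta>)) ` path_image g"
      using pathstart_in_path_image[of g] pathfinish_in_path_image[of g] g by auto
    ultimately have "t \<in> (\<lambda>x. norm (x - \<zeta>)) ` path_image g"
      by (rule connectedD_interval) (use \<xi>0 \<eta>r t in auto)
    then show ?thesis by auto
  qed
  \<comment> \<open>\<open>M\<close> is so large that the one pole controlled only by \<delta> costs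
    at most 1 after averaging. With the 2 from \<open>sum_ln_distance_ge\<close> this makes the
    constant 3 of the lower bound.\<close>
  obtain M0 :: nat where M0: "\<bar>ln \<delta>\<bar> < real M0" using reals_Archimedean2 by blast
  define M where "M = Suc M0"
  have M: "M > 0" "\<bar>ln \<delta>\<bar> \<le> real M" using M0 unfolding M_def by auto
  define t where "t i = r/2 + real i * r / (2 * real M)" for i :: nat
  have t: "r/2 \<le> t i" "t i \<le> r" if "i < M" for i
  proof -
    have "real i * r \<le> real M * r" using that r by (intro mult_mono) auto
    then have "real i * r / (2 * real M) \<le> r/2" using M by (simp add: pos_divide_le_eq mult.commute)
    moreover have "0 \<le> real i * r / (2 * real M)" using r by simp
    ultimately show "r/2 \<le> t i" "t i \<le> r" unfolding t_def by linarith+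
  qed
  define \<xi> where "\<xi> i = (SOME x. x \<in> path_image g \<and> norm (x - \<zeta>) = t i)" for i
  have "\<xi> i \<in> path_image g \<and> norm (\<xi> i - \<zeta>) = t i" if "i < M" for i
    unfolding \<xi>_def by (rule someI_ex) (use ex[OF t[OF that]] in blast)
  then have \<xi>: "\<xi> i \<in> path_image g" "norm (\<xi> i - \<zeta>) = t i" if "i < M" for i
    using that by simp_all
  have \<xi>S: "\<xi> i \<notin> S" if "i < M" for i using \<xi>(1)[OF that] g(2) by auto
  define p where "p z = (1 / real M) * (\<Sum>i<M. ln (norm (z - \<xi> i)))" for z
  have dist\<delta>: "\<delta> \<le> norm (z - \<xi> i)" if "z \<in> S" "i < M" for z i
    using \<delta>(2)[OF \<xi>(1)[OF that(2)] that(1)] by (simp add: dist_norm norm_minus_commute)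
  have near: "\<bar>norm (z - \<xi> i) - norm (z - \<zeta>)\<bar> \<le> r" if "i < M" for z i
    using norm_triangle_ineq3[of "z - \<xi> i" "z - \<zeta>"] \<xi>(2)[OF that] t(2)[OF that]
    by (simp add: norm_minus_commute)
  have dt: "\<bar>norm (z - \<zeta>) - t i\<bar> \<le> norm (z - \<xi> i)" if "i < M" for z i
    using norm_triangle_ineq3[of "z - \<zeta>" "\<xi> i - \<zeta>"] \<xi>(2)[OF that] by simp
  have avg: "(1 / real M) * (\<Sum>i<M. c) = c" for c :: real using M by simp
  show ?thesis
  proof (rule that[of p])
    show "re_poly_approx S p" unfolding p_def
      using S \<xi>S by (intro re_poly_approx_cmult re_poly_approx_sum poly_approx_Cauchy_kernel) auto
  next
    fix z assume z: "z \<in> S"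
    have "(1 / real M) * (\<Sum>i<M. ln (norm (z - \<xi> i))) \<le> (1 / real M) * (\<Sum>i<M. ln (norm (z - \<zeta>) + r))"
    proof (intro mult_left_mono sum_mono)
      fix i assume "i \<in> {..<M}"
      then have i: "i < M" by simp
      have "norm (z - \<xi> i) \<le> norm (z - \<zeta>) + r" using near[OF i, of z] by linarith
      then show "ln (norm (z - \<xi> i)) \<le> ln (norm (z - \<zeta>) + r)"
        using dist\<delta>[OF z i] \<delta>(1) by (subst ln_le_cancel_iff) linarith+
    qed (use M in auto)
    then show "p z \<le> ln (norm (z - \<zeta>) + r)" unfolding p_def avg .
  next
    fix z assume z: "z \<in> S" and far: "2 * r \<le> norm (z - \<zeta>)"
    have "p z - ln (norm (z - \<zeta>)) = (1 / real M) * (\<Sum>i<M. ln (norm (z - \<xi> i)) - ln (norm (z - \<zeta>)))"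
      unfolding p_def by (simp only: sum_subtractf right_diff_distrib avg)
    also have "\<bar>\<dots>\<bar> \<le> (1 / real M) * (\<Sum>i<M. \<bar>ln (norm (z - \<xi> i)) - ln (norm (z - \<zeta>))\<bar>)"
      using M by (simp add: abs_mult divide_right_mono)
    also have "\<dots> \<le> (1 / real M) * (\<Sum>i<M. 2 * r / norm (z - \<zeta>))"
      using abs_ln_diff_le[OF r(1) far] near by (intro mult_left_mono sum_mono) auto
    finally show "\<bar>p z - ln (norm (z - \<zeta>))\<bar> \<le> 2 * r / norm (z - \<zeta>)" unfolding avg .
  next
    fix z assume z: "z \<in> S"
    define u where "u = norm (z - \<zeta>)"
    \<comment> \<open>The radius nearest to |z - \<zeta>|. Any other satisfies |t i - t i0| \<le> 2
      |u - t i|, so its pole is at least |i - i0| r/(4 M) away from z, wherever it sits on its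
      circle.\<close>
    define i0 where "i0 = arg_min_on (\<lambda>i. \<bar>u - t i\<bar>) {..<M}"
    have ne: "{..<M} \<noteq> {}" using M by auto
    have i0: "i0 < M" "\<And>i. i < M \<Longrightarrow> \<bar>u - t i0\<bar> \<le> \<bar>u - t i\<bar>"
      using arg_min_if_finite(1)[OF _ ne, of "\<lambda>i. \<bar>u - t i\<bar>"]
        arg_min_least[OF _ ne, of _ "\<lambda>i. \<bar>u - t i\<bar>"]
      unfolding i0_def by simp_all
    have gap: "\<bar>real i - real i0\<bar> * r / (4 * real M) \<le> norm (z - \<xi> i)" if i: "i < M" for i
    proof -
      have "t i - t i0 = (real i - real i0) * r / (2 * real M)"
        unfolding t_def by (simp add: left_diff_distrib diff_divide_distrib)
      then have "\<bar>t i - t i0\<bar> = \<bar>real i - real i0\<bar> * r / (2 * real M)"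
        using r M by (simp add: abs_mult)
      moreover have "\<bar>t i - t i0\<bar> \<le> 2 * \<bar>u - t i\<bar>"
        using i0(2)[OF i] abs_triangle_ineq4[of "u - t i0" "u - t i"] by simp
      moreover define q where "q = \<bar>real i - real i0\<bar> * r / (4 * real M)"
      moreover have "\<bar>real i - real i0\<bar> * r / (2 * real M) = 2 * q" unfolding q_def by simp
      ultimately have "2 * q \<le> 2 * \<bar>u - t i\<bar>" by metis
      then have "q \<le> \<bar>u - t i\<bar>" by simp
      then show ?thesis using dt[OF i, of z] unfolding u_def q_def by (rule order_trans)
    qed
    have ln\<delta>: "ln \<delta> \<le> ln (norm (z - \<xi> i0))"
      using dist\<delta>[OF z i0(1)] \<delta>(1) by (subst ln_le_cancel_iff) linarith+
    have "2 * (real M * ln (r/4) - real M) + ln \<delta>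
        \<le> (\<Sum>i\<in>{..<M} - {i0}. ln (\<bar>real i - real i0\<bar> * r / (4 * real M))) + ln (norm (z - \<xi> i0))"
      by (rule add_mono[OF sum_ln_distance_ge[OF r i0(1)] ln\<delta>])
    also have "\<dots> \<le> (\<Sum>i\<in>{..<M} - {i0}. ln (norm (z - \<xi> i))) + ln (norm (z - \<xi> i0))"
    proof (intro add_right_mono sum_mono)
      fix i assume i: "i \<in> {..<M} - {i0}"
      then have "0 < \<bar>real i - real i0\<bar> * r / (4 * real M)" using r M by auto
      then show "ln (\<bar>real i - real i0\<bar> * r / (4 * real M)) \<le> ln (norm (z - \<xi> i))"
        using gap[of i] i by (subst ln_le_cancel_iff) auto
    qed
    also have "\<dots> = (\<Sum>i<M. ln (norm (z - \<xi> i)))"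
      using i0(1) by (simp add: sum.remove[of "{..<M}" i0])
    also have "\<dots> = real M * p z" unfolding p_def using M by simp
    finally have "2 * (real M * ln (r/4) - real M) + ln \<delta> \<le> real M * p z" .
    moreover have "- real M \<le> ln \<delta>" using M(2) by simp
    ultimately have "real M * (2 * ln (r/4) - 3) \<le> real M * p z"
      unfolding right_diff_distrib by simp
    then show "2 * ln (r/4) - 3 \<le> p z" using M by (simp add: mult_le_cancel_left_pos)
  qed
qed

section \<open>Roots of unity and a discrete Jensen formula\<close>

lemma norm_root_of_unity:
  fixes u :: complex
  assumes "u ^ N = 1" "N > 0"
  shows "norm u = 1"
  using assms by (metis norm_power norm_one power_eq_1_iff norm_ge_zero nat_less_le)

text \<open>The powers of x = u/v sum to zero, so some x^j has nonpositive real part and distance at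
  least 1 from 1; but |x^j - 1| \<le> j |x - 1|.\<close>

lemma roots_of_unity_separated:
  fixes u v :: complex
  assumes N: "N > 0" and uv: "u ^ N = 1" "v ^ N = 1" "u \<noteq> v"
  shows "norm (u - v) \<ge> 1 / real N"
proof -
  have nv: "norm v = 1" "norm u = 1" using uv N norm_root_of_unity by blast+
  then have "v \<noteq> 0" by auto
  define x where "x = u / v"
  have x: "x ^ N = 1" "x \<noteq> 1" "norm x = 1" unfolding x_def using uv \<open>v \<noteq> 0\<close> nv
    by (auto simp: power_divide norm_divide)
  have "(\<Sum>j<N. x ^ j) = 0" using x by (simp add: geometric_sum)
  then have sum0: "(\<Sum>j<N. Re (x ^ j)) = 0" by (metis Re_sum zero_complex.sel(1))
  have "\<exists>j<N. Re (x ^ j) \<le> 0"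
  proof (rule ccontr)
    assume "\<not> ?thesis"
    then have "(\<Sum>j<N. Re (x ^ j)) > 0" using N by (intro sum_pos) auto
    then show False using sum0 by simp
  qed
  then obtain j where j: "j < N" "Re (x ^ j) \<le> 0" by blast
  have "1 \<le> \<bar>Re (x ^ j - 1)\<bar>" using j by simp
  also have "\<dots> \<le> norm (x ^ j - 1 ^ j)" using abs_Re_le_cmod[of "x ^ j - 1"] by simp
  also have "\<dots> \<le> real j * norm (x - 1)" using x by (intro norm_power_diff) auto
  also have "\<dots> \<le> real N * norm (x - 1)" using j by (intro mult_right_mono) auto
  also have "norm (x - 1) = norm (u - v)"
    unfolding x_def using \<open>v \<noteq> 0\<close> nv by (simp add: field_simps norm_divide flip: diff_divide_distrib)
  finally show ?thesis using N by (simp add: field_simps)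
qed

text \<open>Both sides are the quotient of w^N - \<rho>^N by w - \<rho> u. Since division fails at w
  = \<rho> u, they are compared as polynomials in w of degree at most N - 1: same leading
  coefficient, same values at the N - 1 other roots.\<close>

lemma prod_other_roots:
  fixes w u :: complex and \<rho> :: real
  assumes N: "N > 0" and u: "u ^ N = 1" and \<rho>: "\<rho> > 0"
  shows "(\<Prod>v\<in>{v. v ^ N = 1} - {u}. w - of_real \<rho> * v)
    = (\<Sum>j<N. w ^ j * (of_real \<rho> * u) ^ (N - 1 - j))"
proof -
  define U where "U = {v :: complex. v ^ N = 1} - {u}"
  have fin: "finite U" and card: "card U = N - 1"
    using card_roots_unity_eq[OF N] finite_roots_unity[of N] N u unfolding U_def
    by (auto simp: card_Diff_singleton)
  define p where "p = (\<Prod>v\<in>U. [:- (of_real \<rho> * v), 1:])"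
  define q where "q = (\<Sum>j<N. Polynomial.monom ((of_real \<rho> * u) ^ (N - 1 - j)) j)"
  have "p = q"
  proof (rule poly_eqI_degree_lead_coeff)
    have dp: "degree p = N - 1"
      unfolding p_def using card by (subst degree_prod_eq_sum_degree) auto
    show "degree p \<le> N - 1" using dp by simp
    show "degree q \<le> N - 1"
      unfolding q_def by (intro degree_sum_le) (auto intro: order_trans[OF degree_monom_le])
    have "Polynomial.lead_coeff p = 1" unfolding p_def by (subst lead_coeff_prod) simp
    moreover have "poly.coeff q (N - 1) = (\<Sum>j<N. if j = N - 1 then 1 else 0)"
      unfolding q_def coeff_sum by (intro sum.cong) auto
    ultimately show "poly.coeff p (N - 1) = poly.coeff q (N - 1)"
      using dp N by simp
    show "card ((\<lambda>v. of_real \<rho> * v) ` U) \<ge> N - 1"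
      using card \<rho> by (subst card_image) (auto intro!: inj_onI)
    fix z assume "z \<in> (\<lambda>v. of_real \<rho> * v) ` U"
    then obtain v where v: "v \<in> U" "z = of_real \<rho> * v" by auto
    have "poly p z = 0" using v fin unfolding p_def by (auto simp: poly_prod)
    moreover have "(z - of_real \<rho> * u) * poly q z = 0"
    proof -
      have "(z - of_real \<rho> * u) * poly q z = z ^ N - (of_real \<rho> * u) ^ N"
        unfolding q_def poly_sum poly_monom
        by (subst power_diff_sumr2) (auto intro!: arg_cong2[of _ _ _ _ times] sum.cong)
      also have "\<dots> = 0" using v u by (simp add: U_def power_mult_distrib)
      finally show ?thesis .
    qed
    then have "poly q z = 0" using v \<rho> unfolding U_def by auto
    ultimately show "poly p z = poly q z" by simp
  qed
  then have "poly p w = poly q w" by simp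
  then show ?thesis
    unfolding p_def q_def U_def by (simp add: poly_prod poly_sum poly_monom mult.commute)
qed

lemma norm_other_roots_upper:
  fixes w u :: complex
  assumes "N > 0" "norm u = 1" "\<rho> > 0"
  shows "norm (\<Sum>j<N. w ^ j * (of_real \<rho> * u) ^ (N - 1 - j)) \<le> real N * max (norm w) \<rho> ^ (N - 1)"
proof -
  define m where "m = max (norm w) \<rho>"
  have "norm (\<Sum>j<N. w ^ j * (of_real \<rho> * u) ^ (N - 1 - j)) \<le> (\<Sum>j<N. m ^ (N - 1))"
  proof (rule sum_norm_le)
    fix j assume j: "j \<in> {..<N}"
    have "norm (w ^ j * (of_real \<rho> * u) ^ (N - 1 - j)) = norm w ^ j * \<rho> ^ (N - 1 - j)"
      using assms by (simp add: norm_mult norm_power)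
    also have "\<dots> \<le> m ^ j * m ^ (N - 1 - j)"
      unfolding m_def using assms by (intro mult_mono power_mono) auto
    also have "\<dots> = m ^ (N - 1)" using j by (simp flip: power_add)
    finally show "norm (w ^ j * (of_real \<rho> * u) ^ (N - 1 - j)) \<le> m ^ (N - 1)" .
  qed
  then show ?thesis by (simp add: m_def)
qed

text \<open>Concavity of the sine on [0, pi], evaluated on the chord from 0 to pi/2.\<close>

lemma sin_half_ge:
  assumes "N > 0"
  shows "sin (pi / (2 * real N)) \<ge> 1 / real N"
proof -
  have "convex_on {0..pi} (\<lambda>x. - sin x)"
    by (rule f''_ge0_imp_convex[where f' = "\<lambda>x. - cos x" and f'' = sin])
       (auto intro!: derivative_eq_intros sin_ge_zero)
  then have "- sin ((1 - 1 / real N) *\<^sub>R 0 + (1 / real N) *\<^sub>R (pi/2))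
      \<le> (1 - 1 / real N) * (- sin 0) + (1 / real N) * (- sin (pi/2))"
    using assms by (intro convex_onD) auto
  then show ?thesis by (simp add: field_simps)
qed

text \<open>If \<open>u\<close> is a nearest root of unity, then after a rotation all summands of
  \<open>\<Sum>j<N. w^j (\<rho> u)^(N-1-j)\<close> have nonnegative real part, so there is no cancellation.\<close>

lemma norm_other_roots_lower:
  fixes w u :: complex
  assumes N: "N > 0" and u: "u ^ N = 1" and \<rho>: "\<rho> > 0"
    and nearest: "\<And>v. v ^ N = 1 \<Longrightarrow> norm (w - of_real \<rho> * u) \<le> norm (w - of_real \<rho> * v)"
  shows "max (norm w) \<rho> ^ (N - 1) / real N \<le> norm (\<Sum>j<N. w ^ j * (of_real \<rho> * u) ^ (N - 1 - j))"
proof -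
  have nu: "norm u = 1" by (rule norm_root_of_unity[OF u N])
  then have u0: "u \<noteq> 0" by auto
  define t where "t = norm w"
  define \<alpha> where "\<alpha> = Arg (w / u)"
  have t: "norm (w / u) = t" by (simp add: t_def norm_divide nu)
  have wu: "w / u = of_real t * cis \<alpha>" unfolding \<alpha>_def using t rcis_cmod_Arg[of "w/u"] by (simp add: rcis_def)
  then have w: "w = of_real t * cis \<alpha> * u" using u0 by (simp add: field_simps)
  have t0: "t \<ge> 0" by (simp add: t_def)
  \<comment> \<open>If w made a larger angle with u, rotating u by 2 pi/N towards w would yield a
    strictly nearer root; \<open>\<beta>\<close> below is that rotation.\<close>
  have ang: "t = 0 \<or> \<bar>\<alpha>\<bar> \<le> pi / real N"
  proof (rule ccontr)
    assume "\<not> ?thesis"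
    then have tp: "t > 0" and big: "\<bar>\<alpha>\<bar> > pi / real N" using t0 by auto
    have sq: "(t * a - \<rho> * b)\<^sup>2 + (t * c - \<rho> * e)\<^sup>2
        = t\<^sup>2 * (c\<^sup>2 + a\<^sup>2) + \<rho>\<^sup>2 * (e\<^sup>2 + b\<^sup>2) - 2 * t * \<rho> * (a * b + c * e)" for a b c e :: real
      by (simp add: power2_eq_square algebra_simps)
    have dsq: "(norm (w - of_real \<rho> * (u * cis \<beta>)))\<^sup>2 = t\<^sup>2 + \<rho>\<^sup>2 - 2 * t * \<rho> * cos (\<alpha> - \<beta>)" for \<beta>
    proof -
      have "w - of_real \<rho> * (u * cis \<beta>) = (of_real t * cis \<alpha> - of_real \<rho> * cis \<beta>) * u"
        unfolding w by (simp add: algebra_simps)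
      then have "(norm (w - of_real \<rho> * (u * cis \<beta>)))\<^sup>2 = (norm (of_real t * cis \<alpha> - of_real \<rho> * cis \<beta>))\<^sup>2"
        by (simp add: norm_mult nu)
      also have "\<dots> = (t * cos \<alpha> - \<rho> * cos \<beta>)\<^sup>2 + (t * sin \<alpha> - \<rho> * sin \<beta>)\<^sup>2"
        by (simp add: cmod_power2)
      also have "\<dots> = t\<^sup>2 * ((sin \<alpha>)\<^sup>2 + (cos \<alpha>)\<^sup>2) + \<rho>\<^sup>2 * ((sin \<beta>)\<^sup>2 + (cos \<beta>)\<^sup>2) - 2 * t * \<rho> * cos (\<alpha> - \<beta>)"
        unfolding cos_diff by (rule sq)
      finally show ?thesis by simp
    qed
    define \<beta> where "\<beta> = (if \<alpha> > 0 then 2 * pi / real N else - (2 * pi / real N))"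
    have "(u * cis \<beta>) ^ N = 1"
    proof -
      have "real N * \<beta> = 2 * pi \<or> real N * \<beta> = - (2 * pi)" using N unfolding \<beta>_def by auto
      then have "cis (real N * \<beta>) = 1" by (auto simp: complex_eq_iff)
      then show ?thesis by (simp only: power_mult_distrib u Complex.DeMoivre mult_1)
    qed
    from nearest[OF this] have "(norm (w - of_real \<rho> * (u * cis 0)))\<^sup>2 \<le> (norm (w - of_real \<rho> * (u * cis \<beta>)))\<^sup>2"
      by (intro power_mono) auto
    then have "2 * t * \<rho> * cos (\<alpha> - \<beta>) \<le> 2 * t * \<rho> * cos \<alpha>" unfolding dsq by simp
    then have le: "cos (\<alpha> - \<beta>) \<le> cos \<alpha>" using tp \<rho> by (simp add: mult_le_cancel_left_pos)
    have "\<bar>\<alpha>\<bar> \<le> pi" using mpi_less_Arg[of "w/u"] Arg_le_pi[of "w/u"] unfolding \<alpha>_def by linarith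
    moreover have "\<bar>\<alpha> - \<beta>\<bar> < \<bar>\<alpha>\<bar>"
      using big N unfolding \<beta>_def by (auto simp: abs_if field_simps)
    ultimately have "cos \<bar>\<alpha>\<bar> < cos \<bar>\<alpha> - \<beta>\<bar>" by (intro cos_monotone_0_pi) auto
    then show False using le by simp
  qed
  define K where "K = (\<Sum>j<N. w ^ j * (of_real \<rho> * u) ^ (N - 1 - j))"
  \<comment> \<open>The arguments j \<alpha> for j < N are centred at (N - 1)/2 \<alpha>. After this
    rotation they stay within pi/2 - pi/(2 N), where the cosine is at least sin (pi/(2 N)) \<ge>
    1/N.\<close>
  define \<gamma> where "\<gamma> = - ((real N - 1) / 2 * \<alpha>)"
  have summand: "w ^ j * (of_real \<rho> * u) ^ (N - 1 - j)
      = u ^ (N - 1) * (of_real (t ^ j * \<rho> ^ (N - 1 - j)) * cis (real j * \<alpha>))" if "j < N" for j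
  proof -
    have "u ^ j * u ^ (N - 1 - j) = u ^ (N - 1)" using that by (simp flip: power_add)
    then show ?thesis unfolding w
      by (simp add: power_mult_distrib Complex.DeMoivre mult.assoc mult.left_commute[of "u ^ j"])
  qed
  have "K = u ^ (N - 1) * (\<Sum>j<N. of_real (t ^ j * \<rho> ^ (N - 1 - j)) * cis (real j * \<alpha>))"
    unfolding K_def sum_distrib_left by (intro sum.cong refl summand) auto
  then have "norm K = norm (cis \<gamma> * (\<Sum>j<N. of_real (t ^ j * \<rho> ^ (N - 1 - j)) * cis (real j * \<alpha>)))"
    by (simp add: norm_mult norm_power nu)
  also have "\<dots> \<ge> Re (cis \<gamma> * (\<Sum>j<N. of_real (t ^ j * \<rho> ^ (N - 1 - j)) * cis (real j * \<alpha>)))"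
    by (rule complex_Re_le_cmod)
  also have "Re (cis \<gamma> * (\<Sum>j<N. of_real (t ^ j * \<rho> ^ (N - 1 - j)) * cis (real j * \<alpha>)))
      = (\<Sum>j<N. t ^ j * \<rho> ^ (N - 1 - j) * cos (\<gamma> + real j * \<alpha>))"
  proof -
    have "cis \<gamma> * (\<Sum>j<N. of_real (t ^ j * \<rho> ^ (N - 1 - j)) * cis (real j * \<alpha>))
      = (\<Sum>j<N. of_real (t ^ j * \<rho> ^ (N - 1 - j)) * cis (\<gamma> + real j * \<alpha>))"
      unfolding sum_distrib_left by (intro sum.cong) (auto simp: mult.left_commute cis_mult)
    then show ?thesis by (simp add: Re_sum flip: of_real_mult of_real_power)
  qed
  finally have 1: "norm K \<ge> (\<Sum>j<N. t ^ j * \<rho> ^ (N - 1 - j) * cos (\<gamma> + real j * \<alpha>))" .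
  have cosge: "t ^ j * \<rho> ^ (N - 1 - j) * cos (\<gamma> + real j * \<alpha>) \<ge> t ^ j * \<rho> ^ (N - 1 - j) / real N" if j: "j < N" "t \<noteq> 0" for j
  proof -
    have \<alpha>: "\<bar>\<alpha>\<bar> \<le> pi / real N" using ang j by auto
    have "\<bar>\<gamma> + real j * \<alpha>\<bar> = \<bar>real j - (real N - 1) / 2\<bar> * \<bar>\<alpha>\<bar>"
      unfolding \<gamma>_def abs_mult[symmetric] by (simp add: algebra_simps)
    also have "\<dots> \<le> ((real N - 1) / 2) * (pi / real N)"
      using j(1) \<alpha> N by (intro mult_mono) (auto simp: abs_if field_simps)
    also have "\<dots> = pi / 2 - pi / (2 * real N)" using N by (simp add: field_simps)
    finally have "cos \<bar>\<gamma> + real j * \<alpha>\<bar> \<ge> cos (pi / 2 - pi / (2 * real N))"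
      using N pi_gt_zero by (intro cos_monotone_0_pi_le) (auto simp: field_simps)
    moreover have "cos (pi / 2 - pi / (2 * real N)) = sin (pi / (2 * real N))"
      using sin_cos_eq[of "pi / (2 * real N)"] by simp
    ultimately have "cos (\<gamma> + real j * \<alpha>) \<ge> sin (pi / (2 * real N))"
      by (simp only: cos_abs_real)
    then have "cos (\<gamma> + real j * \<alpha>) \<ge> 1 / real N" using sin_half_ge[OF N] by linarith
    then have "t ^ j * \<rho> ^ (N - 1 - j) * (1 / real N) \<le> t ^ j * \<rho> ^ (N - 1 - j) * cos (\<gamma> + real j * \<alpha>)"
      using t0 \<rho> by (intro mult_left_mono) auto
    then show ?thesis by simp
  qed
  show ?thesis
  proof (cases "t = 0")
    case True
    have "K = (of_real \<rho> * u) ^ (N - 1)"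
    proof -
      have "w = 0" using True by (simp add: t_def)
      then have "K = (\<Sum>j<N. if j = 0 then (of_real \<rho> * u) ^ (N - 1) else 0)"
        unfolding K_def by (intro sum.cong) auto
      then show ?thesis using N by simp
    qed
    then have "norm K = \<rho> ^ (N - 1)" using \<rho> by (simp add: norm_mult norm_power nu)
    moreover have "max (norm w) \<rho> = \<rho>" using True \<rho> by (simp add: t_def)
    moreover have "\<rho> ^ (N - 1) / real N \<le> \<rho> ^ (N - 1)"
      using N \<rho> using mult_left_mono[of 1 "real N" "\<rho> ^ (N - 1)"] by (simp add: divide_le_eq)
    ultimately show ?thesis unfolding K_def by simp
  next
    case False
    have "(\<Sum>j<N. t ^ j * \<rho> ^ (N - 1 - j) / real N) \<le> norm K"
      using 1 cosge False by (intro order_trans[OF _ 1] sum_mono) auto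
    moreover have "t ^ j * \<rho> ^ (N - 1 - j) / real N \<le> (\<Sum>j<N. t ^ j * \<rho> ^ (N - 1 - j) / real N)" if "j < N" for j
      using that t0 \<rho> by (intro member_le_sum) auto
    ultimately have "t ^ j * \<rho> ^ (N - 1 - j) / real N \<le> norm K" if "j < N" for j
      using that order_trans by blast
    \<comment> \<open>The two extreme summands are \<rho>^(N-1) and |w|^(N-1); the larger one is the
      claim.\<close>
    from this[of 0] this[of "N - 1"] show ?thesis
      using N unfolding K_def t_def max_def by auto
  qed
qed

text \<open>With w = z - c, the product of |w - \<rho> u| over all roots of unity but the nearest
  lies between m^(N-1)/N and N m^(N-1), where m = max |w| \<rho>. So the mean of the logarithms is
  ln m up to O(ln N / N). Each logarithm is replaced by the smeared one of
  \<open>log_average_near_point\<close>, and the unbounded logarithm of the nearest root thereby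
  becomes O(ln N).\<close>

lemma re_poly_approx_ln_max:
  assumes S: "compact S" "interior S = {}" "connected (- S)" and \<rho>: "\<rho> > 0"
  shows "re_poly_approx S (\<lambda>z. ln (max (norm (z - c)) \<rho>))"
proof (rule re_poly_approx_limit)
  fix e :: real assume e: "e > 0"
  obtain R0 where R0: "R0 > 0" "\<And>z. z \<in> S \<Longrightarrow> norm z \<le> R0"
    using compact_imp_bounded[OF S(1)] unfolding bounded_pos by blast
  define R where "R = R0 + norm c + \<rho> + 1"
  have R: "R \<ge> 1" "\<rho> \<le> R" using R0 \<rho> by (auto simp: R_def add_nonneg_nonneg)
  \<comment> \<open>Collects the contributions bounded in N. The 5 ln N that accompanies it is 1
    from the two bounds on the product and 4 from 2 ln (r/4) with r = \<rho>/N^2.\<close>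
  define K where "K = 4 + \<bar>ln \<rho>\<bar> + 2 * \<bar>ln R\<bar> + \<bar>2 * ln (\<rho>/4) - 3\<bar>"
  have "(\<lambda>N. K * (1 / real N) + 5 * (ln (real N) / real N)) \<longlonglongrightarrow> K * 0 + 5 * 0"
    by (intro tendsto_intros lim_ln_over_n lim_1_over_n)
  then have "\<forall>\<^sub>F N in sequentially. K * (1 / real N) + 5 * (ln (real N) / real N) < e"
    using e by (intro order_tendstoD(2)[of _ 0]) auto
  moreover have "\<forall>\<^sub>F N in sequentially. real N \<ge> max 4 \<rho>"
    by (rule filterlim_real_sequentially[unfolded filterlim_at_top, rule_format])
  ultimately have "\<forall>\<^sub>F N in sequentially. K * (1 / real N) + 5 * (ln (real N) / real N) < e \<and> real N \<ge> max 4 \<rho>"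
    by (rule eventually_conj)
  then obtain N where N: "K * (1 / real N) + 5 * (ln (real N) / real N) < e" "real N \<ge> 4" "real N \<ge> \<rho>"
    unfolding eventually_sequentially by auto
  have N0: "N > 0" using N by auto
  \<comment> \<open>Small against the distance \<rho>/(2 N) of z to the other roots: smearing
    changes each of their logarithms by at most 2 r/(\<rho>/(2 N)) = 4/N, hence by 4 in
    total.\<close>
  define r where "r = \<rho> / (real N)\<^sup>2"
  have r: "r > 0" using \<rho> N0 by (simp add: r_def)
  have "\<rho> * 1 \<le> real N * real N" using N \<rho> by (intro mult_mono) auto
  then have r1: "r \<le> 1" using N0 by (simp add: r_def power2_eq_square divide_le_eq)
  define U where "U = {u :: complex. u ^ N = 1}"
  have U: "finite U" "card U = N" using card_roots_unity_eq[OF N0] finite_roots_unity[of N] N0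
    by (auto simp: U_def)
  have nU: "norm u = 1" if "u \<in> U" for u
    using that N0 norm_root_of_unity unfolding U_def by simp
  have ex: "\<exists>p. re_poly_approx S p \<and> (\<forall>z\<in>S. 2 * ln (r/4) - 3 \<le> p z \<and> p z \<le> ln (norm (z - \<zeta>) + r) \<and>
     (2 * r \<le> norm (z - \<zeta>) \<longrightarrow> \<bar>p z - ln (norm (z - \<zeta>))\<bar> \<le> 2 * r / norm (z - \<zeta>)))" for \<zeta>
    by (rule log_average_near_point[OF S r r1, of \<zeta>]) (metis (no_types))
  define p where "p u = (SOME p. re_poly_approx S p \<and> (\<forall>z\<in>S. 2 * ln (r/4) - 3 \<le> p z \<and> p z \<le> ln (norm (z - (c + of_real \<rho> * u)) + r) \<and>
     (2 * r \<le> norm (z - (c + of_real \<rho> * u)) \<longrightarrow> \<bar>p z - ln (norm (z - (c + of_real \<rho> * u)))\<bar> \<le> 2 * r / norm (z - (c + of_real \<rho> * u)))))" for u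
  have p: "re_poly_approx S (p u)"
      "\<And>z. z \<in> S \<Longrightarrow> 2 * ln (r/4) - 3 \<le> p u z"
      "\<And>z. z \<in> S \<Longrightarrow> p u z \<le> ln (norm (z - (c + of_real \<rho> * u)) + r)"
      "\<And>z. z \<in> S \<Longrightarrow> 2 * r \<le> norm (z - (c + of_real \<rho> * u)) \<Longrightarrow>
        \<bar>p u z - ln (norm (z - (c + of_real \<rho> * u)))\<bar> \<le> 2 * r / norm (z - (c + of_real \<rho> * u))" for u
    using someI_ex[OF ex[of "c + of_real \<rho> * u"]] unfolding p_def[symmetric] by blast+
  define q where "q z = (1 / real N) * (\<Sum>u\<in>U. p u z)" for z
  have "re_poly_approx S q" unfolding q_def by (intro re_poly_approx_cmult re_poly_approx_sum p)
  moreover have "\<bar>ln (max (norm (z - c)) \<rho>) - q z\<bar> < e" if z: "z \<in> S" for z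
  proof -
    define w where "w = z - c"
    define m where "m = max (norm w) \<rho>"
    have zc: "z - (c + of_real \<rho> * u) = w - of_real \<rho> * u" for u by (simp add: w_def)
    have wR: "norm w \<le> R0 + norm c" using norm_triangle_ineq4[of z c] R0(2)[OF z] by (simp add: w_def)
    have m: "\<rho> \<le> m" "m \<le> R" using wR R0 \<rho> by (auto simp: m_def R_def add_nonneg_nonneg)
    define u0 where "u0 = arg_min_on (\<lambda>u. norm (w - of_real \<rho> * u)) U"
    have "U \<noteq> {}" using U N0 by auto
    then have u0: "u0 \<in> U" "\<And>u. u \<in> U \<Longrightarrow> norm (w - of_real \<rho> * u0) \<le> norm (w - of_real \<rho> * u)"
      using arg_min_if_finite(1)[OF U(1), of "\<lambda>u. norm (w - of_real \<rho> * u)"]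
        arg_min_least[OF U(1), of _ "\<lambda>u. norm (w - of_real \<rho> * u)"] unfolding u0_def by auto
    \<comment> \<open>As \<open>u0\<close> is nearest, half the separation of the roots remains for
      every other root.\<close>
    have sep: "\<rho> / (2 * real N) \<le> norm (w - of_real \<rho> * u)" if u: "u \<in> U - {u0}" for u
    proof -
      have "1 / real N \<le> norm (u - u0)"
        using u u0(1) N0 by (intro roots_of_unity_separated) (auto simp: U_def)
      then have "\<rho> * (1 / real N) \<le> \<rho> * norm (u - u0)" using \<rho> by (intro mult_left_mono) auto
      also have "\<dots> = norm (of_real \<rho> * u - of_real \<rho> * u0)"
        using \<rho> by (simp add: norm_mult flip: right_diff_distrib)
      also have "\<dots> \<le> norm (w - of_real \<rho> * u0) + norm (w - of_real \<rho> * u)"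
        using norm_triangle_ineq4[of "w - of_real \<rho> * u0" "w - of_real \<rho> * u"] by simp
      also have "\<dots> \<le> 2 * norm (w - of_real \<rho> * u)" using u0(2) u by auto
      finally show ?thesis by simp
    qed
    have r2: "2 * r \<le> \<rho> / (2 * real N)"
      using N \<rho> N0 by (simp add: r_def power2_eq_square field_simps)
    have summand: "\<bar>p u z - ln (norm (w - of_real \<rho> * u))\<bar> \<le> 4 / real N" if u: "u \<in> U - {u0}" for u
    proof -
      have "\<bar>p u z - ln (norm (w - of_real \<rho> * u))\<bar> \<le> 2 * r / norm (w - of_real \<rho> * u)"
        using p(4)[OF z, of u] r2 sep[OF u] unfolding zc by auto
      also have "\<dots> \<le> 2 * r / (\<rho> / (2 * real N))"
      proof (rule divide_left_mono)
        have "0 < \<rho> / (2 * real N)" using \<rho> N0 by simp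
        then show "0 < norm (w - of_real \<rho> * u) * (\<rho> / (2 * real N))"
          using sep[OF u] by (intro mult_pos_pos) linarith+
      qed (use sep[OF u] r in auto)
      also have "\<dots> = 4 / real N" using \<rho> N0 by (simp add: r_def power2_eq_square field_simps)
      finally show ?thesis .
    qed
    have 1: "\<bar>(\<Sum>u\<in>U - {u0}. p u z) - (\<Sum>u\<in>U - {u0}. ln (norm (w - of_real \<rho> * u)))\<bar> \<le> 4"
    proof -
      have "\<bar>(\<Sum>u\<in>U - {u0}. p u z) - (\<Sum>u\<in>U - {u0}. ln (norm (w - of_real \<rho> * u)))\<bar>
          \<le> (\<Sum>u\<in>U - {u0}. 4 / real N)"
        unfolding sum_subtractf[symmetric] by (intro order_trans[OF sum_abs] sum_mono summand)
      also have "\<dots> \<le> (\<Sum>u\<in>U. 4 / real N)" using U by (intro sum_mono2) auto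
      also have "\<dots> = 4" using U N0 by simp
      finally show ?thesis .
    qed
    define K' where "K' = (\<Sum>j<N. w ^ j * (of_real \<rho> * u0) ^ (N - 1 - j))"
    have u0N: "u0 ^ N = 1" using u0(1) by (simp add: U_def)
    have pos: "0 < norm (w - of_real \<rho> * u)" if "u \<in> U - {u0}" for u
      by (rule less_le_trans[OF _ sep[OF that]]) (use \<rho> N0 in simp)
    have "(\<Sum>u\<in>U - {u0}. ln (norm (w - of_real \<rho> * u))) = ln (\<Prod>u\<in>U - {u0}. norm (w - of_real \<rho> * u))"
      using U pos by (subst ln_prod) auto
    also have "(\<Prod>u\<in>U - {u0}. norm (w - of_real \<rho> * u)) = norm K'"
      unfolding K'_def prod_other_roots[OF N0 u0N \<rho>, symmetric] U_def by (simp add: prod_norm)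
    finally have sumK: "(\<Sum>u\<in>U - {u0}. ln (norm (w - of_real \<rho> * u))) = ln (norm K')" .
    have up: "norm K' \<le> real N * m ^ (N - 1)"
      unfolding K'_def m_def by (rule norm_other_roots_upper[OF N0 nU[OF u0(1)] \<rho>])
    have lo: "m ^ (N - 1) / real N \<le> norm K'"
      unfolding K'_def m_def using u0(2) by (intro norm_other_roots_lower[OF N0 u0N \<rho>]) (auto simp: U_def)
    have mp: "m > 0" using m \<rho> by auto
    have K'pos: "norm K' > 0" by (rule less_le_trans[OF _ lo]) (use mp N0 in simp)
    have "ln (norm K') \<le> ln (real N * m ^ (N - 1))"
      using up K'pos mp N0 by (subst ln_le_cancel_iff) auto
    also have "\<dots> = ln (real N) + (real N - 1) * ln m"
      using mp N0 by (simp add: ln_mult ln_realpow of_nat_diff)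
    finally have 2: "ln (norm K') \<le> ln (real N) + (real N - 1) * ln m" .
    have "ln (m ^ (N - 1) / real N) \<le> ln (norm K')"
      using lo mp N0 K'pos by (subst ln_le_cancel_iff) auto
    also have "ln (m ^ (N - 1) / real N) = (real N - 1) * ln m - ln (real N)"
      using mp N0 by (simp add: ln_div ln_realpow of_nat_diff)
    finally have 3: "(real N - 1) * ln m - ln (real N) \<le> ln (norm K')" .
    have 4: "2 * ln (\<rho>/4) - 3 - 4 * ln (real N) \<le> p u0 z"
    proof -
      have "r / 4 = (\<rho>/4) / (real N)\<^sup>2" by (simp add: r_def)
      then have "ln (r/4) = ln (\<rho>/4) - 2 * ln (real N)"
        using \<rho> N0 by (simp only:) (subst ln_div, auto simp: ln_realpow)
      then show ?thesis using p(2)[OF z, of u0] by linarith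
    qed
    have 5: "p u0 z \<le> ln R"
    proof -
      have "norm (w - of_real \<rho> * u0) \<le> norm w + \<rho>"
        using norm_triangle_ineq4[of w "of_real \<rho> * u0"] nU[OF u0(1)] \<rho> by (simp add: norm_mult)
      then have "norm (w - of_real \<rho> * u0) + r \<le> R" using wR r1 by (simp add: R_def)
      then have "ln (norm (w - of_real \<rho> * u0) + r) \<le> ln R"
        using r R(1) by (subst ln_le_cancel_iff) (auto intro: add_nonneg_pos)
      then show ?thesis using p(3)[OF z, of u0] unfolding zc by linarith
    qed
    have lnm: "ln \<rho> \<le> ln m" "ln m \<le> ln R" using m mp \<rho> by auto
    have Nq: "real N * q z = (\<Sum>u\<in>U - {u0}. p u z) + p u0 z"
      unfolding q_def using U u0(1) N0 by (simp add: sum.remove[of U u0])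
    have lnN: "ln (real N) \<ge> 0" using N0 by simp
    have "(real N - 1) * ln m = real N * ln m - ln m" by (simp add: algebra_simps)
    then have "\<bar>real N * ln m - real N * q z\<bar> \<le> K + 5 * ln (real N)"
      using 1[unfolded sumK] 2 3 4 5 lnm lnN unfolding Nq K_def by arith
    then have "\<bar>real N * (ln m - q z)\<bar> \<le> K + 5 * ln (real N)" by (simp only: right_diff_distrib)
    then have "\<bar>ln m - q z\<bar> * real N \<le> K + 5 * ln (real N)"
      by (simp only: abs_mult abs_of_nat mult.commute)
    then have "\<bar>ln m - q z\<bar> \<le> (K + 5 * ln (real N)) / real N"
      using N0 by (subst pos_le_divide_eq) auto
    also have "\<dots> = K * (1 / real N) + 5 * (ln (real N) / real N)" by (simp add: add_divide_distrib)
    finally show ?thesis using N(1) unfolding m_def w_def by linarith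
  qed
  ultimately show "\<exists>h. re_poly_approx S h \<and> (\<forall>z\<in>S. \<bar>ln (max (norm (z - c)) \<rho>) - h z\<bar> < e)" by blast
qed

text \<open>Interpolation by functions that are piecewise affine in \<open>ln x\<close> and constant near \<open>0\<close>.\<close>

lemma re_poly_approx_radial:
  assumes S: "compact S" "interior S = {}" "connected (- S)"
    and cont: "continuous_on {0..} \<phi>"
  shows "re_poly_approx S (\<lambda>z. \<phi> (norm (z - c)))"
proof (rule re_poly_approx_limit)
  fix e :: real assume e: "e > 0"
  obtain R0 where R0: "R0 > 0" "\<And>z. z \<in> S \<Longrightarrow> norm z \<le> R0"
    using compact_imp_bounded[OF S(1)] unfolding bounded_pos by blast
  define R where "R = R0 + norm c"
  have R: "R > 0" "\<And>z. z \<in> S \<Longrightarrow> norm (z - c) \<le> R"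
    using R0 by (auto simp: R_def intro: add_pos_nonneg order_trans[OF norm_triangle_ineq4])
  have "uniformly_continuous_on {0..R} \<phi>"
    by (intro compact_uniformly_continuous continuous_on_subset[OF cont]) auto
  then obtain \<delta> where \<delta>: "\<delta> > 0" "\<And>x y. x \<in> {0..R} \<Longrightarrow> y \<in> {0..R} \<Longrightarrow> dist y x < \<delta> \<Longrightarrow> dist (\<phi> y) (\<phi> x) < e"
    using e unfolding uniformly_continuous_on_def by metis
  obtain K where K: "R / \<delta> < real K" using reals_Archimedean2 by blast
  have K0: "K > 0" using K R(1) \<delta>(1) by (metis divide_pos_pos gr0I less_asym of_nat_0)
  define h where "h = R / real K"
  have h: "h > 0" "h < \<delta>" using K K0 R(1) \<delta>(1) by (auto simp: h_def field_simps)
  define \<rho> where "\<rho> k = real (Suc k) * h" for k :: nat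
  have \<rho>: "\<rho> k > 0" "\<rho> k < \<rho> (Suc k)" "\<rho> (Suc k) - \<rho> k = h" for k
    using h by (auto simp: \<rho>_def algebra_simps intro: add_pos_nonneg)
  \<comment> \<open>A difference of two truncated logarithms, normalised to rise from 0 at \<rho> k
    to 1 at \<rho> (k + 1).\<close>
  define ramp where "ramp k x = (ln (max x (\<rho> k)) - ln (max x (\<rho> (Suc k))) + ln (\<rho> (Suc k)) - ln (\<rho> k))
     / (ln (\<rho> (Suc k)) - ln (\<rho> k))" for k and x :: real
  have lnlt: "ln (\<rho> k) < ln (\<rho> (Suc k))" for k using \<rho>[of k] by simp
  have ramp0: "ramp k x = 0" if "x \<le> \<rho> k" for k x
    using that \<rho>(2)[of k] unfolding ramp_def by (simp add: max_absorb2)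
  have ramp1: "ramp k x = 1" if "\<rho> (Suc k) \<le> x" for k x
    using that \<rho>(2)[of k] lnlt[of k] unfolding ramp_def by (simp add: max_absorb1)
  have ramp01: "0 \<le> ramp k x \<and> ramp k x \<le> 1" for k x
  proof (cases "x \<le> \<rho> k \<or> \<rho> (Suc k) \<le> x")
    case True then show ?thesis using ramp0 ramp1 by fastforce
  next
    case False
    then have "ln (\<rho> k) \<le> ln x" "ln x \<le> ln (\<rho> (Suc k))" using \<rho>(1)[of k] by auto
    then show ?thesis using False lnlt[of k] unfolding ramp_def by (auto simp: max_def field_simps)
  qed
  \<comment> \<open>Telescoping sum: at the nodes \<rho> k with k \<le> n it equals \<phi> (\<rho>
    k), and between nodes it is a convex combination of neighbouring values.\<close>
  define g where "g n x = \<phi> (\<rho> 0) + (\<Sum>k<n. (\<phi> (\<rho> (Suc k)) - \<phi> (\<rho> k)) * ramp k x)" for n x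
  have g_after: "g n x = \<phi> (\<rho> n)" if "\<rho> n \<le> x" for n x
    using that
  proof (induction n)
    case (Suc n)
    then have "g n x = \<phi> (\<rho> n)" using \<rho>(2)[of n] by simp
    then show ?case using Suc.prems ramp1[of n x] by (simp add: g_def)
  qed (simp add: g_def)
  have g_before: "g (n + m) x = g n x" if "x \<le> \<rho> n" for n m x
  proof (induction m)
    case (Suc m)
    have "\<rho> n \<le> \<rho> (n + m)" using h by (simp add: \<rho>_def)
    then have "ramp (n + m) x = 0" using that by (intro ramp0) simp
    then show ?case using Suc by (simp add: g_def)
  qed simp
  have main: "\<bar>\<phi> x - g K x\<bar> < e" if x: "0 \<le> x" "x \<le> R" for x
  proof (cases "x \<le> \<rho> 0")
    case True
    then have "g K x = \<phi> (\<rho> 0)" using g_before[of x 0 K] by (simp add: g_def)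
    moreover have "\<rho> 0 \<le> R" using K0 R(1) by (simp add: \<rho>_def h_def field_simps)
    moreover have "\<bar>x - \<rho> 0\<bar> < \<delta>" using True x h by (simp add: \<rho>_def)
    ultimately show ?thesis using \<delta>(2)[of "\<rho> 0" x] x \<rho>(1)[of 0] by (auto simp: dist_real_def)
  next
    case False
    \<comment> \<open>Since \<rho> k = (k + 1) h, the interval from \<rho> k to \<rho> (k + 1)
      consists of the x with ceiling of x/h equal to k + 2.\<close>
    define k where "k = nat \<lceil>x / h\<rceil> - 2"
    have xh: "x / h > 1" using False h by (simp add: \<rho>_def field_simps)
    then have c2: "\<lceil>x / h\<rceil> \<ge> 2" by linarith
    have kk: "real k = of_int \<lceil>x / h\<rceil> - 2" using c2 unfolding k_def by (simp add: of_nat_diff nat_le_iff le_nat_iff)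
    have "real (Suc k) < x / h" "x / h \<le> real (Suc (Suc k))" using kk by (simp_all, linarith+)
    then have kx: "\<rho> k < x" "x \<le> \<rho> (Suc k)" using h by (simp_all add: \<rho>_def field_simps)
    have "x / h \<le> real K" using x R(1) K0 h by (simp add: h_def field_simps)
    then have "\<lceil>x / h\<rceil> \<le> int K" by (simp add: ceiling_le_iff)
    then have kK: "Suc (Suc k) \<le> K" using c2 unfolding k_def by linarith
    have "g K x = g (Suc k) x" using g_before[OF kx(2), of "K - Suc k"] kK by simp
    also have "\<dots> = \<phi> (\<rho> k) + (\<phi> (\<rho> (Suc k)) - \<phi> (\<rho> k)) * ramp k x"
      using g_after[of k x] kx by (simp add: g_def)
    finally have "\<phi> x - g K x = (1 - ramp k x) * (\<phi> x - \<phi> (\<rho> k)) + ramp k x * (\<phi> x - \<phi> (\<rho> (Suc k)))"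
      by (simp add: algebra_simps)
    moreover have "\<rho> (Suc k) \<le> R"
    proof -
      have "real (Suc (Suc k)) * h \<le> real K * h" using kK h by (intro mult_right_mono) auto
      then show ?thesis using K0 by (simp add: \<rho>_def h_def)
    qed
    then have "\<bar>\<phi> x - \<phi> (\<rho> k)\<bar> < e" "\<bar>\<phi> x - \<phi> (\<rho> (Suc k))\<bar> < e"
      using \<delta>(2)[of "\<rho> k" x] \<delta>(2)[of "\<rho> (Suc k)" x] x kx \<rho>[of k] \<rho>(1)[of "Suc k"] h
      by (auto simp: dist_real_def)
    moreover have "\<bar>(1 - a) * s + a * t\<bar> < e" if "0 \<le> a" "a \<le> 1" "\<bar>s\<bar> < e" "\<bar>t\<bar> < e" for a s t :: real
    proof -
      have "\<bar>(1 - a) * s + a * t\<bar> \<le> (1 - a) * \<bar>s\<bar> + a * \<bar>t\<bar>"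
        using that abs_triangle_ineq[of "(1 - a) * s" "a * t"] by (simp add: abs_mult)
      also have "\<dots> \<le> (1 - a) * max \<bar>s\<bar> \<bar>t\<bar> + a * max \<bar>s\<bar> \<bar>t\<bar>"
        using that by (intro add_mono mult_left_mono) auto
      also have "\<dots> = max \<bar>s\<bar> \<bar>t\<bar>" by (simp add: algebra_simps)
      finally show ?thesis using that by simp
    qed
    ultimately show ?thesis using ramp01[of k x] by simp
  qed
  have "re_poly_approx S (\<lambda>z. g K (norm (z - c)))"
  proof -
    have rr: "re_poly_approx S (\<lambda>z. ramp k (norm (z - c)))" for k
    proof -
      have "re_poly_approx S (\<lambda>z. (1 / (ln (\<rho> (Suc k)) - ln (\<rho> k))) *
        ((ln (max (norm (z - c)) (\<rho> k)) - ln (max (norm (z - c)) (\<rho> (Suc k)))) + (ln (\<rho> (Suc k)) - ln (\<rho> k))))"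
        by (intro re_poly_approx_cmult re_poly_approx_add re_poly_approx_diff re_poly_approx_const
            re_poly_approx_ln_max S \<rho>)
      then show ?thesis by (rule re_poly_approx_cong) (simp add: ramp_def)
    qed
    show ?thesis unfolding g_def
      by (intro re_poly_approx_add re_poly_approx_const re_poly_approx_sum re_poly_approx_cmult rr)
  qed
  moreover have "\<forall>z\<in>S. \<bar>\<phi> (norm (z - c)) - g K (norm (z - c))\<bar> < e"
    using main R(2) by auto
  ultimately show "\<exists>h. re_poly_approx S h \<and> (\<forall>z\<in>S. \<bar>\<phi> (norm (z - c)) - h z\<bar> < e)" by blast
qed

text \<open>A product of two Gaussians is again a Gaussian, so their span is an algebra.\<close>

inductive_set gauss_span :: "(complex \<Rightarrow> real) set" where
  gauss: "a \<ge> 0 \<Longrightarrow> (\<lambda>z. b * exp (- (a * (norm (z - c))\<^sup>2))) \<in> gauss_span"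
| add: "f \<in> gauss_span \<Longrightarrow> g \<in> gauss_span \<Longrightarrow> (\<lambda>z. f z + g z) \<in> gauss_span"

text \<open>Completing the square in each coordinate; the new centre \<open>m\<close> is the
  weighted mean of the old ones.\<close>

lemma gauss_mult:
  fixes c c' z :: complex
  assumes "a \<ge> 0" "a' \<ge> 0" "a + a' > 0"
  defines "m \<equiv> (of_real a * c + of_real a' * c') / of_real (a + a')"
  shows "exp (- (a * (norm (z - c))\<^sup>2)) * exp (- (a' * (norm (z - c'))\<^sup>2))
    = exp (- (a * a' / (a + a') * (norm (c - c'))\<^sup>2)) * exp (- ((a + a') * (norm (z - m))\<^sup>2))"
proof -
  have key: "a * (x - p)\<^sup>2 + a' * (x - q)\<^sup>2
      = a * a' / (a + a') * (p - q)\<^sup>2 + (a + a') * (x - (a * p + a' * q) / (a + a'))\<^sup>2" for x p q :: real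
  proof -
    have "(a + a') * (a * (x - p)\<^sup>2 + a' * (x - q)\<^sup>2) = a * a' * (p - q)\<^sup>2 + ((a + a') * x - (a * p + a' * q))\<^sup>2"
      by (simp add: power2_eq_square algebra_simps)
    moreover have "(a + a') * x - (a * p + a' * q) = (a + a') * (x - (a * p + a' * q) / (a + a'))"
      using assms(3) by (simp add: field_simps)
    ultimately have "(a + a') * (a * (x - p)\<^sup>2 + a' * (x - q)\<^sup>2)
        = (a + a') * (a * a' / (a + a') * (p - q)\<^sup>2 + (a + a') * (x - (a * p + a' * q) / (a + a'))\<^sup>2)"
      using assms(3) by (simp add: power_mult_distrib power2_eq_square distrib_left)
    then show ?thesis using assms(3) by simp
  qed
  have "Re m = (a * Re c + a' * Re c') / (a + a')" "Im m = (a * Im c + a' * Im c') / (a + a')"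
    unfolding m_def by (simp_all add: Re_divide_of_real Im_divide_of_real del: of_real_add)
  then have "a * (norm (z - c))\<^sup>2 + a' * (norm (z - c'))\<^sup>2
     = a * a' / (a + a') * (norm (c - c'))\<^sup>2 + (a + a') * (norm (z - m))\<^sup>2"
    using key[of "Re z" "Re c" "Re c'"] key[of "Im z" "Im c" "Im c'"]
    by (simp add: cmod_power2 distrib_left)
  then show ?thesis by (simp add: exp_add[symmetric])
qed

lemma gauss_span_mult:
  assumes "f \<in> gauss_span" "g \<in> gauss_span"
  shows "(\<lambda>z. f z * g z) \<in> gauss_span"
  using assms
proof (induction rule: gauss_span.induct)
  case (gauss a b c)
  show ?case using gauss(2)
  proof (induction rule: gauss_span.induct)
    case (gauss a' b' c')
    show ?case
    proof (cases "a + a' = 0")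
      case True
      then have "a = 0" "a' = 0" using gauss \<open>a \<ge> 0\<close> by auto
      then show ?thesis using gauss_span.gauss[of 0 "b * b'" c] by simp
    next
      case False
      then have "a + a' > 0" using gauss \<open>a \<ge> 0\<close> by auto
      define m where "m = (of_real a * c + of_real a' * c') / of_real (a + a')"
      have "(\<lambda>z. b * exp (- (a * (norm (z - c))\<^sup>2)) * (b' * exp (- (a' * (norm (z - c'))\<^sup>2))))
         = (\<lambda>z. (b * b' * exp (- (a * a' / (a + a') * (norm (c - c'))\<^sup>2))) * exp (- ((a + a') * (norm (z - m))\<^sup>2)))"
      proof
        fix z
        have "b * exp (- (a * (norm (z - c))\<^sup>2)) * (b' * exp (- (a' * (norm (z - c'))\<^sup>2)))
          = b * b' * (exp (- (a * (norm (z - c))\<^sup>2)) * exp (- (a' * (norm (z - c'))\<^sup>2)))" by simp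
        also have "\<dots> = b * b' * (exp (- (a * a' / (a + a') * (norm (c - c'))\<^sup>2)) * exp (- ((a + a') * (norm (z - m))\<^sup>2)))"
          unfolding m_def using gauss_mult[OF \<open>a \<ge> 0\<close> \<open>a' \<ge> 0\<close> \<open>a + a' > 0\<close>, of z c c'] by (simp only:)
        finally show "b * exp (- (a * (norm (z - c))\<^sup>2)) * (b' * exp (- (a' * (norm (z - c'))\<^sup>2)))
          = (b * b' * exp (- (a * a' / (a + a') * (norm (c - c'))\<^sup>2))) * exp (- ((a + a') * (norm (z - m))\<^sup>2))" by simp
      qed
      then show ?thesis using gauss_span.gauss[of "a + a'"] \<open>a + a' > 0\<close> by simp
    qed
  next
    case (add f g)
    then show ?case using gauss_span.add by (simp add: distrib_left)
  qed
next
  case (add f1 f2)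
  then show ?case using gauss_span.add by (simp add: distrib_right)
qed

text \<open>Empty interior is essential for reaching all continuous functions: uniform limits of
  real parts of polynomials are harmonic on any open subset of S.\<close>

theorem Walsh_Lebesgue_empty_interior:
  assumes S: "compact S" "interior S = {}" "connected (- S)" and f: "continuous_on S f"
  shows "re_poly_approx S f"
proof (rule re_poly_approx_limit)
  fix e :: real assume "e > 0"
  interpret function_ring_on gauss_span S
  proof
    show "compact S" by fact
    show "continuous_on S f" if "f \<in> gauss_span" for f
      using that by induction (auto intro!: continuous_intros)
    show "(\<lambda>x. f x + g x) \<in> gauss_span" if "f \<in> gauss_span" "g \<in> gauss_span" for f g
      using gauss_span.add that .
    show "(\<lambda>x. f x * g x) \<in> gauss_span" if "f \<in> gauss_span" "g \<in> gauss_span" for f g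
      using gauss_span_mult that .
    show "(\<lambda>_. c) \<in> gauss_span" for c using gauss_span.gauss[of 0 c 0] by simp
    show "\<exists>f\<in>gauss_span. f x \<noteq> f y" if "x \<noteq> y" for x y
      using that gauss_span.gauss[of 1 1 x] by (intro bexI[of _ "\<lambda>z. 1 * exp (- (1 * (norm (z - x))\<^sup>2))"]) auto
  qed
  obtain g where g: "g \<in> gauss_span" "\<forall>x\<in>S. \<bar>f x - g x\<bar> < e"
    using Stone_Weierstrass_basic[OF f \<open>e > 0\<close>] by blast
  have "re_poly_approx S g" using g(1)
  proof induction
    case (gauss a b c)
    have "continuous_on {0..} (\<lambda>x. exp (- (a * x\<^sup>2)))" by (intro continuous_intros)
    then show ?case by (intro re_poly_approx_cmult re_poly_approx_radial[OF S])
  next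
    case (add f g)
    then show ?case by (intro re_poly_approx_add)
  qed
  then show "\<exists>h. re_poly_approx S h \<and> (\<forall>z\<in>S. \<bar>f z - h z\<bar> < e)" using g by blast
qed

section \<open>Frobenius norm, trace and eigenvalues\<close>

definition fro2 :: "complex mat \<Rightarrow> real" where
  "fro2 A = (\<Sum>i<dim_row A. \<Sum>j<dim_col A. (norm (A $$ (i,j)))\<^sup>2)"

definition mtrace :: "complex mat \<Rightarrow> complex" where
  "mtrace A = (\<Sum>i<dim_row A. A $$ (i,i))"

definition madj :: "complex mat \<Rightarrow> complex mat" where
  "madj A = mat (dim_col A) (dim_row A) (\<lambda>(i,j). cnj (A $$ (j,i)))"

lemma madj_carrier[simp]: "A \<in> carrier_mat n m \<Longrightarrow> madj A \<in> carrier_mat m n"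
  unfolding madj_def by auto

lemma index_mult_mat_sum:
  assumes "A \<in> carrier_mat n m" "B \<in> carrier_mat m k" "i < n" "j < k"
  shows "(A * B) $$ (i,j) = (\<Sum>l<m. A $$ (i,l) * B $$ (l,j))"
  using assms by (simp add: scalar_prod_def atLeast0LessThan)

lemma mtrace_comm:
  assumes "A \<in> carrier_mat n m" "B \<in> carrier_mat m n"
  shows "mtrace (A * B) = mtrace (B * A)"
proof -
  have "mtrace (A * B) = (\<Sum>i<n. \<Sum>l<m. A $$ (i,l) * B $$ (l,i))"
    using assms unfolding mtrace_def by (auto simp: index_mult_mat_sum[OF assms] simp del: index_mult_mat(1) intro!: sum.cong)
  also have "\<dots> = (\<Sum>l<m. \<Sum>i<n. B $$ (l,i) * A $$ (i,l))"
    by (subst sum.swap) (simp add: mult.commute)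
  also have "\<dots> = mtrace (B * A)"
    using assms unfolding mtrace_def by (auto simp: index_mult_mat_sum[OF assms(2,1)] simp del: index_mult_mat(1) intro!: sum.cong)
  finally show ?thesis .
qed

lemma madj_mult:
  assumes "A \<in> carrier_mat n m" "B \<in> carrier_mat m k"
  shows "madj (A * B) = madj B * madj A"
proof (rule eq_matI)
  fix i j assume "i < dim_row (madj B * madj A)" "j < dim_col (madj B * madj A)"
  then have ij: "i < k" "j < n" using assms by (auto simp: madj_def)
  have "madj (A * B) $$ (i,j) = cnj (\<Sum>l<m. A $$ (j,l) * B $$ (l,i))"
    using ij assms index_mult_mat_sum[OF assms ij(2,1)] unfolding madj_def by auto
  also have "\<dots> = (\<Sum>l<m. madj B $$ (i,l) * madj A $$ (l,j))"
    using ij assms by (auto simp: madj_def mult.commute intro!: sum.cong)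
  also have "\<dots> = (madj B * madj A) $$ (i,j)"
    using ij assms by (subst index_mult_mat_sum[of _ k m _ n]) auto
  finally show "madj (A * B) $$ (i,j) = (madj B * madj A) $$ (i,j)" .
qed (use assms in \<open>auto simp: madj_def\<close>)

lemma fro2_eq_mtrace:
  assumes A: "A \<in> carrier_mat n m"
  shows "of_real (fro2 A) = mtrace (A * madj A)" "of_real (fro2 A) = mtrace (madj A * A)"
proof -
  have "mtrace (A * madj A) = (\<Sum>i<n. \<Sum>j<m. A $$ (i,j) * cnj (A $$ (i,j)))"
    using A unfolding mtrace_def
    by (auto simp: index_mult_mat_sum[OF A madj_carrier[OF A]] simp del: index_mult_mat(1) intro!: sum.cong)
      (simp add: madj_def)
  then show "of_real (fro2 A) = mtrace (A * madj A)"
    using A unfolding fro2_def by (simp add: complex_norm_square del: of_real_power)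
  then show "of_real (fro2 A) = mtrace (madj A * A)"
    using mtrace_comm[OF A madj_carrier[OF A]] by simp
qed

lemma fro2_unitary_conj:
  assumes A: "A \<in> carrier_mat n n" and U: "U \<in> carrier_mat n n" and UU: "U * madj U = 1\<^sub>m n"
  shows "fro2 (madj U * A * U) = fro2 A"
proof -
  have V: "madj U \<in> carrier_mat n n" using U by simp
  have adj2: "madj (madj U) = U" using U by (auto simp: madj_def intro!: eq_matI)
  note mc = mult_carrier_mat[of _ n n _ n]
  have "madj (madj U * A * U) = madj U * (madj A * U)"
    using A U V by (simp add: madj_mult[of _ n n _ n] adj2 mc)
  then have "of_real (fro2 (madj U * A * U)) = mtrace (madj U * A * U * (madj U * (madj A * U)))"
    using fro2_eq_mtrace(1)[of "madj U * A * U" n n, OF mc[OF mc[OF V A] U]] by simp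
  also have "madj U * A * U * (madj U * (madj A * U)) = madj U * (A * madj A * U)"
  proof -
    have "madj U * A * U * (madj U * (madj A * U)) = madj U * A * (U * madj U) * (madj A * U)"
      using A U V by (simp add: assoc_mult_mat[of _ n n _ n _ n] mult_carrier_mat[of _ n n _ n])
    then show ?thesis using A U V UU by (simp add: assoc_mult_mat[of _ n n _ n _ n] mult_carrier_mat[of _ n n _ n])
  qed
  also have "mtrace \<dots> = mtrace (A * madj A * U * madj U)"
    using A U V by (intro mtrace_comm[of _ n n] mult_carrier_mat[of _ n n _ n]) auto
  also have "A * madj A * U * madj U = A * madj A"
    using A U V UU right_mult_one_mat[of "madj A" n n]
    by (simp add: assoc_mult_mat[of _ n n _ n _ n] mult_carrier_mat[of _ n n _ n])
  also have "mtrace \<dots> = of_real (fro2 A)" using fro2_eq_mtrace(1)[OF A] by simp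
  finally show ?thesis by simp
qed

text \<open>Gram-Schmidt on a basis beginning with v, followed by normalisation of the columns. The
  columns must have norm 1 so that conjugation preserves the Frobenius norm.\<close>

lemma unitary_completion:
  fixes v :: "complex vec"
  assumes v: "v \<in> carrier_vec n" and v0: "v \<noteq> 0\<^sub>v n"
  obtains U where "U \<in> carrier_mat n n" "madj U * U = 1\<^sub>m n" "U * madj U = 1\<^sub>m n"
    "\<exists>c. \<forall>i<n. U $$ (i,0) = c * v $ i"
proof -
  interpret cof_vec_space n "TYPE(complex)" .
  have n: "n > 0" using v v0 by (cases n) auto
  define b where "b = basis_completion v"
  from basis_completion[OF v v0, folded b_def]
  have dist_b: "distinct b" and indep: "\<not> lin_dep (set b)" and b: "set b \<subseteq> carrier_vec n"
    and hdb: "hd b = v" and len_b: "length b = n" by auto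
  from hdb len_b n obtain vs where bv: "b = v # vs" by (cases b) auto
  define ws where "ws = gram_schmidt n b"
  from gram_schmidt_result[OF b dist_b indep refl, folded ws_def]
  have ws: "set ws \<subseteq> carrier_vec n" "corthogonal ws" "length ws = n" by (auto simp: len_b)
  have hdws: "hd ws = v" using gram_schmidt_hd[OF v, of vs] unfolding ws_def bv .
  have ws0: "ws ! 0 = v" using hdws ws(3) n by (metis hd_conv_nth list.size(3) less_not_refl)
  have wsc: "ws ! j \<in> carrier_vec n" if "j < n" for j using ws that by auto
  have sp: "ws ! j \<bullet>c ws ! k = (\<Sum>i<n. ws ! j $ i * cnj (ws ! k $ i))" if "j < n" "k < n" for j k
    using wsc[OF that(1)] wsc[OF that(2)] by (simp add: scalar_prod_def atLeast0LessThan)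
  define \<nu> where "\<nu> j = sqrt (\<Sum>i<n. (norm (ws ! j $ i))\<^sup>2)" for j
  have \<nu>2: "ws ! j \<bullet>c ws ! j = of_real ((\<nu> j)\<^sup>2)" if "j < n" for j
    using sp[OF that that] by (simp add: \<nu>_def sum_nonneg complex_norm_square del: of_real_power)
  have \<nu>0: "\<nu> j \<noteq> 0" if "j < n" for j
    using \<nu>2[OF that] corthogonalD[OF ws(2), of j j] ws(3) that by auto
  define U where "U = mat n n (\<lambda>(i,j). ws ! j $ i / of_real (\<nu> j))"
  have U: "U \<in> carrier_mat n n" by (simp add: U_def)
  have VU: "madj U * U = 1\<^sub>m n"
  proof (rule eq_matI)
    fix k j assume "k < dim_row (1\<^sub>m n :: complex mat)" "j < dim_col (1\<^sub>m n :: complex mat)"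
    then have kj: "k < n" "j < n" by auto
    have "(madj U * U) $$ (k,j) = (\<Sum>i<n. ws ! j $ i * cnj (ws ! k $ i)) / (of_real (\<nu> k) * of_real (\<nu> j))"
      using kj U index_mult_mat_sum[OF madj_carrier[OF U] U kj]
      by (simp add: U_def madj_def sum_divide_distrib mult.commute)
    also have "\<dots> = (ws ! j \<bullet>c ws ! k) / (of_real (\<nu> k) * of_real (\<nu> j))" by (simp add: sp kj)
    also have "\<dots> = 1\<^sub>m n $$ (k,j)"
    proof (cases "k = j")
      case True
      then show ?thesis using \<nu>2[OF kj(2)] \<nu>0[OF kj(2)] kj by (simp add: power2_eq_square)
    next
      case False
      then show ?thesis using corthogonalD[OF ws(2), of j k] ws(3) kj by simp
    qed
    finally show "(madj U * U) $$ (k,j) = 1\<^sub>m n $$ (k,j)" .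
  qed (auto simp: madj_def U_def)
  moreover have "U * madj U = 1\<^sub>m n"
    using mat_mult_left_right_inverse[OF madj_carrier[OF U] U VU] .
  moreover have "\<forall>i<n. U $$ (i,0) = (1 / of_real (\<nu> 0)) * v $ i"
    using n by (simp add: U_def ws0)
  ultimately show ?thesis using that[OF U] by blast
qed

text \<open>Deflation by a unitary whose first column is an eigenvector: the Frobenius norm is
  unchanged, the eigenvalue e appears in the corner, and the trailing block carries the remaining
  eigenvalues. The rest of the first row is discarded.\<close>

lemma Schur_inequality:
  assumes "A \<in> carrier_mat n n" "char_poly A = (\<Prod>e\<leftarrow>es. [:- e, 1:])"
  shows "(\<Sum>e\<leftarrow>es. (norm e)\<^sup>2) \<le> fro2 A"
  using assms
proof (induction es arbitrary: n A)
  case Nil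
  then show ?case by (auto simp: fro2_def intro!: sum_nonneg)
next
  case (Cons e es)
  note A = Cons.prems(1)
  have cp: "char_poly A = [:- e, 1:] * (\<Prod>e\<leftarrow>es. [:- e, 1:])" using Cons.prems by simp
  then have "eigenvalue A e" unfolding eigenvalue_root_char_poly[OF A] by simp
  then obtain v where v: "v \<in> carrier_vec n" "v \<noteq> 0\<^sub>v n" "A *\<^sub>v v = e \<cdot>\<^sub>v v"
    unfolding eigenvalue_def eigenvector_def using A by auto
  obtain U c where U: "U \<in> carrier_mat n n" "madj U * U = 1\<^sub>m n" "U * madj U = 1\<^sub>m n"
    and c: "\<And>i. i < n \<Longrightarrow> U $$ (i,0) = c * v $ i"
    using unitary_completion[OF v(1,2)] by metis
  have V: "madj U \<in> carrier_mat n n" using U by simp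
  have n: "n > 0" using v by (cases n) auto
  then obtain m where m: "n = Suc m" by (cases n) auto
  define A' where "A' = madj U * A * U"
  have A': "A' \<in> carrier_mat n n" using A U V unfolding A'_def by (intro mult_carrier_mat[of _ n n _ n]) auto
  have AU: "(A * U) $$ (k,0) = e * U $$ (k,0)" if "k < n" for k
  proof -
    have "(A * U) $$ (k,0) = (\<Sum>l<n. A $$ (k,l) * (c * v $ l))"
      using that n by (subst index_mult_mat_sum[OF A U(1)]) (auto simp: c)
    also have "\<dots> = c * (A *\<^sub>v v) $ k"
      using that A v(1) by (simp add: scalar_prod_def atLeast0LessThan sum_distrib_left algebra_simps)
    also have "\<dots> = e * U $$ (k,0)" using that v by (simp add: c)
    finally show ?thesis .
  qed
  have col0: "A' $$ (i,0) = (if i = 0 then e else 0)" if "i < n" for i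
  proof -
    have "A' = madj U * (A * U)" unfolding A'_def using A U V by (simp add: assoc_mult_mat[of _ n n _ n _ n] mult_carrier_mat[of _ n n _ n])
    then have "A' $$ (i,0) = (\<Sum>k<n. madj U $$ (i,k) * (e * U $$ (k,0)))"
      using that n A U V AU by (simp add: index_mult_mat_sum[of _ n n _ n])
    also have "\<dots> = e * (madj U * U) $$ (i,0)"
      using that n by (subst index_mult_mat_sum[OF V U(1)]) (simp_all add: sum_distrib_left algebra_simps)
    finally show ?thesis using U that n by simp
  qed
  have sim: "similar_mat A' A"
    unfolding similar_mat_def
    using similar_mat_witI[OF U(2,3) A'_def A' A V U(1)] by blast
  define A2 where "A2 = mat 1 m (\<lambda>(i,j). A' $$ (0, Suc j))"
  define A3 where "A3 = mat m m (\<lambda>(i,j). A' $$ (Suc i, Suc j))"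
  define A1 where "A1 = mat 1 1 (\<lambda>_. e)"
  have A3: "A3 \<in> carrier_mat m m" by (simp add: A3_def)
  \<comment> \<open>Zeros below the corner make the characteristic polynomial factor, which hands
    the remaining list \<open>es\<close> to \<open>A3\<close>.\<close>
  have blk: "A' = four_block_mat A1 A2 (0\<^sub>m m 1) A3"
    using A' col0 by (intro eq_matI) (auto simp: m A1_def A2_def A3_def)
  have "char_poly A' = char_poly A1 * char_poly A3"
    unfolding blk by (rule char_poly_four_block_zeros_col) (auto simp: A1_def A2_def A3_def)
  moreover have "char_poly A1 = [:- e, 1:]"
    by (simp add: A1_def char_poly_defs det_def sign_def)
  moreover have "char_poly A' = char_poly A" by (rule char_poly_similar[OF sim])
  ultimately have "[:- e, 1:] * char_poly A3 = [:- e, 1:] * (\<Prod>e\<leftarrow>es. [:- e, 1:])" using cp by simp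
  then have cp3: "char_poly A3 = (\<Prod>e\<leftarrow>es. [:- e, 1:])"
    by (metis mult_cancel_left pCons_eq_0_iff zero_neq_one)
  have "(\<Sum>e\<leftarrow>e # es. (norm e)\<^sup>2) \<le> (norm e)\<^sup>2 + fro2 A3"
    using Cons.IH[OF A3 cp3] by simp
  also have "\<dots> \<le> fro2 A'"
  proof -
    have "fro2 A' = (\<Sum>j<n. (norm (A' $$ (0,j)))\<^sup>2) + (\<Sum>i<m. \<Sum>j<n. (norm (A' $$ (Suc i,j)))\<^sup>2)"
      using A' unfolding fro2_def m by (simp only: carrier_matD sum.lessThan_Suc_shift)
    moreover have "(norm e)\<^sup>2 \<le> (\<Sum>j<n. (norm (A' $$ (0,j)))\<^sup>2)"
      using member_le_sum[of 0 "{..<n}" "\<lambda>j. (norm (A' $$ (0,j)))\<^sup>2"] n col0[of 0] by simp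
    moreover have "fro2 A3 \<le> (\<Sum>i<m. \<Sum>j<n. (norm (A' $$ (Suc i,j)))\<^sup>2)"
      unfolding fro2_def m by (simp only: A3_def dim_row_mat dim_col_mat, intro sum_mono, subst sum.lessThan_Suc_shift) simp
    ultimately show ?thesis by linarith
  qed
  also have "\<dots> = fro2 A" unfolding A'_def by (rule fro2_unitary_conj[OF A U(1,3)])
  finally show ?case .
qed

section \<open>Polynomials and powers of matrices via triangular forms\<close>

lemma shift_mat_carrier[simp]: "X \<in> carrier_mat m m \<Longrightarrow> X - c \<cdot>\<^sub>m 1\<^sub>m m \<in> carrier_mat m m"
  by (intro minus_carrier_mat smult_carrier_mat one_carrier_mat)

text \<open>Horner evaluation of the polynomial with coefficient list \<open>cs\<close> at a matrix.
  The size is an argument so that the empty list gives the zero matrix of the right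
  dimension.\<close>

fun mpl :: "nat \<Rightarrow> complex list \<Rightarrow> complex mat \<Rightarrow> complex mat" where
  "mpl n [] A = 0\<^sub>m n n"
| "mpl n (c # cs) A = c \<cdot>\<^sub>m 1\<^sub>m n + A * mpl n cs A"

lemma mpl_carrier[simp]: "A \<in> carrier_mat n n \<Longrightarrow> mpl n cs A \<in> carrier_mat n n"
  by (induction cs) auto

lemma mpl_similar:
  assumes sim: "similar_mat_wit A B P Q" and A: "A \<in> carrier_mat n n"
  shows "mpl n cs A = P * mpl n cs B * Q"
proof -
  from similar_mat_witD2[OF A sim] have B: "B \<in> carrier_mat n n" and P: "P \<in> carrier_mat n n"
    and Q: "Q \<in> carrier_mat n n" and PQ: "P * Q = 1\<^sub>m n" and QP: "Q * P = 1\<^sub>m n" and AB: "A = P * B * Q" by auto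
  note mc = mult_carrier_mat[of _ n n _ n]
  note as = assoc_mult_mat[of _ n n _ n _ n]
  show ?thesis
  proof (induction cs)
    case Nil
    then show ?case using P Q by simp
  next
    case (Cons c cs)
    let ?M = "mpl n cs B"
    have M: "?M \<in> carrier_mat n n" using B by simp
    have "A * mpl n cs A = (P * B * Q) * (P * ?M * Q)" by (simp only: Cons AB[symmetric])
    also have "\<dots> = P * B * (Q * P) * ?M * Q" using B P Q M by (simp add: as mc)
    also have "\<dots> = P * (B * ?M) * Q" using B P Q M QP by (simp add: as mc)
    finally have 1: "A * mpl n cs A = P * (B * ?M) * Q" .
    have "P * (c \<cdot>\<^sub>m 1\<^sub>m n + B * ?M) * Q = P * (c \<cdot>\<^sub>m 1\<^sub>m n) * Q + P * (B * ?M) * Q"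
      using B P Q M
      by (simp add: mult_add_distrib_mat[of _ n n _ n] add_mult_distrib_mat[of _ n n _ _ n] mc)
    also have "P * (c \<cdot>\<^sub>m 1\<^sub>m n) * Q = c \<cdot>\<^sub>m 1\<^sub>m n"
      using P Q PQ by (simp add: mult_smult_distrib[of _ n n _ n] mult_smult_assoc_mat[of _ n n _ n])
    finally show ?case using 1 by simp
  qed
qed

lemma upper_triangular_mult:
  assumes A: "A \<in> carrier_mat n n" "upper_triangular A" and B: "B \<in> carrier_mat n n" "upper_triangular B"
  shows "upper_triangular (A * B :: complex mat)"
    and "i < n \<Longrightarrow> (A * B) $$ (i,i) = A $$ (i,i) * B $$ (i,i)"
proof -
  have z: "A $$ (i,l) * B $$ (l,j) = 0" if "i < n" "l < n" "j < i \<or> (j = i \<and> l \<noteq> i)" for i j l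
  proof (cases "l < i")
    case True then show ?thesis using upper_triangularD[OF A(2) True] A(1) that by simp
  next
    case False
    then have "j < l" using that by auto
    then show ?thesis using upper_triangularD[OF B(2), of j l] B(1) that by simp
  qed
  show "upper_triangular (A * B)"
  proof
    fix i j assume "j < i" "i < dim_row (A * B)"
    then have ij: "j < i" "i < n" "j < n" using A B by auto
    show "(A * B) $$ (i,j) = 0"
      unfolding index_mult_mat_sum[OF A(1) B(1) ij(2,3)] using z ij by (intro sum.neutral) blast
  qed
  assume i: "i < n"
  have "(A * B) $$ (i,i) = (\<Sum>l<n. A $$ (i,l) * B $$ (l,i))"
    using i by (intro index_mult_mat_sum[OF A(1) B(1)]) auto
  also have "\<dots> = (\<Sum>l<n. if l = i then A $$ (i,i) * B $$ (i,i) else 0)"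
    using z i by (intro sum.cong) auto
  finally show "(A * B) $$ (i,i) = A $$ (i,i) * B $$ (i,i)" using i by simp
qed

lemma mpl_upper_triangular:
  assumes A: "A \<in> carrier_mat n n" "upper_triangular A"
  shows "upper_triangular (mpl n cs A) \<and> (\<forall>i<n. mpl n cs A $$ (i,i) = poly (Poly cs) (A $$ (i,i)))"
proof (induction cs)
  case (Cons c cs)
  have M: "mpl n cs A \<in> carrier_mat n n" using A by simp
  note ut = upper_triangular_mult[OF A M]
  have "upper_triangular (mpl n (c # cs) A)"
  proof
    fix i j assume "j < i" "i < dim_row (mpl n (c # cs) A)"
    then have ij: "j < i" "i < n" using mpl_carrier[OF A(1), of "c # cs"] by auto
    then have "(A * mpl n cs A) $$ (i,j) = 0"
      by (intro upper_triangularD[OF ut(1)]) (use Cons A M in auto)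
    then show "mpl n (c # cs) A $$ (i,j) = 0" using ij A M carrier_matD[OF A(1)] carrier_matD[OF M] by (simp del: index_mult_mat(1))
  qed
  moreover have "mpl n (c # cs) A $$ (i,i) = poly (Poly (c # cs)) (A $$ (i,i))" if "i < n" for i
    using that ut(2)[of i] Cons A M carrier_matD[OF A(1)] carrier_matD[OF M] by (simp del: index_mult_mat(1))
  ultimately show ?case by blast
qed auto

lemma pow_upper_triangular:
  fixes A :: "complex mat"
  assumes A: "A \<in> carrier_mat n n" "upper_triangular A"
  shows "upper_triangular (A ^\<^sub>m k) \<and> (\<forall>i<n. (A ^\<^sub>m k) $$ (i,i) = (A $$ (i,i)) ^ k)"
proof (induction k)
  case (Suc k)
  have M: "A ^\<^sub>m k \<in> carrier_mat n n" using A by simp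
  have "upper_triangular (A ^\<^sub>m Suc k)"
    using upper_triangular_mult(1)[OF M Suc[THEN conjunct1] A] by simp
  moreover have "(A ^\<^sub>m Suc k) $$ (i,i) = (A $$ (i,i)) ^ Suc k" if "i < n" for i
    using upper_triangular_mult(2)[OF M Suc[THEN conjunct1] A that] Suc[THEN conjunct2] that
    by (simp del: index_mult_mat(1) add: mult.commute)
  ultimately show ?case by blast
qed (use A in auto)

text \<open>Common pattern for polynomials and powers: if F is compatible with similarity and acts
  by f on the diagonal of triangular matrices, then it acts by f on the eigenvalues with
  multiplicity.\<close>

lemma char_poly_diag_transform:
  assumes A: "A \<in> carrier_mat n n" "char_poly A = (\<Prod>e\<leftarrow>es. [:- e, 1:])"
    and X: "\<And>B P Q. similar_mat_wit A B P Q \<Longrightarrow> similar_mat_wit (F A) (F B) P Q"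
    and T: "\<And>B. B \<in> carrier_mat n n \<Longrightarrow> upper_triangular B \<Longrightarrow>
      F B \<in> carrier_mat n n \<and> upper_triangular (F B) \<and> (\<forall>i<n. F B $$ (i,i) = f (B $$ (i,i)))"
  shows "char_poly (F A) = (\<Prod>e\<leftarrow>map f es. [:- e, 1:])" "mtrace (F A) = (\<Sum>e\<leftarrow>es. f e)"
proof -
  obtain B P Q where BPQ: "schur_decomposition A es = (B,P,Q)" by (cases "schur_decomposition A es") auto
  from schur_decomposition[OF A BPQ]
  have sim: "similar_mat_wit A B P Q" and ut: "upper_triangular B" and diag: "diag_mat B = es" by auto
  from similar_mat_witD2[OF A(1) sim] have B: "B \<in> carrier_mat n n" by auto
  have len: "length es = n" using B unfolding diag[symmetric] by (simp add: diag_mat_def)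
  have FB: "F B \<in> carrier_mat n n" "upper_triangular (F B)" "\<And>i. i < n \<Longrightarrow> F B $$ (i,i) = f (es ! i)"
    using T[OF B ut] B unfolding diag[symmetric] by (auto simp: diag_mat_def)
  have simF: "similar_mat_wit (F A) (F B) P Q" by (rule X[OF sim])
  then have FA: "similar_mat (F A) (F B)" unfolding similar_mat_def by blast
  have diagF: "diag_mat (F B) = map f es"
    using FB len by (intro nth_equalityI) (auto simp: diag_mat_def)
  show "char_poly (F A) = (\<Prod>e\<leftarrow>map f es. [:- e, 1:])"
    unfolding char_poly_similar[OF FA] char_poly_upper_triangular[OF FB(1,2)] diagF ..
  from simF have FAc: "F A \<in> carrier_mat n n" using similar_mat_witD2[OF FB(1) similar_mat_wit_sym[OF simF]] by auto
  from similar_mat_witD2[OF FAc simF] have PQ: "P \<in> carrier_mat n n" "Q \<in> carrier_mat n n" "Q * P = 1\<^sub>m n" "F A = P * F B * Q"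
    by auto
  have "mtrace (F A) = mtrace (P * (F B * Q))" using PQ FB by (simp add: assoc_mult_mat[of _ n n _ n _ n])
  also have "\<dots> = mtrace (F B * Q * P)" using PQ FB by (intro mtrace_comm[of _ n n]) (auto intro: mult_carrier_mat[of _ n n _ n])
  also have "F B * Q * P = F B" using PQ FB by (simp add: assoc_mult_mat[of _ n n _ n _ n])
  also have "mtrace (F B) = (\<Sum>i<n. f (es ! i))" using FB by (simp add: mtrace_def)
  also have "\<dots> = (\<Sum>e\<leftarrow>es. f e)" using len by (simp add: sum_list_sum_nth atLeast0LessThan)
  finally show "mtrace (F A) = (\<Sum>e\<leftarrow>es. f e)" .
qed

lemma
  assumes A: "A \<in> carrier_mat n n" "char_poly A = (\<Prod>e\<leftarrow>es. [:- e, 1:])"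
  shows char_poly_mpl: "char_poly (mpl n cs A) = (\<Prod>e\<leftarrow>map (poly (Poly cs)) es. [:- e, 1:])"
    and mtrace_mpl: "mtrace (mpl n cs A) = (\<Sum>e\<leftarrow>es. poly (Poly cs) e)"
    and char_poly_pow_mat: "char_poly (A ^\<^sub>m k) = (\<Prod>e\<leftarrow>map (\<lambda>e. e ^ k) es. [:- e, 1:])"
proof -
  have sim: "similar_mat_wit (mpl n cs A) (mpl n cs B) P Q" if s: "similar_mat_wit A B P Q" for B P Q
  proof -
    from similar_mat_witD2[OF A(1) s] have c: "B \<in> carrier_mat n n" "P \<in> carrier_mat n n" "Q \<in> carrier_mat n n"
      "P * Q = 1\<^sub>m n" "Q * P = 1\<^sub>m n" by auto
    show ?thesis by (rule similar_mat_witI[of _ _ n]) (use c A mpl_similar[OF s A(1)] in auto)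
  qed
  show "char_poly (mpl n cs A) = (\<Prod>e\<leftarrow>map (poly (Poly cs)) es. [:- e, 1:])"
    using mpl_upper_triangular
    by (intro char_poly_diag_transform(1)[where F = "mpl n cs" and f = "poly (Poly cs)", OF A sim]) auto
  show "mtrace (mpl n cs A) = (\<Sum>e\<leftarrow>es. poly (Poly cs) e)"
    using mpl_upper_triangular
    by (intro char_poly_diag_transform(2)[where F = "mpl n cs" and f = "poly (Poly cs)", OF A sim]) auto
  show "char_poly (A ^\<^sub>m k) = (\<Prod>e\<leftarrow>map (\<lambda>e. e ^ k) es. [:- e, 1:])"
    using pow_upper_triangular
    by (intro char_poly_diag_transform(1)[where F = "\<lambda>A. A ^\<^sub>m k" and f = "\<lambda>e. e ^ k", OF A similar_mat_wit_pow]) auto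
qed

lemma eigs_eq_mset:
  assumes "char_poly A = (\<Prod>e\<leftarrow>es. [:- e, 1:])"
  shows "eigs A = mset es"
proof -
  have "proots (\<Prod>e\<leftarrow>es. [:- e, 1:]) = mset es"
  proof (induction es)
    case (Cons e es)
    have "(\<Prod>e\<leftarrow>es. [:- e, 1:]) \<noteq> (0 :: complex poly)" by (auto simp: prod_list_zero_iff)
    then show ?case using Cons by (simp add: proots_mult del: mult_pCons_left)
  qed auto
  then show ?thesis using assms by (simp add: eigs_def)
qed

section \<open>Newton expansion of matrix powers and their decay\<close>

primrec newton_mat :: "nat \<Rightarrow> complex list \<Rightarrow> complex mat \<Rightarrow> nat \<Rightarrow> complex mat" where
  "newton_mat m es X 0 = 1\<^sub>m m"
| "newton_mat m es X (Suc j) = newton_mat m es X j * (X - (es ! j) \<cdot>\<^sub>m 1\<^sub>m m)"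

lemma newton_mat_carrier[simp]: "X \<in> carrier_mat m m \<Longrightarrow> newton_mat m es X j \<in> carrier_mat m m"
  by (induction j) (auto intro!: mult_carrier_mat[of _ m m _ m])

lemma newton_mat_similar:
  assumes sim: "similar_mat_wit A B P Q" and A: "A \<in> carrier_mat m m"
  shows "newton_mat m es A j = P * newton_mat m es B j * Q"
proof -
  from similar_mat_witD2[OF A sim] have B: "B \<in> carrier_mat m m" and P: "P \<in> carrier_mat m m"
    and Q: "Q \<in> carrier_mat m m" and PQ: "P * Q = 1\<^sub>m m" and QP: "Q * P = 1\<^sub>m m" and AB: "A = P * B * Q" by auto
  note mc = mult_carrier_mat[of _ m m _ m]
  note as = assoc_mult_mat[of _ m m _ m _ m]
  show ?thesis
  proof (induction j)
    case 0
    then show ?case using P Q PQ by simp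
  next
    case (Suc j)
    let ?N = "newton_mat m es B j" and ?c = "es ! j"
    have N: "?N \<in> carrier_mat m m" using B by simp
    have "P * (B - ?c \<cdot>\<^sub>m 1\<^sub>m m) * Q = P * B * Q - P * (?c \<cdot>\<^sub>m 1\<^sub>m m) * Q"
      using P Q B by (simp add: mult_minus_distrib_mat[of _ m m _ m] minus_mult_distrib_mat[of _ m m _ _ m] mc)
    also have "P * (?c \<cdot>\<^sub>m 1\<^sub>m m) * Q = ?c \<cdot>\<^sub>m 1\<^sub>m m"
      using P Q PQ by (simp add: mult_smult_distrib[of _ m m _ m] mult_smult_assoc_mat[of _ m m _ m])
    finally have "A - ?c \<cdot>\<^sub>m 1\<^sub>m m = P * (B - ?c \<cdot>\<^sub>m 1\<^sub>m m) * Q" using AB by simp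
    moreover define C where "C = B - ?c \<cdot>\<^sub>m 1\<^sub>m m"
    moreover have C: "C \<in> carrier_mat m m" using B by (simp add: C_def)
    ultimately have "newton_mat m es A (Suc j) = P * ?N * Q * (P * C * Q)" using Suc by simp
    also have "\<dots> = P * ?N * (Q * P) * C * Q" using P Q N C by (simp add: as mc)
    also have "\<dots> = P * (?N * C) * Q" using P Q N C QP by (simp add: as mc)
    finally show ?case by (simp add: C_def)
  qed
qed

text \<open>A factorised form of the Cayley--Hamilton theorem.\<close>

lemma newton_mat_zero:
  assumes X: "X \<in> carrier_mat m m" "char_poly X = (\<Prod>e\<leftarrow>es. [:- e, 1:])"
  shows "newton_mat m es X m = 0\<^sub>m m m"
proof -
  obtain B P Q where BPQ: "schur_decomposition X es = (B,P,Q)" by (cases "schur_decomposition X es") auto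
  from schur_decomposition[OF X BPQ]
  have sim: "similar_mat_wit X B P Q" and ut: "upper_triangular B" and diag: "diag_mat B = es" by auto
  from similar_mat_witD2[OF X(1) sim] have B: "B \<in> carrier_mat m m" and P: "P \<in> carrier_mat m m" and Q: "Q \<in> carrier_mat m m" by auto
  have es: "es ! i = B $$ (i,i)" if "i < m" for i using that B unfolding diag[symmetric] by (simp add: diag_mat_def)
  \<comment> \<open>In triangular form, the product of the first j factors annihilates the first j
    basis vectors.\<close>
  have col: "newton_mat m es B j $$ (a,l) = 0" if "j \<le> m" "l < j" "a < m" for j a l
    using that
  proof (induction j arbitrary: l)
    case (Suc j)
    let ?C = "B - (es ! j) \<cdot>\<^sub>m 1\<^sub>m m"
    have C: "?C \<in> carrier_mat m m" using B by simp
    have "newton_mat m es B (Suc j) $$ (a,l) = (\<Sum>i<m. newton_mat m es B j $$ (a,i) * ?C $$ (i,l))"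
      using Suc.prems B C by (simp del: index_mult_mat(1) add: index_mult_mat_sum[OF newton_mat_carrier[OF B] C])
    also have "\<dots> = 0"
    proof (intro sum.neutral ballI)
      fix i assume "i \<in> {..<m}"
      then have i: "i < m" by simp
      consider "i < j" | "i \<ge> j" "l < i" | "i = j" "l = j" using Suc.prems by linarith
      then show "newton_mat m es B j $$ (a,i) * ?C $$ (i,l) = 0"
      proof cases
        case 1 then show ?thesis using Suc by auto
      next
        case 2
        then have "?C $$ (i,l) = 0" using upper_triangularD[OF ut, of l i] B i Suc.prems by auto
        then show ?thesis by simp
      next
        case 3
        then have "?C $$ (i,l) = 0" using es[of j] B i by auto
        then show ?thesis by simp
      qed
    qed
    finally show ?case .
  qed auto
  have "newton_mat m es B m = 0\<^sub>m m m"
    using col[of m] B carrier_matD[OF newton_mat_carrier[OF B, of es m]] by (intro eq_matI) auto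
  then show ?thesis using newton_mat_similar[OF sim X(1), of es m] P Q by simp
qed

text \<open>The divided difference of x^k at the nodes e_0, ..., e_j, that is, the complete
  homogeneous symmetric polynomial of degree k - j in them. Expanding powers in the Newton basis
  gives bounds that involve the eigenvalues and entries only, with no condition number of an
  eigenbasis.\<close>

primrec newton_coeff :: "complex list \<Rightarrow> nat \<Rightarrow> nat \<Rightarrow> complex" where
  "newton_coeff es 0 j = (if j = 0 then 1 else 0)"
| "newton_coeff es (Suc k) j = es ! j * newton_coeff es k j + (if j = 0 then 0 else newton_coeff es k (j - 1))"

text \<open>Multiplying the j-th basis matrix by X gives the next one plus e_j times itself. The
  m-th basis matrix vanishes, so m terms suffice for every power.\<close>

lemma pow_mat_newton:
  assumes X: "X \<in> carrier_mat m m" "char_poly X = (\<Prod>e\<leftarrow>es. [:- e, 1:])" and ab: "a < m" "b < m"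
  shows "(X ^\<^sub>m k) $$ (a,b) = (\<Sum>j<m. newton_coeff es k j * newton_mat m es X j $$ (a,b))"
  using ab
proof (induction k arbitrary: b)
  case 0
  have "(\<Sum>j<m. newton_coeff es 0 j * newton_mat m es X j $$ (a,b))
      = (\<Sum>j<m. if j = 0 then 1\<^sub>m m $$ (a,b) else 0)"
    by (intro sum.cong) auto
  also have "\<dots> = 1\<^sub>m m $$ (a,b)" using 0 by (subst sum.delta) auto
  finally show ?case using X by simp
next
  case (Suc k)
  let ?N = "\<lambda>j. newton_mat m es X j" and ?h = "newton_coeff es k"
  have N: "?N j \<in> carrier_mat m m" for j using X by simp
  have NX: "(\<Sum>c<m. ?N j $$ (a,c) * X $$ (c,b)) = ?N (Suc j) $$ (a,b) + es ! j * ?N j $$ (a,b)" for j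
  proof -
    have "?N (Suc j) $$ (a,b) = (\<Sum>c<m. ?N j $$ (a,c) * (X - (es ! j) \<cdot>\<^sub>m 1\<^sub>m m) $$ (c,b))"
      unfolding newton_mat.simps using Suc.prems X by (intro index_mult_mat_sum[of _ m m _ m] N) auto
    also have "\<dots> = (\<Sum>c<m. ?N j $$ (a,c) * X $$ (c,b) - (if c = b then es ! j * ?N j $$ (a,b) else 0))"
      using Suc.prems X by (intro sum.cong) (auto simp: algebra_simps)
    also have "\<dots> = (\<Sum>c<m. ?N j $$ (a,c) * X $$ (c,b)) - es ! j * ?N j $$ (a,b)"
      using Suc.prems by (simp add: sum_subtractf)
    finally show ?thesis by simp
  qed
  obtain m' where m': "m = Suc m'" using Suc.prems by (cases m) auto
  have zero: "?N m $$ (a,b) = 0" using newton_mat_zero[OF X] Suc.prems by simp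
  have "(X ^\<^sub>m Suc k) $$ (a,b) = (\<Sum>c<m. (X ^\<^sub>m k) $$ (a,c) * X $$ (c,b))"
    using Suc.prems X by (simp del: index_mult_mat(1) add: index_mult_mat_sum[of _ m m _ m])
  also have "\<dots> = (\<Sum>c<m. \<Sum>j<m. ?h j * (?N j $$ (a,c) * X $$ (c,b)))"
    using Suc by (simp add: sum_distrib_right mult.assoc)
  also have "\<dots> = (\<Sum>j<m. ?h j * (?N (Suc j) $$ (a,b) + es ! j * ?N j $$ (a,b)))"
    by (subst sum.swap) (simp only: sum_distrib_left[symmetric] NX)
  also have "\<dots> = (\<Sum>j<m. ?h j * ?N (Suc j) $$ (a,b)) + (\<Sum>j<m. es ! j * ?h j * ?N j $$ (a,b))"
    by (simp only: distrib_left sum.distrib) (simp only: mult_ac)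
  also have "(\<Sum>j<m. ?h j * ?N (Suc j) $$ (a,b)) = (\<Sum>j<m. (if j = 0 then 0 else ?h (j - 1)) * ?N j $$ (a,b))"
  proof -
    have "(\<Sum>j<m. ?h j * ?N (Suc j) $$ (a,b)) = (\<Sum>j<m'. ?h j * ?N (Suc j) $$ (a,b)) + ?h m' * ?N m $$ (a,b)"
      unfolding m' by (simp only: sum.lessThan_Suc)
    also have "\<dots> = (\<Sum>j<m'. ?h j * ?N (Suc j) $$ (a,b))" unfolding zero by simp
    also have "\<dots> = (\<Sum>j<m. (if j = 0 then 0 else ?h (j - 1)) * ?N j $$ (a,b))"
      unfolding m' by (subst sum.lessThan_Suc_shift) simp
    finally show ?thesis .
  qed
  also have "(\<Sum>j<m. (if j = 0 then 0 else ?h (j - 1)) * ?N j $$ (a,b)) + (\<Sum>j<m. es ! j * ?h j * ?N j $$ (a,b))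
     = (\<Sum>j<m. newton_coeff es (Suc k) j * ?N j $$ (a,b))"
    unfolding sum.distrib[symmetric] by (intro sum.cong refl) (simp add: algebra_simps)
  finally show ?case .
qed

text \<open>The weight 8^j turns the two terms of the recursion into 1/4 + 1/8 = 3/8. The rate must
  stay below the 1/2 of the clustering argument.\<close>

lemma norm_newton_coeff_le:
  assumes es: "\<And>i. i < m \<Longrightarrow> norm (es ! i) \<le> 1/4" and "j < m"
  shows "norm (newton_coeff es k j) \<le> 8 ^ j * (3/8) ^ k"
  using assms(2)
proof (induction k arbitrary: j)
  case (Suc k)
  have 1: "norm (es ! j * newton_coeff es k j) \<le> 1/4 * (8 ^ j * (3/8) ^ k)"
    unfolding norm_mult using Suc es[of j] by (intro mult_mono) auto
  show ?case
  proof (cases j)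
    case 0
    then have "norm (es ! j * newton_coeff es k j) \<le> 1/4 * (3/8) ^ k" using 1 by simp
    also have "\<dots> \<le> 3/8 * (3/8) ^ k" by (rule mult_right_mono) auto
    finally show ?thesis using 0 by simp
  next
    case (Suc i)
    have "norm (newton_coeff es k i) \<le> 8 ^ i * (3/8) ^ k" using Suc.IH Suc.prems Suc by simp
    then show ?thesis using 1 norm_triangle_ineq[of "es ! j * newton_coeff es k j" "newton_coeff es k i"] Suc by simp
  qed
qed auto

lemma norm_newton_mat_le:
  assumes X: "X \<in> carrier_mat m m" and K: "\<And>a b. a < m \<Longrightarrow> b < m \<Longrightarrow> norm (X $$ (a,b)) \<le> K"
    and es: "\<And>i. i < m \<Longrightarrow> norm (es ! i) \<le> 1" and "j \<le> m" "a < m" "b < m" "K \<ge> 0"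
  shows "norm (newton_mat m es X j $$ (a,b)) \<le> (real m * (K + 1)) ^ j"
  using assms(4-6)
proof (induction j arbitrary: b)
  case (Suc j)
  let ?C = "X - (es ! j) \<cdot>\<^sub>m 1\<^sub>m m"
  have C: "?C \<in> carrier_mat m m" using X by simp
  have "newton_mat m es X (Suc j) $$ (a,b) = (\<Sum>i<m. newton_mat m es X j $$ (a,i) * ?C $$ (i,b))"
    using Suc.prems X C by (simp del: index_mult_mat(1) add: index_mult_mat_sum[OF newton_mat_carrier[OF X] C])
  also have "norm \<dots> \<le> (\<Sum>i<m. (real m * (K + 1)) ^ j * (K + 1))"
  proof (rule sum_norm_le)
    fix i assume "i \<in> {..<m}"
    then have i: "i < m" by simp
    have "norm (?C $$ (i,b)) \<le> norm (X $$ (i,b)) + norm (es ! j)"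
      using X i Suc.prems norm_triangle_ineq4[of "X $$ (i,b)" "es ! j"] by auto
    also have "\<dots> \<le> K + 1" using K[OF i, of b] es[of j] Suc.prems by (intro add_mono) auto
    finally show "norm (newton_mat m es X j $$ (a,i) * ?C $$ (i,b)) \<le> (real m * (K + 1)) ^ j * (K + 1)"
      unfolding norm_mult using Suc i \<open>K \<ge> 0\<close> by (intro mult_mono) auto
  qed
  also have "\<dots> = (real m * (K + 1)) ^ Suc j" by (simp add: algebra_simps)
  finally show ?case .
qed (auto simp: one_mat_def)

text \<open>The constant depends only on the size and the entry bound, so the decay is uniform over
  all values of a bounded symbol.\<close>

lemma norm_pow_mat_le:
  fixes X :: "complex mat"
  assumes X: "X \<in> carrier_mat m m" "char_poly X = (\<Prod>e\<leftarrow>es. [:- e, 1:])"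
    and K: "\<And>a b. a < m \<Longrightarrow> b < m \<Longrightarrow> norm (X $$ (a,b)) \<le> K"
    and es: "\<And>e. e \<in> set es \<Longrightarrow> norm e \<le> 1/4" and ab: "a < m" "b < m" and "K \<ge> 0"
  shows "norm ((X ^\<^sub>m k) $$ (a,b)) \<le> (real m * 8 ^ m * (real m * (K + 1)) ^ m) * (3/8) ^ k"
proof -
  have "length es = m"
    using degree_monic_char_poly[OF X(1)] X(2) by (simp add: degree_linear_factors)
  then have es': "norm (es ! i) \<le> 1/4" if "i < m" for i using es that by simp
  have m1: "real m \<ge> 1" using ab by auto
  then have mK: "real m * (K + 1) \<ge> 1" using \<open>K \<ge> 0\<close> mult_mono[of 1 "real m" 1 "K + 1"] by simp
  have "norm ((X ^\<^sub>m k) $$ (a,b)) \<le> (\<Sum>j<m. 8 ^ m * (real m * (K + 1)) ^ m * (3/8) ^ k)"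
    unfolding pow_mat_newton[OF X ab]
  proof (rule sum_norm_le)
    fix j assume "j \<in> {..<m}"
    then have j: "j < m" by simp
    have "norm (newton_coeff es k j * newton_mat m es X j $$ (a,b)) \<le> (8 ^ j * (3/8) ^ k) * (real m * (K + 1)) ^ j"
      unfolding norm_mult using j ab \<open>K \<ge> 0\<close> es' K
      by (intro mult_mono norm_newton_coeff_le[of m] norm_newton_mat_le[OF X(1)]) (auto intro: order_trans[OF es'])
    also have "\<dots> \<le> (8 ^ m * (3/8) ^ k) * (real m * (K + 1)) ^ m"
      using j mK by (intro mult_mono[OF mult_right_mono] power_increasing) auto
    finally show "norm (newton_coeff es k j * newton_mat m es X j $$ (a,b)) \<le> 8 ^ m * (real m * (K + 1)) ^ m * (3/8) ^ k"
      by (simp add: mult_ac)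
  qed
  then show ?thesis by (simp add: mult_ac)
qed

section \<open>Measurable eigenvalue labelings\<close>

text \<open>On a compact set a continuous function has a zero iff its modulus gets arbitrarily small
  on a countable dense subset; this replaces an uncountable existential by countable
  quantifiers.\<close>

lemma measurable_ex_zero_compact:
  fixes f :: "'x \<Rightarrow> 'b :: {first_countable_topology, second_countable_topology, metric_space} \<Rightarrow> complex"
  assumes C: "compact C" and cont: "\<And>x. continuous_on C (f x)"
    and meas: "\<And>t. t \<in> C \<Longrightarrow> (\<lambda>x. f x t) \<in> borel_measurable M"
  shows "{x \<in> space M. \<exists>t\<in>C. f x t = 0} \<in> sets M"
proof -
  obtain D where D: "countable D" "D \<subseteq> C" "C \<subseteq> closure D" using separable[of C] by blast
  have "(\<exists>t\<in>C. f x t = 0) \<longleftrightarrow> (\<forall>n::nat. \<exists>t\<in>D. norm (f x t) < 1 / real (Suc n))" for x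
  proof
    assume "\<exists>t\<in>C. f x t = 0"
    then obtain t where t: "t \<in> C" "f x t = 0" by blast
    show "\<forall>n::nat. \<exists>t\<in>D. norm (f x t) < 1 / real (Suc n)"
    proof
      fix n :: nat
      obtain \<delta> where \<delta>: "\<delta> > 0" "\<And>u. u \<in> C \<Longrightarrow> dist u t < \<delta> \<Longrightarrow> dist (f x u) (f x t) < 1 / real (Suc n)"
        using cont[of x] t(1) unfolding continuous_on_iff by (metis of_nat_0_less_iff zero_less_Suc zero_less_divide_1_iff)
      obtain u where "u \<in> D" "dist u t < \<delta>" using D(3) t(1) \<delta>(1) unfolding closure_approachable by (meson closure_approachable subsetD)
      then show "\<exists>t\<in>D. norm (f x t) < 1 / real (Suc n)" using \<delta>(2)[of u] D(2) t(2) by (auto simp: dist_norm)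
    qed
  next
    assume "\<forall>n::nat. \<exists>t\<in>D. norm (f x t) < 1 / real (Suc n)"
    then obtain u where u: "\<And>n. u n \<in> D" "\<And>n. norm (f x (u n)) < 1 / real (Suc n)" by metis
    obtain l r where l: "l \<in> C" "strict_mono r" "(u \<circ> r) \<longlonglongrightarrow> l"
      using C D(2) u(1) unfolding compact_def by (metis subsetD)
    have "(\<lambda>n. f x ((u \<circ> r) n)) \<longlonglongrightarrow> f x l"
      using continuous_on_tendsto_compose[OF cont[of x] l(3,1)] D(2) u(1) by (auto intro!: always_eventually)
    moreover have "(\<lambda>n. f x ((u \<circ> r) n)) \<longlonglongrightarrow> 0"
    proof (rule Lim_null_comparison)
      show "\<forall>\<^sub>F n in sequentially. norm (f x ((u \<circ> r) n)) \<le> 1 / real (Suc n)"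
      proof (intro always_eventually allI)
        fix n
        have "norm (f x (u (r n))) < 1 / real (Suc (r n))" by (rule u(2))
        also have "\<dots> \<le> 1 / real (Suc n)" using seq_suble[OF l(2), of n] by (intro divide_left_mono) auto
        finally show "norm (f x ((u \<circ> r) n)) \<le> 1 / real (Suc n)" by simp
      qed
      show "(\<lambda>n. 1 / real (Suc n)) \<longlonglongrightarrow> 0" using LIMSEQ_inverse_real_of_nat by (simp add: inverse_eq_divide)
    qed
    ultimately have "f x l = 0" by (rule LIMSEQ_unique)
    then show "\<exists>t\<in>C. f x t = 0" using l(1) by blast
  qed
  then have "{x \<in> space M. \<exists>t\<in>C. f x t = 0}
      = {x \<in> space M. \<forall>n::nat. \<exists>t\<in>D. norm (f x t) < 1 / real (Suc n)}" by simp
  also have "\<dots> \<in> sets M"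
    using D(1,2) meas
    by (intro sets.sets_Collect_countable_All sets.sets_Collect_countable_Ex' borel_measurable_less
        borel_measurable_norm borel_measurable_const) auto
  finally show ?thesis .
qed

definition poly_measurable :: "'x measure \<Rightarrow> ('x \<Rightarrow> complex poly) \<Rightarrow> bool" where
  "poly_measurable M p \<longleftrightarrow> (\<forall>k. (\<lambda>x. poly.coeff (p x) k) \<in> borel_measurable M)"

lemma poly_measurable_const: "poly_measurable M (\<lambda>_. c)"
  by (simp add: poly_measurable_def)

lemma poly_measurable_add: "poly_measurable M p \<Longrightarrow> poly_measurable M q \<Longrightarrow> poly_measurable M (\<lambda>x. p x + q x)"
  by (auto simp: poly_measurable_def intro!: borel_measurable_add)

lemma poly_measurable_mult: "poly_measurable M p \<Longrightarrow> poly_measurable M q \<Longrightarrow> poly_measurable M (\<lambda>x. p x * q x)"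
  by (auto simp: poly_measurable_def coeff_mult intro!: borel_measurable_sum borel_measurable_times)

lemma poly_measurable_sum:
  "(\<And>i. i \<in> I \<Longrightarrow> poly_measurable M (p i)) \<Longrightarrow> poly_measurable M (\<lambda>x. \<Sum>i\<in>I. p i x)"
  by (induction I rule: infinite_finite_induct) (auto intro: poly_measurable_const poly_measurable_add)

lemma poly_measurable_prod:
  "(\<And>i. i \<in> I \<Longrightarrow> poly_measurable M (p i)) \<Longrightarrow> poly_measurable M (\<lambda>x. \<Prod>i\<in>I. p i x)"
  by (induction I rule: infinite_finite_induct) (auto intro: poly_measurable_const poly_measurable_mult)

text \<open>The Leibniz formula exhibits the characteristic polynomial as a finite sum of products
  of polynomials with measurable coefficients.\<close>

lemma poly_measurable_char_poly:
  assumes H: "\<And>x. H x \<in> carrier_mat m m"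
    and meas: "\<And>a b. a < m \<Longrightarrow> b < m \<Longrightarrow> (\<lambda>x. H x $$ (a,b)) \<in> borel_measurable M"
  shows "poly_measurable M (\<lambda>x. char_poly (H x))"
proof -
  have c: "char_poly_matrix (H x) \<in> carrier_mat m m" for x using H by simp
  have eq: "char_poly (H x) = (\<Sum>p\<in>{p. p permutes {0..<m}}. signof p *
     (\<Prod>i = 0..<m. (if i = p i then [:0,1:] else 0) + [:- H x $$ (i, p i):]))" for x
    unfolding char_poly_def det_def'[OF c]
  proof (intro sum.cong refl arg_cong2[of _ _ _ _ times] prod.cong)
    fix p i assume p: "p \<in> {p. p permutes {0..<m}}" and i: "i \<in> {0..<m}"
    have "p i < m" using permutes_in_image[of p "{0..<m}" i] p i by auto
    then show "char_poly_matrix (H x) $$ (i, p i) = (if i = p i then [:0,1:] else 0) + [:- H x $$ (i, p i):]"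
      using i H[of x] by (auto simp: char_poly_matrix_def)
  qed
  have const: "poly_measurable M (\<lambda>x. [:- H x $$ (a,b):])" if "a < m" "b < m" for a b
    using meas[OF that] by (auto simp: poly_measurable_def coeff_pCons split: nat.split)
  show ?thesis unfolding eq
  proof (intro poly_measurable_sum poly_measurable_mult poly_measurable_prod poly_measurable_add
      poly_measurable_const const)
    fix p i assume p: "p \<in> {p. p permutes {0..<m}}" and i: "i \<in> {0..<m}"
    show "i < m" using i by simp
    show "p i < m" using permutes_in_image[of p "{0..<m}" i] p i by auto
  qed
qed

lemma borel_measurable_poly:
  assumes p: "poly_measurable M p" and deg: "\<And>x. degree (p x) \<le> m" and g: "g \<in> borel_measurable M"
  shows "(\<lambda>x. poly (p x) (g x)) \<in> borel_measurable M"
proof -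
  have "poly (p x) (g x) = (\<Sum>k\<le>m. poly.coeff (p x) k * g x ^ k)" for x
    unfolding poly_altdef using deg[of x]
    by (intro sum.mono_neutral_left) (auto simp: coeff_eq_0)
  then show ?thesis using p g
    by (auto simp: poly_measurable_def intro!: borel_measurable_sum borel_measurable_times borel_measurable_power)
qed

text \<open>The lexicographically least root depends measurably on the polynomial.\<close>

lemma measurable_root_selection:
  assumes p: "poly_measurable M p" and deg: "\<And>x. degree (p x) = m" and m: "m > 0"
  obtains r where "r \<in> borel_measurable M" "\<And>x. poly (p x) (r x) = 0"
proof -
  define Z where "Z x = {z. poly (p x) z = 0}" for x
  have ne: "p x \<noteq> 0" for x using deg[of x] m by auto
  have fin: "finite (Z x)" for x unfolding Z_def by (rule poly_roots_finite[OF ne])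
  have nempty: "Z x \<noteq> {}" for x
    using fundamental_theorem_of_algebra_alt[of "p x"] deg[of x] m unfolding Z_def
    by (auto simp: fundamental_theorem_of_algebra constant_degree)
  define \<xi> where "\<xi> x = Min (Re ` Z x)" for x
  have \<xi>in: "\<xi> x \<in> Re ` Z x" for x unfolding \<xi>_def using fin nempty by (intro Min_in) auto
  have \<xi>le: "\<xi> x \<le> a \<longleftrightarrow> (\<exists>z\<in>Z x. Re z \<le> a)" for x a
    unfolding \<xi>_def using fin nempty by (subst Min_le_iff) auto
  have \<xi>: "\<xi> \<in> borel_measurable M"
    unfolding borel_measurable_iff_le
  proof
    fix a
    \<comment> \<open>Compact rectangles exhausting the half plane Re z \<le> a, so that
      \<open>measurable_ex_zero_compact\<close> applies to each.\<close>
    define C where "C n = cbox (Complex (- real n) (- real n)) (Complex a (real n))" for n :: nat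
    have Cin: "z \<in> C n \<longleftrightarrow> - real n \<le> Re z \<and> Re z \<le> a \<and> \<bar>Im z\<bar> \<le> real n" for z n
      unfolding C_def by (auto simp: in_cbox_complex_iff abs_le_iff)
    have "(\<exists>z\<in>Z x. Re z \<le> a) \<longleftrightarrow> (\<exists>n. \<exists>z\<in>C n. poly (p x) z = 0)" for x
    proof
      assume "\<exists>z\<in>Z x. Re z \<le> a"
      then obtain z where z: "z \<in> Z x" "Re z \<le> a" by blast
      obtain n where "norm z \<le> real n" using real_arch_simple by blast
      then have "z \<in> C n" unfolding Cin using z abs_Re_le_cmod[of z] abs_Im_le_cmod[of z] by linarith
      then show "\<exists>n. \<exists>z\<in>C n. poly (p x) z = 0" using z unfolding Z_def by auto
    qed (auto simp: Z_def Cin)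
    then have "{x \<in> space M. \<xi> x \<le> a} = (\<Union>n. {x \<in> space M. \<exists>z\<in>C n. poly (p x) z = 0})"
      using \<xi>le by auto
    also have "\<dots> \<in> sets M"
    proof (intro sets.countable_UN image_subsetI measurable_ex_zero_compact)
      fix n show "compact (C n)" unfolding C_def by simp
      fix t show "(\<lambda>x. poly (p x) t) \<in> borel_measurable M"
        using borel_measurable_poly[OF p, of m "\<lambda>_. t"] deg by auto
    qed (auto intro!: continuous_intros)
    finally show "{x \<in> space M. \<xi> x \<le> a} \<in> sets M" .
  qed
  \<comment> \<open>Several roots may share the least real part; among them the least imaginary part
    is selected.\<close>
  define Y where "Y x = {y. poly (p x) (Complex (\<xi> x) y) = 0}" for x
  have Yfin: "finite (Y x)" for x
  proof (rule finite_imageD[of "Complex (\<xi> x)"])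
    show "finite (Complex (\<xi> x) ` Y x)" by (rule finite_subset[OF _ fin[of x]]) (auto simp: Y_def Z_def)
  qed (auto intro: inj_onI)
  have Yne: "Y x \<noteq> {}" for x
  proof -
    obtain z where "z \<in> Z x" "Re z = \<xi> x" using \<xi>in[of x] by auto
    then have "Im z \<in> Y x" unfolding Y_def Z_def using complex.collapse[of z] by simp
    then show ?thesis by auto
  qed
  define \<eta> where "\<eta> x = Min (Y x)" for x
  have \<eta>in: "\<eta> x \<in> Y x" for x unfolding \<eta>_def using Yfin Yne by (intro Min_in) auto
  have \<eta>: "\<eta> \<in> borel_measurable M"
    unfolding borel_measurable_iff_le
  proof
    fix b
    have "\<eta> x \<le> b \<longleftrightarrow> (\<exists>n. \<exists>y\<in>{- real n..b}. poly (p x) (Complex (\<xi> x) y) = 0)" for x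
    proof -
      have "\<eta> x \<le> b \<longleftrightarrow> (\<exists>y\<in>Y x. y \<le> b)" unfolding \<eta>_def using Yfin Yne by (subst Min_le_iff) auto
      moreover have "\<exists>n. - real n \<le> y" for y :: real using real_arch_simple[of "-y"] by (auto simp: minus_le_iff)
      ultimately show ?thesis unfolding Y_def by (metis (mono_tags, lifting) atLeastAtMost_iff mem_Collect_eq)
    qed
    then have "{x \<in> space M. \<eta> x \<le> b} = (\<Union>n. {x \<in> space M. \<exists>y\<in>{- real n..b}. poly (p x) (Complex (\<xi> x) y) = 0})"
      by auto
    also have "\<dots> \<in> sets M"
    proof (intro sets.countable_UN image_subsetI measurable_ex_zero_compact)
      fix t
      have "(\<lambda>x. Complex (\<xi> x) t) \<in> borel_measurable M"
        using \<xi> by (intro borel_measurable_complex_iff[THEN iffD2]) auto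
      then show "(\<lambda>x. poly (p x) (Complex (\<xi> x) t)) \<in> borel_measurable M"
        using deg by (intro borel_measurable_poly[OF p, of m]) auto
    next
      fix n x
      have "(\<lambda>y. Complex (\<xi> x) y) = (\<lambda>y. of_real (\<xi> x) + \<i> * of_real y)" by (auto simp: complex_eq_iff)
      then show "continuous_on {- real n..b} (\<lambda>y. poly (p x) (Complex (\<xi> x) y))"
        by (auto intro!: continuous_intros)
    qed auto
    finally show "{x \<in> space M. \<eta> x \<le> b} \<in> sets M" .
  qed
  show ?thesis
  proof (rule that[of "\<lambda>x. Complex (\<xi> x) (\<eta> x)"])
    show "(\<lambda>x. Complex (\<xi> x) (\<eta> x)) \<in> borel_measurable M"
      using \<xi> \<eta> by (intro borel_measurable_complex_iff[THEN iffD2]) auto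
    show "poly (p x) (Complex (\<xi> x) (\<eta> x)) = 0" for x using \<eta>in[of x] by (simp add: Y_def)
  qed
qed

text \<open>Peel off one measurably chosen root at a time; the quotient by the linear factor is
  again monic with measurable coefficients.\<close>

lemma measurable_factorization:
  assumes "poly_measurable M p" "\<And>x. degree (p x) = m" "\<And>x. poly.coeff (p x) m = 1"
  shows "\<exists>lam. (\<forall>j<m. lam j \<in> borel_measurable M) \<and> (\<forall>x. p x = (\<Prod>j<m. [:- lam j x, 1:]))"
  using assms
proof (induction m arbitrary: p)
  case 0
  have "p x = 1" for x using 0(2)[of x] 0(3)[of x] by (metis degree_eq_zeroE coeff_pCons_0 one_pCons)
  then show ?case by auto
next
  case (Suc m)
  obtain r where r: "r \<in> borel_measurable M" "\<And>x. poly (p x) (r x) = 0"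
    using measurable_root_selection[OF Suc.prems(1,2)] by auto
  define q where "q x = synthetic_div (p x) (r x)" for x
  have pq: "p x = [:- r x, 1:] * q x" for x
    using synthetic_div_correct'[of "r x" "p x"] r(2)[of x] unfolding q_def by simp
  have dq: "degree (q x) = m" for x unfolding q_def using Suc.prems(2)[of x] by (simp add: degree_synthetic_div)
  have cf: "poly.coeff (q x) k = poly.coeff (p x) (Suc k) + r x * poly.coeff (q x) (Suc k)" for x k
    unfolding pq[of x] by simp
  have lead: "poly.coeff (q x) m = 1" for x
    using cf[of x m] dq[of x] Suc.prems(3)[of x] by (simp add: coeff_eq_0)
  have q: "poly_measurable M q"
    unfolding poly_measurable_def
  proof
    fix k
    show "(\<lambda>x. poly.coeff (q x) k) \<in> borel_measurable M"
    proof (cases "k \<le> m")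
      case True
      then show ?thesis
      \<comment> \<open>Synthetic division determines the coefficients of the quotient downwards
        from its leading coefficient 1, each from the next higher one.\<close>
      proof (induction rule: inc_induct)
        case base then show ?case by (simp add: lead)
      next
        case (step n)
        then show ?case unfolding cf[of _ n] using r(1) Suc.prems(1)
            by (auto simp: poly_measurable_def intro!: borel_measurable_add borel_measurable_times)
      qed
    next
      case False
      then show ?thesis using dq by (simp add: coeff_eq_0)
    qed
  qed
  obtain lam where lam: "\<And>j. j < m \<Longrightarrow> lam j \<in> borel_measurable M" "\<And>x. q x = (\<Prod>j<m. [:- lam j x, 1:])"
    using Suc.IH[OF q dq lead] by blast
  define lam' where "lam' j = (if j = m then r else lam j)" for j
  have "(\<Prod>j<Suc m. [:- lam' j x, 1:]) = p x" for x
  proof -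
    have "(\<Prod>j<m. [:- lam' j x, 1:]) = (\<Prod>j<m. [:- lam j x, 1:])"
      by (intro prod.cong) (auto simp: lam'_def)
    then show ?thesis unfolding pq[of x] lam(2)[of x] prod.lessThan_Suc by (simp add: lam'_def mult.commute)
  qed
  moreover have "\<forall>j<Suc m. lam' j \<in> borel_measurable M" using lam(1) r(1) by (auto simp: lam'_def less_Suc_eq)
  ultimately show ?case by metis
qed

lemma measurable_eigenvalue_labeling:
  assumes H: "\<And>x. H x \<in> carrier_mat m m"
    and meas: "\<And>a b. a < m \<Longrightarrow> b < m \<Longrightarrow> (\<lambda>x. H x $$ (a,b)) \<in> borel_measurable M"
  obtains lam where "\<And>j. j < m \<Longrightarrow> lam j \<in> borel_measurable M"
    "\<And>x. image_mset (\<lambda>j. lam j x) (mset_set {..<m}) = eigs (H x)"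
proof -
  obtain lam where lam: "\<And>j. j < m \<Longrightarrow> lam j \<in> borel_measurable M"
    "\<And>x. char_poly (H x) = (\<Prod>j<m. [:- lam j x, 1:])"
    using measurable_factorization[OF poly_measurable_char_poly[OF H meas], of m]
      degree_monic_char_poly[OF H] by blast
  have "eigs (H x) = mset (map (\<lambda>j. lam j x) [0..<m])" for x
  proof (rule eigs_eq_mset)
    show "char_poly (H x) = (\<Prod>e\<leftarrow>map (\<lambda>j. lam j x) [0..<m]. [:- e, 1:])"
      unfolding lam(2) using prod.distinct_set_conv_list[of "[0..<m]" "\<lambda>j. [:- lam j x, 1:]"]
      by (simp add: comp_def atLeast0LessThan)
  qed
  then show ?thesis using lam(1) that[of lam] by (simp add: lessThan_atLeast0)
qed

section \<open>Averages and Fourier analysis on the torus\<close>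

abbreviation circle_measure :: "real measure" where
  "circle_measure \<equiv> restrict_space lborel {-pi..<pi}"

lemma circle_measure_simps:
  "space circle_measure = {-pi..<pi}" "emeasure circle_measure {-pi..<pi} = ennreal (2 * pi)"
  by (auto simp: space_restrict_space emeasure_restrict_space)

lemma finite_measure_circle: "finite_measure circle_measure"
  by (rule finite_measureI) (use circle_measure_simps in simp)

lemma product_sigma_finite_circle: "product_sigma_finite (\<lambda>_. circle_measure)"
proof -
  interpret finite_measure circle_measure by (rule finite_measure_circle)
  show ?thesis by standard (rule sigma_finite_measure.sigma_finite_countable[OF sigma_finite_measure_axioms])
qed

lemma space_torus: "space (torus d) = (\<Pi>\<^sub>E i\<in>{..<d}. {-pi..<pi})"
  by (simp add: torus_def space_PiM circle_measure_simps)

lemma emeasure_torus: "emeasure (torus d) (space (torus d)) = ennreal ((2 * pi) ^ d)"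
proof -
  interpret product_sigma_finite "\<lambda>_::nat. circle_measure" by (rule product_sigma_finite_circle)
  have "{-pi..<pi} \<in> sets circle_measure" using sets.top[of circle_measure] by (simp only: circle_measure_simps)
  then have "emeasure (torus d) (space (torus d)) = (\<Prod>i<d. emeasure circle_measure {-pi..<pi})"
    unfolding space_torus by (subst torus_def, intro emeasure_PiM) auto
  then show ?thesis unfolding circle_measure_simps by (simp add: ennreal_power)
qed

lemma finite_measure_torus: "finite_measure (torus d)"
  by (rule finite_measureI) (simp add: emeasure_torus)

lemma measure_torus: "measure (torus d) (space (torus d)) = (2 * pi) ^ d"
  using emeasure_torus[of d] by (simp add: measure_def)

definition av :: "nat \<Rightarrow> ((nat \<Rightarrow> real) \<Rightarrow> complex) \<Rightarrow> complex" where
  "av d f = complex_of_real (1 / (2*pi)^d) * integral\<^sup>L (torus d) f"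

definition nsq :: "nat \<Rightarrow> ((nat \<Rightarrow> real) \<Rightarrow> complex) \<Rightarrow> real" where
  "nsq d f = 1 / (2*pi)^d * integral\<^sup>L (torus d) (\<lambda>\<theta>. (norm (f \<theta>))\<^sup>2)"

definition Linf :: "nat \<Rightarrow> ((nat \<Rightarrow> real) \<Rightarrow> complex) \<Rightarrow> bool" where
  "Linf d f \<longleftrightarrow> f \<in> borel_measurable (torus d) \<and> (\<exists>B. AE \<theta> in torus d. norm (f \<theta>) \<le> B)"

lemma LinfI: "f \<in> borel_measurable (torus d) \<Longrightarrow> (\<And>\<theta>. \<theta> \<in> space (torus d) \<Longrightarrow> norm (f \<theta>) \<le> B) \<Longrightarrow> Linf d f"
  unfolding Linf_def by (auto intro!: exI[of _ B] AE_I2)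

lemma Linf_bound:
  assumes "Linf d f"
  obtains B where "B > 0" "AE \<theta> in torus d. norm (f \<theta>) \<le> B"
proof -
  obtain B where "AE \<theta> in torus d. norm (f \<theta>) \<le> B" using assms by (auto simp: Linf_def)
  then have "AE \<theta> in torus d. norm (f \<theta>) \<le> \<bar>B\<bar> + 1" by eventually_elim simp
  then show ?thesis using that[of "\<bar>B\<bar> + 1"] by auto
qed

lemma Linf_integrable:
  assumes "Linf d f" shows "integrable (torus d) f"
proof -
  interpret finite_measure "torus d" by (rule finite_measure_torus)
  show ?thesis using assms by (auto simp: Linf_def intro: integrable_const_bound)
qed

lemma Linf_const: "Linf d (\<lambda>_. c)"
  by (rule LinfI[of _ _ "norm c"]) auto

lemma Linf_add:
  assumes "Linf d f" "Linf d g" shows "Linf d (\<lambda>\<theta>. f \<theta> + g \<theta>)"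
proof -
  obtain A B where "AE \<theta> in torus d. norm (f \<theta>) \<le> A" "AE \<theta> in torus d. norm (g \<theta>) \<le> B"
    using assms by (auto simp: Linf_def)
  then have "AE \<theta> in torus d. norm (f \<theta> + g \<theta>) \<le> A + B"
    by eventually_elim (rule norm_add_rule_thm)
  then show ?thesis using assms by (auto simp: Linf_def)
qed

lemma Linf_mult:
  assumes "Linf d f" "Linf d g" shows "Linf d (\<lambda>\<theta>. f \<theta> * g \<theta>)"
proof -
  obtain A B where A: "A > 0" and "AE \<theta> in torus d. norm (f \<theta>) \<le> A" "AE \<theta> in torus d. norm (g \<theta>) \<le> B"
    using assms Linf_bound by metis
  from this(2,3) have "AE \<theta> in torus d. norm (f \<theta> * g \<theta>) \<le> A * B"
    by eventually_elim (use A in \<open>auto simp: norm_mult intro!: mult_mono\<close>)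
  then show ?thesis using assms by (auto simp: Linf_def)
qed

lemma Linf_cnj: "Linf d f \<Longrightarrow> Linf d (\<lambda>\<theta>. cnj (f \<theta>))"
  by (auto simp: Linf_def intro!: measurable_compose[OF _ borel_measurable_continuous_onI[of cnj]] continuous_intros)

lemma Linf_cmult: "Linf d f \<Longrightarrow> Linf d (\<lambda>\<theta>. c * f \<theta>)"
  by (intro Linf_mult Linf_const)

lemma Linf_diff: "Linf d f \<Longrightarrow> Linf d g \<Longrightarrow> Linf d (\<lambda>\<theta>. f \<theta> - g \<theta>)"
  using Linf_add[OF _ Linf_cmult[of d g "-1"], of f] by simp

lemma Linf_sum: "(\<And>i. i \<in> I \<Longrightarrow> Linf d (f i)) \<Longrightarrow> Linf d (\<lambda>\<theta>. \<Sum>i\<in>I. f i \<theta>)"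
  by (induction I rule: infinite_finite_induct) (auto intro: Linf_const Linf_add)

lemma av_add: "Linf d f \<Longrightarrow> Linf d g \<Longrightarrow> av d (\<lambda>\<theta>. f \<theta> + g \<theta>) = av d f + av d g"
  by (simp add: av_def Linf_integrable distrib_left)

lemma av_diff: "Linf d f \<Longrightarrow> Linf d g \<Longrightarrow> av d (\<lambda>\<theta>. f \<theta> - g \<theta>) = av d f - av d g"
  by (simp add: av_def Linf_integrable right_diff_distrib)

lemma av_cmult: "av d (\<lambda>\<theta>. c * f \<theta>) = c * av d f"
  by (simp add: av_def)

lemma av_sum: "(\<And>i. i \<in> I \<Longrightarrow> Linf d (f i)) \<Longrightarrow> av d (\<lambda>\<theta>. \<Sum>i\<in>I. f i \<theta>) = (\<Sum>i\<in>I. av d (f i))"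
  by (simp add: av_def Linf_integrable sum_distrib_left)

lemma av_cnj: "av d (\<lambda>\<theta>. cnj (f \<theta>)) = cnj (av d f)"
  by (simp add: av_def)

lemma av_const: "av d (\<lambda>_. c) = c"
  by (simp add: av_def measure_torus scaleR_conv_of_real)

lemma of_real_nsq: "of_real (nsq d f) = av d (\<lambda>\<theta>. f \<theta> * cnj (f \<theta>))"
  by (simp only: av_def nsq_def complex_norm_square[symmetric] integral_complex_of_real of_real_mult)

lemma nsq_nonneg: "nsq d f \<ge> 0"
  by (simp add: nsq_def)

lemma Linf_norm_square_integrable:
  assumes "Linf d f" shows "integrable (torus d) (\<lambda>\<theta>. (norm (f \<theta>))\<^sup>2)"
proof -
  have "(norm (f \<theta>))\<^sup>2 = Re (f \<theta> * cnj (f \<theta>))" for \<theta>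
    unfolding complex_norm_square[symmetric] by simp
  then show ?thesis
    using integrable_Re[OF Linf_integrable[OF Linf_mult[OF assms Linf_cnj[OF assms]]]] by (simp only:)
qed

lemma nsq_mono_AE:
  assumes "Linf d f" "Linf d g" "AE \<theta> in torus d. (norm (f \<theta>))\<^sup>2 \<le> c * (norm (g \<theta>))\<^sup>2"
  shows "nsq d f \<le> c * nsq d g"
proof -
  have "integral\<^sup>L (torus d) (\<lambda>\<theta>. (norm (f \<theta>))\<^sup>2) \<le> integral\<^sup>L (torus d) (\<lambda>\<theta>. c * (norm (g \<theta>))\<^sup>2)"
    using assms by (intro integral_mono_AE Linf_norm_square_integrable integrable_mult_right) auto
  then have "1 / (2*pi)^d * integral\<^sup>L (torus d) (\<lambda>\<theta>. (norm (f \<theta>))\<^sup>2)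
     \<le> 1 / (2*pi)^d * (c * integral\<^sup>L (torus d) (\<lambda>\<theta>. (norm (g \<theta>))\<^sup>2))"
    by (intro mult_left_mono) auto
  then show ?thesis by (simp add: nsq_def mult_ac)
qed

lemma nsq_const: "nsq d (\<lambda>_. c) = (norm c)\<^sup>2"
  by (simp add: nsq_def measure_torus)

lemma nsq_le_AE:
  assumes "Linf d f" "AE \<theta> in torus d. norm (f \<theta>) \<le> B" "B \<ge> 0"
  shows "nsq d f \<le> B\<^sup>2"
proof -
  have "nsq d f \<le> 1 * nsq d (\<lambda>_. of_real B)"
    using assms(2,3) by (intro nsq_mono_AE assms Linf_const) (auto intro!: power_mono elim!: eventually_mono)
  then show ?thesis using assms(3) by (simp add: nsq_const)
qed

lemma nsq_mult_le:
  assumes "Linf d f" "Linf d g" "AE \<theta> in torus d. norm (g \<theta>) \<le> B"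
  shows "nsq d (\<lambda>\<theta>. g \<theta> * f \<theta>) \<le> B\<^sup>2 * nsq d f"
proof (rule nsq_mono_AE)
  show "AE \<theta> in torus d. (norm (g \<theta> * f \<theta>))\<^sup>2 \<le> B\<^sup>2 * (norm (f \<theta>))\<^sup>2"
    using assms(3) by eventually_elim (auto simp: norm_mult power_mult_distrib intro!: mult_right_mono power_mono)
qed (use assms in \<open>auto intro: Linf_mult\<close>)

lemma norm_add_square_le: "(norm (a + b))\<^sup>2 \<le> 2 * (norm a)\<^sup>2 + 2 * (norm b)\<^sup>2" for a b :: complex
proof -
  have "(norm (a + b))\<^sup>2 \<le> (norm a + norm b)\<^sup>2" by (intro power_mono norm_triangle_ineq) auto
  also have "\<dots> \<le> 2 * (norm a)\<^sup>2 + 2 * (norm b)\<^sup>2"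
    using sum_squares_bound[of "norm a" "norm b"] by (simp add: power2_sum)
  finally show ?thesis .
qed

lemma nsq_add_le:
  assumes "Linf d f" "Linf d g"
  shows "nsq d (\<lambda>\<theta>. f \<theta> + g \<theta>) \<le> 2 * nsq d f + 2 * nsq d g"
proof -
  have "integral\<^sup>L (torus d) (\<lambda>\<theta>. (norm (f \<theta> + g \<theta>))\<^sup>2)
      \<le> integral\<^sup>L (torus d) (\<lambda>\<theta>. 2 * (norm (f \<theta>))\<^sup>2 + 2 * (norm (g \<theta>))\<^sup>2)"
    using assms by (intro integral_mono norm_add_square_le Linf_norm_square_integrable Bochner_Integration.integrable_add
        integrable_mult_right Linf_add) auto
  also have "\<dots> = 2 * integral\<^sup>L (torus d) (\<lambda>\<theta>. (norm (f \<theta>))\<^sup>2) + 2 * integral\<^sup>L (torus d) (\<lambda>\<theta>. (norm (g \<theta>))\<^sup>2)"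
    using assms by (simp add: Linf_norm_square_integrable)
  finally have "1 / (2*pi)^d * integral\<^sup>L (torus d) (\<lambda>\<theta>. (norm (f \<theta> + g \<theta>))\<^sup>2)
     \<le> 1 / (2*pi)^d * (2 * integral\<^sup>L (torus d) (\<lambda>\<theta>. (norm (f \<theta>))\<^sup>2) + 2 * integral\<^sup>L (torus d) (\<lambda>\<theta>. (norm (g \<theta>))\<^sup>2))"
    by (intro mult_left_mono) auto
  then show ?thesis unfolding nsq_def by (simp only: distrib_left mult.left_commute)
qed

text \<open>Completing the square isolates the distance of x from the Fourier coefficients c. Taking
  x = c gives Bessel's inequality, comparing x with c gives best approximation, and f = 0 gives the
  norm of a linear combination.\<close>

lemma nsq_diff_orthonormal:
  assumes P: "finite P" and u: "\<And>p. p \<in> P \<Longrightarrow> Linf d (u p)"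
    and on: "\<And>p q. p \<in> P \<Longrightarrow> q \<in> P \<Longrightarrow> av d (\<lambda>\<theta>. u p \<theta> * cnj (u q \<theta>)) = (if p = q then 1 else 0)"
    and f: "Linf d f"
  defines "c \<equiv> \<lambda>p. av d (\<lambda>\<theta>. f \<theta> * cnj (u p \<theta>))"
  shows "nsq d (\<lambda>\<theta>. f \<theta> - (\<Sum>p\<in>P. x p * u p \<theta>))
    = nsq d f - (\<Sum>p\<in>P. (norm (c p))\<^sup>2) + (\<Sum>p\<in>P. (norm (x p - c p))\<^sup>2)"
proof -
  define s where "s \<theta> = (\<Sum>p\<in>P. x p * u p \<theta>)" for \<theta>
  have s: "Linf d s" unfolding s_def by (intro Linf_sum Linf_cmult u)
  note L = Linf_mult Linf_cnj f s u Linf_cmult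
  have fs: "av d (\<lambda>\<theta>. f \<theta> * cnj (s \<theta>)) = (\<Sum>p\<in>P. cnj (x p) * c p)"
  proof -
    have "(\<lambda>\<theta>. f \<theta> * cnj (s \<theta>)) = (\<lambda>\<theta>. \<Sum>p\<in>P. cnj (x p) * (f \<theta> * cnj (u p \<theta>)))"
      by (simp add: s_def cnj_sum sum_distrib_left mult_ac)
    then show ?thesis unfolding c_def by (simp add: av_sum av_cmult L)
  qed
  have sf: "av d (\<lambda>\<theta>. s \<theta> * cnj (f \<theta>)) = (\<Sum>p\<in>P. x p * cnj (c p))"
    using av_cnj[of d "\<lambda>\<theta>. f \<theta> * cnj (s \<theta>)"] unfolding fs by (simp add: mult.commute cnj_sum)
  have ss: "av d (\<lambda>\<theta>. s \<theta> * cnj (s \<theta>)) = (\<Sum>p\<in>P. x p * cnj (x p))"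
  proof -
    have "(\<lambda>\<theta>. s \<theta> * cnj (s \<theta>)) = (\<lambda>\<theta>. \<Sum>p\<in>P. \<Sum>q\<in>P. (x p * cnj (x q)) * (u p \<theta> * cnj (u q \<theta>)))"
      by (simp add: s_def cnj_sum sum_product mult_ac)
    then have "av d (\<lambda>\<theta>. s \<theta> * cnj (s \<theta>)) = (\<Sum>p\<in>P. \<Sum>q\<in>P. (x p * cnj (x q)) * av d (\<lambda>\<theta>. u p \<theta> * cnj (u q \<theta>)))"
      by (simp add: av_sum av_cmult L Linf_sum)
    also have "\<dots> = (\<Sum>p\<in>P. \<Sum>q\<in>P. if p = q then x p * cnj (x q) else 0)"
      by (intro sum.cong refl) (auto simp: on)
    finally show ?thesis using P by simp
  qed
  have "of_real (nsq d (\<lambda>\<theta>. f \<theta> - s \<theta>))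
      = av d (\<lambda>\<theta>. (f \<theta> * cnj (f \<theta>) - f \<theta> * cnj (s \<theta>)) - (s \<theta> * cnj (f \<theta>) - s \<theta> * cnj (s \<theta>)))"
    unfolding of_real_nsq by (simp add: algebra_simps)
  also have "\<dots> = of_real (nsq d f) - (\<Sum>p\<in>P. cnj (x p) * c p) - ((\<Sum>p\<in>P. x p * cnj (c p)) - (\<Sum>p\<in>P. x p * cnj (x p)))"
    by (simp add: av_diff L Linf_diff fs sf ss of_real_nsq)
  also have "\<dots> = of_real (nsq d f) - (\<Sum>p\<in>P. c p * cnj (c p)) + (\<Sum>p\<in>P. (x p - c p) * cnj (x p - c p))"
    by (simp add: algebra_simps sum.distrib sum_subtractf)
  also have "\<dots> = of_real (nsq d f - (\<Sum>p\<in>P. (norm (c p))\<^sup>2) + (\<Sum>p\<in>P. (norm (x p - c p))\<^sup>2))"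
    by (simp add: complex_norm_square del: of_real_power)
  finally show ?thesis unfolding s_def of_real_eq_iff .
qed

lemma Bessel_inequality:
  assumes "finite P" "\<And>p. p \<in> P \<Longrightarrow> Linf d (u p)"
    and "\<And>p q. p \<in> P \<Longrightarrow> q \<in> P \<Longrightarrow> av d (\<lambda>\<theta>. u p \<theta> * cnj (u q \<theta>)) = (if p = q then 1 else 0)"
    and "Linf d f"
  shows "(\<Sum>p\<in>P. (norm (av d (\<lambda>\<theta>. f \<theta> * cnj (u p \<theta>))))\<^sup>2) \<le> nsq d f"
  using nsq_diff_orthonormal[OF assms, of "\<lambda>p. av d (\<lambda>\<theta>. f \<theta> * cnj (u p \<theta>))"]
    nsq_nonneg[of d "\<lambda>\<theta>. f \<theta> - (\<Sum>p\<in>P. av d (\<lambda>\<theta>. f \<theta> * cnj (u p \<theta>)) * u p \<theta>)"] by simp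

section \<open>Characters of the torus and density of trigonometric polynomials\<close>

definition ech :: "nat \<Rightarrow> (nat \<Rightarrow> int) \<Rightarrow> (nat \<Rightarrow> real) \<Rightarrow> complex" where
  "ech d k \<theta> = exp (\<i> * complex_of_real (ipS {..<d} k \<theta>))"

lemma ech_add: "ech d (\<lambda>j. k j + l j) \<theta> = ech d k \<theta> * ech d l \<theta>"
  by (simp add: ech_def ipS_def distrib_right sum.distrib distrib_left exp_add)

lemma cnj_ech: "cnj (ech d k \<theta>) = ech d (\<lambda>j. - k j) \<theta>"
  by (simp add: ech_def ipS_def exp_cnj sum_negf)

lemma norm_ech[simp]: "norm (ech d k \<theta>) = 1"
  by (simp add: ech_def norm_exp_i_times)

lemma ech_cong: "(\<And>j. j < d \<Longrightarrow> k j = l j) \<Longrightarrow> ech d k \<theta> = ech d l \<theta>"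
  by (simp add: ech_def ipS_def)

lemma measurable_torus_component: "j < d \<Longrightarrow> (\<lambda>\<theta>. \<theta> j) \<in> borel_measurable (torus d)"
proof -
  assume j: "j < d"
  have "(\<lambda>\<theta>. \<theta> j) \<in> measurable (torus d) circle_measure"
    unfolding torus_def using j by (intro measurable_component_singleton) auto
  moreover have "(\<lambda>x. x) \<in> borel_measurable circle_measure" by (rule measurable_restrict_space1) simp
  ultimately show ?thesis using measurable_compose by blast
qed

lemma measurable_ech: "ech d k \<in> borel_measurable (torus d)"
proof -
  have "(\<lambda>\<theta>. ipS {..<d} k \<theta>) \<in> borel_measurable (torus d)"
    unfolding ipS_def by (intro borel_measurable_sum borel_measurable_times borel_measurable_const measurable_torus_component) auto
  moreover have "(\<lambda>x. exp (\<i> * complex_of_real x)) \<in> borel_measurable borel"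
    by (intro borel_measurable_continuous_onI continuous_intros)
  ultimately show ?thesis unfolding ech_def by (rule measurable_compose)
qed

lemma Linf_ech: "Linf d (ech d k)"
  using measurable_ech by (rule LinfI[of _ _ 1]) auto

lemma integral_circle_character:
  "integrable circle_measure (\<lambda>x. exp (\<i> * of_real (real_of_int k * x)))"
  "(\<integral>x. exp (\<i> * of_real (real_of_int k * x)) \<partial>circle_measure) = (if k = 0 then 2 * of_real pi else 0)"
proof -
  let ?f = "\<lambda>x. exp (\<i> * of_real (real_of_int k * x)) :: complex"
  interpret finite_measure circle_measure by (rule finite_measure_circle)
  have "?f \<in> borel_measurable borel"
    by (intro borel_measurable_continuous_onI continuous_intros)
  then show "integrable circle_measure ?f"
    by (intro integrable_const_bound[of _ 1] measurable_restrict_space1) (auto simp: norm_exp_i_times)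
  have "(\<integral>x. ?f x \<partial>circle_measure) = (\<integral>x. indicator {-pi..<pi} x *\<^sub>R ?f x \<partial>lborel)"
    by (rule integral_restrict_space) simp
  \<comment> \<open>Closing the interval changes only a null set and makes the fundamental theorem
    of calculus applicable.\<close>
  also have "\<dots> = (\<integral>x. indicator {-pi..pi} x *\<^sub>R ?f x \<partial>lborel)"
  proof (rule integral_cong_AE)
    have "AE x in lborel. x \<noteq> pi" by (rule AE_lborel_singleton)
    then show "AE x in lborel. indicator {-pi..<pi} x *\<^sub>R ?f x = indicator {-pi..pi} x *\<^sub>R ?f x"
      by eventually_elim (auto simp: indicator_def)
  qed (use \<open>?f \<in> _\<close> in \<open>auto intro!: borel_measurable_scaleR borel_measurable_indicator\<close>)
  also have "\<dots> = (if k = 0 then 2 * of_real pi else 0)"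
  proof (cases "k = 0")
    case True
    then show ?thesis by (simp add: scaleR_conv_of_real)
  next
    case False
    define c where "c = \<i> * complex_of_int k"
    have c0: "c \<noteq> 0" using False by (simp add: c_def)
    have fc: "?f x = exp (c * of_real x)" for x by (simp add: c_def mult_ac)
    define F where "F x = exp (c * of_real x) / c" for x :: real
    have d: "(F has_vector_derivative ?f x) (at x within {-pi..pi})" for x
      unfolding F_def fc
      by (rule has_vector_derivative_real_field) (auto intro!: derivative_eq_intros simp: c0)
    have cont: "continuous_on {-pi..pi} ?f" by (intro continuous_intros)
    have "(\<integral>x. indicator {-pi..pi} x *\<^sub>R ?f x \<partial>lborel) = F pi - F (-pi)"
      by (rule integral_FTC_Icc[OF _ d cont]) simp
    also have "F pi - F (-pi) = 0"
    proof -
      have "?f pi = ?f (-pi)"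
      proof -
        have "?f x = cis (real_of_int k * x)" for x by (simp add: cis_conv_exp)
        moreover have "cis (real_of_int k * pi) = cis (real_of_int k * (-pi))"
          using sin_npi_int[of k] by (simp add: complex_eq_iff mult.commute)
        ultimately show ?thesis by (simp only:)
      qed
      then have "F pi = F (-pi)" unfolding fc F_def by (rule arg_cong)
      then show ?thesis by (simp only: diff_self)
    qed
    finally show ?thesis using False by simp
  qed
  finally show "(\<integral>x. ?f x \<partial>circle_measure) = (if k = 0 then 2 * of_real pi else 0)" .
qed

lemma av_ech: "av d (ech d k) = (if \<forall>j<d. k j = 0 then 1 else 0)"
proof -
  interpret product_sigma_finite "\<lambda>_::nat. circle_measure" by (rule product_sigma_finite_circle)
  have "integral\<^sup>L (torus d) (ech d k) = (\<integral>\<theta>. (\<Prod>j<d. exp (\<i> * of_real (real_of_int (k j) * \<theta> j))) \<partial>torus d)"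
    unfolding ech_def ipS_def by (simp only: of_real_sum sum_distrib_left exp_sum[OF finite_lessThan])
  also have "\<dots> = (\<Prod>j<d. \<integral>x. exp (\<i> * of_real (real_of_int (k j) * x)) \<partial>circle_measure)"
    unfolding torus_def by (rule product_integral_prod) (use integral_circle_character(1) in auto)
  also have "\<dots> = (\<Prod>j<d. if k j = 0 then 2 * of_real pi else 0)" by (simp only: integral_circle_character(2))
  also have "\<dots> = (if \<forall>j<d. k j = 0 then (2 * of_real pi) ^ d else 0)"
    by (auto intro!: prod_zero)
  finally show ?thesis by (simp add: av_def)
qed

inductive_set trig :: "nat \<Rightarrow> ((nat \<Rightarrow> real) \<Rightarrow> complex) set" for d where
  ech: "(\<lambda>\<theta>. c * ech d k \<theta>) \<in> trig d"
| add: "s \<in> trig d \<Longrightarrow> t \<in> trig d \<Longrightarrow> (\<lambda>\<theta>. s \<theta> + t \<theta>) \<in> trig d"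

lemma ech_zero: "ech d (\<lambda>_. 0) \<theta> = 1"
  by (simp add: ech_def ipS_def)

lemma trig_const: "(\<lambda>_. c) \<in> trig d"
  using trig.ech[of c d "\<lambda>_. 0"] by (simp add: ech_zero)

lemma trig_mult:
  assumes "s \<in> trig d" "t \<in> trig d" shows "(\<lambda>\<theta>. s \<theta> * t \<theta>) \<in> trig d"
  using assms
proof (induction rule: trig.induct)
  case (ech c k)
  show ?case using ech
  proof (induction rule: trig.induct)
    case (ech c' k')
    have "(\<lambda>\<theta>. c * ech d k \<theta> * (c' * ech d k' \<theta>)) = (\<lambda>\<theta>. (c * c') * ech d (\<lambda>j. k j + k' j) \<theta>)"
      by (simp add: ech_add mult_ac)
    then show ?case using trig.ech by simp
  next
    case (add s t)
    then show ?case using trig.add by (simp add: distrib_left)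
  qed
next
  case (add s1 s2)
  then show ?case using trig.add by (simp add: distrib_right)
qed

lemma trig_bounded: "t \<in> trig d \<Longrightarrow> \<exists>B>0. \<forall>\<theta>. norm (t \<theta>) \<le> B"
proof (induction rule: trig.induct)
  case (ech c k)
  then show ?case by (intro exI[of _ "norm c + 1"]) (auto simp: norm_mult intro: add_nonneg_pos)
next
  case (add s t)
  then obtain A B where "A > 0" "B > 0" "\<forall>\<theta>. norm (s \<theta>) \<le> A" "\<forall>\<theta>. norm (t \<theta>) \<le> B" by blast
  then show ?case by (intro exI[of _ "A + B"]) (auto intro: norm_add_rule_thm)
qed

lemma Linf_trig: "t \<in> trig d \<Longrightarrow> Linf d t"
  by (induction rule: trig.induct) (auto intro: Linf_cmult Linf_ech Linf_add)

text \<open>Approximation in L^2, but of bounded functions only: boundedness is what makes the class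
  closed under products.\<close>

definition trig_approx :: "nat \<Rightarrow> ((nat \<Rightarrow> real) \<Rightarrow> complex) \<Rightarrow> bool" where
  "trig_approx d f \<longleftrightarrow> Linf d f \<and> (\<forall>e>0. \<exists>t\<in>trig d. nsq d (\<lambda>\<theta>. f \<theta> - t \<theta>) < e)"

lemma trig_approx_trig: "t \<in> trig d \<Longrightarrow> trig_approx d t"
  unfolding trig_approx_def using nsq_const[of d 0] by (auto intro: Linf_trig intro!: bexI[of _ t])

lemma trig_approx_limit:
  assumes f: "Linf d f" and ex: "\<And>e. e > 0 \<Longrightarrow> \<exists>g. trig_approx d g \<and> nsq d (\<lambda>\<theta>. f \<theta> - g \<theta>) < e"
  shows "trig_approx d f"
  unfolding trig_approx_def
proof (intro conjI allI impI f)
  fix e :: real assume e: "e > 0"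
  obtain g where g: "trig_approx d g" "nsq d (\<lambda>\<theta>. f \<theta> - g \<theta>) < e/4" using ex[of "e/4"] e by auto
  have "e/4 > 0" using e by simp
  then obtain t where t: "t \<in> trig d" "nsq d (\<lambda>\<theta>. g \<theta> - t \<theta>) < e/4" using g(1) unfolding trig_approx_def by blast
  have "nsq d (\<lambda>\<theta>. (f \<theta> - g \<theta>) + (g \<theta> - t \<theta>)) \<le> 2 * nsq d (\<lambda>\<theta>. f \<theta> - g \<theta>) + 2 * nsq d (\<lambda>\<theta>. g \<theta> - t \<theta>)"
    using g(1) by (intro nsq_add_le Linf_diff f Linf_trig[OF t(1)]) (auto simp: trig_approx_def)
  then show "\<exists>t\<in>trig d. nsq d (\<lambda>\<theta>. f \<theta> - t \<theta>) < e" using g(2) t by (intro bexI[of _ t]) auto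
qed

lemma trig_approx_add:
  assumes "trig_approx d f" "trig_approx d g"
  shows "trig_approx d (\<lambda>\<theta>. f \<theta> + g \<theta>)"
  unfolding trig_approx_def
proof (intro conjI allI impI)
  show "Linf d (\<lambda>\<theta>. f \<theta> + g \<theta>)" using assms by (auto simp: trig_approx_def intro: Linf_add)
  fix e :: real assume "e > 0"
  then have "e/4 > 0" by simp
  then obtain s t where st: "s \<in> trig d" "t \<in> trig d" "nsq d (\<lambda>\<theta>. f \<theta> - s \<theta>) < e/4" "nsq d (\<lambda>\<theta>. g \<theta> - t \<theta>) < e/4"
    using assms unfolding trig_approx_def by blast
  have "nsq d (\<lambda>\<theta>. (f \<theta> - s \<theta>) + (g \<theta> - t \<theta>)) \<le> 2 * nsq d (\<lambda>\<theta>. f \<theta> - s \<theta>) + 2 * nsq d (\<lambda>\<theta>. g \<theta> - t \<theta>)"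
    using assms by (intro nsq_add_le Linf_diff Linf_trig[OF st(1)] Linf_trig[OF st(2)]) (auto simp: trig_approx_def)
  then have "nsq d (\<lambda>\<theta>. f \<theta> + g \<theta> - (s \<theta> + t \<theta>)) < e" using st by (simp add: algebra_simps)
  then show "\<exists>t\<in>trig d. nsq d (\<lambda>\<theta>. f \<theta> + g \<theta> - t \<theta>) < e" using trig.add[OF st(1,2)] by (intro bexI)
qed

text \<open>First f is replaced by a trigonometric polynomial s, at the cost of the bound for g;
  only then g is replaced, at the cost of the bound for s. The order matters because the bound for s
  is known only once s is chosen.\<close>

lemma trig_approx_mult:
  assumes "trig_approx d f" "trig_approx d g"
  shows "trig_approx d (\<lambda>\<theta>. f \<theta> * g \<theta>)"
proof (rule trig_approx_limit)
  have Lf: "Linf d f" and Lg: "Linf d g" using assms by (auto simp: trig_approx_def)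
  show "Linf d (\<lambda>\<theta>. f \<theta> * g \<theta>)" by (intro Linf_mult Lf Lg)
  fix e :: real assume e: "e > 0"
  obtain B where B: "B > 0" "AE \<theta> in torus d. norm (g \<theta>) \<le> B" using Linf_bound[OF Lg] by blast
  have "e / B\<^sup>2 > 0" using e B by simp
  then obtain s where s: "s \<in> trig d" "nsq d (\<lambda>\<theta>. f \<theta> - s \<theta>) < e / B\<^sup>2" using assms(1) unfolding trig_approx_def by blast
  obtain C where C: "C > 0" "\<And>\<theta>. norm (s \<theta>) \<le> C" using trig_bounded[OF s(1)] by blast
  have Ls: "Linf d s" using s(1) by (rule Linf_trig)
  have "trig_approx d (\<lambda>\<theta>. s \<theta> * g \<theta>)"
    unfolding trig_approx_def
  proof (intro conjI allI impI)
    show "Linf d (\<lambda>\<theta>. s \<theta> * g \<theta>)" by (intro Linf_mult Ls Lg)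
    fix e' :: real assume "e' > 0"
    then have "e' / C\<^sup>2 > 0" using C by simp
    then obtain t where t: "t \<in> trig d" "nsq d (\<lambda>\<theta>. g \<theta> - t \<theta>) < e' / C\<^sup>2" using assms(2) unfolding trig_approx_def by blast
    have "nsq d (\<lambda>\<theta>. s \<theta> * (g \<theta> - t \<theta>)) \<le> C\<^sup>2 * nsq d (\<lambda>\<theta>. g \<theta> - t \<theta>)"
      using C by (intro nsq_mult_le Linf_diff Ls Lg Linf_trig t) auto
    also have "\<dots> < e'" using t(2) C by (simp add: field_simps)
    finally have "nsq d (\<lambda>\<theta>. s \<theta> * g \<theta> - s \<theta> * t \<theta>) < e'" by (simp add: right_diff_distrib)
    then show "\<exists>t\<in>trig d. nsq d (\<lambda>\<theta>. s \<theta> * g \<theta> - t \<theta>) < e'" using trig_mult[OF s(1) t(1)] by (intro bexI)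
  qed
  moreover have "nsq d (\<lambda>\<theta>. f \<theta> * g \<theta> - s \<theta> * g \<theta>) < e"
  proof -
    have "nsq d (\<lambda>\<theta>. g \<theta> * (f \<theta> - s \<theta>)) \<le> B\<^sup>2 * nsq d (\<lambda>\<theta>. f \<theta> - s \<theta>)"
      by (intro nsq_mult_le Linf_diff Ls Lg Lf B)
    also have "\<dots> < e" using s(2) B by (simp add: field_simps)
    finally show ?thesis by (simp add: algebra_simps)
  qed
  ultimately show "\<exists>h. trig_approx d h \<and> nsq d (\<lambda>\<theta>. f \<theta> * g \<theta> - h \<theta>) < e" by blast
qed

lemma trig_approx_const: "trig_approx d (\<lambda>_. c)"
  by (intro trig_approx_trig trig_const)

lemma trig_approx_cmult: "trig_approx d f \<Longrightarrow> trig_approx d (\<lambda>\<theta>. c * f \<theta>)"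
  by (intro trig_approx_mult trig_approx_const)

lemma trig_approx_diff: "trig_approx d f \<Longrightarrow> trig_approx d g \<Longrightarrow> trig_approx d (\<lambda>\<theta>. f \<theta> - g \<theta>)"
  using trig_approx_add[OF _ trig_approx_cmult[of d g "-1"], of f] by simp

lemma trig_approx_sum: "(\<And>i. i \<in> I \<Longrightarrow> trig_approx d (f i)) \<Longrightarrow> trig_approx d (\<lambda>\<theta>. \<Sum>i\<in>I. f i \<theta>)"
  by (induction I rule: infinite_finite_induct) (auto intro: trig_approx_const trig_approx_add)

lemma nsq_cong: "(\<And>\<theta>. \<theta> \<in> space (torus d) \<Longrightarrow> norm (f \<theta>) = norm (g \<theta>)) \<Longrightarrow> nsq d f = nsq d g"
  unfolding nsq_def by (simp cong: Bochner_Integration.integral_cong)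

lemma trig_approx_cong:
  assumes "trig_approx d f" "\<And>\<theta>. \<theta> \<in> space (torus d) \<Longrightarrow> f \<theta> = g \<theta>"
  shows "trig_approx d g"
proof (rule trig_approx_limit)
  have "g \<in> borel_measurable (torus d)"
    using assms measurable_cong[of "torus d" f g] by (auto simp: trig_approx_def Linf_def)
  moreover obtain B where "AE \<theta> in torus d. norm (f \<theta>) \<le> B" using assms(1) by (auto simp: trig_approx_def Linf_def)
  then have "AE \<theta> in torus d. norm (g \<theta>) \<le> B" using AE_space by eventually_elim (simp add: assms(2)[symmetric])
  ultimately show "Linf d g" by (auto simp: Linf_def)
  fix e :: real assume "e > 0"
  moreover have "nsq d (\<lambda>\<theta>. g \<theta> - f \<theta>) = nsq d (\<lambda>_. 0)" by (rule nsq_cong) (simp add: assms(2))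
  ultimately show "\<exists>h. trig_approx d h \<and> nsq d (\<lambda>\<theta>. g \<theta> - h \<theta>) < e" using assms(1) by (auto simp: nsq_const)
qed

lemma trig_approx_uniform_limit:
  assumes f: "f \<in> borel_measurable (torus d)"
    and ex: "\<And>e. e > 0 \<Longrightarrow> \<exists>g. trig_approx d g \<and> (AE \<theta> in torus d. norm (f \<theta> - g \<theta>) \<le> e)"
  shows "trig_approx d f"
proof -
  have Lf: "Linf d f"
  proof -
    obtain g where g: "trig_approx d g" "AE \<theta> in torus d. norm (f \<theta> - g \<theta>) \<le> 1" using ex[of 1] by auto
    obtain B where "AE \<theta> in torus d. norm (g \<theta>) \<le> B" using g(1) by (auto simp: trig_approx_def Linf_def)
    with g(2) have "AE \<theta> in torus d. norm (f \<theta>) \<le> 1 + B"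
      by eventually_elim (use norm_triangle_ineq in \<open>smt (verit) diff_add_cancel\<close>)
    then show ?thesis using f by (auto simp: Linf_def)
  qed
  show ?thesis
  proof (rule trig_approx_limit[OF Lf])
    fix e :: real assume e: "e > 0"
    then have "sqrt (e/2) > 0" by simp
    then obtain g where g: "trig_approx d g" "AE \<theta> in torus d. norm (f \<theta> - g \<theta>) \<le> sqrt (e/2)" using ex by blast
    have "nsq d (\<lambda>\<theta>. f \<theta> - g \<theta>) \<le> (sqrt (e/2))\<^sup>2"
      using g e Lf by (intro nsq_le_AE Linf_diff) (auto simp: trig_approx_def)
    then show "\<exists>g. trig_approx d g \<and> nsq d (\<lambda>\<theta>. f \<theta> - g \<theta>) < e" using g(1) e by (intro exI[of _ g]) auto
  qed
qed

lemma trig_approx_dominated_limit: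
  assumes f: "f \<in> borel_measurable (torus d)" and g: "\<And>n. trig_approx d (g n)"
    and bound: "\<And>n \<theta>. \<theta> \<in> space (torus d) \<Longrightarrow> norm (g n \<theta>) \<le> B"
    and lim: "\<And>\<theta>. \<theta> \<in> space (torus d) \<Longrightarrow> (\<lambda>n. g n \<theta>) \<longlonglongrightarrow> f \<theta>"
  shows "trig_approx d f"
proof -
  have bf: "norm (f \<theta>) \<le> B" if "\<theta> \<in> space (torus d)" for \<theta>
    using Lim_bounded[OF tendsto_norm[OF lim[OF that]]] bound[OF that] by auto
  then have Lf: "Linf d f" using f by (intro LinfI)
  have mg: "g n \<in> borel_measurable (torus d)" for n using g by (auto simp: trig_approx_def Linf_def)
  interpret finite_measure "torus d" by (rule finite_measure_torus)
  have "(\<lambda>n. integral\<^sup>L (torus d) (\<lambda>\<theta>. (norm (f \<theta> - g n \<theta>))\<^sup>2)) \<longlonglongrightarrow> integral\<^sup>L (torus d) (\<lambda>\<theta>. 0)"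
  proof (rule integral_dominated_convergence[where w = "\<lambda>_. (2 * B)\<^sup>2"])
    show "AE \<theta> in torus d. (\<lambda>n. (norm (f \<theta> - g n \<theta>))\<^sup>2) \<longlonglongrightarrow> 0"
    proof (rule AE_I2)
      fix \<theta> assume "\<theta> \<in> space (torus d)"
      from tendsto_power[OF tendsto_norm[OF tendsto_diff[OF tendsto_const[of "f \<theta>"] lim[OF this]]], of 2]
      show "(\<lambda>n. (norm (f \<theta> - g n \<theta>))\<^sup>2) \<longlonglongrightarrow> 0" by simp
    qed
    show "AE \<theta> in torus d. norm ((norm (f \<theta> - g n \<theta>))\<^sup>2) \<le> (2 * B)\<^sup>2" for n
    proof (rule AE_I2)
      fix \<theta> assume \<theta>: "\<theta> \<in> space (torus d)"
      have "norm (f \<theta> - g n \<theta>) \<le> 2 * B"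
        using norm_triangle_ineq4[of "f \<theta>" "g n \<theta>"] bf[OF \<theta>] bound[OF \<theta>, of n] by simp
      then have "(norm (f \<theta> - g n \<theta>))\<^sup>2 \<le> (2 * B)\<^sup>2" by (intro power_mono) auto
      then show "norm ((norm (f \<theta> - g n \<theta>))\<^sup>2) \<le> (2 * B)\<^sup>2" by (simp only: real_norm_def abs_power2)
    qed
    show "(\<lambda>\<theta>. (norm (f \<theta> - g n \<theta>))\<^sup>2) \<in> borel_measurable (torus d)" for n
      by (intro borel_measurable_power measurable_compose[OF borel_measurable_diff[OF f mg] borel_measurable_norm])
  qed auto
  then have "(\<lambda>n. 1 / (2*pi)^d * integral\<^sup>L (torus d) (\<lambda>\<theta>. (norm (f \<theta> - g n \<theta>))\<^sup>2)) \<longlonglongrightarrow> 1 / (2*pi)^d * 0"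
    by (intro tendsto_mult_left) simp
  then have lim0: "(\<lambda>n. nsq d (\<lambda>\<theta>. f \<theta> - g n \<theta>)) \<longlonglongrightarrow> 0" by (simp add: nsq_def)
  show ?thesis
  proof (rule trig_approx_limit[OF Lf])
    fix e :: real assume "e > 0"
    then have "\<forall>\<^sub>F n in sequentially. nsq d (\<lambda>\<theta>. f \<theta> - g n \<theta>) < e" using lim0 by (rule order_tendstoD(2)[rotated])
    then obtain n where "nsq d (\<lambda>\<theta>. f \<theta> - g n \<theta>) < e" unfolding eventually_sequentially by blast
    then show "\<exists>g. trig_approx d g \<and> nsq d (\<lambda>\<theta>. f \<theta> - g \<theta>) < e" using g by blast
  qed
qed

text \<open>Weierstrass approximation of h on [-1, 1]; polynomials in g are approximable because the
  approximable functions form an algebra.\<close>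

lemma trig_approx_continuous_compose:
  fixes g :: "(nat \<Rightarrow> real) \<Rightarrow> real" and h :: "real \<Rightarrow> real"
  assumes g: "trig_approx d (\<lambda>\<theta>. of_real (g \<theta>))" and gm: "g \<in> borel_measurable (torus d)"
    and range: "\<And>\<theta>. \<bar>g \<theta>\<bar> \<le> 1" and h: "continuous_on UNIV h"
  shows "trig_approx d (\<lambda>\<theta>. of_real (h (g \<theta>)))"
proof (rule trig_approx_uniform_limit)
  have "h \<in> borel_measurable borel" using h by (rule borel_measurable_continuous_onI)
  from measurable_compose[OF gm this]
  show "(\<lambda>\<theta>. complex_of_real (h (g \<theta>))) \<in> borel_measurable (torus d)" by simp
  fix e :: real assume e: "e > 0"
  obtain p where p: "real_polynomial_function p" "\<And>x. x \<in> {-1..1} \<Longrightarrow> \<bar>h x - p x\<bar> < e"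
    using Stone_Weierstrass_real_polynomial_function[of "{-1..1}" h e] continuous_on_subset[OF h] e by auto
  have "trig_approx d (\<lambda>\<theta>. of_real (p (g \<theta>)))" using p(1)
  proof (induction rule: real_polynomial_function.induct)
    case (linear f)
    then obtain c where "f = (\<lambda>x. x * c)" by (auto simp: real_bounded_linear)
    then show ?case using trig_approx_cmult[OF g, of "of_real c"] by (simp add: mult.commute)
  next
    case (const c)
    then show ?case by (rule trig_approx_const)
  next
    case (add f g)
    then show ?case using trig_approx_add by simp
  next
    case (mult f g)
    then show ?case using trig_approx_mult by simp
  qed
  moreover have "AE \<theta> in torus d. norm (complex_of_real (h (g \<theta>)) - of_real (p (g \<theta>))) \<le> e"
  proof (rule AE_I2)
    fix \<theta>
    have "g \<theta> \<in> {-1..1}" using range[of \<theta>] by (auto simp: abs_le_iff)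
    from p(2)[OF this] show "norm (complex_of_real (h (g \<theta>)) - of_real (p (g \<theta>))) \<le> e"
      by (simp flip: of_real_diff)
  qed
  ultimately show "\<exists>k. trig_approx d k \<and> (AE \<theta> in torus d. norm (complex_of_real (h (g \<theta>)) - k \<theta>) \<le> e)" by blast
qed

text \<open>The indicator of a strict superlevel set is the pointwise limit of continuous ramps in g
  with values in [0, 1].\<close>

lemma trig_approx_superlevel:
  fixes g :: "(nat \<Rightarrow> real) \<Rightarrow> real"
  assumes g: "trig_approx d (\<lambda>\<theta>. of_real (g \<theta>))" and gm: "g \<in> borel_measurable (torus d)"
    and range: "\<And>\<theta>. \<bar>g \<theta>\<bar> \<le> 1"
  shows "trig_approx d (indicator {\<theta> \<in> space (torus d). g \<theta> > c})"
proof (rule trig_approx_dominated_limit[where B = 1])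
  define h where "h n x = min 1 (max 0 (real n * (x - c)))" for n :: nat and x :: real
  show "trig_approx d (\<lambda>\<theta>. of_real (h n (g \<theta>)))" for n
    unfolding h_def by (intro trig_approx_continuous_compose[OF g gm range] continuous_intros)
  show "norm (complex_of_real (h n (g \<theta>))) \<le> 1" for n \<theta> by (simp add: h_def)
  have "{\<theta> \<in> space (torus d). g \<theta> > c} \<in> sets (torus d)"
    using gm by (simp add: borel_measurable_iff_greater)
  then show "(indicator {\<theta> \<in> space (torus d). g \<theta> > c} :: _ \<Rightarrow> complex) \<in> borel_measurable (torus d)" by simp
  fix \<theta> assume \<theta>: "\<theta> \<in> space (torus d)"
  show "(\<lambda>n. complex_of_real (h n (g \<theta>))) \<longlonglongrightarrow> indicator {\<theta> \<in> space (torus d). g \<theta> > c} \<theta>"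
  proof (cases "g \<theta> > c")
    case True
    obtain N :: nat where N: "1 / (g \<theta> - c) < real N" using reals_Archimedean2 by blast
    have "complex_of_real (h n (g \<theta>)) = 1" if "n \<ge> N" for n
    proof -
      have "1 < real N * (g \<theta> - c)" using N True by (simp add: field_simps)
      also have "\<dots> \<le> real n * (g \<theta> - c)" using that True by (intro mult_right_mono) auto
      finally show ?thesis by (simp add: h_def)
    qed
    then have "(\<lambda>n. complex_of_real (h n (g \<theta>))) \<longlonglongrightarrow> 1"
      by (intro tendsto_eventually) (auto simp: eventually_sequentially)
    then show ?thesis using True \<theta> by simp
  next
    case False
    then have "real n * (g \<theta> - c) \<le> 0" for n by (intro mult_nonneg_nonpos) auto
    then have "h n (g \<theta>) = 0" for n by (simp add: h_def max_absorb1)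
    then show ?thesis using False by simp
  qed
qed

lemma trig_approx_cos_sin:
  assumes "j < d"
  shows "trig_approx d (\<lambda>\<theta>. of_real (cos (\<theta> j)))" "trig_approx d (\<lambda>\<theta>. of_real (sin (\<theta> j)))"
proof -
  define k where "k i = (if i = j then 1 else 0 :: int)" for i :: nat
  have "ipS {..<d} k \<theta> = \<theta> j" for \<theta>
  proof -
    have "(\<Sum>i<d. real_of_int (k i) * \<theta> i) = (\<Sum>i<d. if i = j then \<theta> i else 0)"
      by (intro sum.cong) (auto simp: k_def)
    then show ?thesis using assms by (simp add: ipS_def)
  qed
  then have e: "ech d k \<theta> = cis (\<theta> j)" "ech d (\<lambda>i. - k i) \<theta> = cis (- \<theta> j)" for \<theta>
    using cnj_ech[of d k \<theta>] by (simp_all add: ech_def cis_conv_exp exp_cnj)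
  have "(\<lambda>\<theta>. 1/2 * ech d k \<theta> + 1/2 * ech d (\<lambda>i. - k i) \<theta>) \<in> trig d" by (intro trig.add trig.ech)
  then show "trig_approx d (\<lambda>\<theta>. of_real (cos (\<theta> j)))"
    by (rule trig_approx_cong[OF trig_approx_trig]) (simp add: e complex_eq_iff)
  have "(\<lambda>\<theta>. (-\<i>/2) * ech d k \<theta> + (\<i>/2) * ech d (\<lambda>i. - k i) \<theta>) \<in> trig d" by (intro trig.add trig.ech)
  then show "trig_approx d (\<lambda>\<theta>. of_real (sin (\<theta> j)))"
    by (rule trig_approx_cong[OF trig_approx_trig]) (simp add: e complex_eq_iff)
qed

text \<open>The sets with approximable indicator form a \<open>\<sigma>\<close>-algebra for which all coordinates are measurable.\<close>

lemma trig_approx_indicator: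
  assumes "A \<in> sets (torus d)"
  shows "trig_approx d (indicator A)"
proof -
  define \<A> where "\<A> = {A \<in> sets (torus d). trig_approx d (indicator A)}"
  have compl: "space (torus d) - A \<in> \<A>" if "A \<in> \<A>" for A
  proof -
    have "trig_approx d (\<lambda>\<theta>. 1 - indicator A \<theta>)"
      using that by (intro trig_approx_diff trig_approx_const) (simp add: \<A>_def)
    then have "trig_approx d (indicator (space (torus d) - A))"
      by (rule trig_approx_cong) (auto simp: indicator_def)
    then show ?thesis using that by (auto simp: \<A>_def)
  qed
  have inter: "A \<inter> B \<in> \<A>" if "A \<in> \<A>" "B \<in> \<A>" for A B
  proof -
    have "trig_approx d (\<lambda>\<theta>. indicator A \<theta> * indicator B \<theta>)"
      using that by (intro trig_approx_mult) (simp_all add: \<A>_def)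
    then have "trig_approx d (indicator (A \<inter> B))"
      by (rule trig_approx_cong) (auto simp: indicator_def)
    then show ?thesis using that by (auto simp: \<A>_def)
  qed
  have sub: "A \<subseteq> space (torus d)" if "A \<in> \<A>" for A using that sets.sets_into_space by (auto simp: \<A>_def)
  have union: "A \<union> B \<in> \<A>" if "A \<in> \<A>" "B \<in> \<A>" for A B
  proof -
    have "A \<union> B = space (torus d) - ((space (torus d) - A) \<inter> (space (torus d) - B))"
      using sub[OF that(1)] sub[OF that(2)] by auto
    then show ?thesis using compl inter that by simp
  qed
  have empty: "{} \<in> \<A>"
    using trig_approx_cong[OF trig_approx_const[of d 0], of "indicator {}"] by (auto simp: \<A>_def)
  have UN: "(\<Union>i::nat. A i) \<in> \<A>" if "range A \<subseteq> \<A>" for A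
  proof -
    have fin: "(\<Union>i<n. A i) \<in> \<A>" for n :: nat
      using that empty union by (induction n) (auto simp: lessThan_Suc)
    have UNs: "(\<Union>i. A i) \<in> sets (torus d)" using that by (intro sets.countable_UN) (auto simp: \<A>_def)
    have "trig_approx d (indicator (\<Union>i. A i))"
    proof (rule trig_approx_dominated_limit[where B = 1])
      show "trig_approx d (indicator (\<Union>i<n. A i))" for n using fin[of n] by (simp add: \<A>_def)
      show "(indicator (\<Union>i. A i) :: _ \<Rightarrow> complex) \<in> borel_measurable (torus d)" using UNs by simp
      show "norm (indicator (\<Union>i<n. A i) \<theta> :: complex) \<le> 1" for n \<theta> by (simp add: indicator_def)
      show "(\<lambda>n. indicator (\<Union>i<n. A i) \<theta> :: complex) \<longlonglongrightarrow> indicator (\<Union>i. A i) \<theta>" for \<theta>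
        by (rule LIMSEQ_indicator_UN)
    qed
    then show ?thesis using UNs by (simp add: \<A>_def)
  qed
  have sig: "sigma_algebra (space (torus d)) \<A>"
    unfolding sigma_algebra_iff2 using sub compl empty UN by (auto simp del: UN_iff)
  define N where "N = sigma (space (torus d)) \<A>"
  have spN: "space N = space (torus d)" and setsN: "sets N = \<A>"
    using sub sig unfolding N_def by (auto simp: space_measure_of_conv sets_measure_of_conv sigma_algebra.sigma_sets_eq)
  have cosN: "{\<theta> \<in> space (torus d). cos (\<theta> j) > c} \<in> \<A>" and sinN: "{\<theta> \<in> space (torus d). sin (\<theta> j) > c} \<in> \<A>"
    if j: "j < d" for j c
  proof -
    have mc: "(\<lambda>\<theta>. cos (\<theta> j)) \<in> borel_measurable (torus d)" "(\<lambda>\<theta>. sin (\<theta> j)) \<in> borel_measurable (torus d)"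
      using measurable_torus_component[OF j] by (auto intro!: measurable_compose[OF _ borel_measurable_continuous_onI] continuous_intros)
    show "{\<theta> \<in> space (torus d). cos (\<theta> j) > c} \<in> \<A>" "{\<theta> \<in> space (torus d). sin (\<theta> j) > c} \<in> \<A>"
      unfolding \<A>_def using mc trig_approx_superlevel[OF trig_approx_cos_sin(1)[OF j] mc(1)]
        trig_approx_superlevel[OF trig_approx_cos_sin(2)[OF j] mc(2)]
      by (auto simp: borel_measurable_iff_greater)
  qed
  \<comment> \<open>The cosine alone does not separate \<theta> from -\<theta>. The sign of the sine
    decides the half of the circle, and on each half the cosine is strictly monotone, so every
    initial interval is a combination of superlevel sets.\<close>
  have coord: "(\<lambda>\<theta>. \<theta> j) \<in> borel_measurable N" if j: "j < d" for j
    unfolding borel_measurable_iff_less spN setsN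
  proof
    fix a :: real
    let ?S = "space (torus d)"
    have rng: "-pi \<le> \<theta> j" "\<theta> j < pi" if "\<theta> \<in> ?S" for \<theta>
      using PiE_mem[OF that[unfolded space_torus], of j] j by simp_all
    have sgn: "sin (\<theta> j) > 0 \<longleftrightarrow> \<theta> j > 0" if "\<theta> \<in> ?S" for \<theta>
    proof (cases "\<theta> j > 0")
      case True then show ?thesis using rng[OF that] sin_gt_zero by auto
    next
      case False
      then have "sin (- \<theta> j) \<ge> 0" using rng[OF that] by (intro sin_ge_zero) auto
      then show ?thesis using False by simp
    qed
    have neg: "{\<theta> \<in> ?S. \<not> sin (\<theta> j) > 0} \<in> \<A>"
    proof -
      have "{\<theta> \<in> ?S. \<not> sin (\<theta> j) > 0} = ?S - {\<theta> \<in> ?S. sin (\<theta> j) > 0}" by blast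
      then show ?thesis using compl[OF sinN[OF j, of 0]] by (simp only:)
    qed
    consider "a \<le> -pi" | "-pi < a" "a \<le> 0" | "0 < a" "a < pi" | "a \<ge> pi" by linarith
    then show "{\<theta> \<in> ?S. \<theta> j < a} \<in> \<A>"
    proof cases
      case 1
      then have "{\<theta> \<in> ?S. \<theta> j < a} = {}" using rng by fastforce
      then show ?thesis using empty by (simp only:)
    next
      case 2
      have cmp: "cos (\<theta> j) < cos a \<longleftrightarrow> \<theta> j < a" if "\<theta> \<in> ?S" "\<not> \<theta> j > 0" for \<theta>
      proof -
        have "cos (- \<theta> j) < cos (- a) \<longleftrightarrow> - a < - \<theta> j"
          by (rule cos_mono_less_eq) (use rng[OF that(1)] that(2) 2 in linarith)+
        then show ?thesis by (simp only: cos_minus neg_less_iff_less)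
      qed
      have "{\<theta> \<in> ?S. \<not> cos (\<theta> j) < cos a} \<in> \<A>"
      proof -
        \<comment> \<open>Only strict superlevel sets are available so far; the weak one is a
          countable intersection of them.\<close>
        have "{\<theta> \<in> ?S. \<not> cos (\<theta> j) < cos a} = (\<Inter>n::nat. {\<theta> \<in> ?S. cos (\<theta> j) > cos a - 1 / real (Suc n)})"
        proof (intro equalityI subsetI)
          fix \<theta> assume "\<theta> \<in> {\<theta> \<in> ?S. \<not> cos (\<theta> j) < cos a}"
          then show "\<theta> \<in> (\<Inter>n::nat. {\<theta> \<in> ?S. cos (\<theta> j) > cos a - 1 / real (Suc n)})"
            by (auto intro: less_le_trans[of _ "cos a"])
        next
          fix \<theta> assume *: "\<theta> \<in> (\<Inter>n::nat. {\<theta> \<in> ?S. cos (\<theta> j) > cos a - 1 / real (Suc n)})"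
          have "\<not> cos (\<theta> j) < cos a"
          proof
            assume "cos (\<theta> j) < cos a"
            then obtain n where "inverse (real (Suc n)) < cos a - cos (\<theta> j)" using reals_Archimedean[of "cos a - cos (\<theta> j)"] by auto
            moreover have "cos (\<theta> j) > cos a - 1 / real (Suc n)" using * by blast
            ultimately show False by (simp add: inverse_eq_divide)
          qed
          then show "\<theta> \<in> {\<theta> \<in> ?S. \<not> cos (\<theta> j) < cos a}" using * by auto
        qed
        also have "\<dots> = ?S - (\<Union>n::nat. ?S - {\<theta> \<in> ?S. cos (\<theta> j) > cos a - 1 / real (Suc n)})" by auto
        also have "\<dots> \<in> \<A>" by (intro compl UN) (auto intro: compl cosN[OF j])
        finally show ?thesis .
      qed
      from inter[OF neg compl[OF this]]
      have "{\<theta> \<in> ?S. \<not> sin (\<theta> j) > 0} \<inter> (?S - {\<theta> \<in> ?S. \<not> cos (\<theta> j) < cos a}) \<in> \<A>" .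
      also have "{\<theta> \<in> ?S. \<not> sin (\<theta> j) > 0} \<inter> (?S - {\<theta> \<in> ?S. \<not> cos (\<theta> j) < cos a}) = {\<theta> \<in> ?S. \<theta> j < a}"
      proof (intro Set.set_eqI)
        fix \<theta>
        show "\<theta> \<in> {\<theta> \<in> ?S. \<not> sin (\<theta> j) > 0} \<inter> (?S - {\<theta> \<in> ?S. \<not> cos (\<theta> j) < cos a}) \<longleftrightarrow> \<theta> \<in> {\<theta> \<in> ?S. \<theta> j < a}"
          using cmp[of \<theta>] sgn[of \<theta>] 2 by (cases "\<theta> j > 0") auto
      qed
      finally show ?thesis .
    next
      case 3
      have cmp: "cos a < cos (\<theta> j) \<longleftrightarrow> \<theta> j < a" if "\<theta> \<in> ?S" "\<theta> j > 0" for \<theta>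
        by (rule cos_mono_less_eq) (use rng[OF that(1)] that(2) 3 in linarith)+
      have "{\<theta> \<in> ?S. \<not> sin (\<theta> j) > 0} \<union> {\<theta> \<in> ?S. cos (\<theta> j) > cos a} \<in> \<A>" by (intro union neg cosN j)
      moreover have "{\<theta> \<in> ?S. \<not> sin (\<theta> j) > 0} = {\<theta> \<in> ?S. \<not> \<theta> j > 0}" using sgn by (intro Collect_cong) blast
      ultimately have A: "{\<theta> \<in> ?S. \<not> \<theta> j > 0} \<union> {\<theta> \<in> ?S. cos (\<theta> j) > cos a} \<in> \<A>" by (simp only:)
      have "{\<theta> \<in> ?S. \<not> \<theta> j > 0} \<union> {\<theta> \<in> ?S. cos (\<theta> j) > cos a} = {\<theta> \<in> ?S. \<theta> j < a}"
      proof (intro Set.set_eqI)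
        fix \<theta>
        show "\<theta> \<in> {\<theta> \<in> ?S. \<not> \<theta> j > 0} \<union> {\<theta> \<in> ?S. cos (\<theta> j) > cos a} \<longleftrightarrow> \<theta> \<in> {\<theta> \<in> ?S. \<theta> j < a}"
          using cmp[of \<theta>] 3 by (cases "\<theta> j > 0") auto
      qed
      then show ?thesis using A by (simp only:)
    next
      case 4
      then have "{\<theta> \<in> ?S. \<theta> j < a} = ?S - {}" using rng(2) by (auto intro: less_le_trans)
      then show ?thesis using compl[OF empty] by (simp only:)
    qed
  qed
  \<comment> \<open>This is the identity on the torus. Its measurability from the smaller
    \<sigma>-algebra says that every measurable set of the torus belongs to \<A>.\<close>
  have "(\<lambda>\<theta> j. if j < d then \<theta> j else undefined) \<in> measurable N (torus d)"
    unfolding torus_def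
  proof (rule measurable_PiM_single')
    fix j assume j: "j \<in> {..<d}"
    have "(\<lambda>\<theta>. \<theta> j) \<in> measurable N circle_measure"
      using coord j by (intro measurable_restrict_space2) (auto simp: spN space_torus PiE_iff)
    then show "(\<lambda>\<theta>. if j < d then \<theta> j else undefined) \<in> measurable N circle_measure" using j by simp
  next
    show "(\<lambda>\<theta> j. if j < d then \<theta> j else undefined) \<in> space N \<rightarrow> ({..<d} \<rightarrow>\<^sub>E space circle_measure)"
      unfolding spN space_torus by (auto simp: circle_measure_simps PiE_iff extensional_def)
  qed
  from measurable_sets[OF this assms]
  have "(\<lambda>\<theta> j. if j < d then \<theta> j else undefined) -` A \<inter> space (torus d) \<in> \<A>" by (simp add: spN setsN)
  also have "(\<lambda>\<theta> j. if j < d then \<theta> j else undefined) -` A \<inter> space (torus d) = A"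
  proof -
    have "(\<lambda>j. if j < d then \<theta> j else undefined) = \<theta>" if "\<theta> \<in> space (torus d)" for \<theta>
      using that by (auto simp: space_torus PiE_iff extensional_def fun_eq_iff)
    then show ?thesis using sets.sets_into_space[OF assms] by auto
  qed
  finally show ?thesis by (simp add: \<A>_def)
qed

text \<open>Rounding f down to multiples of 1/n gives a function of finitely many values that is
  uniformly within 1/n of f almost everywhere; \<open>K\<close> bounds the levels that
  occur.\<close>

lemma trig_approx_real:
  fixes f :: "(nat \<Rightarrow> real) \<Rightarrow> real"
  assumes f: "f \<in> borel_measurable (torus d)" and B: "AE \<theta> in torus d. \<bar>f \<theta>\<bar> \<le> B"
  shows "trig_approx d (\<lambda>\<theta>. of_real (f \<theta>))"
proof (rule trig_approx_uniform_limit)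
  show "(\<lambda>\<theta>. complex_of_real (f \<theta>)) \<in> borel_measurable (torus d)" using f by simp
  fix e :: real assume e: "e > 0"
  obtain n :: nat where n: "1 / e < real n" using reals_Archimedean2 by blast
  have n0: "real n > 0" using n e by (meson less_trans zero_less_divide_1_iff)
  obtain K :: nat where K: "real n * B + 1 < real K" using reals_Archimedean2 by blast
  define L where "L k = {\<theta> \<in> space (torus d). \<lfloor>real n * f \<theta>\<rfloor> = k}" for k :: int
  have L: "L k \<in> sets (torus d)" for k
  proof -
    have "L k = {\<theta> \<in> space (torus d). real_of_int k \<le> real n * f \<theta>} \<inter> {\<theta> \<in> space (torus d). real n * f \<theta> < real_of_int k + 1}"
      by (auto simp: L_def floor_eq_iff)
    then show ?thesis using f by (simp add: borel_measurable_le borel_measurable_less sets.Int)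
  qed
  define g where "g \<theta> = (\<Sum>k\<in>{- int K..int K}. of_real (real_of_int k / real n) * indicator (L k) \<theta> :: complex)" for \<theta>
  have "trig_approx d g" unfolding g_def
    by (intro trig_approx_sum trig_approx_cmult trig_approx_indicator L)
  moreover have "AE \<theta> in torus d. norm (complex_of_real (f \<theta>) - g \<theta>) \<le> e"
    using B AE_space
  proof eventually_elim
    fix \<theta> assume b: "\<bar>f \<theta>\<bar> \<le> B" and \<theta>: "\<theta> \<in> space (torus d)"
    define k0 where "k0 = \<lfloor>real n * f \<theta>\<rfloor>"
    have "\<bar>real n * f \<theta>\<bar> \<le> real n * B" using b n0 by (simp add: abs_mult)
    then have k0: "k0 \<in> {- int K..int K}" using K unfolding k0_def by (auto simp: le_floor_iff floor_le_iff)
    have "g \<theta> = (\<Sum>k\<in>{- int K..int K}. if k = k0 then of_real (real_of_int k0 / real n) else 0)"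
      unfolding g_def using \<theta> by (intro sum.cong) (auto simp: L_def k0_def indicator_def)
    then have "g \<theta> = of_real (real_of_int k0 / real n)" using k0 by simp
    then have "complex_of_real (f \<theta>) - g \<theta> = of_real (f \<theta> - real_of_int k0 / real n)" by (simp only: of_real_diff)
    then have "norm (complex_of_real (f \<theta>) - g \<theta>) = \<bar>f \<theta> - real_of_int k0 / real n\<bar>" by (simp only: norm_of_real)
    also have "\<dots> \<le> 1 / real n"
    proof -
      have "real_of_int k0 \<le> real n * f \<theta>" "real n * f \<theta> < real_of_int k0 + 1" unfolding k0_def by linarith+
      then have "\<bar>real n * f \<theta> - real_of_int k0\<bar> / real n \<le> 1 / real n" using n0 by (intro divide_right_mono) auto
      moreover have "f \<theta> - real_of_int k0 / real n = (real n * f \<theta> - real_of_int k0) / real n"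
        using n0 by (simp add: diff_divide_distrib)
      ultimately show ?thesis by (simp add: abs_divide)
    qed
    also have "\<dots> \<le> e" using n n0 e by (simp add: field_simps)
    finally show "norm (complex_of_real (f \<theta>) - g \<theta>) \<le> e" .
  qed
  ultimately show "\<exists>g. trig_approx d g \<and> (AE \<theta> in torus d. norm (complex_of_real (f \<theta>) - g \<theta>) \<le> e)" by blast
qed

lemma Linf_trig_approx:
  assumes "Linf d f" shows "trig_approx d f"
proof -
  obtain B where B: "AE \<theta> in torus d. norm (f \<theta>) \<le> B" and m: "f \<in> borel_measurable (torus d)"
    using assms by (auto simp: Linf_def)
  have "AE \<theta> in torus d. \<bar>Re (f \<theta>)\<bar> \<le> B" "AE \<theta> in torus d. \<bar>Im (f \<theta>)\<bar> \<le> B"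
    using B by (eventually_elim, use abs_Re_le_cmod abs_Im_le_cmod order_trans in blast)+
  then have "trig_approx d (\<lambda>\<theta>. of_real (Re (f \<theta>)) + \<i> * of_real (Im (f \<theta>)))"
    using m by (intro trig_approx_add trig_approx_cmult trig_approx_real) auto
  then show ?thesis by (simp add: complex_eq[symmetric])
qed

section \<open>Multi-index limits and compression errors\<close>

text \<open>The limit min n_j \<longrightarrow> \<infinity> as a filter. By
  \<open>eventually_mlim\<close> its eventual statements unfold to the quantifiers of
  \<open>lambda_distributed\<close>.\<close>

definition mlim :: "nat \<Rightarrow> (nat \<Rightarrow> nat) filter" where
  "mlim d = (INF M. principal {n. \<forall>j<d. M \<le> n j})"

lemma eventually_mlim: "eventually P (mlim d) \<longleftrightarrow> (\<exists>M. \<forall>n. (\<forall>j<d. M \<le> n j) \<longrightarrow> P n)"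
  unfolding mlim_def
proof (subst eventually_INF_base)
  fix a b :: nat
  show "\<exists>x\<in>UNIV. principal {n. \<forall>j<d. x \<le> n j} \<le> inf (principal {n. \<forall>j<d. a \<le> n j}) (principal {n. \<forall>j<d. b \<le> n j})"
    by (intro bexI[of _ "max a b"]) auto
qed (auto simp: eventually_principal)

lemma Nn_pos: "(\<And>j. j < d \<Longrightarrow> 0 < n j) \<Longrightarrow> Nn d n > 0"
  by (simp add: Nn_def)

lemma eventually_mlim_pos: "\<forall>\<^sub>F n in mlim d. \<forall>j<d. 0 < n j"
  unfolding eventually_mlim by (intro exI[of _ 1]) auto

lemma lex_idx_last: "lex_idx (Suc d) n p d = p mod n d"
proof -
  have "{d<..<Suc d} = {}" by auto
  then show ?thesis by (simp add: lex_idx_def)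
qed

lemma lex_idx_Suc:
  assumes "j < d" shows "lex_idx (Suc d) n p j = lex_idx d n (p div n d) j"
proof -
  have "{j<..<Suc d} = insert d {j<..<d}" using assms by auto
  then show ?thesis by (simp add: lex_idx_def div_mult2_eq)
qed

text \<open>A multi-index is the list of mixed-radix digits of its position, the last coordinate
  being the least significant digit.\<close>

lemma lex_idx_inj:
  assumes "p < Nn d n" "q < Nn d n" "\<And>j. j < d \<Longrightarrow> lex_idx d n p j = lex_idx d n q j"
  shows "p = q"
  using assms
proof (induction d arbitrary: p q)
  case 0
  then show ?case by (simp add: Nn_def)
next
  case (Suc d)
  have N: "Nn (Suc d) n = Nn d n * n d" by (simp add: Nn_def)
  have "p div n d = q div n d"
  proof (rule Suc.IH)
    show "p div n d < Nn d n" "q div n d < Nn d n" using Suc.prems(1,2) unfolding N by (auto intro: less_mult_imp_div_less)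
    show "lex_idx d n (p div n d) j = lex_idx d n (q div n d) j" if "j < d" for j
      using Suc.prems(3)[of j] that by (simp add: lex_idx_Suc)
  qed
  moreover have "p mod n d = q mod n d" using Suc.prems(3)[of d] by (simp add: lex_idx_last)
  ultimately show ?case by (metis div_mult_mod_eq)
qed

lemma bij_betw_lex_idx:
  assumes "\<And>j. j < d \<Longrightarrow> 0 < n j"
  shows "bij_betw (\<lambda>p. restrict (lex_idx d n p) {..<d}) {..<Nn d n} (\<Pi>\<^sub>E j\<in>{..<d}. {..<n j})"
proof -
  let ?f = "\<lambda>p. restrict (lex_idx d n p) {..<d}"
  have inj: "inj_on ?f {..<Nn d n}"
  proof (rule inj_onI)
    fix p q assume pq: "p \<in> {..<Nn d n}" "q \<in> {..<Nn d n}" and eq: "?f p = ?f q"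
    have "lex_idx d n p j = lex_idx d n q j" if "j < d" for j
      using fun_cong[OF eq, of j] that by simp
    then show "p = q" using pq by (intro lex_idx_inj[of p d n q]) auto
  qed
  have "?f ` {..<Nn d n} \<subseteq> (\<Pi>\<^sub>E j\<in>{..<d}. {..<n j})"
    using assms by (simp add: image_subset_iff restrict_PiE_iff lex_idx_def)
  moreover have "card (\<Pi>\<^sub>E j\<in>{..<d}. {..<n j}) = card (?f ` {..<Nn d n})"
    using card_image[OF inj] by (simp add: card_PiE Nn_def)
  ultimately have "?f ` {..<Nn d n} = (\<Pi>\<^sub>E j\<in>{..<d}. {..<n j})"
    by (intro card_subset_eq) (auto intro: finite_PiE)
  then show ?thesis using inj by (simp add: bij_betw_def)
qed

text \<open>Every digit is equidistributed, since prescribing one digit leaves the others free. The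
  factor n l on the left avoids a division.\<close>

lemma card_lex_idx_in:
  assumes pos: "\<And>j. j < d \<Longrightarrow> 0 < n j" and l: "l < d" and A: "A \<subseteq> {..<n l}"
  shows "n l * card {p \<in> {..<Nn d n}. lex_idx d n p l \<in> A} = card A * Nn d n"
proof -
  let ?f = "\<lambda>p. restrict (lex_idx d n p) {..<d}"
  let ?C = "\<lambda>j. if j = l then A else {..<n j}"
  have bij: "bij_betw ?f {..<Nn d n} (\<Pi>\<^sub>E j\<in>{..<d}. {..<n j})" by (rule bij_betw_lex_idx[OF pos])
  have "?f ` {p \<in> {..<Nn d n}. lex_idx d n p l \<in> A} = (\<Pi>\<^sub>E j\<in>{..<d}. ?C j)"
  proof (intro equalityI subsetI)
    fix b assume "b \<in> ?f ` {p \<in> {..<Nn d n}. lex_idx d n p l \<in> A}"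
    then obtain p where p: "p < Nn d n" "lex_idx d n p l \<in> A" "b = ?f p" by auto
    then show "b \<in> (\<Pi>\<^sub>E j\<in>{..<d}. ?C j)" using pos by (simp add: restrict_PiE_iff) (simp add: lex_idx_def)
  next
    fix b assume b: "b \<in> (\<Pi>\<^sub>E j\<in>{..<d}. ?C j)"
    have "b \<in> (\<Pi>\<^sub>E j\<in>{..<d}. {..<n j})"
    proof (rule PiE_I)
      fix j assume "j \<in> {..<d}"
      then show "b j \<in> {..<n j}" using PiE_mem[OF b, of j] A by (cases "j = l") auto
    qed (use b in \<open>auto simp: PiE_def extensional_def\<close>)
    then obtain p where p: "p \<in> {..<Nn d n}" "b = ?f p" using bij unfolding bij_betw_def by blast
    moreover have "lex_idx d n p l \<in> A" using PiE_mem[OF b, of l] l p(2) by simp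
    ultimately show "b \<in> ?f ` {p \<in> {..<Nn d n}. lex_idx d n p l \<in> A}" by blast
  qed
  moreover have "inj_on ?f {p \<in> {..<Nn d n}. lex_idx d n p l \<in> A}"
    using bij unfolding bij_betw_def by (auto intro: inj_on_subset)
  ultimately have "card {p \<in> {..<Nn d n}. lex_idx d n p l \<in> A} = card (\<Pi>\<^sub>E j\<in>{..<d}. ?C j)"
    using card_image by fastforce
  also have "\<dots> = (\<Prod>j<d. card (?C j))" by (simp add: card_PiE)
  also have "\<dots> = card A * (\<Prod>j\<in>{..<d} - {l}. n j)"
    using l by (subst prod.remove[of _ l]) auto
  finally have "n l * card {p \<in> {..<Nn d n}. lex_idx d n p l \<in> A} = card A * (n l * (\<Prod>j\<in>{..<d} - {l}. n j))" by simp
  also have "n l * (\<Prod>j\<in>{..<d} - {l}. n j) = Nn d n"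
    unfolding Nn_def using l by (subst (2) prod.remove[of _ l]) auto
  finally show ?thesis .
qed

section \<open>Compressions of multiplication operators to boxes of frequencies\<close>

abbreviation ub :: "nat \<Rightarrow> (nat \<Rightarrow> nat) \<Rightarrow> nat \<Rightarrow> (nat \<Rightarrow> real) \<Rightarrow> complex" where
  "ub d n p \<equiv> ech d (\<lambda>j. int (lex_idx d n p j))"

lemma ub_orthonormal:
  assumes "p < Nn d n" "q < Nn d n"
  shows "av d (\<lambda>\<theta>. ub d n p \<theta> * cnj (ub d n q \<theta>)) = (if p = q then 1 else 0)"
proof -
  have "(\<lambda>\<theta>. ub d n p \<theta> * cnj (ub d n q \<theta>)) = ech d (\<lambda>j. int (lex_idx d n p j) + - int (lex_idx d n q j))"
    unfolding cnj_ech by (rule ext, rule ech_add[symmetric])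
  then have "av d (\<lambda>\<theta>. ub d n p \<theta> * cnj (ub d n q \<theta>)) = (if \<forall>j<d. lex_idx d n p j = lex_idx d n q j then 1 else 0)"
    by (simp add: av_ech)
  also have "(\<forall>j<d. lex_idx d n p j = lex_idx d n q j) \<longleftrightarrow> p = q" using lex_idx_inj[OF assms] by blast
  finally show ?thesis .
qed

text \<open>The entry <f u_q, u_p> of multiplication by f compressed to the span of the exponentials
  with frequencies in the box; by \<open>tc_eq_av\<close> it depends on the difference of the
  multi-indices only.\<close>

definition tc :: "nat \<Rightarrow> (nat \<Rightarrow> nat) \<Rightarrow> ((nat \<Rightarrow> real) \<Rightarrow> complex) \<Rightarrow> nat \<Rightarrow> nat \<Rightarrow> complex" where
  "tc d n f p q = av d (\<lambda>\<theta>. f \<theta> * ub d n q \<theta> * cnj (ub d n p \<theta>))"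

lemma nsq_mult_ub: "nsq d (\<lambda>\<theta>. f \<theta> * ub d n q \<theta>) = nsq d f"
  by (simp add: nsq_def norm_mult)

lemma Bessel_ub:
  assumes "Linf d f"
  shows "(\<Sum>p<Nn d n. (norm (av d (\<lambda>\<theta>. f \<theta> * cnj (ub d n p \<theta>))))\<^sup>2) \<le> nsq d f"
  using assms by (intro Bessel_inequality) (auto simp: ub_orthonormal intro: Linf_ech)

lemma nsq_ub_sum: "nsq d (\<lambda>\<theta>. \<Sum>q<Nn d n. x q * ub d n q \<theta>) = (\<Sum>q<Nn d n. (norm (x q))\<^sup>2)"
proof -
  have "nsq d (\<lambda>\<theta>. 0 - (\<Sum>q<Nn d n. x q * ub d n q \<theta>)) = (\<Sum>q<Nn d n. (norm (x q))\<^sup>2)"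
    by (subst nsq_diff_orthonormal) (auto simp: ub_orthonormal nsq_const av_const intro: Linf_ech Linf_const)
  then show ?thesis by (simp add: nsq_def)
qed

text \<open>Applied to the coefficient vector of F, the matrix gives Fourier coefficients of f F,
  which Bessel's inequality bounds by the norm of f F.\<close>

lemma toeplitz_scalar_op_bound:
  assumes f: "Linf d f" and B: "AE \<theta> in torus d. norm (f \<theta>) \<le> B"
  shows "(\<Sum>p<Nn d n. (norm (\<Sum>q<Nn d n. tc d n f p q * x q))\<^sup>2) \<le> B\<^sup>2 * (\<Sum>q<Nn d n. (norm (x q))\<^sup>2)"
proof -
  define F where "F \<theta> = (\<Sum>q<Nn d n. x q * ub d n q \<theta>)" for \<theta>
  have F: "Linf d F" unfolding F_def by (intro Linf_sum Linf_cmult Linf_ech)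
  have "(\<Sum>q<Nn d n. tc d n f p q * x q) = av d (\<lambda>\<theta>. f \<theta> * F \<theta> * cnj (ub d n p \<theta>))" for p
  proof -
    have "(\<lambda>\<theta>. f \<theta> * F \<theta> * cnj (ub d n p \<theta>)) = (\<lambda>\<theta>. \<Sum>q<Nn d n. x q * (f \<theta> * ub d n q \<theta> * cnj (ub d n p \<theta>)))"
      by (simp add: F_def sum_distrib_left sum_distrib_right mult_ac)
    then show ?thesis unfolding tc_def
      by (simp add: av_sum av_cmult Linf_cmult Linf_mult Linf_cnj f Linf_ech mult.commute)
  qed
  then have "(\<Sum>p<Nn d n. (norm (\<Sum>q<Nn d n. tc d n f p q * x q))\<^sup>2) \<le> nsq d (\<lambda>\<theta>. f \<theta> * F \<theta>)"
    using Bessel_ub[OF Linf_mult[OF f F]] by simp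
  also have "\<dots> \<le> B\<^sup>2 * nsq d F" by (intro nsq_mult_le F f B)
  also have "nsq d F = (\<Sum>q<Nn d n. (norm (x q))\<^sup>2)" unfolding F_def by (rule nsq_ub_sum)
  finally show ?thesis .
qed

lemma toeplitz_scalar_fro_bound:
  assumes f: "Linf d f"
  shows "(\<Sum>p<Nn d n. \<Sum>q<Nn d n. (norm (tc d n f p q))\<^sup>2) \<le> real (Nn d n) * nsq d f"
proof -
  have "(\<Sum>p<Nn d n. (norm (tc d n f p q))\<^sup>2) \<le> nsq d f" for q
    using Bessel_ub[OF Linf_mult[OF f Linf_ech[of d "\<lambda>j. int (lex_idx d n q j)"]], of n]
    by (simp only: tc_def nsq_mult_ub)
  then have "(\<Sum>q<Nn d n. \<Sum>p<Nn d n. (norm (tc d n f p q))\<^sup>2) \<le> (\<Sum>q<Nn d n. nsq d f)" by (intro sum_mono)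
  then show ?thesis by (subst sum.swap) simp
qed

text \<open>Squared distance of b u_q from the span of the exponentials of the box: what the
  compression loses in column q.\<close>

definition resid :: "nat \<Rightarrow> (nat \<Rightarrow> nat) \<Rightarrow> ((nat \<Rightarrow> real) \<Rightarrow> complex) \<Rightarrow> nat \<Rightarrow> real" where
  "resid d n b q = nsq d (\<lambda>\<theta>. b \<theta> * ub d n q \<theta> - (\<Sum>l<Nn d n. tc d n b l q * ub d n l \<theta>))"

text \<open>Column q of T(ab) - T(a) T(b) is the compression of a times the residual of b u_q, so
  boundedness of a and Bessel suffice.\<close>

lemma toeplitz_scalar_product:
  assumes a: "Linf d a" and b: "Linf d b" and B: "AE \<theta> in torus d. norm (a \<theta>) \<le> B"
  shows "(\<Sum>p<Nn d n. (norm (tc d n (\<lambda>\<theta>. a \<theta> * b \<theta>) p q - (\<Sum>l<Nn d n. tc d n a p l * tc d n b l q)))\<^sup>2)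
    \<le> B\<^sup>2 * resid d n b q"
proof -
  define R where "R \<theta> = b \<theta> * ub d n q \<theta> - (\<Sum>l<Nn d n. tc d n b l q * ub d n l \<theta>)" for \<theta>
  have R: "Linf d R" unfolding R_def by (intro Linf_diff Linf_sum Linf_cmult Linf_mult b Linf_ech)
  have "tc d n (\<lambda>\<theta>. a \<theta> * b \<theta>) p q - (\<Sum>l<Nn d n. tc d n a p l * tc d n b l q)
      = av d (\<lambda>\<theta>. a \<theta> * R \<theta> * cnj (ub d n p \<theta>))" for p
  proof -
    have "(\<lambda>\<theta>. a \<theta> * R \<theta> * cnj (ub d n p \<theta>)) = (\<lambda>\<theta>. a \<theta> * b \<theta> * ub d n q \<theta> * cnj (ub d n p \<theta>)
        - (\<Sum>l<Nn d n. tc d n b l q * (a \<theta> * ub d n l \<theta> * cnj (ub d n p \<theta>))))"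
      by (simp add: R_def right_diff_distrib left_diff_distrib sum_distrib_left sum_distrib_right mult_ac)
    then show ?thesis
      by (simp add: av_diff av_sum av_cmult Linf_sum Linf_cmult Linf_mult Linf_cnj a b Linf_ech mult.commute tc_def[symmetric])
        (simp add: tc_def mult.commute)
  qed
  then have "(\<Sum>p<Nn d n. (norm (tc d n (\<lambda>\<theta>. a \<theta> * b \<theta>) p q - (\<Sum>l<Nn d n. tc d n a p l * tc d n b l q)))\<^sup>2)
     \<le> nsq d (\<lambda>\<theta>. a \<theta> * R \<theta>)"
    using Bessel_ub[OF Linf_mult[OF a R]] by simp
  also have "\<dots> \<le> B\<^sup>2 * nsq d R" by (intro nsq_mult_le R a B)
  finally show ?thesis by (simp add: resid_def R_def[abs_def])
qed

lemma resid_minimal: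
  assumes b: "Linf d b"
  shows "resid d n b q \<le> nsq d (\<lambda>\<theta>. b \<theta> * ub d n q \<theta> - (\<Sum>l<Nn d n. x l * ub d n l \<theta>))"
proof -
  have L: "Linf d (\<lambda>\<theta>. b \<theta> * ub d n q \<theta>)" by (intro Linf_mult b Linf_ech)
  note e = nsq_diff_orthonormal[of "{..<Nn d n}" d "ub d n" "\<lambda>\<theta>. b \<theta> * ub d n q \<theta>", OF _ _ _ L]
  show ?thesis unfolding resid_def
    by (subst (1 2) e) (auto simp: ub_orthonormal Linf_ech tc_def intro!: sum_nonneg)
qed

definition good :: "nat \<Rightarrow> (nat \<Rightarrow> nat) \<Rightarrow> nat \<Rightarrow> nat \<Rightarrow> bool" where
  "good d n L q \<longleftrightarrow> (\<forall>j<d. L \<le> lex_idx d n q j \<and> lex_idx d n q j + L < n j)"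

text \<open>Multiplication by a character shifts the frequency. If q lies at depth L inside the box,
  no frequency of t of size at most L leads out of it, so nothing is lost by compression.\<close>

lemma trig_shift:
  assumes "t \<in> trig d"
  shows "\<exists>L. \<forall>n q. (\<forall>j<d. 0 < n j) \<longrightarrow> good d n L q \<longrightarrow>
    (\<exists>x. \<forall>\<theta>. t \<theta> * ub d n q \<theta> = (\<Sum>l<Nn d n. x l * ub d n l \<theta>))"
  using assms
proof (induction rule: trig.induct)
  case (ech c k)
  \<comment> \<open>The sum is a convenient common bound for all |k j|.\<close>
  define L where "L = (\<Sum>j<d. nat \<bar>k j\<bar>)"
  have kL: "\<bar>k j\<bar> \<le> int L" if "j < d" for j
    using member_le_sum[of j "{..<d}" "\<lambda>j. nat \<bar>k j\<bar>"] that unfolding L_def by (simp add: nat_le_iff)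
  show ?case
  proof (intro exI[of _ L] allI impI)
    fix n q assume pos: "\<forall>j<d. 0 < n j" and g: "good d n L q"
    define b where "b = (\<lambda>j\<in>{..<d}. nat (int (lex_idx d n q j) + k j))"
    have nn: "0 \<le> int (lex_idx d n q j) + k j" "int (lex_idx d n q j) + k j < int (n j)" if "j < d" for j
      using kL[OF that] g that unfolding good_def by (force simp: abs_le_iff)+
    have "b \<in> (\<Pi>\<^sub>E j\<in>{..<d}. {..<n j})" using nn by (auto simp: b_def nat_less_iff)
    then have "b \<in> (\<lambda>p. restrict (lex_idx d n p) {..<d}) ` {..<Nn d n}"
      using bij_betw_imp_surj_on[OF bij_betw_lex_idx[of d n]] pos by simp
    then obtain p where p: "p < Nn d n" "b = restrict (lex_idx d n p) {..<d}" by blast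
    have "ech d k \<theta> * ub d n q \<theta> = ub d n p \<theta>" for \<theta>
      unfolding ech_add[symmetric]
    proof (rule ech_cong)
      fix j assume j: "j < d"
      have "nat (int (lex_idx d n q j) + k j) = lex_idx d n p j"
        using fun_cong[OF p(2), of j] j by (simp add: b_def)
      then show "k j + int (lex_idx d n q j) = int (lex_idx d n p j)" using nn[OF j] by linarith
    qed
    then have "c * ech d k \<theta> * ub d n q \<theta> = (\<Sum>l<Nn d n. (if l = p then c else 0) * ub d n l \<theta>)" for \<theta>
      using p(1) by (simp add: mult.assoc if_distrib[of "\<lambda>x. x * _"] cong: if_cong)
    then show "\<exists>x. \<forall>\<theta>. c * ech d k \<theta> * ub d n q \<theta> = (\<Sum>l<Nn d n. x l * ub d n l \<theta>)"
      by (intro exI[of _ "\<lambda>l. if l = p then c else 0"] allI)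
  qed
next
  case (add s t)
  then obtain L1 L2 where L1: "\<And>n q. (\<forall>j<d. 0 < n j) \<Longrightarrow> good d n L1 q \<Longrightarrow>
      \<exists>x. \<forall>\<theta>. s \<theta> * ub d n q \<theta> = (\<Sum>l<Nn d n. x l * ub d n l \<theta>)"
    and L2: "\<And>n q. (\<forall>j<d. 0 < n j) \<Longrightarrow> good d n L2 q \<Longrightarrow>
      \<exists>x. \<forall>\<theta>. t \<theta> * ub d n q \<theta> = (\<Sum>l<Nn d n. x l * ub d n l \<theta>)" by blast
  show ?case
  proof (intro exI[of _ "max L1 L2"] allI impI)
    fix n q assume pos: "\<forall>j<d. 0 < n j" and g: "good d n (max L1 L2) q"
    then have g1: "good d n L1 q" and g2: "good d n L2 q" by (force simp: good_def)+
    obtain x where x: "\<And>\<theta>. s \<theta> * ub d n q \<theta> = (\<Sum>l<Nn d n. x l * ub d n l \<theta>)" using L1[OF pos g1] by blast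
    obtain y where y: "\<And>\<theta>. t \<theta> * ub d n q \<theta> = (\<Sum>l<Nn d n. y l * ub d n l \<theta>)" using L2[OF pos g2] by blast
    have "(s \<theta> + t \<theta>) * ub d n q \<theta> = (\<Sum>l<Nn d n. (x l + y l) * ub d n l \<theta>)" for \<theta>
      by (simp add: distrib_right x y sum.distrib)
    then show "\<exists>x. \<forall>\<theta>. (s \<theta> + t \<theta>) * ub d n q \<theta> = (\<Sum>l<Nn d n. x l * ub d n l \<theta>)" by (intro exI[of _ "\<lambda>l. x l + y l"]) simp
  qed
qed

text \<open>An index that is not deep has some coordinate in one of two slabs of thickness L; by
  equidistribution each slab pair holds a fraction of at most 2 L / n_j.\<close>

lemma card_bad:
  assumes pos: "\<And>j. j < d \<Longrightarrow> 0 < n j"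
  shows "real (card {q \<in> {..<Nn d n}. \<not> good d n L q}) \<le> (\<Sum>j<d. 2 * real L / real (n j)) * real (Nn d n)"
proof -
  define A where "A j = {v \<in> {..<n j}. v < L \<or> n j \<le> v + L}" for j
  have cA: "card (A j) \<le> 2 * L" for j
  proof -
    have "A j \<subseteq> {..<L} \<union> {n j - L..<n j}" by (auto simp: A_def)
    then have "card (A j) \<le> card ({..<L} \<union> {n j - L..<n j})" by (intro card_mono) auto
    also have "\<dots> \<le> card {..<L} + card {n j - L..<n j}" by (rule card_Un_le)
    also have "\<dots> \<le> 2 * L" by simp
    finally show ?thesis .
  qed
  have "{q \<in> {..<Nn d n}. \<not> good d n L q} \<subseteq> (\<Union>j<d. {q \<in> {..<Nn d n}. lex_idx d n q j \<in> A j})"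
    using pos by (auto simp: good_def A_def lex_idx_def not_le not_less)
  then have "card {q \<in> {..<Nn d n}. \<not> good d n L q} \<le> card (\<Union>j<d. {q \<in> {..<Nn d n}. lex_idx d n q j \<in> A j})"
    by (intro card_mono) auto
  also have "\<dots> \<le> (\<Sum>j<d. card {q \<in> {..<Nn d n}. lex_idx d n q j \<in> A j})" by (intro card_UN_le) auto
  finally have "real (card {q \<in> {..<Nn d n}. \<not> good d n L q}) \<le> (\<Sum>j<d. real (card {q \<in> {..<Nn d n}. lex_idx d n q j \<in> A j}))"
    by (simp flip: of_nat_sum)
  also have "\<dots> \<le> (\<Sum>j<d. 2 * real L / real (n j) * real (Nn d n))"
  proof (rule sum_mono)
    fix j assume "j \<in> {..<d}"
    then have j: "j < d" by simp
    have "real (n j) * real (card {q \<in> {..<Nn d n}. lex_idx d n q j \<in> A j}) = real (card (A j)) * real (Nn d n)"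
      using card_lex_idx_in[where n = n and d = d and l = j and A = "A j", OF pos j] unfolding of_nat_mult[symmetric]
      by (simp add: A_def Collect_mono_iff subset_eq)
    also have "\<dots> \<le> 2 * real L * real (Nn d n)" using cA[of j] by (intro mult_right_mono) linarith+
    finally show "real (card {q \<in> {..<Nn d n}. lex_idx d n q j \<in> A j}) \<le> 2 * real L / real (n j) * real (Nn d n)"
      using pos[OF j] by (simp add: field_simps)
  qed
  finally show ?thesis by (simp add: sum_distrib_right)
qed

text \<open>For deep indices the residual is at most the squared distance of b to a trigonometric
  polynomial, which is small by density. The remaining indices have residual at most that of b
  itself, and their proportion vanishes.\<close>

lemma resid_average_tendsto:
  assumes b: "Linf d b"
  shows "((\<lambda>n. (\<Sum>q<Nn d n. resid d n b q) / real (Nn d n)) \<longlongrightarrow> 0) (mlim d)"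
proof (rule tendstoI)
  fix e :: real assume e: "e > 0"
  have "e/2 > 0" using e by simp
  then obtain t where t: "t \<in> trig d" "nsq d (\<lambda>\<theta>. b \<theta> - t \<theta>) < e/2"
    using Linf_trig_approx[OF b] unfolding trig_approx_def by blast
  obtain L where L: "\<And>n q. (\<forall>j<d. 0 < n j) \<Longrightarrow> good d n L q \<Longrightarrow>
      \<exists>x. \<forall>\<theta>. t \<theta> * ub d n q \<theta> = (\<Sum>l<Nn d n. x l * ub d n l \<theta>)"
    using trig_shift[OF t(1)] by blast
  define K where "K = nsq d b * (real d * 2 * real L)"
  obtain M :: nat where M: "2 * K / e < real M" using reals_Archimedean2 by blast
  have main: "(\<Sum>q<Nn d n. resid d n b q) / real (Nn d n) < e"
    if n: "\<forall>j<d. Suc M \<le> n j" for n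
  proof -
    have pos: "\<forall>j<d. 0 < n j" using n by auto
    then have N: "Nn d n > 0" by (intro Nn_pos) auto
    have g: "resid d n b q \<le> nsq d (\<lambda>\<theta>. b \<theta> - t \<theta>)" if gq: "good d n L q" for q
    proof -
      obtain x where x: "\<And>\<theta>. t \<theta> * ub d n q \<theta> = (\<Sum>l<Nn d n. x l * ub d n l \<theta>)" using L[OF pos gq] by blast
      have "resid d n b q \<le> nsq d (\<lambda>\<theta>. b \<theta> * ub d n q \<theta> - (\<Sum>l<Nn d n. x l * ub d n l \<theta>))" by (rule resid_minimal[OF b])
      also have "\<dots> = nsq d (\<lambda>\<theta>. (b \<theta> - t \<theta>) * ub d n q \<theta>)" unfolding x[symmetric] by (simp add: left_diff_distrib)
      finally show ?thesis unfolding nsq_mult_ub .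
    qed
    have bad: "resid d n b q \<le> nsq d b" for q
      using resid_minimal[OF b, of n q "\<lambda>_. 0"] nsq_mult_ub[of d b n q] by simp
    have "(\<Sum>q<Nn d n. resid d n b q)
        \<le> (\<Sum>q<Nn d n. nsq d (\<lambda>\<theta>. b \<theta> - t \<theta>) + (if good d n L q then 0 else nsq d b))"
      using g bad by (intro sum_mono) (auto intro: order_trans[OF bad] simp: nsq_nonneg)
    also have "\<dots> = real (Nn d n) * nsq d (\<lambda>\<theta>. b \<theta> - t \<theta>) + nsq d b * real (card {q \<in> {..<Nn d n}. \<not> good d n L q})"
    proof -
      have "(\<Sum>q<Nn d n. if good d n L q then 0 else nsq d b) = (\<Sum>q\<in>{q \<in> {..<Nn d n}. \<not> good d n L q}. nsq d b)"
        by (subst sum.inter_filter) (auto intro!: sum.cong)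
      then show ?thesis by (simp add: sum.distrib)
    qed
    also have "\<dots> \<le> real (Nn d n) * nsq d (\<lambda>\<theta>. b \<theta> - t \<theta>) + nsq d b * ((\<Sum>j<d. 2 * real L / real (n j)) * real (Nn d n))"
      using pos by (intro add_left_mono mult_left_mono card_bad nsq_nonneg) auto
    also have "\<dots> \<le> real (Nn d n) * nsq d (\<lambda>\<theta>. b \<theta> - t \<theta>) + nsq d b * ((\<Sum>j<d. 2 * real L / real (Suc M)) * real (Nn d n))"
      using n by (intro add_left_mono mult_left_mono mult_right_mono sum_mono divide_left_mono nsq_nonneg) auto
    also have "\<dots> = real (Nn d n) * (nsq d (\<lambda>\<theta>. b \<theta> - t \<theta>) + K / real (Suc M))"
      by (simp add: K_def algebra_simps)
    finally have "(\<Sum>q<Nn d n. resid d n b q) / real (Nn d n) \<le> nsq d (\<lambda>\<theta>. b \<theta> - t \<theta>) + K / real (Suc M)"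
      using N by (simp add: field_simps)
    also have "\<dots> < e/2 + e/2"
    proof (rule add_less_le_mono[OF t(2)])
      have "2 * K < real (Suc M) * e"
      proof -
        have "2 * K / e < real (Suc M)" using M by simp
        then show ?thesis using e by (simp add: field_simps)
      qed
      then show "K / real (Suc M) \<le> e/2" by (simp add: field_simps)
    qed
    finally show ?thesis by simp
  qed
  have nonneg: "0 \<le> (\<Sum>q<Nn d n. resid d n b q) / real (Nn d n)" for n
    by (intro divide_nonneg_nonneg sum_nonneg) (auto simp: resid_def nsq_nonneg)
  show "\<forall>\<^sub>F n in mlim d. dist ((\<Sum>q<Nn d n. resid d n b q) / real (Nn d n)) 0 < e"
    unfolding eventually_mlim
  proof (intro exI[of _ "Suc M"] allI impI)
    fix n assume n: "\<forall>j<d. Suc M \<le> n j"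
    show "dist ((\<Sum>q<Nn d n. resid d n b q) / real (Nn d n)) 0 < e"
      using main[OF n] nonneg[of n] by (simp only: dist_real_def diff_zero abs_of_nonneg)
  qed
qed

section \<open>Reflections of the half-open torus\<close>

lemma tmod_ident: "-pi \<le> x \<Longrightarrow> x < pi \<Longrightarrow> tmod x = x"
proof -
  assume "-pi \<le> x" "x < pi"
  then have "\<lfloor>(x + pi) / (2 * pi)\<rfloor> = 0" by (intro floor_unique) (auto simp: field_simps)
  then show ?thesis by (simp add: tmod_def)
qed

lemma tmod_pi: "tmod pi = - pi"
proof -
  have "(pi + pi) / (2 * pi) = 1" by (simp add: field_simps)
  then show ?thesis unfolding tmod_def by simp
qed

lemma tmod_uminus: "-pi \<le> x \<Longrightarrow> x < pi \<Longrightarrow> tmod (- x) = (if x = -pi then -pi else - x)"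
  using tmod_ident[of "-x"] tmod_pi by auto

lemma tmod_uminus_range: "-pi \<le> x \<Longrightarrow> x < pi \<Longrightarrow> -pi \<le> tmod (- x) \<and> tmod (- x) < pi"
  by (auto simp: tmod_uminus)

lemma tmod_uminus_involution: "-pi \<le> x \<Longrightarrow> x < pi \<Longrightarrow> tmod (- tmod (- x)) = x"
  by (cases "x = -pi") (simp_all add: tmod_uminus tmod_pi tmod_ident)

lemma exp_tmod:
  "exp (\<i> * complex_of_real (real_of_int k * tmod x)) = exp (\<i> * complex_of_real (real_of_int k * x))"
proof -
  define l where "l = \<lfloor>(x + pi) / (2 * pi)\<rfloor>"
  have "\<i> * complex_of_real (real_of_int k * x) = \<i> * complex_of_real (real_of_int k * tmod x) + of_int (2 * (k * l)) * (of_real pi * \<i>)"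
    unfolding tmod_def l_def[symmetric] by (simp add: algebra_simps)
  then have "exp (\<i> * complex_of_real (real_of_int k * x)) = exp (\<i> * complex_of_real (real_of_int k * tmod x)) * exp (of_int (2 * (k * l)) * (of_real pi * \<i>))"
    by (simp only: exp_add)
  also have "exp (of_int (2 * (k * l)) * (of_real pi * \<i>)) = (1 :: complex)"
    using exp_integer_2pi[of "of_int (k * l)"] by (simp add: mult_ac)
  finally show ?thesis by simp
qed

text \<open>One form for \<open>tneg\<close> (all coordinates) and, on the torus, for
  \<open>rS\<close> (the coordinates in \<open>SL\<close>). Reflections compose by symmetric
  difference. The wrapping \<open>tmod\<close> matters only at -pi, whose negative falls outside the
  half-open interval and is sent back to -pi.\<close>

definition flp :: "nat \<Rightarrow> nat set \<Rightarrow> (nat \<Rightarrow> real) \<Rightarrow> (nat \<Rightarrow> real)" where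
  "flp d A \<theta> = (\<lambda>j. if j < d then (if j \<in> A then tmod (- \<theta> j) else \<theta> j) else undefined)"

lemma torus_coord: "\<theta> \<in> space (torus d) \<Longrightarrow> j < d \<Longrightarrow> -pi \<le> \<theta> j \<and> \<theta> j < pi"
  using PiE_mem[of \<theta> "{..<d}" "\<lambda>_. {-pi..<pi}" j] by (simp add: space_torus)

lemma torus_undefined: "\<theta> \<in> space (torus d) \<Longrightarrow> \<not> j < d \<Longrightarrow> \<theta> j = undefined"
  using PiE_arb[of \<theta> "{..<d}" "\<lambda>_. {-pi..<pi}" j] by (simp add: space_torus)

lemma flp_space:
  assumes "\<theta> \<in> space (torus d)" shows "flp d A \<theta> \<in> space (torus d)"
  unfolding space_torus
proof (rule PiE_I)
  fix j assume "j \<in> {..<d}"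
  then show "flp d A \<theta> j \<in> {-pi..<pi}"
    using torus_coord[OF assms, of j] tmod_uminus_range[of "\<theta> j"] by (simp add: flp_def)
qed (simp add: flp_def)

lemma flp_flp:
  assumes "\<theta> \<in> space (torus d)"
  shows "flp d A (flp d B \<theta>) = flp d ((A - B) \<union> (B - A)) \<theta>"
proof
  fix j
  show "flp d A (flp d B \<theta>) j = flp d ((A - B) \<union> (B - A)) \<theta> j"
    using torus_coord[OF assms, of j] tmod_uminus_involution[of "\<theta> j"] by (simp add: flp_def)
qed

lemma flp_empty: "\<theta> \<in> space (torus d) \<Longrightarrow> flp d {} \<theta> = \<theta>"
  using torus_undefined[of \<theta> d] by (auto simp: flp_def fun_eq_iff)

lemma tneg_eq_flp: "tneg d \<theta> = flp d {..<d} \<theta>"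
  by (auto simp: tneg_def flp_def)

lemma rS_eq_flp:
  assumes "\<theta> \<in> space (torus d)" shows "rS d SL \<theta> = flp d SL \<theta>"
proof
  fix j
  show "rS d SL \<theta> j = flp d SL \<theta> j"
    using torus_coord[OF assms, of j] tmod_ident[of "\<theta> j"] by (simp add: rS_def flp_def)
qed

lemma ech_flp: "ech d k (flp d A \<theta>) = ech d (\<lambda>j. if j \<in> A then - k j else k j) \<theta>"
proof -
  have e: "ech d l \<theta>' = (\<Prod>j<d. exp (\<i> * complex_of_real (real_of_int (l j) * \<theta>' j)))" for l \<theta>'
    unfolding ech_def ipS_def by (simp only: of_real_sum sum_distrib_left exp_sum[OF finite_lessThan])
  show ?thesis unfolding e
  proof (intro prod.cong refl)
    fix j assume j: "j \<in> {..<d}"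
    show "exp (\<i> * complex_of_real (real_of_int (k j) * flp d A \<theta> j))
      = exp (\<i> * complex_of_real (real_of_int (if j \<in> A then - k j else k j) * \<theta> j))"
      using j exp_tmod[of "k j" "- \<theta> j"] by (auto simp: flp_def)
  qed
qed

lemma measurable_circle_flip: "(\<lambda>x. tmod (- x)) \<in> measurable circle_measure circle_measure"
proof -
  have "(\<lambda>x. if x = -pi then -pi else - x) \<in> borel_measurable circle_measure"
    by (rule measurable_restrict_space1) simp
  then have "(\<lambda>x. tmod (- x)) \<in> borel_measurable circle_measure"
    by (subst measurable_cong[where g = "\<lambda>x. if x = -pi then -pi else - x"])
       (auto simp: circle_measure_simps tmod_uminus)
  then show ?thesis
    using tmod_uminus_range by (intro measurable_restrict_space2) (auto simp: circle_measure_simps)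
qed

text \<open>Wrapped and plain negation give preimages that differ at most at the two points -pi and
  pi, a null set.\<close>

lemma emeasure_circle_flip:
  assumes A: "A \<in> sets circle_measure"
  shows "emeasure circle_measure ((\<lambda>x. tmod (- x)) -` A \<inter> {-pi..<pi}) = emeasure circle_measure A"
proof -
  have AS: "A \<subseteq> {-pi..<pi}" using sets.sets_into_space[OF A] by (simp add: circle_measure_simps)
  have Ab: "A \<in> sets lborel" using A by (auto simp: sets_restrict_space)
  have em: "emeasure circle_measure B = emeasure lborel B" if "B \<subseteq> {-pi..<pi}" for B
    by (rule emeasure_restrict_space) (use that in auto)
  let ?B = "(\<lambda>x. tmod (- x)) -` A \<inter> {-pi..<pi}"
  have B: "?B \<in> sets circle_measure"
    using measurable_sets[OF measurable_circle_flip A] by (simp add: circle_measure_simps)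
  then have Bb: "?B \<in> sets lborel" by (auto simp: sets_restrict_space)
  have "emeasure lborel ?B = emeasure lborel (uminus -` A)"
  proof (rule emeasure_eq_AE)
    have "AE x in lborel. x \<noteq> pi" "AE x in lborel. x \<noteq> - pi" by (rule AE_lborel_singleton)+
    then show "AE x in lborel. x \<in> ?B \<longleftrightarrow> x \<in> uminus -` A"
    proof eventually_elim
      fix x assume x: "x \<noteq> pi" "x \<noteq> -pi"
      show "x \<in> ?B \<longleftrightarrow> x \<in> uminus -` A"
      proof (cases "x \<in> {-pi..<pi}")
        case True
        then show ?thesis using x by (simp add: tmod_uminus)
      next
        case False
        then have "- x \<notin> {-pi..<pi}" using x by auto
        then have "- x \<notin> A" using AS by blast
        then show ?thesis using False by auto
      qed
    qed
    show "uminus -` A \<in> sets lborel"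
      using measurable_sets[of uminus borel borel A] Ab by simp
  qed (rule Bb)
  also have "\<dots> = emeasure (distr lborel borel uminus) A"
    using Ab by (subst emeasure_distr) auto
  also have "\<dots> = emeasure lborel A" by (simp add: lborel_distr_uminus)
  finally show ?thesis using em[of ?B] em[OF AS] by auto
qed

lemma measurable_flp: "flp d A \<in> measurable (torus d) (torus d)"
proof -
  have "(\<lambda>\<theta> j. if j < d then (if j \<in> A then tmod (- \<theta> j) else \<theta> j) else undefined) \<in> measurable (torus d) (Pi\<^sub>M {..<d} (\<lambda>_. circle_measure))"
  proof (rule measurable_PiM_single')
    fix j assume j: "j \<in> {..<d}"
    have c: "(\<lambda>\<theta>. \<theta> j) \<in> measurable (torus d) circle_measure"
      unfolding torus_def using j by (intro measurable_component_singleton) auto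
    show "(\<lambda>\<theta>. if j < d then (if j \<in> A then tmod (- \<theta> j) else \<theta> j) else undefined) \<in> measurable (torus d) circle_measure"
      using c measurable_compose[OF c measurable_circle_flip] j by (cases "j \<in> A") auto
  next
    show "(\<lambda>\<theta> j. if j < d then (if j \<in> A then tmod (- \<theta> j) else \<theta> j) else undefined) \<in> space (torus d) \<rightarrow> ({..<d} \<rightarrow>\<^sub>E space circle_measure)"
      using flp_space[of _ d A] by (auto simp: flp_def space_torus circle_measure_simps)
  qed
  then show ?thesis by (simp add: flp_def[abs_def] torus_def)
qed

lemma distr_flp: "distr (torus d) (torus d) (flp d A) = torus d"
proof -
  interpret product_sigma_finite "\<lambda>_::nat. circle_measure" by (rule product_sigma_finite_circle)
  have "distr (torus d) (torus d) (flp d A) = Pi\<^sub>M {..<d} (\<lambda>_. circle_measure)"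
  proof (rule PiM_eqI)
    fix B assume B: "\<And>i. i \<in> {..<d} \<Longrightarrow> B i \<in> sets circle_measure"
    have BS: "B i \<subseteq> {-pi..<pi}" if "i < d" for i
      using sets.sets_into_space[OF B[of i]] that by (simp add: circle_measure_simps)
    define C where "C i = (if i \<in> A then (\<lambda>x. tmod (- x)) -` B i \<inter> {-pi..<pi} else B i)" for i
    have C: "C i \<in> sets circle_measure" if "i < d" for i
      using measurable_sets[OF measurable_circle_flip B[of i]] B[of i] that by (auto simp: C_def circle_measure_simps)
    have "flp d A -` (Pi\<^sub>E {..<d} B) \<inter> space (torus d) = Pi\<^sub>E {..<d} C"
    proof (intro equalityI subsetI)
      fix \<theta> assume "\<theta> \<in> flp d A -` (Pi\<^sub>E {..<d} B) \<inter> space (torus d)"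
      then have 1: "flp d A \<theta> \<in> Pi\<^sub>E {..<d} B" and 2: "\<theta> \<in> space (torus d)" by auto
      show "\<theta> \<in> Pi\<^sub>E {..<d} C"
      proof (rule PiE_I)
        fix j assume j: "j \<in> {..<d}"
        then show "\<theta> j \<in> C j" using PiE_mem[OF 1 j] torus_coord[OF 2, of j] by (auto simp: flp_def C_def)
      qed (use torus_undefined[OF 2] in auto)
    next
      fix \<theta> assume 1: "\<theta> \<in> Pi\<^sub>E {..<d} C"
      have CS: "C j \<subseteq> {-pi..<pi}" if "j < d" for j using BS[OF that] by (auto simp: C_def)
      have 2: "\<theta> \<in> space (torus d)" unfolding space_torus
      proof (rule PiE_I)
        fix j assume j: "j \<in> {..<d}"
        then show "\<theta> j \<in> {-pi..<pi}" using PiE_mem[OF 1 j] CS[of j] by blast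
      qed (use PiE_arb[OF 1] in auto)
      have "flp d A \<theta> \<in> Pi\<^sub>E {..<d} B"
      proof (rule PiE_I)
        fix j assume j: "j \<in> {..<d}"
        then show "flp d A \<theta> j \<in> B j" using PiE_mem[OF 1 j] by (auto simp: flp_def C_def split: if_splits)
      qed (auto simp: flp_def)
      then show "\<theta> \<in> flp d A -` (Pi\<^sub>E {..<d} B) \<inter> space (torus d)" using 2 by simp
    qed
    moreover have "Pi\<^sub>E {..<d} B \<in> sets (torus d)" unfolding torus_def using B by (intro sets_PiM_I_finite) auto
    ultimately have "emeasure (distr (torus d) (torus d) (flp d A)) (Pi\<^sub>E {..<d} B) = emeasure (torus d) (Pi\<^sub>E {..<d} C)"
      by (subst emeasure_distr[OF measurable_flp]) auto
    also have "\<dots> = (\<Prod>i<d. emeasure circle_measure (C i))"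
      unfolding torus_def using C by (intro emeasure_PiM) auto
    also have "\<dots> = (\<Prod>i<d. emeasure circle_measure (B i))"
    proof (intro prod.cong refl)
      fix i assume "i \<in> {..<d}"
      then show "emeasure circle_measure (C i) = emeasure circle_measure (B i)"
        unfolding C_def using emeasure_circle_flip[OF B[of i]] by simp
    qed
    finally show "emeasure (distr (torus d) (torus d) (flp d A)) (Pi\<^sub>E {..<d} B) = (\<Prod>i<d. emeasure circle_measure (B i))" .
  qed (auto simp: torus_def)
  then show ?thesis by (simp add: torus_def)
qed

lemma av_flp:
  assumes "f \<in> borel_measurable (torus d)"
  shows "av d (\<lambda>\<theta>. f (flp d A \<theta>)) = av d f"
  unfolding av_def using integral_distr[OF measurable_flp[of d A] assms] unfolding distr_flp by simp

lemma av_cong: "(\<And>\<theta>. \<theta> \<in> space (torus d) \<Longrightarrow> f \<theta> = g \<theta>) \<Longrightarrow> av d f = av d g"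
  unfolding av_def by (simp cong: Bochner_Integration.integral_cong)

lemma Linf_flp:
  assumes "Linf d f" shows "Linf d (\<lambda>\<theta>. f (flp d A \<theta>))"
proof -
  obtain B where B: "AE \<theta> in torus d. norm (f \<theta>) \<le> B" and m: "f \<in> borel_measurable (torus d)"
    using assms by (auto simp: Linf_def)
  have "AE \<theta> in distr (torus d) (torus d) (flp d A). norm (f \<theta>) \<le> B" using B unfolding distr_flp .
  then have "AE \<theta> in torus d. norm (f (flp d A \<theta>)) \<le> B" by (rule AE_distrD[OF measurable_flp])
  then show ?thesis using measurable_compose[OF measurable_flp m] by (auto simp: Linf_def)
qed

lemma Linf_cong:
  assumes "Linf d f" "\<And>\<theta>. \<theta> \<in> space (torus d) \<Longrightarrow> f \<theta> = g \<theta>"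
  shows "Linf d g"
  using trig_approx_cong[OF Linf_trig_approx[OF assms(1)] assms(2)] by (simp add: trig_approx_def)

section \<open>The block Toeplitz matrix behind \<open>Phi\<close>\<close>

definition Pidx :: "nat \<Rightarrow> (nat \<Rightarrow> nat) \<Rightarrow> nat \<Rightarrow> nat \<Rightarrow> nat" where
  "Pidx d n s i = (i mod (Nn d n * s)) div s"

definition Ridx :: "nat \<Rightarrow> (nat \<Rightarrow> nat) \<Rightarrow> nat \<Rightarrow> nat \<Rightarrow> nat" where
  "Ridx d n s i = (if i < Nn d n * s then 0 else s) + (i mod (Nn d n * s)) mod s"

text \<open>Block Toeplitz matrix of H with its rows ordered as \<open>Phi\<close> orders them:
  first the half (Z row or W row), then the multi-index, then the entry inside a block.
  \<open>Pidx\<close> reads off the multi-index position and \<open>Ridx\<close> the row of the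
  symbol, so \<open>Phi_toeplitz\<close> is an equality without any permutation.\<close>

definition TT :: "nat \<Rightarrow> (nat \<Rightarrow> nat) \<Rightarrow> nat \<Rightarrow> ((nat \<Rightarrow> real) \<Rightarrow> complex mat) \<Rightarrow> complex mat" where
  "TT d n s H = mat (2 * (Nn d n * s)) (2 * (Nn d n * s))
     (\<lambda>(i,j). tc d n (\<lambda>\<theta>. H \<theta> $$ (Ridx d n s i, Ridx d n s j)) (Pidx d n s i) (Pidx d n s j))"

lemma tc_eq_av:
  "tc d n f p q = av d (\<lambda>\<theta>. f \<theta> * cnj (ech d (\<lambda>j. int (lex_idx d n p j) - int (lex_idx d n q j)) \<theta>))"
proof -
  have "ub d n q \<theta> * cnj (ub d n p \<theta>) = cnj (ech d (\<lambda>j. int (lex_idx d n p j) - int (lex_idx d n q j)) \<theta>)" for \<theta>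
    unfolding cnj_ech ech_add[symmetric] by simp
  then show ?thesis unfolding tc_def by (simp add: mult.assoc)
qed

text \<open>Moving the unit j past the right exponential conjugates it, so the W-part carries a
  character with the frequencies in S_R negated. Reflecting those coordinates makes it an ordinary
  Fourier coefficient of a reflected W. Conjugating a coefficient amounts to reflecting all
  coordinates, which turns S_R into S_L. This explains the arguments of Z and W in
  \<open>Gsym\<close>.\<close>

lemma sandwich_coeff_eq:
  assumes SL: "SL \<subseteq> {..<d}"
    and Zm: "(\<lambda>\<theta>. Z \<theta> a b) \<in> borel_measurable (torus d)" and Wm: "(\<lambda>\<theta>. W \<theta> a b) \<in> borel_measurable (torus d)"
  shows "fst (sandwich_coeff d SL Z W k a b) = av d (\<lambda>\<theta>. Z \<theta> a b * cnj (ech d k \<theta>))"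
    and "snd (sandwich_coeff d SL Z W k a b) = av d (\<lambda>\<theta>. W (flp d ({..<d} - SL) \<theta>) a b * cnj (ech d k \<theta>))"
    and "- cnj (snd (sandwich_coeff d SL Z W k a b)) = av d (\<lambda>\<theta>. - cnj (W (flp d SL \<theta>) a b) * cnj (ech d k \<theta>))"
    and "cnj (fst (sandwich_coeff d SL Z W k a b)) = av d (\<lambda>\<theta>. cnj (Z (flp d {..<d} \<theta>) a b) * cnj (ech d k \<theta>))"
proof -
  let ?A = "{..<d} - SL"
  have split: "ipS {..<d} l \<theta> = ipS SL l \<theta> + ipS ?A l \<theta>" for l \<theta>
    unfolding ipS_def using sum.subset_diff[OF SL] by (simp add: add.commute)
  have cn: "cnj (exp (\<i> * complex_of_real x)) = exp (- \<i> * complex_of_real x)" for x by (simp add: exp_cnj)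
  have 1: "exp (- \<i> * complex_of_real (ipS SL k \<theta>)) * z * exp (- \<i> * complex_of_real (ipS ?A k \<theta>)) = z * cnj (ech d k \<theta>)" for \<theta> z
  proof -
    have ce: "cnj (ech d k \<theta>) = exp (- \<i> * complex_of_real (ipS {..<d} k \<theta>))" by (simp only: ech_def cn)
    show ?thesis unfolding ce split of_real_add distrib_left exp_add by (simp only: mult_ac)
  qed
  show F: "fst (sandwich_coeff d SL Z W k a b) = av d (\<lambda>\<theta>. Z \<theta> a b * cnj (ech d k \<theta>))"
    unfolding av_def by (simp only: sandwich_coeff_def Let_def qmul_def fst_conv snd_conv complex_cnj_zero
        mult_zero_left mult_zero_right diff_zero add_0_left add_0_right 1)
  have diffexp: "exp (- \<i> * complex_of_real (x - y)) = exp (- \<i> * complex_of_real x) * exp (\<i> * complex_of_real y)" for x y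
    by (simp add: exp_add[symmetric] algebra_simps)
  have 2: "exp (- \<i> * complex_of_real (ipS SL k \<theta>)) * w * cnj (exp (- \<i> * complex_of_real (ipS ?A k \<theta>))) = w * cnj (ech d k (flp d ?A \<theta>))" for \<theta> w
  proof -
    have "ipS {..<d} (\<lambda>j. if j \<in> ?A then - k j else k j) \<theta> = ipS SL k \<theta> - ipS ?A k \<theta>"
    proof -
      have "ipS SL (\<lambda>j. if j \<in> ?A then - k j else k j) \<theta> = ipS SL k \<theta>"
        unfolding ipS_def by (intro sum.cong) auto
      moreover have "ipS ?A (\<lambda>j. if j \<in> ?A then - k j else k j) \<theta> = - ipS ?A k \<theta>"
        unfolding ipS_def sum_negf[symmetric] by (intro sum.cong) auto
      ultimately show ?thesis unfolding split by simp
    qed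
    then have "cnj (ech d k (flp d ?A \<theta>)) = exp (- \<i> * complex_of_real (ipS SL k \<theta>)) * exp (\<i> * complex_of_real (ipS ?A k \<theta>))"
      by (subst ech_flp) (simp only: ech_def cn diffexp)
    moreover have "cnj (exp (- \<i> * complex_of_real (ipS ?A k \<theta>))) = exp (\<i> * complex_of_real (ipS ?A k \<theta>))"
      by (simp add: exp_cnj)
    ultimately show ?thesis by (simp only: mult_ac)
  qed
  have S0: "snd (sandwich_coeff d SL Z W k a b) = av d (\<lambda>\<theta>. W \<theta> a b * cnj (ech d k (flp d ?A \<theta>)))"
    unfolding av_def by (simp only: sandwich_coeff_def Let_def qmul_def fst_conv snd_conv complex_cnj_zero
        mult_zero_left mult_zero_right diff_zero add_0_left add_0_right 2)
  have cm: "(\<lambda>\<theta>. cnj (g \<theta>)) \<in> borel_measurable (torus d)" if "g \<in> borel_measurable (torus d)" for g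
    using that by (intro measurable_compose[OF that borel_measurable_continuous_onI[of cnj]] continuous_intros)
  have em: "(\<lambda>\<theta>. cnj (ech d k (flp d B \<theta>))) \<in> borel_measurable (torus d)" for B
    by (intro cm measurable_compose[OF measurable_flp measurable_ech])
  have "snd (sandwich_coeff d SL Z W k a b) = av d (\<lambda>\<theta>. W (flp d ?A \<theta>) a b * cnj (ech d k (flp d ?A (flp d ?A \<theta>))))"
    unfolding S0 using Wm em by (intro av_flp[symmetric] borel_measurable_times) auto
  also have "\<dots> = av d (\<lambda>\<theta>. W (flp d ?A \<theta>) a b * cnj (ech d k \<theta>))"
    by (intro av_cong) (simp add: flp_flp flp_empty)
  finally show S: "snd (sandwich_coeff d SL Z W k a b) = av d (\<lambda>\<theta>. W (flp d ?A \<theta>) a b * cnj (ech d k \<theta>))" .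
  have full: "ech d k (flp d {..<d} \<theta>) = cnj (ech d k \<theta>)" for \<theta>
    unfolding ech_flp cnj_ech by (rule ech_cong) simp
  \<comment> \<open>Reflecting in S_R and then everywhere reflects in \<open>SL\<close>.\<close>
  have sd: "(?A - {..<d}) \<union> ({..<d} - ?A) = SL" using SL by auto
  have mW: "(\<lambda>\<theta>. - cnj (W (flp d ?A \<theta>) a b) * ech d k \<theta>) \<in> borel_measurable (torus d)"
    by (intro borel_measurable_times borel_measurable_uminus cm measurable_compose[OF measurable_flp Wm] measurable_ech)
  have "- cnj (snd (sandwich_coeff d SL Z W k a b)) = av d (\<lambda>\<theta>. - cnj (W (flp d ?A \<theta>) a b) * ech d k \<theta>)"
    unfolding S av_cnj[symmetric] using av_cmult[of d "-1"] by simp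
  also have "\<dots> = av d (\<lambda>\<theta>. - cnj (W (flp d ?A (flp d {..<d} \<theta>)) a b) * ech d k (flp d {..<d} \<theta>))"
    by (rule av_flp[OF mW, symmetric])
  also have "\<dots> = av d (\<lambda>\<theta>. - cnj (W (flp d SL \<theta>) a b) * cnj (ech d k \<theta>))"
    by (intro av_cong) (simp only: full flp_flp sd)
  finally show "- cnj (snd (sandwich_coeff d SL Z W k a b)) = av d (\<lambda>\<theta>. - cnj (W (flp d SL \<theta>) a b) * cnj (ech d k \<theta>))" .
  have mZ: "(\<lambda>\<theta>. cnj (Z \<theta> a b) * ech d k \<theta>) \<in> borel_measurable (torus d)"
    by (intro borel_measurable_times cm Zm measurable_ech)
  have "cnj (fst (sandwich_coeff d SL Z W k a b)) = av d (\<lambda>\<theta>. cnj (Z \<theta> a b) * ech d k \<theta>)"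
    unfolding F av_cnj[symmetric] by simp
  also have "\<dots> = av d (\<lambda>\<theta>. cnj (Z (flp d {..<d} \<theta>) a b) * ech d k (flp d {..<d} \<theta>))"
    by (rule av_flp[OF mZ, symmetric])
  finally show "cnj (fst (sandwich_coeff d SL Z W k a b)) = av d (\<lambda>\<theta>. cnj (Z (flp d {..<d} \<theta>) a b) * cnj (ech d k \<theta>))"
    unfolding full .
qed

lemma Gsym_index:
  assumes \<theta>: "\<theta> \<in> space (torus d)" and "i < 2 * s" "j < 2 * s"
  shows "Gsym d SL s Z W \<theta> $$ (i,j) = (if i < s \<and> j < s then Z \<theta> i j
     else if i < s then W (flp d ({..<d} - SL) \<theta>) i (j - s)
     else if j < s then - cnj (W (flp d SL \<theta>) (i - s) j)
     else cnj (Z (flp d {..<d} \<theta>) (i - s) (j - s)))"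
proof -
  have r: "rS d SL (tneg d \<theta>) = flp d ({..<d} - SL) \<theta>"
  proof -
    have "rS d SL (tneg d \<theta>) = flp d SL (flp d {..<d} \<theta>)"
      unfolding tneg_eq_flp by (rule rS_eq_flp[OF flp_space[OF \<theta>]])
    also have "\<dots> = flp d ({..<d} - SL) \<theta>" unfolding flp_flp[OF \<theta>] by (auto simp: flp_def fun_eq_iff)
    finally show ?thesis .
  qed
  show ?thesis unfolding Gsym_def using assms by (simp add: r[unfolded tneg_eq_flp] rS_eq_flp[OF \<theta>] tneg_eq_flp)
qed

lemma Phi_toeplitz:
  assumes s: "s \<ge> 1" and SL: "SL \<subseteq> {..<d}"
    and Zm: "\<And>a b. a < s \<Longrightarrow> b < s \<Longrightarrow> (\<lambda>\<theta>. Z \<theta> a b) \<in> borel_measurable (torus d)"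
    and Wm: "\<And>a b. a < s \<Longrightarrow> b < s \<Longrightarrow> (\<lambda>\<theta>. W \<theta> a b) \<in> borel_measurable (torus d)"
  shows "Phi (toeplitz d SL s Z W n) = TT d n s (Gsym d SL s Z W)"
proof (rule eq_matI)
  define m where "m = Nn d n * s"
  show "dim_row (Phi (toeplitz d SL s Z W n)) = dim_row (TT d n s (Gsym d SL s Z W))"
    "dim_col (Phi (toeplitz d SL s Z W n)) = dim_col (TT d n s (Gsym d SL s Z W))"
    by (simp_all add: Phi_def toeplitz_def TT_def Let_def)
  fix i j assume "i < dim_row (TT d n s (Gsym d SL s Z W))" "j < dim_col (TT d n s (Gsym d SL s Z W))"
  then have ij: "i < 2 * m" "j < 2 * m" by (auto simp: TT_def m_def)
  define i' j' where "i' = i mod m" and "j' = j mod m"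
  have i': "i' = (if i < m then i else i - m)" "j' = (if j < m then j else j - m)"
    using ij unfolding i'_def j'_def by (auto simp: mod_if)
  have lt: "i' < m" "j' < m" using ij i' by auto
  have sm: "i' mod s < s" "j' mod s < s" using s by auto
  define k where "k l = int (lex_idx d n (i' div s) l) - int (lex_idx d n (j' div s) l)" for l
  define c where "c = sandwich_coeff d SL Z W k (i' mod s) (j' mod s)"
  note sc = sandwich_coeff_eq[where Z = Z and W = W and a = "i' mod s" and b = "j' mod s" and k = k,
      OF SL Zm[OF sm] Wm[OF sm], folded c_def]
  have R: "Ridx d n s i = (if i < m then 0 else s) + i' mod s" "Ridx d n s j = (if j < m then 0 else s) + j' mod s"
    by (simp_all add: Ridx_def m_def i'_def j'_def)
  have "(if i < m then 0 else s) \<le> s" "(if j < m then 0 else s) \<le> s" by auto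
  then have Rlt: "Ridx d n s i < 2 * s" "Ridx d n s j < 2 * s" unfolding R using sm by linarith+
  have "TT d n s (Gsym d SL s Z W) $$ (i,j)
      = av d (\<lambda>\<theta>. Gsym d SL s Z W \<theta> $$ (Ridx d n s i, Ridx d n s j) * cnj (ech d k \<theta>))"
    using ij unfolding TT_def m_def tc_eq_av k_def[abs_def] i'_def j'_def by (simp add: Pidx_def)
  also have "\<dots> = (if i < m \<and> j < m then fst c else if i < m then snd c else if j < m then - cnj (snd c) else cnj (fst c))"
  proof -
    consider "i < m" "j < m" | "i < m" "\<not> j < m" | "\<not> i < m" "j < m" | "\<not> i < m" "\<not> j < m" by blast
    then show ?thesis
    proof cases
      case 1 then show ?thesis using sm by (simp add: sc(1)) (intro av_cong, simp add: Gsym_index[OF _ Rlt], simp add: R)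
    next
      case 2 then show ?thesis using sm by (simp add: sc(2)) (intro av_cong, simp add: Gsym_index[OF _ Rlt], simp add: R)
    next
      case 3 then show ?thesis using sm by (simp add: sc(3)) (intro av_cong, simp add: Gsym_index[OF _ Rlt], simp add: R)
    next
      case 4 then show ?thesis using sm by (simp add: sc(4)) (intro av_cong, simp add: Gsym_index[OF _ Rlt], simp add: R)
    qed
  qed
  also have "\<dots> = Phi (toeplitz d SL s Z W n) $$ (i,j)"
    using ij lt i' unfolding Phi_def toeplitz_def Let_def c_def k_def[abs_def] by (auto simp: m_def[symmetric])
  finally show "Phi (toeplitz d SL s Z W n) $$ (i,j) = TT d n s (Gsym d SL s Z W) $$ (i,j)" by simp
qed

lemma Linf_Gsym:
  assumes SL: "SL \<subseteq> {..<d}"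
    and Z: "\<And>a b. a < s \<Longrightarrow> b < s \<Longrightarrow> Linf d (\<lambda>\<theta>. Z \<theta> a b)"
    and W: "\<And>a b. a < s \<Longrightarrow> b < s \<Longrightarrow> Linf d (\<lambda>\<theta>. W \<theta> a b)"
    and ij: "i < 2 * s" "j < 2 * s"
  shows "Linf d (\<lambda>\<theta>. Gsym d SL s Z W \<theta> $$ (i,j))"
proof -
  have "Linf d (\<lambda>\<theta>. if i < s \<and> j < s then Z \<theta> i j
     else if i < s then W (flp d ({..<d} - SL) \<theta>) i (j - s)
     else if j < s then - cnj (W (flp d SL \<theta>) (i - s) j)
     else cnj (Z (flp d {..<d} \<theta>) (i - s) (j - s)))"
  proof -
    consider "i < s" "j < s" | "i < s" "\<not> j < s" | "\<not> i < s" "j < s" | "\<not> i < s" "\<not> j < s" by blast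
    then show ?thesis
    proof cases
      case 1 then show ?thesis using Z by simp
    next
      case 2
      then have "j - s < s" using ij by auto
      then show ?thesis using 2 Linf_flp[OF W, of i "j - s"] by simp
    next
      case 3
      then have "i - s < s" using ij by auto
      then show ?thesis using 3 Linf_cmult[OF Linf_cnj[OF Linf_flp[OF W]], of "i - s" j "-1"] by simp
    next
      case 4
      then have "i - s < s" "j - s < s" using ij by auto
      then show ?thesis using 4 Linf_cnj[OF Linf_flp[OF Z]] by simp
    qed
  qed
  then show ?thesis by (rule Linf_cong) (simp add: Gsym_index ij)
qed

section \<open>Matrix-valued symbols\<close>

text \<open>Inverse of the pair (\<open>Pidx\<close>, \<open>Ridx\<close>), by
  \<open>Jidx_props\<close> and \<open>PR_props\<close>; through \<open>sum_Jidx\<close> every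
  matrix sum becomes a sum over positions and symbol rows.\<close>

definition Jidx :: "nat \<Rightarrow> (nat \<Rightarrow> nat) \<Rightarrow> nat \<Rightarrow> nat \<Rightarrow> nat \<Rightarrow> nat" where
  "Jidx d n s q b = (if b < s then q * s + b else Nn d n * s + (q * s + (b - s)))"

lemma mult_add_less:
  fixes q s b N :: nat
  assumes "q < N" "b < s" shows "q * s + b < N * s"
proof -
  have "q * s + b < q * s + s" using assms by simp
  also have "\<dots> = Suc q * s" by simp
  also have "\<dots> \<le> N * s" using assms by (intro mult_right_mono) auto
  finally show ?thesis .
qed

lemma Jidx_props:
  assumes "q < Nn d n" "b < 2 * s"
  shows "Jidx d n s q b < 2 * (Nn d n * s)" "Pidx d n s (Jidx d n s q b) = q" "Ridx d n s (Jidx d n s q b) = b"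
proof -
  have s: "s > 0" using assms by auto
  show "Jidx d n s q b < 2 * (Nn d n * s)" "Pidx d n s (Jidx d n s q b) = q" "Ridx d n s (Jidx d n s q b) = b"
  proof (atomize (full), cases "b < s")
    case True
    then show "Jidx d n s q b < 2 * (Nn d n * s) \<and> Pidx d n s (Jidx d n s q b) = q \<and> Ridx d n s (Jidx d n s q b) = b"
      using mult_add_less[OF assms(1) True] by (simp add: Jidx_def Pidx_def Ridx_def)
  next
    case False
    then obtain c where c: "b = s + c" by (metis le_Suc_ex not_less)
    then have "c < s" using assms by simp
    then show "Jidx d n s q b < 2 * (Nn d n * s) \<and> Pidx d n s (Jidx d n s q b) = q \<and> Ridx d n s (Jidx d n s q b) = b"
      using mult_add_less[OF assms(1) \<open>c < s\<close>] by (simp add: Jidx_def Pidx_def Ridx_def c mult.commute[of s "Nn d n"])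
  qed
qed

lemma PR_props:
  assumes "i < 2 * (Nn d n * s)"
  shows "Pidx d n s i < Nn d n" "Ridx d n s i < 2 * s" "Jidx d n s (Pidx d n s i) (Ridx d n s i) = i"
proof -
  have s: "s > 0" and N: "Nn d n > 0" using assms by (auto intro!: Nat.gr0I)
  define m where "m = Nn d n * s"
  define i' where "i' = i mod m"
  have i': "i' = (if i < m then i else i - m)" "i' < m"
    using assms N s unfolding i'_def m_def[symmetric] by (auto simp: mod_if m_def)
  have "i' div s < Nn d n" using i'(2) unfolding m_def by (rule less_mult_imp_div_less)
  then show "Pidx d n s i < Nn d n" by (simp add: Pidx_def i'_def m_def)
  have ms: "i' mod s < s" using s by simp
  have R: "Ridx d n s i = (if i < m then 0 else s) + i' mod s" by (simp add: Ridx_def i'_def m_def)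
  show "Ridx d n s i < 2 * s" using R ms by (cases "i < m") auto
  have "i' div s * s + i' mod s = i'" by simp
  then show "Jidx d n s (Pidx d n s i) (Ridx d n s i) = i"
    using ms i' R by (cases "i < m") (auto simp: Jidx_def Pidx_def i'_def m_def)
qed

lemma sum_Jidx:
  "(\<Sum>i<2 * (Nn d n * s). f i) = (\<Sum>q<Nn d n. \<Sum>b<2 * s. f (Jidx d n s q b))"
proof -
  have "(\<Sum>q<Nn d n. \<Sum>b<2 * s. f (Jidx d n s q b)) = (\<Sum>(q,b)\<in>{..<Nn d n} \<times> {..<2 * s}. f (Jidx d n s q b))"
    by (rule sum.cartesian_product)
  also have "\<dots> = (\<Sum>i<2 * (Nn d n * s). f i)"
    by (rule sum.reindex_bij_witness[where i = "\<lambda>i. (Pidx d n s i, Ridx d n s i)" and j = "\<lambda>(q,b). Jidx d n s q b"])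
       (auto simp: Jidx_props PR_props)
  finally show ?thesis by simp
qed

lemma TT_carrier[simp]: "TT d n s H \<in> carrier_mat (2 * (Nn d n * s)) (2 * (Nn d n * s))"
  by (simp add: TT_def)

lemma TT_Jidx:
  assumes "p < Nn d n" "a < 2 * s" "q < Nn d n" "b < 2 * s"
  shows "TT d n s H $$ (Jidx d n s p a, Jidx d n s q b) = tc d n (\<lambda>\<theta>. H \<theta> $$ (a,b)) p q"
  using assms by (simp add: TT_def Jidx_props)

lemma norm_sum_square_le:
  fixes z :: "'i \<Rightarrow> complex"
  shows "(norm (\<Sum>i\<in>I. z i))\<^sup>2 \<le> real (card I) * (\<Sum>i\<in>I. (norm (z i))\<^sup>2)"
proof -
  have "(norm (\<Sum>i\<in>I. z i))\<^sup>2 \<le> (\<Sum>i\<in>I. norm (z i))\<^sup>2" by (intro power_mono norm_sum) auto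
  also have "\<dots> \<le> (\<Sum>i\<in>I. (norm (z i))\<^sup>2) * real (card I)" by (rule sum_squared_le_sum_of_squares)
  finally show ?thesis by (simp add: mult.commute)
qed

lemma fro2_nonneg: "fro2 A \<ge> 0"
  by (auto simp: fro2_def intro!: sum_nonneg)

lemma fro2_add_le:
  assumes "A \<in> carrier_mat k l" "B \<in> carrier_mat k l"
  shows "fro2 (A + B) \<le> 2 * fro2 A + 2 * fro2 B"
proof -
  have "fro2 (A + B) = (\<Sum>i<k. \<Sum>j<l. (norm (A $$ (i,j) + B $$ (i,j)))\<^sup>2)"
    unfolding fro2_def using assms by (auto intro!: sum.cong)
  also have "\<dots> \<le> (\<Sum>i<k. \<Sum>j<l. 2 * (norm (A $$ (i,j)))\<^sup>2 + 2 * (norm (B $$ (i,j)))\<^sup>2)"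
    by (intro sum_mono norm_add_square_le)
  also have "\<dots> = 2 * fro2 A + 2 * fro2 B"
    unfolding fro2_def using assms by (simp add: sum.distrib sum_distrib_left)
  finally show ?thesis .
qed

lemma fro2_smult: "fro2 (c \<cdot>\<^sub>m A) = (norm c)\<^sup>2 * fro2 A"
  by (simp add: fro2_def norm_mult power_mult_distrib sum_distrib_left)

lemma fro2_madj: "fro2 (madj A) = fro2 A"
proof -
  have "fro2 (madj A) = (\<Sum>i<dim_col A. \<Sum>j<dim_row A. (norm (A $$ (j,i)))\<^sup>2)"
    unfolding fro2_def by (auto simp: madj_def intro!: sum.cong)
  then show ?thesis unfolding fro2_def by (subst (asm) sum.swap)
qed

text \<open>C bounds the squared operator norm. Allowing any number of columns lets the same bound
  serve eigenvectors (one column) and Frobenius norms of matrix products.\<close>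

definition opb :: "nat \<Rightarrow> real \<Rightarrow> complex mat \<Rightarrow> bool" where
  "opb k C A \<longleftrightarrow> (\<forall>r. \<forall>X\<in>carrier_mat k r. fro2 (A * X) \<le> C * fro2 X)"

definition Lmat :: "nat \<Rightarrow> nat \<Rightarrow> ((nat \<Rightarrow> real) \<Rightarrow> complex mat) \<Rightarrow> bool" where
  "Lmat d m H \<longleftrightarrow> (\<forall>\<theta>. H \<theta> \<in> carrier_mat m m) \<and> (\<forall>a<m. \<forall>b<m. Linf d (\<lambda>\<theta>. H \<theta> $$ (a,b)))"

lemma Lmat_bound:
  assumes "Lmat d m H"
  obtains K where "K > 0" "\<And>a b. a < m \<Longrightarrow> b < m \<Longrightarrow> AE \<theta> in torus d. norm (H \<theta> $$ (a,b)) \<le> K"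
proof -
  have "\<exists>B>0. AE \<theta> in torus d. norm (H \<theta> $$ (a,b)) \<le> B" if "a < m" "b < m" for a b
    using Linf_bound[of d "\<lambda>\<theta>. H \<theta> $$ (a,b)"] assms that unfolding Lmat_def by metis
  then obtain B where B: "\<And>a b. a < m \<Longrightarrow> b < m \<Longrightarrow> B a b > 0 \<and> (AE \<theta> in torus d. norm (H \<theta> $$ (a,b)) \<le> B a b)"
    by metis
  define K where "K = 1 + (\<Sum>a<m. \<Sum>b<m. B a b)"
  have "B a b \<le> K" if "a < m" "b < m" for a b
  proof -
    have "B a b \<le> (\<Sum>b<m. B a b)" using that B by (intro member_le_sum) (auto intro: less_imp_le)
    also have "\<dots> \<le> (\<Sum>a<m. \<Sum>b<m. B a b)"
      using that B by (intro member_le_sum[of a "{..<m}" "\<lambda>a. \<Sum>b<m. B a b"]) (auto intro!: sum_nonneg intro: less_imp_le)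
    finally show ?thesis by (simp add: K_def)
  qed
  then have "AE \<theta> in torus d. norm (H \<theta> $$ (a,b)) \<le> K" if "a < m" "b < m" for a b
    using B[OF that] that by (auto elim!: eventually_mono intro: order_trans)
  moreover have "K > 0" unfolding K_def using B by (intro add_pos_nonneg sum_nonneg) (auto intro: less_imp_le)
  ultimately show ?thesis using that by blast
qed

text \<open>The matrix consists of 2s by 2s scalar Toeplitz blocks of operator norm at most K.
  Cauchy-Schwarz along a row of blocks gives one factor 2s, summation over the block rows the
  other.\<close>

lemma opb_TT:
  assumes H: "Lmat d (2 * s) H"
    and K: "\<And>a b. a < 2 * s \<Longrightarrow> b < 2 * s \<Longrightarrow> AE \<theta> in torus d. norm (H \<theta> $$ (a,b)) \<le> K"
  shows "opb (2 * (Nn d n * s)) ((real (2 * s))\<^sup>2 * K\<^sup>2) (TT d n s H)"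
  unfolding opb_def
proof (intro allI ballI)
  let ?D = "2 * (Nn d n * s)" and ?N = "Nn d n" and ?m = "2 * s" and ?J = "Jidx d n s"
  fix r and X :: "complex mat" assume X: "X \<in> carrier_mat ?D r"
  have col: "(\<Sum>i<?D. (norm ((TT d n s H * X) $$ (i,c)))\<^sup>2) \<le> ((real ?m)\<^sup>2 * K\<^sup>2) * (\<Sum>j<?D. (norm (X $$ (j,c)))\<^sup>2)"
    if c: "c < r" for c
  proof -
    define x where "x q b = X $$ (?J q b, c)" for q b
    have ent: "(TT d n s H * X) $$ (?J p a, c) = (\<Sum>b<?m. \<Sum>q<?N. tc d n (\<lambda>\<theta>. H \<theta> $$ (a,b)) p q * x q b)"
      if "p < ?N" "a < ?m" for p a
    proof -
      have "(TT d n s H * X) $$ (?J p a, c) = (\<Sum>j<?D. TT d n s H $$ (?J p a, j) * X $$ (j,c))"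
        using that c Jidx_props(1) by (intro index_mult_mat_sum[OF TT_carrier X]) auto
      also have "\<dots> = (\<Sum>q<?N. \<Sum>b<?m. tc d n (\<lambda>\<theta>. H \<theta> $$ (a,b)) p q * x q b)"
        unfolding sum_Jidx using that by (intro sum.cong refl) (simp add: TT_Jidx x_def)
      finally show ?thesis by (subst sum.swap)
    qed
    have "(\<Sum>i<?D. (norm ((TT d n s H * X) $$ (i,c)))\<^sup>2)
        = (\<Sum>a<?m. \<Sum>p<?N. (norm (\<Sum>b<?m. \<Sum>q<?N. tc d n (\<lambda>\<theta>. H \<theta> $$ (a,b)) p q * x q b))\<^sup>2)"
      unfolding sum_Jidx by (subst sum.swap) (auto simp: ent intro!: sum.cong)
    also have "\<dots> \<le> (\<Sum>a<?m. \<Sum>p<?N. real ?m * (\<Sum>b<?m. (norm (\<Sum>q<?N. tc d n (\<lambda>\<theta>. H \<theta> $$ (a,b)) p q * x q b))\<^sup>2))"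
      using norm_sum_square_le[where I = "{..<?m}"] by (intro sum_mono) simp
    also have "\<dots> = (\<Sum>a<?m. real ?m * (\<Sum>b<?m. \<Sum>p<?N. (norm (\<Sum>q<?N. tc d n (\<lambda>\<theta>. H \<theta> $$ (a,b)) p q * x q b))\<^sup>2))"
      unfolding sum_distrib_left[symmetric] by (subst (2) sum.swap) simp
    also have "\<dots> \<le> (\<Sum>a<?m. real ?m * (\<Sum>b<?m. K\<^sup>2 * (\<Sum>q<?N. (norm (x q b))\<^sup>2)))"
      using H K unfolding Lmat_def by (intro sum_mono mult_left_mono toeplitz_scalar_op_bound) auto
    also have "\<dots> = ((real ?m)\<^sup>2 * K\<^sup>2) * (\<Sum>b<?m. \<Sum>q<?N. (norm (x q b))\<^sup>2)"
      by (simp add: sum_distrib_left power2_eq_square mult_ac)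
    also have "(\<Sum>b<?m. \<Sum>q<?N. (norm (x q b))\<^sup>2) = (\<Sum>j<?D. (norm (X $$ (j,c)))\<^sup>2)"
      unfolding sum_Jidx x_def by (rule sum.swap)
    finally show ?thesis .
  qed
  have "fro2 (TT d n s H * X) = (\<Sum>c<r. \<Sum>i<?D. (norm ((TT d n s H * X) $$ (i,c)))\<^sup>2)"
    unfolding fro2_def using X carrier_matD[OF TT_carrier[of d n s H]]
    by (simp del: index_mult_mat(1)) (rule sum.swap)
  also have "\<dots> \<le> (\<Sum>c<r. ((real ?m)\<^sup>2 * K\<^sup>2) * (\<Sum>j<?D. (norm (X $$ (j,c)))\<^sup>2))"
    using col by (intro sum_mono) auto
  also have "\<dots> = ((real ?m)\<^sup>2 * K\<^sup>2) * fro2 X"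
    unfolding fro2_def using X by (simp only: carrier_matD sum_distrib_left[symmetric] sum.swap[of _ "{..<r}"])
  finally show "fro2 (TT d n s H * X) \<le> ((real ?m)\<^sup>2 * K\<^sup>2) * fro2 X" .
qed

lemma madj_TT:
  assumes "\<And>\<theta>. H \<theta> \<in> carrier_mat (2 * s) (2 * s)"
  shows "madj (TT d n s H) = TT d n s (\<lambda>\<theta>. madj (H \<theta>))"
proof (rule eq_matI)
  fix i j assume "i < dim_row (TT d n s (\<lambda>\<theta>. madj (H \<theta>)))" "j < dim_col (TT d n s (\<lambda>\<theta>. madj (H \<theta>)))"
  then have ij: "i < 2 * (Nn d n * s)" "j < 2 * (Nn d n * s)" by (auto simp: TT_def)
  have "madj (H \<theta>) $$ (Ridx d n s i, Ridx d n s j) = cnj (H \<theta> $$ (Ridx d n s j, Ridx d n s i))" for \<theta>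
    using PR_props(2)[OF ij(1)] PR_props(2)[OF ij(2)] carrier_matD[OF assms[of \<theta>]] by (simp add: madj_def)
  then show "madj (TT d n s H) $$ (i,j) = TT d n s (\<lambda>\<theta>. madj (H \<theta>)) $$ (i,j)"
    using ij by (simp add: madj_def TT_def tc_def av_cnj[symmetric] mult_ac)
qed (auto simp: madj_def TT_def)

text \<open>Adjoints reduce multiplication from the right to \<open>opb_TT\<close>; the adjoint of a
  Toeplitz matrix belongs to the pointwise adjoint symbol.\<close>

lemma fro2_mult_TT_right:
  assumes H: "Lmat d (2 * s) H"
    and K: "\<And>a b. a < 2 * s \<Longrightarrow> b < 2 * s \<Longrightarrow> AE \<theta> in torus d. norm (H \<theta> $$ (a,b)) \<le> K"
    and X: "X \<in> carrier_mat r (2 * (Nn d n * s))"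
  shows "fro2 (X * TT d n s H) \<le> (real (2 * s))\<^sup>2 * K\<^sup>2 * fro2 X"
proof -
  have Hc: "\<And>\<theta>. H \<theta> \<in> carrier_mat (2 * s) (2 * s)" using H by (simp add: Lmat_def)
  have ent: "madj (H \<theta>) $$ (a,b) = cnj (H \<theta> $$ (b,a))" if "a < 2 * s" "b < 2 * s" for a b \<theta>
    using that carrier_matD[OF Hc[of \<theta>]] by (simp add: madj_def)
  have "Lmat d (2 * s) (\<lambda>\<theta>. madj (H \<theta>))"
    unfolding Lmat_def using Hc H by (auto simp: ent Lmat_def intro: Linf_cnj)
  then have "opb (2 * (Nn d n * s)) ((real (2 * s))\<^sup>2 * K\<^sup>2) (TT d n s (\<lambda>\<theta>. madj (H \<theta>)))"
    by (rule opb_TT) (simp add: ent K)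
  then have "fro2 (madj (TT d n s H) * madj X) \<le> (real (2 * s))\<^sup>2 * K\<^sup>2 * fro2 (madj X)"
    unfolding opb_def madj_TT[OF Hc] using madj_carrier[OF X] by blast
  then show ?thesis by (simp only: madj_mult[OF X TT_carrier, symmetric] fro2_madj)
qed

lemma tc_sum: "(\<And>c. c \<in> I \<Longrightarrow> Linf d (f c)) \<Longrightarrow> tc d n (\<lambda>\<theta>. \<Sum>c\<in>I. f c \<theta>) p q = (\<Sum>c\<in>I. tc d n (f c) p q)"
  unfolding tc_def by (simp add: sum_distrib_right av_sum Linf_mult Linf_cnj Linf_ech)

lemma tc_add: "Linf d f \<Longrightarrow> Linf d g \<Longrightarrow> tc d n (\<lambda>\<theta>. f \<theta> + g \<theta>) p q = tc d n f p q + tc d n g p q"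
  unfolding tc_def by (simp add: distrib_right av_add Linf_mult Linf_cnj Linf_ech)

lemma tc_cmult: "tc d n (\<lambda>\<theta>. c * f \<theta>) p q = c * tc d n f p q"
  unfolding tc_def by (simp add: mult.assoc av_cmult)

lemma TT_mult_fro2:
  assumes H: "Lmat d (2 * s) H" and G: "Lmat d (2 * s) G"
    and K: "\<And>a b. a < 2 * s \<Longrightarrow> b < 2 * s \<Longrightarrow> AE \<theta> in torus d. norm (H \<theta> $$ (a,b)) \<le> K"
  shows "fro2 (TT d n s H * TT d n s G - TT d n s (\<lambda>\<theta>. H \<theta> * G \<theta>))
    \<le> (real (2 * s))\<^sup>2 * K\<^sup>2 * (\<Sum>b<2 * s. \<Sum>c<2 * s. \<Sum>q<Nn d n. resid d n (\<lambda>\<theta>. G \<theta> $$ (c,b)) q)"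
proof -
  let ?D = "2 * (Nn d n * s)" and ?N = "Nn d n" and ?m = "2 * s" and ?J = "Jidx d n s"
  define E where "E = TT d n s H * TT d n s G - TT d n s (\<lambda>\<theta>. H \<theta> * G \<theta>)"
  have E: "E \<in> carrier_mat ?D ?D" unfolding E_def by (intro minus_carrier_mat) simp
  have Lh: "Linf d (\<lambda>\<theta>. H \<theta> $$ (a,b))" and Lg: "Linf d (\<lambda>\<theta>. G \<theta> $$ (a,b))" if "a < ?m" "b < ?m" for a b
    using H G that by (auto simp: Lmat_def)
  \<comment> \<open>The scalar compression error for the pair (a,c), (c,b). The sums are reordered
    below so that p is summed innermost, one column q at a time, as
    \<open>toeplitz_scalar_product\<close> requires.\<close>
  define \<delta> where "\<delta> a b c p q = tc d n (\<lambda>\<theta>. H \<theta> $$ (a,c) * G \<theta> $$ (c,b)) p q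
      - (\<Sum>l<?N. tc d n (\<lambda>\<theta>. H \<theta> $$ (a,c)) p l * tc d n (\<lambda>\<theta>. G \<theta> $$ (c,b)) l q)" for a b c p q
  have ent: "E $$ (?J p a, ?J q b) = - (\<Sum>c<?m. \<delta> a b c p q)"
    if "p < ?N" "a < ?m" "q < ?N" "b < ?m" for p a q b
  proof -
    have J: "?J p a < ?D" "?J q b < ?D" using that Jidx_props(1) by auto
    have "(TT d n s H * TT d n s G) $$ (?J p a, ?J q b) = (\<Sum>j<?D. TT d n s H $$ (?J p a, j) * TT d n s G $$ (j, ?J q b))"
      by (rule index_mult_mat_sum[OF TT_carrier TT_carrier J])
    also have "\<dots> = (\<Sum>l<?N. \<Sum>c<?m. tc d n (\<lambda>\<theta>. H \<theta> $$ (a,c)) p l * tc d n (\<lambda>\<theta>. G \<theta> $$ (c,b)) l q)"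
      unfolding sum_Jidx using that by (intro sum.cong refl) (simp add: TT_Jidx)
    also have "\<dots> = (\<Sum>c<?m. \<Sum>l<?N. tc d n (\<lambda>\<theta>. H \<theta> $$ (a,c)) p l * tc d n (\<lambda>\<theta>. G \<theta> $$ (c,b)) l q)"
      by (rule sum.swap)
    finally have 1: "(TT d n s H * TT d n s G) $$ (?J p a, ?J q b) = \<dots>" .
    have "TT d n s (\<lambda>\<theta>. H \<theta> * G \<theta>) $$ (?J p a, ?J q b) = tc d n (\<lambda>\<theta>. (H \<theta> * G \<theta>) $$ (a,b)) p q"
      using that by (intro TT_Jidx)
    also have "(\<lambda>\<theta>. (H \<theta> * G \<theta>) $$ (a,b)) = (\<lambda>\<theta>. \<Sum>c<?m. H \<theta> $$ (a,c) * G \<theta> $$ (c,b))"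
      using that H G unfolding Lmat_def by (intro ext index_mult_mat_sum[of _ ?m ?m _ ?m]) auto
    also have "tc d n \<dots> p q = (\<Sum>c<?m. tc d n (\<lambda>\<theta>. H \<theta> $$ (a,c) * G \<theta> $$ (c,b)) p q)"
      using that by (intro tc_sum Linf_mult Lh Lg) auto
    finally have 2: "TT d n s (\<lambda>\<theta>. H \<theta> * G \<theta>) $$ (?J p a, ?J q b) = \<dots>" .
    have "E $$ (?J p a, ?J q b) = (TT d n s H * TT d n s G) $$ (?J p a, ?J q b) - TT d n s (\<lambda>\<theta>. H \<theta> * G \<theta>) $$ (?J p a, ?J q b)"
      unfolding E_def using J carrier_matD[OF TT_carrier[of d n s "\<lambda>\<theta>. H \<theta> * G \<theta>"]] by (intro index_minus_mat) auto
    then show ?thesis unfolding 1 2 \<delta>_def by (simp add: sum_subtractf)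
  qed
  have "fro2 E = (\<Sum>p<?N. \<Sum>a<?m. \<Sum>q<?N. \<Sum>b<?m. (norm (E $$ (?J p a, ?J q b)))\<^sup>2)"
    unfolding fro2_def using E by (simp only: carrier_matD sum_Jidx)
  also have "\<dots> \<le> (\<Sum>p<?N. \<Sum>a<?m. \<Sum>q<?N. \<Sum>b<?m. real ?m * (\<Sum>c<?m. (norm (\<delta> a b c p q))\<^sup>2))"
  proof (intro sum_mono)
    fix p a q b assume "p \<in> {..<?N}" "a \<in> {..<?m}" "q \<in> {..<?N}" "b \<in> {..<?m}"
    then have "(norm (E $$ (?J p a, ?J q b)))\<^sup>2 = (norm (\<Sum>c<?m. \<delta> a b c p q))\<^sup>2" by (simp add: ent)
    also have "\<dots> \<le> real ?m * (\<Sum>c<?m. (norm (\<delta> a b c p q))\<^sup>2)" using norm_sum_square_le[where I = "{..<?m}"] by simp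
    finally show "(norm (E $$ (?J p a, ?J q b)))\<^sup>2 \<le> real ?m * (\<Sum>c<?m. (norm (\<delta> a b c p q))\<^sup>2)" .
  qed
  also have "\<dots> = real ?m * (\<Sum>a<?m. \<Sum>b<?m. \<Sum>c<?m. \<Sum>q<?N. \<Sum>p<?N. (norm (\<delta> a b c p q))\<^sup>2)"
  proof -
    have "(\<Sum>p<?N. \<Sum>a<?m. \<Sum>q<?N. \<Sum>b<?m. \<Sum>c<?m. (norm (\<delta> a b c p q))\<^sup>2)
      = (\<Sum>a<?m. \<Sum>p<?N. \<Sum>q<?N. \<Sum>b<?m. \<Sum>c<?m. (norm (\<delta> a b c p q))\<^sup>2)" by (rule sum.swap)
    also have "\<dots> = (\<Sum>a<?m. \<Sum>q<?N. \<Sum>p<?N. \<Sum>b<?m. \<Sum>c<?m. (norm (\<delta> a b c p q))\<^sup>2)"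
      by (intro sum.cong refl sum.swap)
    also have "\<dots> = (\<Sum>a<?m. \<Sum>q<?N. \<Sum>b<?m. \<Sum>p<?N. \<Sum>c<?m. (norm (\<delta> a b c p q))\<^sup>2)"
      by (intro sum.cong refl sum.swap)
    also have "\<dots> = (\<Sum>a<?m. \<Sum>b<?m. \<Sum>q<?N. \<Sum>p<?N. \<Sum>c<?m. (norm (\<delta> a b c p q))\<^sup>2)"
      by (intro sum.cong refl sum.swap)
    also have "\<dots> = (\<Sum>a<?m. \<Sum>b<?m. \<Sum>q<?N. \<Sum>c<?m. \<Sum>p<?N. (norm (\<delta> a b c p q))\<^sup>2)"
      by (intro sum.cong refl sum.swap)
    also have "\<dots> = (\<Sum>a<?m. \<Sum>b<?m. \<Sum>c<?m. \<Sum>q<?N. \<Sum>p<?N. (norm (\<delta> a b c p q))\<^sup>2)"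
      by (intro sum.cong refl sum.swap)
    finally show ?thesis by (simp only: sum_distrib_left[symmetric])
  qed
  also have "\<dots> \<le> real ?m * (\<Sum>a<?m. \<Sum>b<?m. \<Sum>c<?m. \<Sum>q<?N. K\<^sup>2 * resid d n (\<lambda>\<theta>. G \<theta> $$ (c,b)) q)"
    unfolding \<delta>_def
    by (intro mult_left_mono sum_mono toeplitz_scalar_product Lh Lg K) auto
  also have "\<dots> = (real ?m)\<^sup>2 * K\<^sup>2 * (\<Sum>b<?m. \<Sum>c<?m. \<Sum>q<?N. resid d n (\<lambda>\<theta>. G \<theta> $$ (c,b)) q)"
    by (simp add: sum_distrib_left[symmetric] power2_eq_square mult_ac)
  finally show ?thesis unfolding E_def .
qed

lemma TT_fro2_le:
  assumes H: "Lmat d (2 * s) H"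
  shows "fro2 (TT d n s H) \<le> real (Nn d n) * (\<Sum>a<2 * s. \<Sum>b<2 * s. nsq d (\<lambda>\<theta>. H \<theta> $$ (a,b)))"
proof -
  let ?N = "Nn d n" and ?m = "2 * s"
  have "fro2 (TT d n s H) = (\<Sum>p<?N. \<Sum>a<?m. \<Sum>q<?N. \<Sum>b<?m. (norm (tc d n (\<lambda>\<theta>. H \<theta> $$ (a,b)) p q))\<^sup>2)"
    unfolding fro2_def by (simp only: carrier_matD[OF TT_carrier] sum_Jidx) (auto simp: TT_Jidx intro!: sum.cong)
  also have "\<dots> = (\<Sum>a<?m. \<Sum>p<?N. \<Sum>q<?N. \<Sum>b<?m. (norm (tc d n (\<lambda>\<theta>. H \<theta> $$ (a,b)) p q))\<^sup>2)" by (rule sum.swap)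
  also have "\<dots> = (\<Sum>a<?m. \<Sum>p<?N. \<Sum>b<?m. \<Sum>q<?N. (norm (tc d n (\<lambda>\<theta>. H \<theta> $$ (a,b)) p q))\<^sup>2)"
    by (intro sum.cong refl sum.swap)
  also have "\<dots> = (\<Sum>a<?m. \<Sum>b<?m. \<Sum>p<?N. \<Sum>q<?N. (norm (tc d n (\<lambda>\<theta>. H \<theta> $$ (a,b)) p q))\<^sup>2)"
    by (intro sum.cong refl sum.swap)
  also have "\<dots> \<le> (\<Sum>a<?m. \<Sum>b<?m. real ?N * nsq d (\<lambda>\<theta>. H \<theta> $$ (a,b)))"
    using H unfolding Lmat_def by (intro sum_mono toeplitz_scalar_fro_bound) auto
  finally show ?thesis by (simp only: sum_distrib_left[symmetric])
qed

lemma mtrace_TT: "mtrace (TT d n s H) = of_nat (Nn d n) * (\<Sum>a<2 * s. av d (\<lambda>\<theta>. H \<theta> $$ (a,a)))"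
proof -
  have diag: "tc d n f p p = av d f" for f p
  proof -
    have "ub d n p \<theta> * cnj (ub d n p \<theta>) = 1" for \<theta>
      using complex_norm_square[of "ub d n p \<theta>"] by simp
    then show ?thesis unfolding tc_def by (simp add: mult.assoc)
  qed
  have "mtrace (TT d n s H) = (\<Sum>p<Nn d n. \<Sum>a<2 * s. av d (\<lambda>\<theta>. H \<theta> $$ (a,a)))"
    unfolding mtrace_def by (simp only: carrier_matD[OF TT_carrier] sum_Jidx) (auto simp: TT_Jidx diag intro!: sum.cong)
  then show ?thesis by simp
qed

text \<open>Orthonormality of the exponentials. It makes constant terms of polynomials
  exact.\<close>

lemma TT_one: "TT d n s (\<lambda>_. 1\<^sub>m (2 * s)) = 1\<^sub>m (2 * (Nn d n * s))"
proof (rule eq_matI)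
  fix i j assume "i < dim_row (1\<^sub>m (2 * (Nn d n * s)) :: complex mat)" "j < dim_col (1\<^sub>m (2 * (Nn d n * s)) :: complex mat)"
  then have ij: "i < 2 * (Nn d n * s)" "j < 2 * (Nn d n * s)" by auto
  note P = PR_props[OF ij(1)] PR_props[OF ij(2)]
  have eq: "i = j \<longleftrightarrow> Pidx d n s i = Pidx d n s j \<and> Ridx d n s i = Ridx d n s j" using P by metis
  have "TT d n s (\<lambda>_. 1\<^sub>m (2 * s)) $$ (i,j)
     = (if Ridx d n s i = Ridx d n s j then 1 else 0) * av d (\<lambda>\<theta>. ub d n (Pidx d n s j) \<theta> * cnj (ub d n (Pidx d n s i) \<theta>))"
    using ij P by (simp add: TT_def tc_def av_cmult[symmetric] mult.assoc)
  then show "TT d n s (\<lambda>_. 1\<^sub>m (2 * s)) $$ (i,j) = 1\<^sub>m (2 * (Nn d n * s)) $$ (i,j)"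
    using ij P eq by (auto simp: ub_orthonormal)
qed (auto simp: TT_def)

section \<open>The algebra of sequences asymptotic to Toeplitz matrices\<close>

abbreviation Dn :: "nat \<Rightarrow> (nat \<Rightarrow> nat) \<Rightarrow> nat \<Rightarrow> nat" where
  "Dn d n s \<equiv> 2 * (Nn d n * s)"

text \<open>\<open>X n\<close> agrees with the Toeplitz matrix of H up to o(N) in squared Frobenius
  norm, N = \<open>Nn d n\<close>. The operator bound uniform in n is part of the notion because in
  a product X Y the error of Y gets multiplied by X.\<close>

definition App :: "nat \<Rightarrow> nat \<Rightarrow> ((nat \<Rightarrow> nat) \<Rightarrow> complex mat) \<Rightarrow> ((nat \<Rightarrow> real) \<Rightarrow> complex mat) \<Rightarrow> bool" where
  "App d s X H \<longleftrightarrow> Lmat d (2 * s) H \<and> (\<forall>n. X n \<in> carrier_mat (Dn d n s) (Dn d n s))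
    \<and> (\<exists>C\<ge>0. \<forall>n. opb (Dn d n s) C (X n))
    \<and> ((\<lambda>n. fro2 (X n - TT d n s H) / real (Nn d n)) \<longlongrightarrow> 0) (mlim d)"

lemma Lmat_carrier: "Lmat d m H \<Longrightarrow> H \<theta> \<in> carrier_mat m m"
  by (simp add: Lmat_def)

lemma Lmat_one: "Lmat d m (\<lambda>_. 1\<^sub>m m)"
  unfolding Lmat_def by (auto intro: Linf_const)

lemma Lmat_smult: "Lmat d m H \<Longrightarrow> Lmat d m (\<lambda>\<theta>. c \<cdot>\<^sub>m H \<theta>)"
  unfolding Lmat_def
proof (intro conjI allI impI)
  assume H: "(\<forall>\<theta>. H \<theta> \<in> carrier_mat m m) \<and> (\<forall>a<m. \<forall>b<m. Linf d (\<lambda>\<theta>. H \<theta> $$ (a,b)))"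
  then show "c \<cdot>\<^sub>m H \<theta> \<in> carrier_mat m m" for \<theta> by simp
  fix a b assume ab: "a < m" "b < m"
  have "(\<lambda>\<theta>. (c \<cdot>\<^sub>m H \<theta>) $$ (a,b)) = (\<lambda>\<theta>. c * H \<theta> $$ (a,b))"
  proof
    fix \<theta>
    show "(c \<cdot>\<^sub>m H \<theta>) $$ (a,b) = c * H \<theta> $$ (a,b)"
      using H ab carrier_matD[of "H \<theta>" m m] by (subst index_smult_mat) auto
  qed
  then show "Linf d (\<lambda>\<theta>. (c \<cdot>\<^sub>m H \<theta>) $$ (a,b))" using H ab by (simp add: Linf_cmult)
qed

lemma Lmat_add:
  assumes H: "Lmat d m H" and G: "Lmat d m G" shows "Lmat d m (\<lambda>\<theta>. H \<theta> + G \<theta>)"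
  unfolding Lmat_def
proof (intro conjI allI impI)
  note c = Lmat_carrier[OF H] Lmat_carrier[OF G]
  show "H \<theta> + G \<theta> \<in> carrier_mat m m" for \<theta> using c by simp
  fix a b assume ab: "a < m" "b < m"
  have "(\<lambda>\<theta>. (H \<theta> + G \<theta>) $$ (a,b)) = (\<lambda>\<theta>. H \<theta> $$ (a,b) + G \<theta> $$ (a,b))"
  proof
    fix \<theta>
    show "(H \<theta> + G \<theta>) $$ (a,b) = H \<theta> $$ (a,b) + G \<theta> $$ (a,b)"
      using ab carrier_matD[OF c(2)[of \<theta>]] by (intro index_add_mat) auto
  qed
  then show "Linf d (\<lambda>\<theta>. (H \<theta> + G \<theta>) $$ (a,b))" using H G ab by (simp add: Lmat_def Linf_add)
qed

lemma Lmat_mult: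
  assumes H: "Lmat d m H" and G: "Lmat d m G" shows "Lmat d m (\<lambda>\<theta>. H \<theta> * G \<theta>)"
  unfolding Lmat_def
proof (intro conjI allI impI)
  note c = Lmat_carrier[OF H] Lmat_carrier[OF G]
  show "H \<theta> * G \<theta> \<in> carrier_mat m m" for \<theta> using c by (intro mult_carrier_mat)
  fix a b assume ab: "a < m" "b < m"
  have "(\<lambda>\<theta>. (H \<theta> * G \<theta>) $$ (a,b)) = (\<lambda>\<theta>. \<Sum>l<m. H \<theta> $$ (a,l) * G \<theta> $$ (l,b))"
    by (intro ext index_mult_mat_sum[of _ m m _ m] c ab)
  moreover have "Linf d (\<lambda>\<theta>. \<Sum>l<m. H \<theta> $$ (a,l) * G \<theta> $$ (l,b))"
    using H G ab unfolding Lmat_def by (intro Linf_sum Linf_mult) auto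
  ultimately show "Linf d (\<lambda>\<theta>. (H \<theta> * G \<theta>) $$ (a,b))" by (simp only:)
qed

lemma fro2_zero: "fro2 (0\<^sub>m k l) = 0"
  by (simp add: fro2_def)

lemma minus_self_mat: "A \<in> carrier_mat k l \<Longrightarrow> A - A = (0\<^sub>m k l :: complex mat)"
  by (intro eq_matI) auto

lemma App_TT:
  assumes H: "Lmat d (2 * s) H"
  shows "App d s (\<lambda>n. TT d n s H) H"
proof -
  obtain K where K: "\<And>a b. a < 2 * s \<Longrightarrow> b < 2 * s \<Longrightarrow> AE \<theta> in torus d. norm (H \<theta> $$ (a,b)) \<le> K"
    using Lmat_bound[OF H] by metis
  have "opb (Dn d n s) ((real (2 * s))\<^sup>2 * K\<^sup>2) (TT d n s H)" for n by (rule opb_TT[OF H K])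
  then have "\<exists>C\<ge>0. \<forall>n. opb (Dn d n s) C (TT d n s H)" by (intro exI[of _ "(real (2 * s))\<^sup>2 * K\<^sup>2"]) simp
  then show ?thesis unfolding App_def using H by (simp add: minus_self_mat[OF TT_carrier] fro2_zero)
qed

lemma App_one: "App d s (\<lambda>n. 1\<^sub>m (Dn d n s)) (\<lambda>_. 1\<^sub>m (2 * s))"
  using App_TT[OF Lmat_one[of d "2 * s"]] by (simp add: TT_one)

lemma TT_smult:
  assumes H: "Lmat d (2 * s) H" shows "TT d n s (\<lambda>\<theta>. c \<cdot>\<^sub>m H \<theta>) = c \<cdot>\<^sub>m TT d n s H"
proof (rule eq_matI)
  fix i j assume "i < dim_row (c \<cdot>\<^sub>m TT d n s H)" "j < dim_col (c \<cdot>\<^sub>m TT d n s H)"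
  then have ij: "i < Dn d n s" "j < Dn d n s" by (auto simp: TT_def)
  have "(c \<cdot>\<^sub>m H \<theta>) $$ (Ridx d n s i, Ridx d n s j) = c * H \<theta> $$ (Ridx d n s i, Ridx d n s j)" for \<theta>
    using PR_props(2)[OF ij(1)] PR_props(2)[OF ij(2)] carrier_matD[OF Lmat_carrier[OF H, of \<theta>]] by (subst index_smult_mat) auto
  then show "TT d n s (\<lambda>\<theta>. c \<cdot>\<^sub>m H \<theta>) $$ (i,j) = (c \<cdot>\<^sub>m TT d n s H) $$ (i,j)"
    using ij by (simp add: TT_def tc_cmult)
qed (auto simp: TT_def)

lemma TT_add:
  assumes H: "Lmat d (2 * s) H" and G: "Lmat d (2 * s) G"
  shows "TT d n s (\<lambda>\<theta>. H \<theta> + G \<theta>) = TT d n s H + TT d n s G"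
proof (rule eq_matI)
  fix i j assume "i < dim_row (TT d n s H + TT d n s G)" "j < dim_col (TT d n s H + TT d n s G)"
  then have ij: "i < Dn d n s" "j < Dn d n s" by (auto simp: TT_def)
  note R = PR_props(2)[OF ij(1)] PR_props(2)[OF ij(2)]
  have "(H \<theta> + G \<theta>) $$ (Ridx d n s i, Ridx d n s j) = H \<theta> $$ (Ridx d n s i, Ridx d n s j) + G \<theta> $$ (Ridx d n s i, Ridx d n s j)" for \<theta>
    using R carrier_matD[OF Lmat_carrier[OF G, of \<theta>]] by (intro index_add_mat) auto
  then show "TT d n s (\<lambda>\<theta>. H \<theta> + G \<theta>) $$ (i,j) = (TT d n s H + TT d n s G) $$ (i,j)"
    using ij R H G by (simp add: TT_def tc_add Lmat_def)
qed (auto simp: TT_def)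

lemma fro2_average_tendsto_0I:
  assumes "\<And>n. 0 \<le> f n" "\<And>n. f n \<le> g n" "((\<lambda>n. g n / real (Nn d n)) \<longlongrightarrow> 0) (mlim d)"
  shows "((\<lambda>n. f n / real (Nn d n)) \<longlongrightarrow> (0::real)) (mlim d)"
  by (rule tendsto_sandwich[OF always_eventually always_eventually tendsto_const assms(3)])
     (use assms in \<open>auto intro: divide_right_mono\<close>)

lemma App_smult:
  assumes A: "App d s X H" shows "App d s (\<lambda>n. c \<cdot>\<^sub>m X n) (\<lambda>\<theta>. c \<cdot>\<^sub>m H \<theta>)"
proof -
  have H: "Lmat d (2 * s) H" and X: "\<And>n. X n \<in> carrier_mat (Dn d n s) (Dn d n s)" using A by (auto simp: App_def)
  obtain C where C: "C \<ge> 0" "\<And>n. opb (Dn d n s) C (X n)" using A by (auto simp: App_def)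
  have "opb (Dn d n s) ((norm c)\<^sup>2 * C) (c \<cdot>\<^sub>m X n)" for n
    unfolding opb_def
  proof (intro allI ballI)
    fix r and Y :: "complex mat" assume Y: "Y \<in> carrier_mat (Dn d n s) r"
    have "c \<cdot>\<^sub>m X n * Y = c \<cdot>\<^sub>m (X n * Y)" by (rule mult_smult_assoc_mat[OF X Y])
    then have "fro2 (c \<cdot>\<^sub>m X n * Y) = (norm c)\<^sup>2 * fro2 (X n * Y)" by (simp only: fro2_smult)
    also have "\<dots> \<le> (norm c)\<^sup>2 * (C * fro2 Y)" using C(2)[of n] Y unfolding opb_def by (intro mult_left_mono) auto
    finally show "fro2 (c \<cdot>\<^sub>m X n * Y) \<le> (norm c)\<^sup>2 * C * fro2 Y" by (simp add: mult.assoc)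
  qed
  then have "\<exists>C\<ge>0. \<forall>n. opb (Dn d n s) C (c \<cdot>\<^sub>m X n)" using C(1) by (intro exI[of _ "(norm c)\<^sup>2 * C"]) simp
  moreover have "fro2 (c \<cdot>\<^sub>m X n - TT d n s (\<lambda>\<theta>. c \<cdot>\<^sub>m H \<theta>)) = (norm c)\<^sup>2 * fro2 (X n - TT d n s H)" for n
  proof -
    have "c \<cdot>\<^sub>m X n - TT d n s (\<lambda>\<theta>. c \<cdot>\<^sub>m H \<theta>) = c \<cdot>\<^sub>m (X n - TT d n s H)"
      unfolding TT_smult[OF H] using carrier_matD[OF X[of n]] carrier_matD[OF TT_carrier[of d n s H]]
      by (intro eq_matI) (auto simp: algebra_simps)
    then show ?thesis by (simp only: fro2_smult)
  qed
  moreover have "((\<lambda>n. (norm c)\<^sup>2 * (fro2 (X n - TT d n s H) / real (Nn d n))) \<longlongrightarrow> (norm c)\<^sup>2 * 0) (mlim d)"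
    using A unfolding App_def by (intro tendsto_mult_left) auto
  ultimately show ?thesis unfolding App_def using Lmat_smult[OF H] X by simp
qed

lemma App_add:
  assumes A: "App d s X H" and B: "App d s Y G"
  shows "App d s (\<lambda>n. X n + Y n) (\<lambda>\<theta>. H \<theta> + G \<theta>)"
proof -
  have H: "Lmat d (2 * s) H" and X: "\<And>n. X n \<in> carrier_mat (Dn d n s) (Dn d n s)" using A by (auto simp: App_def)
  have G: "Lmat d (2 * s) G" and Y: "\<And>n. Y n \<in> carrier_mat (Dn d n s) (Dn d n s)" using B by (auto simp: App_def)
  obtain C where C: "C \<ge> 0" "\<And>n. opb (Dn d n s) C (X n)" using A by (auto simp: App_def)
  obtain E where E: "E \<ge> 0" "\<And>n. opb (Dn d n s) E (Y n)" using B by (auto simp: App_def)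
  have "opb (Dn d n s) (2 * C + 2 * E) (X n + Y n)" for n
    unfolding opb_def
  proof (intro allI ballI)
    fix r and Z :: "complex mat" assume Z: "Z \<in> carrier_mat (Dn d n s) r"
    have "(X n + Y n) * Z = X n * Z + Y n * Z" by (rule add_mult_distrib_mat[OF X Y Z])
    then have "fro2 ((X n + Y n) * Z) \<le> 2 * fro2 (X n * Z) + 2 * fro2 (Y n * Z)"
      using fro2_add_le[OF mult_carrier_mat[OF X Z] mult_carrier_mat[OF Y Z]] by simp
    also have "\<dots> \<le> 2 * (C * fro2 Z) + 2 * (E * fro2 Z)"
      using C(2)[of n] E(2)[of n] Z unfolding opb_def by (intro add_mono mult_left_mono) auto
    finally show "fro2 ((X n + Y n) * Z) \<le> (2 * C + 2 * E) * fro2 Z" by (simp add: algebra_simps)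
  qed
  then have "\<exists>C\<ge>0. \<forall>n. opb (Dn d n s) C (X n + Y n)" using C(1) E(1) by (intro exI[of _ "2 * C + 2 * E"]) simp
  moreover have "((\<lambda>n. fro2 (X n + Y n - TT d n s (\<lambda>\<theta>. H \<theta> + G \<theta>)) / real (Nn d n)) \<longlongrightarrow> 0) (mlim d)"
  proof (rule fro2_average_tendsto_0I)
    fix n
    have "X n + Y n - TT d n s (\<lambda>\<theta>. H \<theta> + G \<theta>) = (X n - TT d n s H) + (Y n - TT d n s G)"
      unfolding TT_add[OF H G] using carrier_matD[OF X[of n]] carrier_matD[OF Y[of n]]
        carrier_matD[OF TT_carrier[of d n s H]] carrier_matD[OF TT_carrier[of d n s G]]
      by (intro eq_matI) auto
    then show "fro2 (X n + Y n - TT d n s (\<lambda>\<theta>. H \<theta> + G \<theta>)) \<le> 2 * fro2 (X n - TT d n s H) + 2 * fro2 (Y n - TT d n s G)"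
      using fro2_add_le[of "X n - TT d n s H" "Dn d n s" "Dn d n s" "Y n - TT d n s G"] by (simp add: minus_carrier_mat)
  next
    have "((\<lambda>n. 2 * (fro2 (X n - TT d n s H) / real (Nn d n)) + 2 * (fro2 (Y n - TT d n s G) / real (Nn d n))) \<longlongrightarrow> 2 * 0 + 2 * 0) (mlim d)"
      using A B unfolding App_def by (intro tendsto_intros) auto
    then show "((\<lambda>n. (2 * fro2 (X n - TT d n s H) + 2 * fro2 (Y n - TT d n s G)) / real (Nn d n)) \<longlongrightarrow> 0) (mlim d)"
      by (simp add: add_divide_distrib)
  qed (rule fro2_nonneg)
  ultimately show ?thesis unfolding App_def using Lmat_add[OF H G] X Y by simp
qed

lemma App_mult:
  assumes A: "App d s X H" and B: "App d s Y G"
  shows "App d s (\<lambda>n. X n * Y n) (\<lambda>\<theta>. H \<theta> * G \<theta>)"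
proof -
  have H: "Lmat d (2 * s) H" and X: "\<And>n. X n \<in> carrier_mat (Dn d n s) (Dn d n s)" using A by (auto simp: App_def)
  have G: "Lmat d (2 * s) G" and Y: "\<And>n. Y n \<in> carrier_mat (Dn d n s) (Dn d n s)" using B by (auto simp: App_def)
  obtain C where C: "C \<ge> 0" "\<And>n. opb (Dn d n s) C (X n)" using A by (auto simp: App_def)
  obtain E where E: "E \<ge> 0" "\<And>n. opb (Dn d n s) E (Y n)" using B by (auto simp: App_def)
  obtain K where K: "\<And>a b. a < 2 * s \<Longrightarrow> b < 2 * s \<Longrightarrow> AE \<theta> in torus d. norm (H \<theta> $$ (a,b)) \<le> K"
    using Lmat_bound[OF H] by metis
  obtain L where L: "\<And>a b. a < 2 * s \<Longrightarrow> b < 2 * s \<Longrightarrow> AE \<theta> in torus d. norm (G \<theta> $$ (a,b)) \<le> L"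
    using Lmat_bound[OF G] by metis
  have "opb (Dn d n s) (C * E) (X n * Y n)" for n
    unfolding opb_def
  proof (intro allI ballI)
    fix r and Z :: "complex mat" assume Z: "Z \<in> carrier_mat (Dn d n s) r"
    have "X n * Y n * Z = X n * (Y n * Z)" by (rule assoc_mult_mat[OF X Y Z])
    then have "fro2 (X n * Y n * Z) \<le> C * fro2 (Y n * Z)"
      using C(2)[of n] mult_carrier_mat[OF Y[of n] Z] unfolding opb_def by simp
    also have "\<dots> \<le> C * (E * fro2 Z)" using E(2)[of n] Z C(1) unfolding opb_def by (intro mult_left_mono) auto
    finally show "fro2 (X n * Y n * Z) \<le> C * E * fro2 Z" by (simp add: mult.assoc)
  qed
  then have op: "\<exists>C\<ge>0. \<forall>n. opb (Dn d n s) C (X n * Y n)" using C(1) E(1) by (intro exI[of _ "C * E"]) simp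
  define S where "S n = (\<Sum>b<2 * s. \<Sum>c<2 * s. \<Sum>q<Nn d n. resid d n (\<lambda>\<theta>. G \<theta> $$ (c,b)) q)" for n
  let ?a = "(real (2 * s))\<^sup>2 * L\<^sup>2" and ?b = "(real (2 * s))\<^sup>2 * K\<^sup>2"
  have lim: "((\<lambda>n. fro2 (X n * Y n - TT d n s (\<lambda>\<theta>. H \<theta> * G \<theta>)) / real (Nn d n)) \<longlongrightarrow> 0) (mlim d)"
  proof (rule fro2_average_tendsto_0I)
    fix n
    let ?D = "Dn d n s"
    define TH TG TP where "TH = TT d n s H" and "TG = TT d n s G" and "TP = TT d n s (\<lambda>\<theta>. H \<theta> * G \<theta>)"
    have T: "TH \<in> carrier_mat ?D ?D" "TG \<in> carrier_mat ?D ?D" "TP \<in> carrier_mat ?D ?D" by (simp_all add: TH_def TG_def TP_def)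
    define x y where "x = X n" and "y = Y n"
    have xy: "x \<in> carrier_mat ?D ?D" "y \<in> carrier_mat ?D ?D" using X Y by (simp_all add: x_def y_def)
    have e1: "x * (y - TG) = x * y - x * TG" by (rule mult_minus_distrib_mat[OF xy T(2)])
    have e2: "(x - TH) * TG = x * TG - TH * TG" by (rule minus_mult_distrib_mat[OF xy(1) T(1,2)])
    have c: "x * y \<in> carrier_mat ?D ?D" "x * TG \<in> carrier_mat ?D ?D" "TH * TG \<in> carrier_mat ?D ?D"
      using mult_carrier_mat[OF xy] mult_carrier_mat[OF xy(1) T(2)] mult_carrier_mat[OF T(1,2)] by auto
    \<comment> \<open>Three errors: that of y, controlled by the operator bound of X; that of x,
      controlled by the bounded symbol G from the right; and the compression error of the two
      Toeplitz matrices.\<close>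
    have dec: "x * y - TP = x * (y - TG) + ((x - TH) * TG + (TH * TG - TP))"
      unfolding e1 e2 using carrier_matD[OF c(1)] carrier_matD[OF c(2)] carrier_matD[OF c(3)] carrier_matD[OF T(3)]
      by (intro eq_matI) (auto simp del: index_mult_mat)
    have m1: "x * (y - TG) \<in> carrier_mat ?D ?D" using mult_carrier_mat[OF xy(1) minus_carrier_mat[OF T(2)]] .
    have m2: "(x - TH) * TG \<in> carrier_mat ?D ?D" using mult_carrier_mat[OF minus_carrier_mat[OF T(1)] T(2)] .
    have m3: "TH * TG - TP \<in> carrier_mat ?D ?D" using minus_carrier_mat[OF T(3)] .
    have "fro2 (x * y - TP) \<le> 2 * fro2 (x * (y - TG)) + 2 * fro2 ((x - TH) * TG + (TH * TG - TP))"
      unfolding dec using m1 m2 m3 by (intro fro2_add_le) auto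
    also have "\<dots> \<le> 2 * fro2 (x * (y - TG)) + 2 * (2 * fro2 ((x - TH) * TG) + 2 * fro2 (TH * TG - TP))"
      by (intro add_left_mono mult_left_mono fro2_add_le[OF m2 m3]) auto
    also have "\<dots> \<le> 2 * (C * fro2 (y - TG)) + 2 * (2 * (?a * fro2 (x - TH)) + 2 * (?b * S n))"
    proof (intro add_mono mult_left_mono)
      show "fro2 (x * (y - TG)) \<le> C * fro2 (y - TG)"
        using C(2)[of n] minus_carrier_mat[OF T(2)] unfolding opb_def x_def by blast
      show "fro2 ((x - TH) * TG) \<le> ?a * fro2 (x - TH)"
        unfolding TG_def by (rule fro2_mult_TT_right[OF G L minus_carrier_mat[OF T(1)]])
      show "fro2 (TH * TG - TP) \<le> ?b * S n"
        unfolding TH_def TG_def TP_def S_def by (rule TT_mult_fro2[OF H G K])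
    qed auto
    finally show "fro2 (X n * Y n - TT d n s (\<lambda>\<theta>. H \<theta> * G \<theta>))
        \<le> 2 * (C * fro2 (Y n - TT d n s G)) + 2 * (2 * (?a * fro2 (X n - TT d n s H)) + 2 * (?b * S n))"
      unfolding x_def y_def TH_def TG_def TP_def .
  next
    have S: "((\<lambda>n. S n / real (Nn d n)) \<longlongrightarrow> 0) (mlim d)"
    proof -
      have "((\<lambda>n. \<Sum>b<2 * s. \<Sum>c<2 * s. (\<Sum>q<Nn d n. resid d n (\<lambda>\<theta>. G \<theta> $$ (c,b)) q) / real (Nn d n)) \<longlongrightarrow> (\<Sum>b<2 * s. \<Sum>c<2 * s. 0)) (mlim d)"
        using G unfolding Lmat_def by (intro tendsto_sum resid_average_tendsto) auto
      then show ?thesis unfolding S_def by (simp add: sum_divide_distrib)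
    qed
    have "((\<lambda>n. 2 * (C * (fro2 (Y n - TT d n s G) / real (Nn d n))) + 2 * (2 * (?a * (fro2 (X n - TT d n s H) / real (Nn d n))) + 2 * (?b * (S n / real (Nn d n)))))
       \<longlongrightarrow> 2 * (C * 0) + 2 * (2 * (?a * 0) + 2 * (?b * 0))) (mlim d)"
      using A B S unfolding App_def by (intro tendsto_add tendsto_mult_left) auto
    then show "((\<lambda>n. (2 * (C * fro2 (Y n - TT d n s G)) + 2 * (2 * (?a * fro2 (X n - TT d n s H)) + 2 * (?b * S n))) / real (Nn d n)) \<longlongrightarrow> 0) (mlim d)"
      by (simp only: distrib_left add_divide_distrib times_divide_eq_right mult_zero_right add_0_right)
  qed (rule fro2_nonneg)
  show ?thesis unfolding App_def using Lmat_mult[OF H G] mult_carrier_mat[OF X Y] op lim by simp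
qed

lemma App_mpl:
  assumes "App d s X H"
  shows "App d s (\<lambda>n. mpl (Dn d n s) cs (X n)) (\<lambda>\<theta>. mpl (2 * s) cs (H \<theta>))"
proof (induction cs)
  case Nil
  have "0 \<cdot>\<^sub>m 1\<^sub>m k = (0\<^sub>m k k :: complex mat)" for k by (intro eq_matI) auto
  then show ?case using App_smult[OF App_one, of d s 0] by simp
next
  case (Cons c cs)
  then show ?case using App_add[OF App_smult[OF App_one, of d s c] App_mult[OF assms Cons]] by simp
qed

lemma App_pow:
  assumes "App d s X H"
  shows "App d s (\<lambda>n. X n ^\<^sub>m k) (\<lambda>\<theta>. H \<theta> ^\<^sub>m k)"
proof (induction k)
  case 0
  have "\<And>n. X n \<in> carrier_mat (Dn d n s) (Dn d n s)" "\<And>\<theta>. H \<theta> \<in> carrier_mat (2 * s) (2 * s)"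
    using assms by (auto simp: App_def Lmat_def)
  then have "dim_row (X n) = Dn d n s" "dim_row (H \<theta>) = 2 * s" for n \<theta> by blast+
  then show ?case using App_one[of d s] by simp
next
  case (Suc k)
  then show ?case using App_mult[OF Suc assms] by simp
qed

text \<open>By Cauchy-Schwarz |tr E|^2 is at most the dimension times the squared Frobenius norm, so
  an o(N) error does not affect the normalised trace.\<close>

lemma App_trace:
  assumes A: "App d s X H" and s: "s \<ge> 1"
  shows "((\<lambda>n. mtrace (X n) / of_nat (Dn d n s)) \<longlongrightarrow> (1 / of_nat (2 * s)) * (\<Sum>a<2 * s. av d (\<lambda>\<theta>. H \<theta> $$ (a,a)))) (mlim d)"
proof -
  have X: "\<And>n. X n \<in> carrier_mat (Dn d n s) (Dn d n s)" using A by (auto simp: App_def)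
  let ?l = "(1 / of_nat (2 * s)) * (\<Sum>a<2 * s. av d (\<lambda>\<theta>. H \<theta> $$ (a,a)))"
  have bound: "norm (mtrace (X n) / of_nat (Dn d n s) - ?l) \<le> sqrt (fro2 (X n - TT d n s H) / real (Nn d n))"
    if pos: "\<forall>j<d. 0 < n j" for n
  proof -
    have N: "Nn d n > 0" using pos by (intro Nn_pos) auto
    let ?D = "Dn d n s"
    have D: "?D > 0" using N s by simp
    define E where "E = X n - TT d n s H"
    have E: "E \<in> carrier_mat ?D ?D" unfolding E_def by (intro minus_carrier_mat) simp
    have tr: "mtrace (X n) - mtrace (TT d n s H) = mtrace E"
      unfolding mtrace_def E_def using carrier_matD[OF X[of n]] carrier_matD[OF TT_carrier[of d n s H]]
      by (simp add: sum_subtractf)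
    have "mtrace (TT d n s H) / of_nat ?D = ?l"
      using N s unfolding mtrace_TT by (simp add: field_simps)
    then have eq: "mtrace (X n) / of_nat ?D - ?l = mtrace E / of_nat ?D"
      by (simp add: tr[symmetric] diff_divide_distrib)
    have "(norm (mtrace E))\<^sup>2 \<le> real ?D * (\<Sum>i<?D. (norm (E $$ (i,i)))\<^sup>2)"
      unfolding mtrace_def using E norm_sum_square_le[of "\<lambda>i. E $$ (i,i)" "{..<?D}"] by simp
    also have "\<dots> \<le> real ?D * fro2 E"
    proof (intro mult_left_mono)
      show "(\<Sum>i<?D. (norm (E $$ (i,i)))\<^sup>2) \<le> fro2 E"
        unfolding fro2_def using E by (auto intro!: sum_mono member_le_sum)
    qed simp
    finally have le: "(norm (mtrace E))\<^sup>2 \<le> real ?D * fro2 E" .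
    define r where "r = real ?D"
    have r: "r > 0" using D unfolding r_def by (simp only: of_nat_0_less_iff)
    have "(norm (mtrace E / of_nat ?D))\<^sup>2 = (norm (mtrace E))\<^sup>2 / r\<^sup>2"
      by (simp only: norm_divide power_divide norm_of_nat r_def)
    also have "\<dots> \<le> r * fro2 E / r\<^sup>2" using le unfolding r_def by (intro divide_right_mono) auto
    also have "\<dots> = fro2 E / real ?D" unfolding r_def[symmetric] using r by (simp add: power2_eq_square)
    finally have "(norm (mtrace E / of_nat ?D))\<^sup>2 \<le> fro2 E / real ?D" .
    also have "\<dots> \<le> fro2 E / real (Nn d n)"
    proof (rule divide_left_mono[OF _ fro2_nonneg])
      have "Nn d n * 1 \<le> Nn d n * s" using s by (intro mult_le_mono) auto
      then have "Nn d n \<le> ?D" by linarith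
      then show "real (Nn d n) \<le> real ?D" by (simp only: of_nat_le_iff)
    qed (use N s in simp)
    finally show ?thesis unfolding eq E_def by (rule real_le_rsqrt)
  qed
  have "((\<lambda>n. sqrt (fro2 (X n - TT d n s H) / real (Nn d n))) \<longlongrightarrow> sqrt 0) (mlim d)"
    using A unfolding App_def by (intro tendsto_real_sqrt) auto
  note lim = this[unfolded real_sqrt_zero]
  have "((\<lambda>n. mtrace (X n) / of_nat (Dn d n s) - ?l) \<longlongrightarrow> 0) (mlim d)"
    by (rule Lim_null_comparison[OF eventually_mono[OF eventually_mlim_pos bound] lim])
  then show ?thesis by (rule LIM_zero_cancel)
qed

section \<open>Eigenvalue clustering\<close>

lemma closed_ess_range:
  assumes f: "f \<in> borel_measurable (torus d)"
  shows "closed (ess_range d f)"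
proof -
  have ms: "{\<theta> \<in> space (torus d). dist (f \<theta>) z < e} \<in> sets (torus d)" for z e
    using f by measurable
  have "open (- ess_range d f)"
    unfolding open_contains_ball
  proof
    fix z assume "z \<in> - ess_range d f"
    then obtain e where e: "e > 0" "emeasure (torus d) {\<theta> \<in> space (torus d). dist (f \<theta>) z < e} = 0"
      by (auto simp: ess_range_def)
    have "w \<in> - ess_range d f" if "w \<in> ball z (e/2)" for w
    proof -
      have "{\<theta> \<in> space (torus d). dist (f \<theta>) w < e/2} \<subseteq> {\<theta> \<in> space (torus d). dist (f \<theta>) z < e}"
      proof safe
        fix \<theta> assume "dist (f \<theta>) w < e/2"
        then show "dist (f \<theta>) z < e" using that dist_triangle[of "f \<theta>" z w] by (simp add: dist_commute)
      qed
      from emeasure_mono[OF this ms]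
      have "emeasure (torus d) {\<theta> \<in> space (torus d). dist (f \<theta>) w < e/2} = 0" using e(2) by simp
      moreover have "e/2 > 0" using e(1) by simp
      ultimately show ?thesis unfolding ess_range_def by blast
    qed
    then show "\<exists>\<epsilon>>0. ball z \<epsilon> \<subseteq> - ess_range d f" using e(1) by (intro exI[of _ "e/2"]) auto
  qed
  then show ?thesis by (simp add: closed_def)
qed

text \<open>Every value outside the essential range has a ball with null preimage; by Lindelof
  countably many such balls cover them all.\<close>

lemma AE_in_ess_range:
  assumes f: "f \<in> borel_measurable (torus d)"
  shows "AE \<theta> in torus d. f \<theta> \<in> ess_range d f"
proof -
  have ms: "{\<theta> \<in> space (torus d). dist (f \<theta>) z < e} \<in> sets (torus d)" for z e
    using f by measurable
  define F where "F = {ball z e | z e. emeasure (torus d) {\<theta> \<in> space (torus d). dist (f \<theta>) z < e} = 0}"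
  obtain F' where F': "F' \<subseteq> F" "countable F'" "\<Union>F' = \<Union>F"
    using Lindelof[of F] by (auto simp: F_def)
  have "AE \<theta> in torus d. \<forall>B\<in>F'. f \<theta> \<notin> B"
    unfolding AE_ball_countable[OF F'(2)]
  proof
    fix B assume "B \<in> F'"
    then obtain z e where B: "B = ball z e" "emeasure (torus d) {\<theta> \<in> space (torus d). dist (f \<theta>) z < e} = 0"
      using F'(1) unfolding F_def by blast
    show "AE \<theta> in torus d. f \<theta> \<notin> B"
    proof (rule AE_I[OF _ B(2) ms])
      show "{\<theta> \<in> space (torus d). \<not> f \<theta> \<notin> B} \<subseteq> {\<theta> \<in> space (torus d). dist (f \<theta>) z < e}"
        by (auto simp: B(1) dist_commute)
    qed
  qed
  then show ?thesis
  proof eventually_elim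
    fix \<theta> assume \<theta>: "\<forall>B\<in>F'. f \<theta> \<notin> B"
    show "f \<theta> \<in> ess_range d f"
    proof (rule ccontr)
      assume "f \<theta> \<notin> ess_range d f"
      then obtain e where e: "e > 0" "emeasure (torus d) {\<theta>' \<in> space (torus d). dist (f \<theta>') (f \<theta>) < e} = 0"
        by (auto simp: ess_range_def)
      then have "ball (f \<theta>) e \<in> F" unfolding F_def by blast
      then have "f \<theta> \<in> \<Union>F" using e(1) by (intro UnionI[of "ball (f \<theta>) e"]) auto
      then show False using \<theta> F'(3) by blast
    qed
  qed
qed

lemma ess_range_bounded:
  assumes f: "f \<in> borel_measurable (torus d)" and B: "AE \<theta> in torus d. norm (f \<theta>) \<le> B"
  shows "ess_range d f \<subseteq> cball 0 B"
proof
  fix z assume z: "z \<in> ess_range d f"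
  show "z \<in> cball 0 B"
  proof (rule ccontr)
    assume "z \<notin> cball 0 B"
    then have e: "norm z - B > 0" by simp
    have ms: "{\<theta> \<in> space (torus d). dist (f \<theta>) z < norm z - B} \<in> sets (torus d)" using f by measurable
    have "AE \<theta> in torus d. \<not> dist (f \<theta>) z < norm z - B"
      using B
    proof eventually_elim
      fix \<theta> assume "norm (f \<theta>) \<le> B"
      then show "\<not> dist (f \<theta>) z < norm z - B" using norm_triangle_ineq2[of z "f \<theta>"] by (simp add: dist_norm norm_minus_commute)
    qed
    then have "emeasure (torus d) {\<theta> \<in> space (torus d). dist (f \<theta>) z < norm z - B} = 0"
      using AE_iff_measurable[OF ms] by simp
    then show False using z e unfolding ess_range_def by blast
  qed
qed

lemma norm_eigenvalue_le:
  fixes A :: "complex mat"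
  assumes A: "A \<in> carrier_mat m m" "char_poly A = (\<Prod>e\<leftarrow>es. [:- e, 1:])"
    and K: "\<And>a b. a < m \<Longrightarrow> b < m \<Longrightarrow> norm (A $$ (a,b)) \<le> K" "K \<ge> 0" and e: "e \<in> set es"
  shows "norm e \<le> real m * K"
proof (rule power2_le_imp_le)
  have "(norm e)\<^sup>2 \<le> (\<Sum>e\<leftarrow>es. (norm e)\<^sup>2)"
    using e by (intro member_le_sum_list) auto
  also have "\<dots> \<le> fro2 A" by (rule Schur_inequality[OF A])
  also have "\<dots> \<le> (\<Sum>a<m. \<Sum>b<m. K\<^sup>2)"
    unfolding fro2_def carrier_matD[OF A(1)] using K by (intro sum_mono power_mono) auto
  also have "\<dots> = (real m * K)\<^sup>2" by (simp add: power2_eq_square)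
  finally show "(norm e)\<^sup>2 \<le> (real m * K)\<^sup>2" .
qed (use K in auto)

text \<open>The operator bound is applied to an eigenvector written as a one-column matrix. Unlike
  an entrywise estimate, this does not grow with the dimension.\<close>

lemma norm_eigenvalue_opb:
  assumes A: "A \<in> carrier_mat k k" "char_poly A = (\<Prod>e\<leftarrow>es. [:- e, 1:])"
    and C: "opb k C A" "C \<ge> 0" and e: "e \<in> set es"
  shows "norm e \<le> sqrt C"
proof -
  have "poly (char_poly A) e = 0" unfolding A(2) using e by (induction es) auto
  then have "eigenvalue A e" unfolding eigenvalue_root_char_poly[OF A(1)] .
  then obtain v where v: "v \<in> carrier_vec k" "v \<noteq> 0\<^sub>v k" "A *\<^sub>v v = e \<cdot>\<^sub>v v"
    unfolding eigenvalue_def eigenvector_def using A by auto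
  define X where "X = mat k 1 (\<lambda>(i,j). v $ i)"
  have X: "X \<in> carrier_mat k 1" by (simp add: X_def)
  have "A * X = e \<cdot>\<^sub>m X"
  proof (rule eq_matI)
    fix i j assume "i < dim_row (e \<cdot>\<^sub>m X)" "j < dim_col (e \<cdot>\<^sub>m X)"
    then have ij: "i < k" "j < 1" by (auto simp: X_def)
    have "(A * X) $$ (i,j) = (\<Sum>l<k. A $$ (i,l) * v $ l)"
      using ij by (subst index_mult_mat_sum[OF A(1) X ij]) (simp add: X_def)
    also have "\<dots> = (A *\<^sub>v v) $ i" using ij A(1) v(1) by (simp add: scalar_prod_def atLeast0LessThan)
    also have "\<dots> = (e \<cdot>\<^sub>m X) $$ (i,j)" unfolding v(3) using ij v(1) by (simp add: X_def)
    finally show "(A * X) $$ (i,j) = (e \<cdot>\<^sub>m X) $$ (i,j)" .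
  qed (use A X in auto)
  then have "(norm e)\<^sup>2 * fro2 X = fro2 (A * X)" by (simp only: fro2_smult)
  then have "(norm e)\<^sup>2 * fro2 X \<le> C * fro2 X"
    using C(1) X unfolding opb_def by simp
  moreover have "fro2 X > 0"
  proof -
    have "\<exists>i<k. v $ i \<noteq> 0"
    proof (rule ccontr)
      assume "\<not> ?thesis"
      then have "v = 0\<^sub>v k" using v(1) by (intro eq_vecI) auto
      then show False using v(2) by simp
    qed
    then obtain i where i: "i < k" "v $ i \<noteq> 0" by blast
    have "fro2 X = (\<Sum>i<k. (norm (v $ i))\<^sup>2)" by (simp add: fro2_def X_def)
    also have "\<dots> \<ge> (norm (v $ i))\<^sup>2" using i by (intro member_le_sum) auto
    finally show ?thesis using i by (auto intro: less_le_trans[of 0 "(norm (v $ i))\<^sup>2"])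
  qed
  ultimately have "(norm e)\<^sup>2 \<le> C" by (simp add: mult_le_cancel_right_pos)
  then show ?thesis by (rule real_le_rsqrt)
qed

text \<open>Polynomials that are small on \<open>S\<close> but not at \<open>z0\<close> confine the eigenvalues: high powers of
  the polynomial beat the non-normality of the symbol.\<close>

lemma eigenvalue_cluster:
  assumes G: "Lmat d (2 * s) G" and s: "s \<ge> 1"
    and S: "compact S" "connected (- S)"
    and GS: "AE \<theta> in torus d. set_mset (eigs (G \<theta>)) \<subseteq> S"
    and z0: "z0 \<notin> S"
  shows "\<exists>U. open U \<and> z0 \<in> U \<and>
    ((\<lambda>n. real (size (filter_mset (\<lambda>z. z \<in> U) (eigs (TT d n s G)))) / real (Nn d n)) \<longlongrightarrow> 0) (mlim d)"
proof -
  let ?m = "2 * s"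
  have bd: "bounded S" using S by (simp add: compact_imp_bounded)
  obtain R where R: "R > 0" "\<And>z. z \<in> S \<Longrightarrow> norm (z - z0) \<le> R"
  proof -
    obtain r where "r > 0" "\<And>z. z \<in> S \<Longrightarrow> norm z \<le> r" using bd unfolding bounded_pos by blast
    then have "0 < r + norm z0" "\<And>z. z \<in> S \<Longrightarrow> norm (z - z0) \<le> r + norm z0"
      by (auto intro: order_trans[OF norm_triangle_ineq4] add_pos_nonneg)
    then show thesis by (rule that)
  qed
  have "1 / (4 * R) > 0" using R by simp
  then obtain q where q: "\<forall>z\<in>S. norm (1 / (z - z0) - poly q z) < 1 / (4 * R)"
    using poly_approx_Cauchy_kernel(1)[OF S z0] unfolding poly_approx_def by blast
  \<comment> \<open>P equals 1 at z0, while on S it is (z - z0) (1/(z - z0) - q z), of modulus at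
    most R/(4 R) = 1/4.\<close>
  define P where "P = 1 - [:- z0, 1:] * q"
  have P0: "poly P z0 = 1" by (simp add: P_def)
  have PS: "norm (poly P z) \<le> 1/4" if z: "z \<in> S" for z
  proof -
    have "z - z0 \<noteq> 0" using z z0 by auto
    then have "poly P z = (z - z0) * (1 / (z - z0) - poly q z)" by (simp add: P_def algebra_simps)
    then have "norm (poly P z) = norm (z - z0) * norm (1 / (z - z0) - poly q z)" by (simp add: norm_mult)
    also have "\<dots> \<le> R * (1 / (4 * R))" using R(1) R(2)[OF z] q z by (intro mult_mono) (auto intro: less_imp_le)
    finally show ?thesis using R(1) by simp
  qed
  define cs where "cs = Polynomial.coeffs P"
  have Pcs: "Poly cs = P" by (simp add: cs_def)
  \<comment> \<open>The threshold 1/2 lies strictly between the decay rate 3/8 of the symbol and the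
    value 1 at z0.\<close>
  define U where "U = {z. norm (poly P z) > 1/2}"
  have "open U" unfolding U_def by (intro open_Collect_less continuous_intros)
  have "z0 \<in> U" by (simp add: U_def P0)
  define T where "T n = TT d n s G" for n
  define X where "X n = mpl (Dn d n s) cs (T n)" for n
  define H where "H \<theta> = mpl ?m cs (G \<theta>)" for \<theta>
  have AppX: "App d s X H" unfolding X_def H_def T_def by (rule App_mpl[OF App_TT[OF G]])
  have Tc: "T n \<in> carrier_mat (Dn d n s) (Dn d n s)" for n by (simp add: T_def)
  define cnt where "cnt n = real (size (filter_mset (\<lambda>z. z \<in> U) (eigs (T n))))" for n
  have HL: "Lmat d ?m H" using AppX by (simp add: App_def)
  obtain K where K: "K > 0" "\<And>a b. a < ?m \<Longrightarrow> b < ?m \<Longrightarrow> AE \<theta> in torus d. norm (H \<theta> $$ (a,b)) \<le> K"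
    using Lmat_bound[OF HL] by blast
  have KAE: "AE \<theta> in torus d. \<forall>a\<in>{..<?m}. \<forall>b\<in>{..<?m}. norm (H \<theta> $$ (a,b)) \<le> K"
    using K(2) by (intro AE_finite_allI) auto
  define C0 where "C0 = real ?m * 8 ^ ?m * (real ?m * (K + 1)) ^ ?m"
  have C0: "C0 \<ge> 0" using K(1) by (simp add: C0_def)
  have powb: "AE \<theta> in torus d. norm ((H \<theta> ^\<^sub>m k) $$ (a,b)) \<le> C0 * (3/8) ^ k" if "a < ?m" "b < ?m" for a b k
    using KAE GS
  proof eventually_elim
    fix \<theta> assume k: "\<forall>a\<in>{..<?m}. \<forall>b\<in>{..<?m}. norm (H \<theta> $$ (a,b)) \<le> K" and g: "set_mset (eigs (G \<theta>)) \<subseteq> S"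
    have Gc: "G \<theta> \<in> carrier_mat ?m ?m" by (rule Lmat_carrier[OF G])
    obtain es where es: "char_poly (G \<theta>) = (\<Prod>e\<leftarrow>es. [:- e, 1:])" using char_poly_factorized[OF Gc] by blast
    have esS: "set es \<subseteq> S" using g eigs_eq_mset[OF es] by simp
    have cpH: "char_poly (H \<theta>) = (\<Prod>e\<leftarrow>map (poly P) es. [:- e, 1:])"
      unfolding H_def using char_poly_mpl[OF Gc es, of cs] by (simp only: Pcs)
    show "norm ((H \<theta> ^\<^sub>m k) $$ (a,b)) \<le> C0 * (3/8) ^ k"
      unfolding C0_def
    proof (rule norm_pow_mat_le[OF Lmat_carrier[OF HL] cpH])
      show "norm e \<le> 1/4" if "e \<in> set (map (poly P) es)" for e using that PS esS by auto
    qed (use k that K(1) in auto)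
  qed
  \<comment> \<open>By Schur's inequality each eigenvalue in U contributes at least (1/4)^k to the
    squared Frobenius norm of the k-th power. The symbol contributes (3/8)^(2 k) = (9/64)^k per unit
    of N, and 4^k (9/64)^k = (9/16)^k.\<close>
  have key: "cnt n / real (Nn d n) \<le> 4 ^ k * (2 * (fro2 (X n ^\<^sub>m k - TT d n s (\<lambda>\<theta>. H \<theta> ^\<^sub>m k)) / real (Nn d n)))
      + 2 * (real ?m)\<^sup>2 * C0\<^sup>2 * (9/16) ^ k" if N: "Nn d n > 0" for n k
  proof -
    let ?D = "Dn d n s"
    let ?TH = "TT d n s (\<lambda>\<theta>. H \<theta> ^\<^sub>m k)"
    obtain es where es: "char_poly (T n) = (\<Prod>e\<leftarrow>es. [:- e, 1:])" using char_poly_factorized[OF Tc] by blast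
    have Xc: "X n \<in> carrier_mat ?D ?D" using AppX by (simp add: App_def)
    have "char_poly (X n) = (\<Prod>e\<leftarrow>map (poly P) es. [:- e, 1:])"
      unfolding X_def using char_poly_mpl[OF Tc es, of cs] by (simp only: Pcs)
    from char_poly_pow_mat[OF Xc this, of k]
    have cpk: "char_poly (X n ^\<^sub>m k) = (\<Prod>e\<leftarrow>map (\<lambda>e. e ^ k) (map (poly P) es). [:- e, 1:])" .
    have Xk: "X n ^\<^sub>m k \<in> carrier_mat ?D ?D" using Xc by simp
    have Sch: "(\<Sum>e\<leftarrow>es. (norm (poly P e ^ k))\<^sup>2) \<le> fro2 (X n ^\<^sub>m k)"
      using Schur_inequality[OF Xk cpk] by (simp add: comp_def)
    have "cnt n * (1/4) ^ k = (\<Sum>e\<leftarrow>es. if e \<in> U then (1/4) ^ k else 0)"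
    proof -
      have "real (size (filter_mset (\<lambda>z. z \<in> U) (mset es))) * c = (\<Sum>e\<leftarrow>es. if e \<in> U then c else 0)" for c :: real
        by (induction es) (auto simp: algebra_simps)
      then show ?thesis unfolding cnt_def eigs_eq_mset[OF es] .
    qed
    also have "\<dots> \<le> (\<Sum>e\<leftarrow>es. (norm (poly P e ^ k))\<^sup>2)"
    proof (rule sum_list_mono)
      fix e
      show "(if e \<in> U then (1/4) ^ k else 0) \<le> (norm (poly P e ^ k))\<^sup>2"
      proof (cases "e \<in> U")
        case True
        then have "(1/2) ^ k \<le> norm (poly P e) ^ k" by (intro power_mono) (auto simp: U_def)
        then have "((1/2) ^ k)\<^sup>2 \<le> (norm (poly P e) ^ k)\<^sup>2" by (rule power_mono) simp
        moreover have "((1/2) ^ k)\<^sup>2 = (1/4 :: real) ^ k"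
        proof -
          have "((1/2 :: real) ^ k)\<^sup>2 = ((1/2)\<^sup>2) ^ k" by (simp only: power_mult[symmetric] mult.commute)
          then show ?thesis by (simp add: power2_eq_square)
        qed
        ultimately show ?thesis using True by (simp only: norm_power if_True)
      qed simp
    qed
    finally have cnt1: "cnt n * (1/4) ^ k \<le> fro2 (X n ^\<^sub>m k)" using Sch by linarith
    have THc: "?TH \<in> carrier_mat ?D ?D" by simp
    have HkL: "Lmat d ?m (\<lambda>\<theta>. H \<theta> ^\<^sub>m k)" using App_pow[OF AppX, of k] by (simp add: App_def)
    have "X n ^\<^sub>m k = (X n ^\<^sub>m k - ?TH) + ?TH"
      using carrier_matD[OF Xk] carrier_matD[OF THc] by (intro eq_matI) auto
    then have "fro2 (X n ^\<^sub>m k) = fro2 ((X n ^\<^sub>m k - ?TH) + ?TH)" by (rule arg_cong)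
    also have "\<dots> \<le> 2 * fro2 (X n ^\<^sub>m k - ?TH) + 2 * fro2 ?TH"
      by (rule fro2_add_le[OF minus_carrier_mat[OF THc] THc])
    also have "fro2 ?TH \<le> real (Nn d n) * ((real ?m)\<^sup>2 * (C0 * (3/8) ^ k)\<^sup>2)"
    proof -
      have "fro2 ?TH \<le> real (Nn d n) * (\<Sum>a<?m. \<Sum>b<?m. nsq d (\<lambda>\<theta>. (H \<theta> ^\<^sub>m k) $$ (a,b)))" by (rule TT_fro2_le[OF HkL])
      also have "\<dots> \<le> real (Nn d n) * (\<Sum>a<?m. \<Sum>b<?m. (C0 * (3/8) ^ k)\<^sup>2)"
        using HkL C0 powb unfolding Lmat_def by (intro mult_left_mono sum_mono nsq_le_AE) auto
      finally show ?thesis by (simp add: power2_eq_square mult_ac)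
    qed
    finally have "cnt n * (1/4) ^ k \<le> 2 * fro2 (X n ^\<^sub>m k - ?TH) + 2 * (real (Nn d n) * ((real ?m)\<^sup>2 * (C0 * (3/8) ^ k)\<^sup>2))"
      using cnt1 by linarith
    then have f1: "4 ^ k * (cnt n * (1/4) ^ k) \<le> 4 ^ k * (2 * fro2 (X n ^\<^sub>m k - ?TH) + 2 * (real (Nn d n) * ((real ?m)\<^sup>2 * (C0 * (3/8) ^ k)\<^sup>2)))"
      by (intro mult_left_mono) auto
    have f2: "4 ^ k * (cnt n * (1/4) ^ k) = cnt n" by (simp add: power_one_over)
    have f3: "4 ^ k * (C0 * (3/8) ^ k)\<^sup>2 = C0\<^sup>2 * (9/16) ^ k"
    proof -
      have "((3/8 :: real) ^ k)\<^sup>2 = (9/64) ^ k"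
      proof -
        have "((3/8 :: real) ^ k)\<^sup>2 = ((3/8)\<^sup>2) ^ k" by (simp only: power_mult[symmetric] mult.commute)
        then show ?thesis by (simp add: power2_eq_square)
      qed
      then have "4 ^ k * (C0 * (3/8) ^ k)\<^sup>2 = C0\<^sup>2 * (4 ^ k * (9/64) ^ k)" by (simp only: power_mult_distrib mult_ac)
      also have "(4 :: real) ^ k * (9/64) ^ k = (9/16) ^ k" by (simp flip: power_mult_distrib)
      finally show ?thesis .
    qed
    have f4: "a * (2 * f + 2 * (c * (b * y))) = a * (2 * f) + c * (2 * b * (a * y))" for a f c b y :: real
      by (simp add: algebra_simps)
    have "cnt n \<le> 4 ^ k * (2 * fro2 (X n ^\<^sub>m k - ?TH)) + real (Nn d n) * (2 * (real ?m)\<^sup>2 * C0\<^sup>2 * (9/16) ^ k)"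
      using f1 unfolding f2 f4 f3 by (simp only: mult.assoc)
    then have "cnt n / real (Nn d n) \<le> (4 ^ k * (2 * fro2 (X n ^\<^sub>m k - ?TH)) + real (Nn d n) * (2 * (real ?m)\<^sup>2 * C0\<^sup>2 * (9/16) ^ k)) / real (Nn d n)"
      by (intro divide_right_mono) auto
    then show ?thesis using N by (simp add: add_divide_distrib)
  qed
  have "((\<lambda>n. cnt n / real (Nn d n)) \<longlongrightarrow> 0) (mlim d)"
  proof (rule tendstoI)
    fix e :: real assume e: "e > 0"
    \<comment> \<open>k first makes the symbol term small; only then n grows, with 4^k a fixed
      factor in front of the compression error.\<close>
    have "(\<lambda>k. 2 * (real ?m)\<^sup>2 * C0\<^sup>2 * (9/16) ^ k) \<longlonglongrightarrow> 2 * (real ?m)\<^sup>2 * C0\<^sup>2 * 0"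
      by (intro tendsto_mult_left LIMSEQ_power_zero) auto
    then have "\<forall>\<^sub>F k in sequentially. 2 * (real ?m)\<^sup>2 * C0\<^sup>2 * (9/16) ^ k < e/2"
      using e by (intro order_tendstoD(2)[of _ 0]) auto
    then obtain k where k: "2 * (real ?m)\<^sup>2 * C0\<^sup>2 * (9/16) ^ k < e/2" unfolding eventually_sequentially by blast
    have "((\<lambda>n. 4 ^ k * (2 * (fro2 (X n ^\<^sub>m k - TT d n s (\<lambda>\<theta>. H \<theta> ^\<^sub>m k)) / real (Nn d n)))) \<longlongrightarrow> 4 ^ k * (2 * 0)) (mlim d)"
      using App_pow[OF AppX, of k] unfolding App_def by (intro tendsto_mult_left) auto
    then have "\<forall>\<^sub>F n in mlim d. 4 ^ k * (2 * (fro2 (X n ^\<^sub>m k - TT d n s (\<lambda>\<theta>. H \<theta> ^\<^sub>m k)) / real (Nn d n))) < e/2"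
      using e by (intro order_tendstoD(2)[of _ 0]) auto
    then show "\<forall>\<^sub>F n in mlim d. dist (cnt n / real (Nn d n)) 0 < e"
      using eventually_mlim_pos
    proof eventually_elim
      fix n assume f: "4 ^ k * (2 * (fro2 (X n ^\<^sub>m k - TT d n s (\<lambda>\<theta>. H \<theta> ^\<^sub>m k)) / real (Nn d n))) < e/2" and pos: "\<forall>j<d. 0 < n j"
      have "cnt n / real (Nn d n) < e/2 + e/2"
        proof -
        have "Nn d n > 0" using pos by (intro Nn_pos) auto
        from key[OF this, of k] show ?thesis using f k by linarith
      qed
      moreover have "cnt n / real (Nn d n) \<ge> 0" by (simp add: cnt_def)
      ultimately show "dist (cnt n / real (Nn d n)) 0 < e" by (simp only: dist_real_def diff_zero abs_of_nonneg field_sum_of_halves)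
    qed
  qed
  then show ?thesis using \<open>open U\<close> \<open>z0 \<in> U\<close> unfolding cnt_def T_def by blast
qed

section \<open>The spectral distribution\<close>

text \<open>Bessel's inequality for the single orthonormal function 1.\<close>

lemma norm_av_le:
  assumes "Linf d f" "AE \<theta> in torus d. norm (f \<theta>) \<le> B" "B \<ge> 0"
  shows "norm (av d f) \<le> B"
proof -
  have "(\<Sum>p\<in>{()}. (norm (av d (\<lambda>\<theta>. f \<theta> * cnj 1)))\<^sup>2) \<le> nsq d f"
    by (rule Bessel_inequality[where u = "\<lambda>_ _. 1"]) (auto intro: Linf_const assms simp: av_const)
  also have "\<dots> \<le> B\<^sup>2" by (rule nsq_le_AE[OF assms])
  finally show ?thesis using assms(3) by (intro power2_le_imp_le[of "norm (av d f)" B]) auto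
qed

lemma sum_mset_eigs_mpl:
  assumes "A \<in> carrier_mat k k"
  shows "sum_mset (image_mset (poly (Poly cs)) (eigs A)) = mtrace (mpl k cs A)"
proof -
  obtain es where es: "char_poly A = (\<Prod>e\<leftarrow>es. [:- e, 1:])" using char_poly_factorized[OF assms] by blast
  show ?thesis unfolding eigs_eq_mset[OF es] mtrace_mpl[OF assms es] by (simp add: sum_mset_sum_list flip: mset_map)
qed

lemma size_eigs:
  assumes "A \<in> carrier_mat k k" shows "size (eigs A) = k"
proof -
  obtain es where es: "char_poly A = (\<Prod>e\<leftarrow>es. [:- e, 1:])" "length es = k" using char_poly_factorized[OF assms] by blast
  then show ?thesis by (simp add: eigs_eq_mset)
qed

context
  fixes d s :: nat and G :: "(nat \<Rightarrow> real) \<Rightarrow> complex mat"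
begin

definition spec_sum :: "(complex \<Rightarrow> complex) \<Rightarrow> (nat \<Rightarrow> real) \<Rightarrow> complex" where
  "spec_sum \<Psi> \<theta> = sum_mset (image_mset \<Psi> (eigs (G \<theta>)))"

definition spec_mean :: "(complex \<Rightarrow> complex) \<Rightarrow> complex" where
  "spec_mean \<Psi> = (1 / of_nat (2 * s)) * av d (spec_sum \<Psi>)"

definition eig_mean :: "(nat \<Rightarrow> nat) \<Rightarrow> (complex \<Rightarrow> complex) \<Rightarrow> complex" where
  "eig_mean n \<Psi> = (1 / of_nat (Dn d n s)) * sum_mset (image_mset \<Psi> (eigs (TT d n s G)))"

context
  fixes S :: "complex set"
  assumes G: "Lmat d (2 * s) G" and s: "s \<ge> 1"
    and S: "compact S" "interior S = {}" "connected (- S)"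
    and GS: "AE \<theta> in torus d. set_mset (eigs (G \<theta>)) \<subseteq> S"
begin

lemma norm_spec_sum_le:
  assumes "\<And>z. z \<in> S \<Longrightarrow> norm (\<Psi> z) \<le> B"
  shows "AE \<theta> in torus d. norm (spec_sum \<Psi> \<theta>) \<le> real (2 * s) * B"
  using GS
proof eventually_elim
  fix \<theta> assume g: "set_mset (eigs (G \<theta>)) \<subseteq> S"
  obtain es where es: "char_poly (G \<theta>) = (\<Prod>e\<leftarrow>es. [:- e, 1:])" "length es = 2 * s"
    using char_poly_factorized[OF Lmat_carrier[OF G]] by blast
  have esS: "set es \<subseteq> S" using g eigs_eq_mset[OF es(1)] by simp
  have "spec_sum \<Psi> \<theta> = (\<Sum>i<2 * s. \<Psi> (es ! i))"
    unfolding spec_sum_def eigs_eq_mset[OF es(1)] using es(2)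
    by (simp add: sum_mset_sum_list sum_list_sum_nth atLeast0LessThan flip: mset_map)
  also have "norm \<dots> \<le> (\<Sum>i<2 * s. B)"
    using esS es(2) by (intro sum_norm_le assms) (auto simp: subset_iff)
  finally show "norm (spec_sum \<Psi> \<theta>) \<le> real (2 * s) * B" by simp
qed

text \<open>Measurability comes from a measurable labeling of the eigenvalues, boundedness from the
  compactness of S.\<close>

lemma Linf_spec_sum:
  assumes \<Psi>: "continuous_on UNIV \<Psi>"
  shows "Linf d (spec_sum \<Psi>)"
proof -
  obtain lam where lam: "\<And>j. j < 2 * s \<Longrightarrow> lam j \<in> borel_measurable (torus d)"
    "\<And>\<theta>. image_mset (\<lambda>j. lam j \<theta>) (mset_set {..<2 * s}) = eigs (G \<theta>)"
    using measurable_eigenvalue_labeling[of G "2 * s" "torus d"] G unfolding Lmat_def Linf_def by blast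
  have "spec_sum \<Psi> = (\<lambda>\<theta>. \<Sum>j<2 * s. \<Psi> (lam j \<theta>))"
    by (rule ext) (unfold spec_sum_def lam(2)[symmetric], simp add: multiset.map_comp comp_def sum_unfold_sum_mset)
  moreover have "(\<lambda>\<theta>. \<Sum>j<2 * s. \<Psi> (lam j \<theta>)) \<in> borel_measurable (torus d)"
    by (intro borel_measurable_sum measurable_compose[OF lam(1) borel_measurable_continuous_onI[OF \<Psi>]]) simp
  ultimately have m: "spec_sum \<Psi> \<in> borel_measurable (torus d)" by (simp only:)
  have "compact (\<Psi> ` S)" using S(1) \<Psi> by (intro compact_continuous_image continuous_on_subset[OF \<Psi>]) auto
  then have "bounded (\<Psi> ` S)" by (rule compact_imp_bounded)
  then obtain B where "\<forall>x\<in>\<Psi> ` S. norm x \<le> B" unfolding bounded_iff by (elim exE)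
  then have "\<And>z. z \<in> S \<Longrightarrow> norm (\<Psi> z) \<le> B" by simp
  from norm_spec_sum_le[OF this] show ?thesis using m unfolding Linf_def by (intro conjI exI)
qed

lemma spec_mean_diff_le:
  assumes "continuous_on UNIV \<Psi>" "continuous_on UNIV \<Xi>" "\<And>z. z \<in> S \<Longrightarrow> norm (\<Psi> z - \<Xi> z) \<le> e" "e \<ge> 0"
  shows "norm (spec_mean \<Psi> - spec_mean \<Xi>) \<le> e"
proof -
  have L: "Linf d (spec_sum \<Psi>)" "Linf d (spec_sum \<Xi>)" using assms Linf_spec_sum by auto
  have eq: "spec_sum (\<lambda>z. \<Psi> z - \<Xi> z) = (\<lambda>\<theta>. spec_sum \<Psi> \<theta> - spec_sum \<Xi> \<theta>)"
    proof
    fix \<theta>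
    have "sum_mset (image_mset (\<lambda>z. \<Psi> z - \<Xi> z) A) = sum_mset (image_mset \<Psi> A) - sum_mset (image_mset \<Xi> A)" for A
      by (induction A) auto
    then show "spec_sum (\<lambda>z. \<Psi> z - \<Xi> z) \<theta> = spec_sum \<Psi> \<theta> - spec_sum \<Xi> \<theta>"
      unfolding spec_sum_def .
  qed
  have "norm (av d (spec_sum (\<lambda>z. \<Psi> z - \<Xi> z))) \<le> real (2 * s) * e"
    using L assms by (intro norm_av_le norm_spec_sum_le) (auto simp: eq intro: Linf_diff)
  moreover have "spec_mean \<Psi> - spec_mean \<Xi> = (1 / of_nat (2 * s)) * av d (spec_sum (\<lambda>z. \<Psi> z - \<Xi> z))"
    unfolding spec_mean_def eq av_diff[OF L] by (simp add: right_diff_distrib)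
  ultimately have "norm (spec_mean \<Psi> - spec_mean \<Xi>) \<le> (1 / real (2 * s)) * (real (2 * s) * e)"
    by (simp only: norm_mult norm_divide norm_one norm_of_nat) (intro mult_left_mono; simp)
  then show ?thesis using s by simp
qed

text \<open>Both sides are traces of the polynomial applied to a matrix, so \<open>App_trace\<close>
  applies to the image of G under the polynomial calculus.\<close>

lemma eig_mean_poly_tendsto:
  "((\<lambda>n. eig_mean n (poly P)) \<longlongrightarrow> spec_mean (poly P)) (mlim d)"
proof -
  define cs where "cs = Polynomial.coeffs P"
  have P: "P = Poly cs" by (simp add: cs_def)
  have A: "App d s (\<lambda>n. mpl (Dn d n s) cs (TT d n s G)) (\<lambda>\<theta>. mpl (2 * s) cs (G \<theta>))"
    by (rule App_mpl[OF App_TT[OF G]])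
  then have L: "Lmat d (2 * s) (\<lambda>\<theta>. mpl (2 * s) cs (G \<theta>))" by (simp add: App_def)
  have "av d (spec_sum (poly P)) = av d (\<lambda>\<theta>. \<Sum>a<2 * s. mpl (2 * s) cs (G \<theta>) $$ (a,a))"
  proof (intro arg_cong[where f = "av d"] ext)
    fix \<theta>
    show "spec_sum (poly P) \<theta> = (\<Sum>a<2 * s. mpl (2 * s) cs (G \<theta>) $$ (a,a))"
      unfolding spec_sum_def P sum_mset_eigs_mpl[OF Lmat_carrier[OF G]] mtrace_def
      using carrier_matD[OF Lmat_carrier[OF L, of \<theta>]] by simp
  qed
  also have "\<dots> = (\<Sum>a<2 * s. av d (\<lambda>\<theta>. mpl (2 * s) cs (G \<theta>) $$ (a,a)))"
    using L unfolding Lmat_def by (intro av_sum) auto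
  finally have "spec_mean (poly P) = (1 / of_nat (2 * s)) * (\<Sum>a<2 * s. av d (\<lambda>\<theta>. mpl (2 * s) cs (G \<theta>) $$ (a,a)))"
    by (simp add: spec_mean_def)
  moreover have "eig_mean n (poly P) = mtrace (mpl (Dn d n s) cs (TT d n s G)) / of_nat (Dn d n s)" for n
    unfolding eig_mean_def P sum_mset_eigs_mpl[OF TT_carrier] by simp
  ultimately show ?thesis using App_trace[OF A s] by simp
qed

lemma eig_mean_Re_poly_tendsto:
  "((\<lambda>n. eig_mean n (\<lambda>z. of_real (Re (poly P z)))) \<longlongrightarrow> spec_mean (\<lambda>z. of_real (Re (poly P z)))) (mlim d)"
proof -
  have Re: "(\<lambda>z. complex_of_real (Re (poly P z))) = (\<lambda>z. (1/2) * (poly P z + cnj (poly P z)))"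
    by (auto simp: complex_eq_iff)
  have cm: "sum_mset (image_mset (\<lambda>z. cnj (poly P z)) A) = cnj (sum_mset (image_mset (poly P) A))" for A
    by (induction A) auto
  have lin: "sum_mset (image_mset (\<lambda>z. (1/2) * (poly P z + cnj (poly P z))) A)
      = (1/2) * (sum_mset (image_mset (poly P) A) + cnj (sum_mset (image_mset (poly P) A)))" for A
    unfolding cm[symmetric] by (induction A) (auto simp: algebra_simps)
  have e: "eig_mean n (\<lambda>z. of_real (Re (poly P z))) = (1/2) * (eig_mean n (poly P) + cnj (eig_mean n (poly P)))" for n
  proof -
    have "(1 / of_nat k) * ((1/2) * (x + cnj x)) = (1/2) * ((1 / of_nat k) * x + cnj ((1 / of_nat k) * x))" for k :: nat and x
      by (simp add: algebra_simps add_divide_distrib)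
    then show ?thesis unfolding eig_mean_def Re lin .
  qed
  have L: "Linf d (spec_sum (poly P))" by (intro Linf_spec_sum continuous_intros)
  have "av d (spec_sum (\<lambda>z. of_real (Re (poly P z)))) = av d (\<lambda>\<theta>. (1/2) * (spec_sum (poly P) \<theta> + cnj (spec_sum (poly P) \<theta>)))"
    unfolding spec_sum_def Re lin ..
  also have "\<dots> = (1/2) * (av d (spec_sum (poly P)) + cnj (av d (spec_sum (poly P))))"
    unfolding av_cmult av_add[OF L Linf_cnj[OF L]] av_cnj ..
  finally have m: "spec_mean (\<lambda>z. of_real (Re (poly P z))) = (1/2) * (spec_mean (poly P) + cnj (spec_mean (poly P)))"
    unfolding spec_mean_def by (simp add: algebra_simps)
  show ?thesis unfolding e m by (intro tendsto_intros eig_mean_poly_tendsto)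
qed

text \<open>Let g = f - Re P. Near S it is below \<epsilon>. The other eigenvalues lie in a compact
  set off S, covered by finitely many of the open sets from \<open>eigenvalue_cluster\<close>; they
  form a vanishing proportion, and g is bounded there.\<close>

lemma eig_mean_real_tendsto:
  assumes f: "continuous_on UNIV (f :: complex \<Rightarrow> real)"
  shows "((\<lambda>n. eig_mean n (\<lambda>z. of_real (f z))) \<longlongrightarrow> spec_mean (\<lambda>z. of_real (f z))) (mlim d)"
proof (rule tendstoI)
  fix e :: real assume e: "e > 0"
  \<comment> \<open>The final comparison spends 2 \<epsilon> on the eigenvalue means of f and Re P,
    and one \<epsilon> each on the polynomial limit and on the means over the symbol.\<close>
  define \<epsilon> where "\<epsilon> = e / 5"
  have \<epsilon>: "\<epsilon> > 0" using e by (simp add: \<epsilon>_def)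
  obtain P where P: "\<forall>z\<in>S. \<bar>f z - Re (poly P z)\<bar> < \<epsilon>"
    using Walsh_Lebesgue_empty_interior[OF S continuous_on_subset[OF f subset_UNIV]] \<epsilon> unfolding re_poly_approx_def by blast
  define g where "g z = f z - Re (poly P z)" for z
  have gc: "continuous_on UNIV g" unfolding g_def by (intro continuous_intros f)
  define U0 where "U0 = {z. \<bar>g z\<bar> < \<epsilon>}"
  have U0: "open U0" "S \<subseteq> U0" unfolding U0_def using P by (auto intro!: open_Collect_less continuous_intros gc) (auto simp: g_def)
  \<comment> \<open>The uniform operator bound gives one disc containing all eigenvalues for every
    n; without it the part away from S would not be compact.\<close>
  obtain C where C: "C \<ge> 0" "\<And>n. opb (Dn d n s) C (TT d n s G)" using App_TT[OF G] unfolding App_def by blast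
  define R where "R = sqrt C"
  have eR: "set_mset (eigs (TT d n s G)) \<subseteq> cball 0 R" for n
  proof -
    obtain es where es: "char_poly (TT d n s G) = (\<Prod>e\<leftarrow>es. [:- e, 1:])" using char_poly_factorized[OF TT_carrier] by blast
    show ?thesis unfolding eigs_eq_mset[OF es] R_def
      using norm_eigenvalue_opb[OF TT_carrier es C(2) C(1)] by auto
  qed
  have "bounded (g ` cball 0 R)"
    by (intro compact_imp_bounded compact_continuous_image continuous_on_subset[OF gc]) auto
  then obtain B where B: "B > 0" "\<And>z. z \<in> cball 0 R \<Longrightarrow> \<bar>g z\<bar> \<le> B" unfolding bounded_pos by auto
  define cnt where "cnt U n = real (size (filter_mset (\<lambda>z. z \<in> U) (eigs (TT d n s G))))" for U n
  define \<U> where "\<U> = {U. open U \<and> ((\<lambda>n. cnt U n / real (Nn d n)) \<longlongrightarrow> 0) (mlim d)}"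
  \<comment> \<open>Compact and disjoint from S, so each of its points has a neighbourhood with o(N)
    eigenvalues.\<close>
  define K where "K = cball 0 R - U0"
  have "compact K" unfolding K_def using U0(1) by (intro compact_diff) auto
  moreover have "K \<subseteq> \<Union>\<U>"
  proof
    fix z assume "z \<in> K"
    then have "z \<notin> S" using U0(2) by (auto simp: K_def)
    from eigenvalue_cluster[OF G s S(1,3) GS this] show "z \<in> \<Union>\<U>" unfolding \<U>_def cnt_def by blast
  qed
  ultimately obtain \<V> where V: "\<V> \<subseteq> \<U>" "finite \<V>" "K \<subseteq> \<Union>\<V>"
    by (elim compactE) (auto simp: \<U>_def)
  have "((\<lambda>n. \<Sum>U\<in>\<V>. cnt U n / real (Nn d n)) \<longlongrightarrow> (\<Sum>U\<in>\<V>. 0)) (mlim d)"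
    using V(1) unfolding \<U>_def by (intro tendsto_sum) auto
  then have lim0: "((\<lambda>n. B * (\<Sum>U\<in>\<V>. cnt U n / real (Nn d n))) \<longlongrightarrow> 0) (mlim d)"
    using tendsto_mult_left[of _ "\<Sum>U\<in>\<V>. 0" "mlim d" B] by simp
  have bound: "norm (eig_mean n (\<lambda>z. of_real (f z)) - eig_mean n (\<lambda>z. of_real (Re (poly P z)))) \<le> \<epsilon> + B * (\<Sum>U\<in>\<V>. cnt U n / real (Nn d n))"
    if pos: "\<forall>j<d. 0 < n j" for n
  proof -
    have N: "Nn d n > 0" using pos by (intro Nn_pos) auto
    define A where "A = eigs (TT d n s G)"
    have szA: "size A = Dn d n s" unfolding A_def by (rule size_eigs) simp
    have AR: "set_mset A \<subseteq> cball 0 R" unfolding A_def by (rule eR)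
    have "norm (sum_mset (image_mset (\<lambda>z. complex_of_real (g z)) A)) \<le> \<epsilon> * real (size A) + B * (\<Sum>U\<in>\<V>. real (size (filter_mset (\<lambda>z. z \<in> U) A)))"
      using AR
    proof (induction A)
      case (add z A)
      have gz: "\<bar>g z\<bar> \<le> \<epsilon> + B * (\<Sum>U\<in>\<V>. if z \<in> U then 1 else 0)"
      proof (cases "z \<in> U0")
        case True
        moreover have "0 \<le> B * (\<Sum>U\<in>\<V>. if z \<in> U then 1 else 0)" using B(1) by (intro mult_nonneg_nonneg sum_nonneg) auto
        ultimately show ?thesis unfolding U0_def by simp
      next
        case False
        then have "z \<in> K" using add.prems by (simp add: K_def)
        then obtain U where U: "U \<in> \<V>" "z \<in> U" using V(3) by blast
        have "(if z \<in> U then 1 else 0) \<le> (\<Sum>U\<in>\<V>. if z \<in> U then 1 else (0::real))"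
          using U(1) V(2) by (intro member_le_sum) auto
        then have "B * 1 \<le> B * (\<Sum>U\<in>\<V>. if z \<in> U then 1 else 0)" using U(2) B(1) by (intro mult_left_mono) auto
        moreover have "\<bar>g z\<bar> \<le> B" using B(2) add.prems by simp
        ultimately show ?thesis using \<epsilon> by linarith
      qed
      have IH: "norm (sum_mset (image_mset (\<lambda>z. complex_of_real (g z)) A)) \<le> \<epsilon> * real (size A) + B * (\<Sum>U\<in>\<V>. real (size (filter_mset (\<lambda>z. z \<in> U) A)))"
        using add by simp
      have sp: "(\<Sum>U\<in>\<V>. real (size (filter_mset (\<lambda>z. z \<in> U) (add_mset z A))))
          = (\<Sum>U\<in>\<V>. if z \<in> U then 1 else 0) + (\<Sum>U\<in>\<V>. real (size (filter_mset (\<lambda>z. z \<in> U) A)))"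
        unfolding sum.distrib[symmetric] by (intro sum.cong) auto
      have "norm (sum_mset (image_mset (\<lambda>z. complex_of_real (g z)) (add_mset z A))) \<le> \<bar>g z\<bar> + norm (sum_mset (image_mset (\<lambda>z. complex_of_real (g z)) A))"
        using norm_triangle_ineq[of "complex_of_real (g z)"] by simp
      also have "\<dots> \<le> (\<epsilon> + B * (\<Sum>U\<in>\<V>. if z \<in> U then 1 else 0)) + (\<epsilon> * real (size A) + B * (\<Sum>U\<in>\<V>. real (size (filter_mset (\<lambda>z. z \<in> U) A))))"
        by (intro add_mono gz IH)
      also have "\<dots> = \<epsilon> * real (size (add_mset z A)) + B * (\<Sum>U\<in>\<V>. real (size (filter_mset (\<lambda>z. z \<in> U) (add_mset z A))))"
        unfolding sp by (simp add: algebra_simps)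
      finally show ?case .
    qed (use B(1) in simp)
    then have main: "norm (sum_mset (image_mset (\<lambda>z. complex_of_real (g z)) A)) \<le> \<epsilon> * real (Dn d n s) + B * (\<Sum>U\<in>\<V>. cnt U n)"
      unfolding cnt_def A_def[symmetric] szA .
    have lin: "sum_mset (image_mset (\<lambda>z. complex_of_real (f z)) A) - sum_mset (image_mset (\<lambda>z. complex_of_real (Re (poly P z))) A)
        = sum_mset (image_mset (\<lambda>z. complex_of_real (g z)) A)"
      by (induction A) (auto simp: g_def algebra_simps)
    define r where "r = real (Dn d n s)"
    have rN: "real (Nn d n) \<le> r"
    proof -
      have "Nn d n * 1 \<le> Nn d n * s" using s by (intro mult_le_mono) auto
      then have "Nn d n \<le> Dn d n s" by linarith
      then show ?thesis unfolding r_def by (simp only: of_nat_le_iff)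
    qed
    have r: "r > 0" using rN N by simp
    have "norm (eig_mean n (\<lambda>z. of_real (f z)) - eig_mean n (\<lambda>z. of_real (Re (poly P z)))) = norm (sum_mset (image_mset (\<lambda>z. complex_of_real (g z)) A)) / r"
      unfolding eig_mean_def A_def[symmetric] right_diff_distrib[symmetric] lin r_def
      by (simp only: norm_mult norm_divide norm_one norm_of_nat) simp
    also have "\<dots> \<le> (\<epsilon> * r + B * (\<Sum>U\<in>\<V>. cnt U n)) / r"
      using main r unfolding r_def by (intro divide_right_mono) auto
    also have "\<dots> = \<epsilon> + B * (\<Sum>U\<in>\<V>. cnt U n) / r" using r by (simp add: add_divide_distrib)
    also have "\<dots> \<le> \<epsilon> + B * (\<Sum>U\<in>\<V>. cnt U n) / real (Nn d n)"
      using rN N B(1) by (intro add_left_mono divide_left_mono mult_nonneg_nonneg sum_nonneg) (auto simp: cnt_def)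
    finally show ?thesis unfolding sum_divide_distrib[symmetric] times_divide_eq_right .
  qed
  have sd: "norm (spec_mean (\<lambda>z. of_real (f z)) - spec_mean (\<lambda>z. of_real (Re (poly P z)))) \<le> \<epsilon>"
  proof (rule spec_mean_diff_le)
    fix z assume "z \<in> S"
    then show "norm (complex_of_real (f z) - complex_of_real (Re (poly P z))) \<le> \<epsilon>"
      using P by (simp only: of_real_diff[symmetric] norm_of_real) (auto intro: less_imp_le)
  qed (use \<epsilon> in \<open>auto intro!: continuous_intros f\<close>)
  have ev1: "\<forall>\<^sub>F n in mlim d. B * (\<Sum>U\<in>\<V>. cnt U n / real (Nn d n)) < \<epsilon>"
    by (rule order_tendstoD(2)[OF lim0 \<epsilon>])
  have ev2: "\<forall>\<^sub>F n in mlim d. dist (eig_mean n (\<lambda>z. of_real (Re (poly P z)))) (spec_mean (\<lambda>z. of_real (Re (poly P z)))) < \<epsilon>"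
    by (rule tendstoD[OF eig_mean_Re_poly_tendsto \<epsilon>])
  from ev1 ev2 eventually_mlim_pos
  show "\<forall>\<^sub>F n in mlim d. dist (eig_mean n (\<lambda>z. of_real (f z))) (spec_mean (\<lambda>z. of_real (f z))) < e"
  proof eventually_elim
    fix n assume 1: "B * (\<Sum>U\<in>\<V>. cnt U n / real (Nn d n)) < \<epsilon>"
      and 2: "dist (eig_mean n (\<lambda>z. of_real (Re (poly P z)))) (spec_mean (\<lambda>z. of_real (Re (poly P z)))) < \<epsilon>"
      and pos: "\<forall>j<d. 0 < n j"
    define x y z w where "x = eig_mean n (\<lambda>z. of_real (f z))" and "y = eig_mean n (\<lambda>z. of_real (Re (poly P z)))"
      and "z = spec_mean (\<lambda>z. of_real (Re (poly P z)))" and "w = spec_mean (\<lambda>z. of_real (f z))"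
    have "dist x y < 2 * \<epsilon>" using bound[OF pos] 1 unfolding dist_norm x_def y_def by linarith
    moreover have "dist y z < \<epsilon>" using 2 unfolding y_def z_def .
    moreover have "dist z w \<le> \<epsilon>" using sd unfolding z_def w_def by (simp add: dist_norm norm_minus_commute)
    moreover have "dist x w \<le> dist x y + dist y z + dist z w"
      using dist_triangle[of x w z] dist_triangle[of x z y] by linarith
    ultimately have "dist x w < 5 * \<epsilon>" using \<epsilon> by linarith
    then show "dist x w < e" by (simp add: \<epsilon>_def)
  qed
qed

lemma eig_mean_tendsto:
  assumes \<Psi>: "continuous_on UNIV \<Psi>"
  shows "((\<lambda>n. eig_mean n \<Psi>) \<longlongrightarrow> spec_mean \<Psi>) (mlim d)"
proof -
  have c: "continuous_on UNIV (\<lambda>z. Re (\<Psi> z))" "continuous_on UNIV (\<lambda>z. Im (\<Psi> z))"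
    using \<Psi> by (auto intro!: continuous_intros)
  have lin: "sum_mset (image_mset \<Psi> A) = sum_mset (image_mset (\<lambda>z. complex_of_real (Re (\<Psi> z))) A)
      + \<i> * sum_mset (image_mset (\<lambda>z. complex_of_real (Im (\<Psi> z))) A)" for A
  proof (induction A)
    case (add z A)
    have z: "\<Psi> z = of_real (Re (\<Psi> z)) + \<i> * of_real (Im (\<Psi> z))" by (simp add: complex_eq)
    have "p + x = (a + y) + \<i> * (b + w)" if "p = a + \<i> * b" "x = y + \<i> * w" for p x a b y w :: complex
      using that by (simp add: algebra_simps)
    from this[OF z add.IH] show ?case unfolding image_mset_add_mset sum_mset.add_mset .
  qed simp
  have e: "eig_mean n \<Psi> = eig_mean n (\<lambda>z. of_real (Re (\<Psi> z))) + \<i> * eig_mean n (\<lambda>z. of_real (Im (\<Psi> z)))" for n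
  proof -
    have "c * (x + \<i> * y) = c * x + \<i> * (c * y)" for c x y by (simp add: algebra_simps)
    then show ?thesis unfolding eig_mean_def lin[of "eigs (TT d n s G)"] .
  qed
  have L: "Linf d (spec_sum (\<lambda>z. of_real (Re (\<Psi> z))))" "Linf d (spec_sum (\<lambda>z. of_real (Im (\<Psi> z))))"
    using c by (auto intro!: Linf_spec_sum continuous_intros)
  have "spec_sum \<Psi> = (\<lambda>\<theta>. spec_sum (\<lambda>z. of_real (Re (\<Psi> z))) \<theta> + \<i> * spec_sum (\<lambda>z. of_real (Im (\<Psi> z))) \<theta>)"
    unfolding spec_sum_def using lin by (intro ext)
  then have "av d (spec_sum \<Psi>) = av d (spec_sum (\<lambda>z. of_real (Re (\<Psi> z)))) + \<i> * av d (spec_sum (\<lambda>z. of_real (Im (\<Psi> z))))"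
    by (simp only: av_add[OF L(1) Linf_cmult[OF L(2)]] av_cmult)
  then have m: "spec_mean \<Psi> = spec_mean (\<lambda>z. of_real (Re (\<Psi> z))) + \<i> * spec_mean (\<lambda>z. of_real (Im (\<Psi> z)))"
    unfolding spec_mean_def by (simp add: algebra_simps)
  show ?thesis unfolding e m using c by (intro tendsto_add tendsto_mult_left eig_mean_real_tendsto)
qed

end

end

text \<open>The range is defined through a chosen labeling. Since a measurable one exists, the
  choice satisfies \<open>meas_labeling\<close>, and only that property is used, so the result does
  not depend on which labeling was chosen.\<close>

lemma spec_ess_range_props:
  assumes G: "Lmat d m G"
  shows "compact (spec_ess_range d m G)" "AE \<theta> in torus d. set_mset (eigs (G \<theta>)) \<subseteq> spec_ess_range d m G"
proof -
  obtain lam0 where "\<And>j. j < m \<Longrightarrow> lam0 j \<in> borel_measurable (torus d)"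
    "\<And>\<theta>. image_mset (\<lambda>j. lam0 j \<theta>) (mset_set {..<m}) = eigs (G \<theta>)"
    using measurable_eigenvalue_labeling[of G m "torus d"] G unfolding Lmat_def Linf_def by blast
  then have lam0: "meas_labeling d m G lam0" unfolding meas_labeling_def by auto
  define lam where "lam = (SOME lam. meas_labeling d m G lam)"
  have "meas_labeling d m G lam" unfolding lam_def by (rule someI[of "meas_labeling d m G", OF lam0])
  then have lam: "\<And>j. j < m \<Longrightarrow> lam j \<in> borel_measurable (torus d)"
    "AE \<theta> in torus d. image_mset (\<lambda>j. lam j \<theta>) (mset_set {..<m}) = eigs (G \<theta>)"
    unfolding meas_labeling_def by auto
  have S: "spec_ess_range d m G = (\<Union>j<m. ess_range d (lam j))"
    unfolding spec_ess_range_def lam_def Let_def ..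
  have seteq: "set_mset (image_mset (\<lambda>j. lam j \<theta>) (mset_set {..<m})) = (\<lambda>j. lam j \<theta>) ` {..<m}" for \<theta> by simp
  obtain K where K: "K > 0" "\<And>a b. a < m \<Longrightarrow> b < m \<Longrightarrow> AE \<theta> in torus d. norm (G \<theta> $$ (a,b)) \<le> K"
    using Lmat_bound[OF G] by blast
  have KAE: "AE \<theta> in torus d. \<forall>a\<in>{..<m}. \<forall>b\<in>{..<m}. norm (G \<theta> $$ (a,b)) \<le> K"
    using K(2) by (intro AE_finite_allI) auto
  have bnd: "AE \<theta> in torus d. norm (lam j \<theta>) \<le> real m * K" if j: "j < m" for j
    using KAE lam(2)
  proof eventually_elim
    fix \<theta> assume k: "\<forall>a\<in>{..<m}. \<forall>b\<in>{..<m}. norm (G \<theta> $$ (a,b)) \<le> K"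
      and l: "image_mset (\<lambda>j. lam j \<theta>) (mset_set {..<m}) = eigs (G \<theta>)"
    have Gc: "G \<theta> \<in> carrier_mat m m" by (rule Lmat_carrier[OF G])
    obtain es where es: "char_poly (G \<theta>) = (\<Prod>e\<leftarrow>es. [:- e, 1:])" using char_poly_factorized[OF Gc] by blast
    have "lam j \<theta> \<in> set_mset (eigs (G \<theta>))" unfolding l[symmetric] seteq using j by blast
    then have "lam j \<theta> \<in> set es" unfolding eigs_eq_mset[OF es] by simp
    then show "norm (lam j \<theta>) \<le> real m * K"
      using k K(1) by (intro norm_eigenvalue_le[OF Gc es]) auto
  qed
  have "compact (ess_range d (lam j))" if "j < m" for j
    unfolding compact_eq_bounded_closed
    using closed_ess_range[OF lam(1)[OF that]] ess_range_bounded[OF lam(1)[OF that] bnd[OF that]]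
    by (auto intro: bounded_subset)
  then show "compact (spec_ess_range d m G)" unfolding S by (intro compact_UN) auto
  have "AE \<theta> in torus d. \<forall>j\<in>{..<m}. lam j \<theta> \<in> ess_range d (lam j)"
    using AE_in_ess_range lam(1) by (intro AE_finite_allI) auto
  then show "AE \<theta> in torus d. set_mset (eigs (G \<theta>)) \<subseteq> spec_ess_range d m G"
    using lam(2)
  proof eventually_elim
    fix \<theta> assume 1: "\<forall>j\<in>{..<m}. lam j \<theta> \<in> ess_range d (lam j)"
      and l: "image_mset (\<lambda>j. lam j \<theta>) (mset_set {..<m}) = eigs (G \<theta>)"
    show "set_mset (eigs (G \<theta>)) \<subseteq> spec_ess_range d m G" unfolding l[symmetric] seteq S using 1 by blast
  qed
qed

text \<open>\<open>SL = {..<d}\<close> and \<open>SL = {}\<close> are the one-sided cases L and R;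
  S_R is always the complement of \<open>SL\<close>.\<close>

theorem mainTheorem12:
  fixes d s :: nat and SL :: "nat set"
    and Z W :: "(nat \<Rightarrow> real) \<Rightarrow> nat \<Rightarrow> nat \<Rightarrow> complex"
  assumes "d \<ge> 1" and "s \<ge> 1" and "SL \<subseteq> {..<d}"
    and Z_Linf: "\<forall>a<s. \<forall>b<s. (\<lambda>\<theta>. Z \<theta> a b) \<in> borel_measurable (torus d) \<and>
                   (\<exists>B. AE \<theta> in torus d. norm (Z \<theta> a b) \<le> B)"
    and W_Linf: "\<forall>a<s. \<forall>b<s. (\<lambda>\<theta>. W \<theta> a b) \<in> borel_measurable (torus d) \<and>
                   (\<exists>B. AE \<theta> in torus d. norm (W \<theta> a b) \<le> B)"
    and "interior (spec_ess_range d (2 * s) (Gsym d SL s Z W)) = {}"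
    and "connected (- spec_ess_range d (2 * s) (Gsym d SL s Z W))"
  shows "lambda_distributed d (toeplitz d SL s Z W) (2 * s) (Gsym d SL s Z W)"
proof -
  let ?G = "Gsym d SL s Z W"
  have Z: "\<And>a b. a < s \<Longrightarrow> b < s \<Longrightarrow> Linf d (\<lambda>\<theta>. Z \<theta> a b)" using Z_Linf by (auto simp: Linf_def)
  have W: "\<And>a b. a < s \<Longrightarrow> b < s \<Longrightarrow> Linf d (\<lambda>\<theta>. W \<theta> a b)" using W_Linf by (auto simp: Linf_def)
  have G: "Lmat d (2 * s) ?G"
    unfolding Lmat_def using Linf_Gsym[OF assms(3) Z W] by (auto simp: Gsym_def)
  note S = spec_ess_range_props[OF G]
  have Phi: "Phi (toeplitz d SL s Z W n) = TT d n s ?G" for n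
    using Z_Linf W_Linf by (intro Phi_toeplitz assms) auto
  have dim: "dim_row (fst (toeplitz d SL s Z W n)) = Nn d n * s" for n
    by (simp add: toeplitz_def Let_def)
  show ?thesis
    unfolding lambda_distributed_def
  proof (intro allI impI)
    fix \<Psi> :: "complex \<Rightarrow> complex" and e :: real
    assume "continuous_on UNIV \<Psi> \<and> compact (closure {z. \<Psi> z \<noteq> 0})" and e: "e > 0"
    then have "continuous_on UNIV \<Psi>" by blast
    from tendstoD[OF eig_mean_tendsto[OF G assms(2) S(1) assms(6,7) S(2) this] e]
    obtain M where M: "\<And>n. \<forall>j<d. M \<le> n j \<Longrightarrow> dist (eig_mean d s ?G n \<Psi>) (spec_mean d s ?G \<Psi>) < e"
      unfolding eventually_mlim by blast
    have lhs: "1 / (2 * of_nat (dim_row (fst (toeplitz d SL s Z W n)))) * sum_mset (image_mset \<Psi> (eigs (Phi (toeplitz d SL s Z W n))))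
        = eig_mean d s ?G n \<Psi>" for n
      unfolding eig_mean_def Phi dim by simp
    have rhs: "complex_of_real (1 / (2*pi)^d) * integral\<^sup>L (torus d) (\<lambda>\<theta>. (1 / of_nat (2 * s)) * sum_mset (image_mset \<Psi> (eigs (?G \<theta>))))
        = spec_mean d s ?G \<Psi>"
      unfolding spec_mean_def av_def spec_sum_def integral_mult_right_zero by (simp only: mult.left_commute)
    show "\<exists>M. \<forall>n. (\<forall>j<d. M \<le> n j) \<longrightarrow>
         norm (1 / (2 * of_nat (dim_row (fst (toeplitz d SL s Z W n)))) * sum_mset (image_mset \<Psi> (eigs (Phi (toeplitz d SL s Z W n))))
           - complex_of_real (1 / (2*pi)^d) *
             integral\<^sup>L (torus d) (\<lambda>\<theta>. (1 / of_nat (2 * s)) * sum_mset (image_mset \<Psi> (eigs (?G \<theta>))))) < e"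
      unfolding lhs rhs using M by (auto simp: dist_norm)
  qed
qed

end
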